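(* Let $F$ be an algebraic number field and let $X\in\mathfrak{gl}(n,F)$ be a semisimple matrix. Consider the following procedure. (1) Compute a finite extension $K\supset F$ containing the eigenvalues $\alpha_1,\ldots,\alpha_n$ of $X$ (listed with multiplicity). (2) Compute a $\mathbb{Q}$-basis of $\Lambda_{\mathbb{Q}}=\{(e_1,\ldots,e_n)\in\mathbb{Q}^n \mid \sum_{k=1}^n e_k\alpha_k=0\}$. (3) Let $I=X^0,X,\ldots,X^t$ be a basis of $A_F(X)$. Compute an $F$-basis of $$\Upsilon=\Big\{(\gamma_0,\ldots,\gamma_t)\in F^{t+1}\ \Big|\ \sum_{i=0}^t\Delta_i(\underline{e})\gamma_i=0\ \text{ for all }\underline{e}\in\Lambda_{\mathbb{Q}}\Big\},\qquad \Delta_i(\underline{e})=\sum_{k=1}^n e_k\alpha_k^i .$$ (4) Return the set of matrices $\sum_{i=0}^t\gamma_iX^i$, where $(\gamma_0,\ldots,\gamma_t)$ runs through the basis computed in step (3). Then every step of this procedure is effectively computable, and the returned set is an $F$-basis of the algebraic hull $\mathfrak{g}_F(X)$ of the Lie algebra spanned by $X$.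
   Context: For a field $F$ of characteristic $0$, a subgroup $G\subset \mathrm{GL}(n,F)$ is called algebraic if it is the set of all $g\in \mathrm{GL}(n,F)$ at which a given set of polynomial functions on the $n\times n$-matrices vanishes; to it corresponds its Lie algebra $\mathrm{Lie}(G)\subset\mathfrak{gl}(n,F)$. A Lie subalgebra of $\mathfrak{gl}(n,F)$ is called algebraic if it equals $\mathrm{Lie}(G)$ for some algebraic subgroup $G$. By a theorem of Chevalley, every Lie subalgebra of $\mathfrak{gl}(n,F)$ is contained in a unique smallest algebraic Lie algebra, called its algebraic hull. For $X\in\mathfrak{gl}(n,F)$, $\mathfrak{g}_F(X)$ denotes the algebraic hull of the Lie algebra spanned by $X$. $A_F(X)$ denotes the associative $F$-algebra with one generated by $X$. A matrix is semisimple if it is diagonalizable over an algebraic closure of $F$. The convention $\alpha^0=1$ is used also for $\alpha=0$. *)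

theory Defs
  imports
    Complex_Main
    "HOL-Library.Nat_Bijection"
    "HOL-Computational_Algebra.Computational_Algebra"
    "Jordan_Normal_Form.Char_Poly"
begin

section \<open>Number fields and matrices over them\<close>

text \<open>Number fields are taken as subfields of the complex numbers; every number field embeds there.\<close>

definition complex_subfield :: "complex set \<Rightarrow> bool" where
  "complex_subfield F \<longleftrightarrow> 0 \<in> F \<and> 1 \<in> F \<and>
     (\<forall>x\<in>F. \<forall>y\<in>F. x + y \<in> F \<and> x * y \<in> F) \<and> (\<forall>x\<in>F. - x \<in> F \<and> inverse x \<in> F)"

definition number_field :: "complex set \<Rightarrow> bool" where
  "number_field F \<longleftrightarrow> complex_subfield F \<and>
     (\<exists>B. finite B \<and> F = module.span (\<lambda>(q::rat) (x::complex). of_rat q * x) B)"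

definition algebraic_closure_of :: "complex set \<Rightarrow> complex set" where
  "algebraic_closure_of F =
     {z. \<exists>p :: complex poly. p \<noteq> 0 \<and> set (coeffs p) \<subseteq> F \<and> poly p z = 0}"

definition mats :: "nat \<Rightarrow> complex set \<Rightarrow> complex mat set" where
  "mats n F = {A \<in> carrier_mat n n. elements_mat A \<subseteq> F}"

definition semisimple :: "nat \<Rightarrow> complex set \<Rightarrow> complex mat \<Rightarrow> bool" where
  "semisimple n F X \<longleftrightarrow> X \<in> mats n F \<and>
     (\<exists>P Q D. P \<in> mats n (algebraic_closure_of F) \<and> Q \<in> mats n (algebraic_closure_of F) \<and>
        D \<in> mats n (algebraic_closure_of F) \<and> diagonal_mat D \<and> similar_mat_wit X D P Q)"

section \<open>Bases over a subfield\<close>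

text \<open>The coefficients range over the set \<open>F\<close>. Linear independence of a list excludes
  repeated entries.\<close>

definition vec_comb :: "nat \<Rightarrow> 'a::field list \<Rightarrow> 'a vec list \<Rightarrow> 'a vec" where
  "vec_comb n cs vs = vec n (\<lambda>i. \<Sum>k<length vs. cs ! k * (vs ! k) $ i)"

definition vec_basis :: "nat \<Rightarrow> 'a::field set \<Rightarrow> 'a vec set \<Rightarrow> 'a vec list \<Rightarrow> bool" where
  "vec_basis n F V vs \<longleftrightarrow> set vs \<subseteq> V \<and>
     V = {vec_comb n cs vs |cs. length cs = length vs \<and> set cs \<subseteq> F} \<and>
     (\<forall>cs. length cs = length vs \<and> set cs \<subseteq> F \<and> vec_comb n cs vs = 0\<^sub>v n \<longrightarrow> set cs \<subseteq> {0})"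

definition mat_comb :: "nat \<Rightarrow> 'a::field list \<Rightarrow> 'a mat list \<Rightarrow> 'a mat" where
  "mat_comb n cs Ms = mat n n (\<lambda>(i, j). \<Sum>k<length Ms. cs ! k * (Ms ! k) $$ (i, j))"

definition mat_span :: "nat \<Rightarrow> 'a::field set \<Rightarrow> 'a mat list \<Rightarrow> 'a mat set" where
  "mat_span n F Ms = {mat_comb n cs Ms |cs. length cs = length Ms \<and> set cs \<subseteq> F}"

definition mat_basis :: "nat \<Rightarrow> 'a::field set \<Rightarrow> 'a mat set \<Rightarrow> 'a mat list \<Rightarrow> bool" where
  "mat_basis n F V Ms \<longleftrightarrow> set Ms \<subseteq> V \<and> V = mat_span n F Ms \<and>
     (\<forall>cs. length cs = length Ms \<and> set cs \<subseteq> F \<and> mat_comb n cs Ms = 0\<^sub>m n n \<longrightarrow> set cs \<subseteq> {0})"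

section \<open>Algebraic groups, their Lie algebras, and the algebraic hull\<close>

text \<open>Polynomial functions with coefficients in \<open>F\<close>, regarded as functions of complex
  matrices. As \<open>F\<close> is infinite, such a function is determined by its values on \<open>mats n F\<close>.\<close>

inductive_set poly_funs :: "nat \<Rightarrow> complex set \<Rightarrow> (complex mat \<Rightarrow> complex) set"
  for n :: nat and F :: "complex set" where
  const: "c \<in> F \<Longrightarrow> (\<lambda>_. c) \<in> poly_funs n F"
| coord: "i < n \<Longrightarrow> j < n \<Longrightarrow> (\<lambda>A. A $$ (i, j)) \<in> poly_funs n F"
| add: "p \<in> poly_funs n F \<Longrightarrow> q \<in> poly_funs n F \<Longrightarrow> (\<lambda>A. p A + q A) \<in> poly_funs n F"
| mult: "p \<in> poly_funs n F \<Longrightarrow> q \<in> poly_funs n F \<Longrightarrow> (\<lambda>A. p A * q A) \<in> poly_funs n F"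

definition GL :: "nat \<Rightarrow> complex set \<Rightarrow> complex mat monoid" where
  "GL n F = \<lparr>carrier = {g \<in> mats n F. det g \<noteq> 0}, monoid.mult = (*), one = 1\<^sub>m n\<rparr>"

definition algebraic_group :: "nat \<Rightarrow> complex set \<Rightarrow> complex mat set \<Rightarrow> bool" where
  "algebraic_group n F G \<longleftrightarrow> subgroup G (GL n F) \<and>
     (\<exists>P \<subseteq> poly_funs n F. G = {g \<in> carrier (GL n F). \<forall>p\<in>P. p g = 0})"

text \<open>The tangent space at the identity, cut out by the whole ideal of polynomials vanishing
  on \<open>G\<close>. The derivative of \<open>p (1 + t A)\<close> at \<open>t = 0\<close> is the formal differential of \<open>p\<close> at the
  identity applied to \<open>A\<close>.\<close>

definition Lie :: "nat \<Rightarrow> complex set \<Rightarrow> complex mat set \<Rightarrow> complex mat set" where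
  "Lie n F G = {A \<in> mats n F. \<forall>p \<in> poly_funs n F. (\<forall>g\<in>G. p g = 0) \<longrightarrow>
     ((\<lambda>t::complex. p (1\<^sub>m n + t \<cdot>\<^sub>m A)) has_field_derivative 0) (at 0)}"

definition lie_subalgebra :: "nat \<Rightarrow> complex set \<Rightarrow> complex mat set \<Rightarrow> bool" where
  "lie_subalgebra n F L \<longleftrightarrow> L \<subseteq> mats n F \<and> 0\<^sub>m n n \<in> L \<and>
     (\<forall>A\<in>L. \<forall>B\<in>L. A + B \<in> L \<and> A * B - B * A \<in> L) \<and> (\<forall>c\<in>F. \<forall>A\<in>L. c \<cdot>\<^sub>m A \<in> L)"

definition algebraic_lie_algebra :: "nat \<Rightarrow> complex set \<Rightarrow> complex mat set \<Rightarrow> bool" where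
  "algebraic_lie_algebra n F L \<longleftrightarrow> lie_subalgebra n F L \<and>
     (\<exists>G. algebraic_group n F G \<and> L = Lie n F G)"

definition is_algebraic_hull ::
    "nat \<Rightarrow> complex set \<Rightarrow> complex mat set \<Rightarrow> complex mat set \<Rightarrow> bool" where
  "is_algebraic_hull n F L H \<longleftrightarrow> algebraic_lie_algebra n F H \<and> L \<subseteq> H \<and>
     (\<forall>M. algebraic_lie_algebra n F M \<and> L \<subseteq> M \<longrightarrow> H \<subseteq> M)"

inductive_set assoc_algebra :: "nat \<Rightarrow> complex set \<Rightarrow> complex mat \<Rightarrow> complex mat set"
  for n :: nat and F :: "complex set" and X :: "complex mat" where
  one: "1\<^sub>m n \<in> assoc_algebra n F X"
| gen: "X \<in> assoc_algebra n F X"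
| add: "A \<in> assoc_algebra n F X \<Longrightarrow> B \<in> assoc_algebra n F X \<Longrightarrow> A + B \<in> assoc_algebra n F X"
| smult: "c \<in> F \<Longrightarrow> A \<in> assoc_algebra n F X \<Longrightarrow> c \<cdot>\<^sub>m A \<in> assoc_algebra n F X"
| mult: "A \<in> assoc_algebra n F X \<Longrightarrow> B \<in> assoc_algebra n F X \<Longrightarrow> A * B \<in> assoc_algebra n F X"

section \<open>The steps of the procedure\<close>

definition eigenvalue_step ::
    "nat \<Rightarrow> complex set \<Rightarrow> complex mat \<Rightarrow> complex set \<Rightarrow> complex list \<Rightarrow> bool" where
  "eigenvalue_step n F X K \<alpha> \<longleftrightarrow> number_field K \<and> F \<subseteq> K \<and> set \<alpha> \<subseteq> K \<and> length \<alpha> = n \<and>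
     char_poly X = (\<Prod>a\<leftarrow>\<alpha>. [:- a, 1:])"

definition Lambda :: "nat \<Rightarrow> complex list \<Rightarrow> rat vec set" where
  "Lambda n \<alpha> = {e \<in> carrier_vec n. (\<Sum>k<n. of_rat (e $ k) * \<alpha> ! k) = 0}"

definition Lambda_step :: "nat \<Rightarrow> complex list \<Rightarrow> rat vec list \<Rightarrow> bool" where
  "Lambda_step n \<alpha> bs \<longleftrightarrow> vec_basis n UNIV (Lambda n \<alpha>) bs"

definition \<Delta> :: "nat \<Rightarrow> complex list \<Rightarrow> nat \<Rightarrow> rat vec \<Rightarrow> complex" where
  "\<Delta> n \<alpha> i e = (\<Sum>k<n. of_rat (e $ k) * (\<alpha> ! k) ^ i)"

definition Upsilon :: "nat \<Rightarrow> complex set \<Rightarrow> complex list \<Rightarrow> nat \<Rightarrow> complex vec set" where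
  "Upsilon n F \<alpha> t = {\<gamma> \<in> carrier_vec (t + 1). set\<^sub>v \<gamma> \<subseteq> F \<and>
     (\<forall>e \<in> Lambda n \<alpha>. (\<Sum>i\<le>t. \<Delta> n \<alpha> i e * \<gamma> $ i) = 0)}"

definition powers :: "complex mat \<Rightarrow> nat \<Rightarrow> complex mat list" where
  "powers X t = map (\<lambda>i. X ^\<^sub>m i) [0..<t + 1]"

definition Upsilon_step ::
    "nat \<Rightarrow> complex set \<Rightarrow> complex mat \<Rightarrow> complex list \<Rightarrow> nat \<Rightarrow> complex vec list \<Rightarrow> bool" where
  "Upsilon_step n F X \<alpha> t \<gamma>s \<longleftrightarrow>
     mat_basis n F (assoc_algebra n F X) (powers X t) \<and>
     vec_basis (t + 1) F (Upsilon n F \<alpha> t) \<gamma>s"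

definition returned_matrices ::
    "nat \<Rightarrow> complex mat \<Rightarrow> nat \<Rightarrow> complex vec list \<Rightarrow> complex mat list" where
  "returned_matrices n X t \<gamma>s = map (\<lambda>\<gamma>. mat_comb n (list_of_vec \<gamma>) (powers X t)) \<gamma>s"

section \<open>Effective computability\<close>

text \<open>Partial recursive functions, in the unary formulation where tuples are passed through
  the Cantor pairing \<^const>\<open>prod_encode\<close>; \<open>None\<close> is divergence.\<close>

inductive partial_recursive :: "(nat \<Rightarrow> nat option) \<Rightarrow> bool" where
  zero: "partial_recursive (\<lambda>_. Some 0)"
| succ: "partial_recursive (\<lambda>x. Some (Suc x))"
| left: "partial_recursive (\<lambda>x. Some (fst (prod_decode x)))"
| right: "partial_recursive (\<lambda>x. Some (snd (prod_decode x)))"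
| pair: "partial_recursive f \<Longrightarrow> partial_recursive g \<Longrightarrow>
    partial_recursive (\<lambda>x. Option.bind (f x) (\<lambda>a. Option.bind (g x) (\<lambda>b.
      Some (prod_encode (a, b)))))"
| comp: "partial_recursive f \<Longrightarrow> partial_recursive g \<Longrightarrow>
    partial_recursive (\<lambda>x. Option.bind (g x) f)"
| prim_rec: "partial_recursive f \<Longrightarrow> partial_recursive g \<Longrightarrow>
    partial_recursive (\<lambda>x. case prod_decode x of (a, m) \<Rightarrow>
      rec_nat (f a) (\<lambda>k r. Option.bind r (\<lambda>v. g (prod_encode (a, prod_encode (k, v))))) m)"
| minimize: "partial_recursive f \<Longrightarrow>
    partial_recursive (\<lambda>a.
      if \<exists>m. f (prod_encode (a, m)) = Some 0 \<and> (\<forall>k<m. f (prod_encode (a, k)) \<noteq> None)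
      then Some (LEAST m. f (prod_encode (a, m)) = Some 0) else None)"

text \<open>For computations a number field is given as \<open>\<rat>(\<theta>)\<close> by an irreducible rational polynomial
  \<open>f\<close> with root \<open>\<theta>\<close> (primitive element theorem), and its elements by rational polynomials
  evaluated at \<open>\<theta>\<close>. Only \<open>f\<close> is seen by an algorithm, not the choice of the root.\<close>

definition val :: "complex \<Rightarrow> rat poly \<Rightarrow> complex" where
  "val \<theta> p = poly (map_poly of_rat p) \<theta>"

definition Q_adjoin :: "complex \<Rightarrow> complex set" where
  "Q_adjoin \<theta> = range (val \<theta>)"

definition presents :: "rat poly \<Rightarrow> complex \<Rightarrow> bool" where
  "presents f \<theta> \<longleftrightarrow> irreducible f \<and> val \<theta> f = 0"

definition code_rat :: "rat \<Rightarrow> nat" where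
  "code_rat q = (case quotient_of q of (a, b) \<Rightarrow> prod_encode (int_encode a, int_encode b))"

definition code_poly :: "rat poly \<Rightarrow> nat" where
  "code_poly p = list_encode (map code_rat (coeffs p))"

definition code_list :: "('a \<Rightarrow> nat) \<Rightarrow> 'a list \<Rightarrow> nat" where
  "code_list c xs = list_encode (map c xs)"

definition code_vec :: "('a \<Rightarrow> nat) \<Rightarrow> 'a vec \<Rightarrow> nat" where
  "code_vec c v = code_list c (list_of_vec v)"

definition code_mat :: "('a \<Rightarrow> nat) \<Rightarrow> 'a mat \<Rightarrow> nat" where
  "code_mat c A = code_list (code_list c) (mat_to_list A)"

text \<open>Valid data before each step. The input is \<open>(f, A)\<close>, the matrix \<open>A\<close> of rational
  polynomials standing for \<open>map_mat (val \<theta>) A\<close>. Step 1 supplies the field \<open>K = \<rat>(\<eta>)\<close> through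
  the irreducible polynomial \<open>g\<close> of \<open>\<eta>\<close>, the inclusion \<open>F \<subseteq> K\<close> through \<open>h\<close> with \<open>\<theta> = h(\<eta>)\<close>,
  and the eigenvalues through polynomials \<open>as\<close> in \<open>\<eta>\<close>.\<close>

definition valid_input :: "rat poly \<Rightarrow> complex \<Rightarrow> nat \<Rightarrow> rat poly mat \<Rightarrow> bool" where
  "valid_input f \<theta> n A \<longleftrightarrow> presents f \<theta> \<and> 0 < n \<and> A \<in> carrier_mat n n \<and>
     semisimple n (Q_adjoin \<theta>) (map_mat (val \<theta>) A)"

definition valid_eigenvalues :: "complex \<Rightarrow> nat \<Rightarrow> rat poly mat \<Rightarrow>
    rat poly \<Rightarrow> complex \<Rightarrow> rat poly \<Rightarrow> rat poly list \<Rightarrow> bool" where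
  "valid_eigenvalues \<theta> n A g \<eta> h as \<longleftrightarrow> presents g \<eta> \<and> val \<eta> h = \<theta> \<and>
     eigenvalue_step n (Q_adjoin \<theta>) (map_mat (val \<theta>) A) (Q_adjoin \<eta>) (map (val \<eta>) as)"

definition valid_Lambda :: "nat \<Rightarrow> complex \<Rightarrow> rat poly list \<Rightarrow> rat vec list \<Rightarrow> bool" where
  "valid_Lambda n \<eta> as bs \<longleftrightarrow> Lambda_step n (map (val \<eta>) as) bs"

definition valid_Upsilon :: "complex \<Rightarrow> nat \<Rightarrow> rat poly mat \<Rightarrow> complex \<Rightarrow> rat poly list \<Rightarrow>
    nat \<Rightarrow> rat poly vec list \<Rightarrow> bool" where
  "valid_Upsilon \<theta> n A \<eta> as t cs \<longleftrightarrow>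
     Upsilon_step n (Q_adjoin \<theta>) (map_mat (val \<theta>) A) (map (val \<eta>) as) t
       (map (map_vec (val \<theta>)) cs)"

definition code_input :: "rat poly \<Rightarrow> rat poly mat \<Rightarrow> nat" where
  "code_input f A = prod_encode (code_poly f, code_mat code_poly A)"

definition code_eigenvalues :: "rat poly \<Rightarrow> rat poly \<Rightarrow> rat poly list \<Rightarrow> nat" where
  "code_eigenvalues g h as =
     prod_encode (code_poly g, prod_encode (code_poly h, code_list code_poly as))"

definition code_Lambda :: "rat vec list \<Rightarrow> nat" where
  "code_Lambda bs = code_list (code_vec code_rat) bs"

definition code_Upsilon :: "nat \<Rightarrow> rat poly vec list \<Rightarrow> nat" where
  "code_Upsilon t cs = prod_encode (t, code_list (code_vec code_poly) cs)"

end

theory Submission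
  imports Defs "Berlekamp_Zassenhaus.Factor_Bound"
begin

text \<open>Diagonalise \<open>X = P diag(d) Q\<close> over the algebraic closure and let \<open>Z\<close> be the set of eigenvalues.
  The group of those \<open>P diag(\<zeta>) Q\<close> defined over \<open>F\<close> for which \<open>\<zeta>\<close> satisfies all integral multiplicative
  relations that hold additively on \<open>Z\<close> is algebraic, and its Lie algebra consists of the
  \<open>P diag(\<zeta>) Q\<close> over \<open>F\<close> with \<open>\<zeta>\<close> orthogonal to all rational relations on \<open>Z\<close>. These \<open>\<zeta>\<close> are
  \<open>\<Sum> \<gamma>\<^sub>i z\<^sup>i\<close> with \<open>\<gamma>\<close> in \<open>\<Upsilon>\<close>. Enough \<open>F\<close>-rational points of the group come from the orthogonal
  projection off the relations, which commutes with Galois conjugation.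

  Each of the first three steps is an unbounded search for a result together with a certificate
  that consists of polynomial identities modulo \<open>f\<close> and \<open>g\<close>: the diagonalising matrices for step 1,
  and one-sided inverses showing that a family is a basis of a kernel for steps 2 and 3.
  Irreducibility over \<open>\<rat>\<close> is decided by the Mignotte bound on the coefficients of factors.\<close>

text \<open>No exponential and no structure theory of algebraic groups enters. For minimality, the
  ideal of an algebraic group with \<open>X\<close> in its Lie algebra is stable under the left
  invariant derivation of \<open>X\<close>, which multiplies a monomial with exponents
  \<open>m\<close> on the diagonal torus by the scalar \<open>\<omega> m\<close>. Iterates evaluated
  at 1 give all power moments of these scalars, hence every function of them, in particular the one
  that replaces \<open>X\<close> by an element of the hull. Conversely, tangency must be seen from
  points over \<open>F\<close>, while the matrices are diagonal only over an extension. With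
  \<open>p\<close> the orthogonal projection and \<open>N\<close> a common denominator, the
  eigenvalues prod_w (1 + s \<zeta>(w))^(N p(z,w)) satisfy the relations, have derivative N
  \<zeta>(z) and respect conjugation. \<open>K\<close> need not be normal, so embeddings of
  \<open>K\<close> over \<open>F\<close> play the part of a Galois group. An algorithm sees
  \<open>f\<close> but not \<theta>, so step 1 can meet a certificate at another root of
  \<open>f\<close>. In step 3 the system lies over \<open>K\<close> and its solutions over
  \<open>F\<close>; equational certificates exist because the same projection shows that solutions
  over \<open>F\<close> span those over \<open>K\<close>.\<close>

hide_const (open) up_ring.coeff up_ring.monom Module.smult Coset.order

section \<open>Computable functions between coded types\<close>

text \<open>Injectivity makes equality testable on codes. The codes need not fill the natural
  numbers: those of reduced fractions and of coefficient lists without trailing zeros do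
  not.\<close>

class coded =
  fixes enc :: "'a \<Rightarrow> nat"
  assumes enc_inj: "enc x = enc y \<Longrightarrow> x = y"
begin

lemma enc_eq_iff [simp]: "enc x = enc y \<longleftrightarrow> x = y"
  using enc_inj by blast

end

instantiation nat :: coded
begin
definition enc_nat_def [simp]: "enc (n :: nat) = n"
instance by standard simp
end

text \<open>\<^const>\<open>True\<close> is coded by \<open>0\<close>, the value that \<open>minimize\<close> searches for.\<close>

instantiation bool :: coded
begin
definition enc_bool_def: "enc b = (if b then 0 else 1 :: nat)"
instance by standard (simp add: enc_bool_def split: if_splits)
end

instantiation prod :: (coded, coded) coded
begin
definition enc_prod_def: "enc p = prod_encode (enc (fst p), enc (snd p))"
instance by standard (auto simp: enc_prod_def prod_eq_iff)
end

instantiation list :: (coded) coded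
begin
definition enc_list_def: "enc xs = list_encode (map enc xs)"
instance
proof
  fix xs ys :: "'a list"
  assume "enc xs = enc ys"
  then have "map enc xs = map enc ys" by (simp add: enc_list_def list_encode_eq)
  then show "xs = ys" by (simp add: inj_map_eq_map inj_def)
qed
end

instantiation int :: coded
begin
definition enc_int_def: "enc i = int_encode i"
instance by standard (simp add: enc_int_def int_encode_eq)
end

instantiation rat :: coded
begin
definition enc_rat_def: "enc q = code_rat q"
instance
proof
  fix p q :: rat
  assume "enc p = enc q"
  then have "quotient_of p = quotient_of q"
    by (cases "quotient_of p"; cases "quotient_of q") (simp add: enc_rat_def code_rat_def int_encode_eq)
  then show "p = q" by (simp add: quotient_of_inject)
qed
end

instantiation poly :: ("{zero,coded}") coded
begin
definition enc_poly_def: "enc p = enc (coeffs p)"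
instance by standard (simp add: enc_poly_def coeffs_eq_iff)
end

definition computable :: "('a::coded \<Rightarrow> 'b::coded) \<Rightarrow> bool" where
  "computable f \<longleftrightarrow> (\<exists>\<phi>. partial_recursive \<phi> \<and> (\<forall>x. \<phi> (enc x) = Some (enc (f x))))"

lemma computableI:
  "partial_recursive \<phi> \<Longrightarrow> (\<And>x. \<phi> (enc x) = Some (enc (f x))) \<Longrightarrow> computable f"
  unfolding computable_def by blast

named_theorems computable_intros

lemma computable_comp:
  assumes "computable f" "computable g"
  shows "computable (\<lambda>x. f (g x))"
proof -
  obtain \<phi> where \<phi>: "partial_recursive \<phi>" "\<And>x. \<phi> (enc x) = Some (enc (f x))"
    using assms(1) unfolding computable_def by blast
  obtain \<psi> where \<psi>: "partial_recursive \<psi>" "\<And>x. \<psi> (enc x) = Some (enc (g x))"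
    using assms(2) unfolding computable_def by blast
  show ?thesis
    by (rule computableI[OF partial_recursive.comp[OF \<phi>(1) \<psi>(1)]]) (simp add: \<phi> \<psi>)
qed

lemma computable_Pair [computable_intros]:
  assumes "computable f" "computable g"
  shows "computable (\<lambda>x. (f x, g x))"
proof -
  obtain \<phi> where \<phi>: "partial_recursive \<phi>" "\<And>x. \<phi> (enc x) = Some (enc (f x))"
    using assms(1) unfolding computable_def by blast
  obtain \<psi> where \<psi>: "partial_recursive \<psi>" "\<And>x. \<psi> (enc x) = Some (enc (g x))"
    using assms(2) unfolding computable_def by blast
  show ?thesis
    by (rule computableI[OF partial_recursive.pair[OF \<phi>(1) \<psi>(1)]]) (simp add: \<phi> \<psi> enc_prod_def)
qed

lemma computable_fst [computable_intros]: "computable f \<Longrightarrow> computable (\<lambda>x. fst (f x))"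
  by (rule computable_comp[of fst], rule computableI[OF partial_recursive.left])
     (simp_all add: enc_prod_def)

lemma computable_snd [computable_intros]: "computable f \<Longrightarrow> computable (\<lambda>x. snd (f x))"
  by (rule computable_comp[of snd], rule computableI[OF partial_recursive.right])
     (simp_all add: enc_prod_def)

text \<open>The basic functions contain no identity; pairing the two projections of
  \<open>prod_decode\<close> rebuilds the argument.\<close>

lemma partial_recursive_id: "partial_recursive (\<lambda>x. Some x)"
  using partial_recursive.comp[OF partial_recursive.left
    partial_recursive.pair[OF partial_recursive.succ partial_recursive.succ]]
    partial_recursive.pair[OF partial_recursive.left partial_recursive.right]
  by simp

lemma computable_ident [computable_intros]: "computable (\<lambda>x. x)"
  by (rule computableI[OF partial_recursive_id]) simp

lemma computable_const [computable_intros]: "computable (\<lambda>_. c)"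
proof -
  have "partial_recursive (\<lambda>_. Some n)" for n
  proof (induction n)
    case (Suc n)
    show ?case using partial_recursive.comp[OF partial_recursive.succ Suc] by simp
  qed (rule partial_recursive.zero)
  then show ?thesis by (rule computableI) simp
qed

text \<open>Codings of different types may be exchanged for one another through \<^const>\<open>enc\<close>.\<close>

lemma computable_enc_iff: "computable (\<lambda>x. enc (f x)) \<longleftrightarrow> computable f"
  unfolding computable_def by simp

text \<open>Computability is a notion for unary functions. This rule substitutes into a binary
  function through its uncurried form, where no introduction rule for that function is at
  hand.\<close>

lemma computable2:
  assumes "computable (\<lambda>p. h (fst p) (snd p))" "computable f" "computable g"
  shows "computable (\<lambda>x. h (f x) (g x))"
  using computable_comp[OF assms(1) computable_Pair[OF assms(2,3)]] by simp

lemma computable3: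
  assumes "computable (\<lambda>p. h (fst p) (fst (snd p)) (snd (snd p)))"
    "computable f" "computable g" "computable k"
  shows "computable (\<lambda>x. h (f x) (g x) (k x))"
  using computable_comp[OF assms(1) computable_Pair[OF assms(2) computable_Pair[OF assms(3,4)]]]
  by simp

lemma computable_Suc [computable_intros]: "computable f \<Longrightarrow> computable (\<lambda>x. Suc (f x))"
  by (rule computable_comp[of Suc], rule computableI[OF partial_recursive.succ]) simp_all

lemma computable_rec_nat [computable_intros]:
  assumes n: "computable n" and i: "computable i"
    and h: "computable (\<lambda>z. h (fst z) (fst (snd z)) (snd (snd z)))"
  shows "computable (\<lambda>x. rec_nat (i x) (\<lambda>k r. h x k r) (n x))"
proof -
  obtain \<phi> where \<phi>: "partial_recursive \<phi>" "\<And>x. \<phi> (enc x) = Some (enc (i x))"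
    using i unfolding computable_def by blast
  obtain \<psi> where \<psi>: "partial_recursive \<psi>"
      "\<And>z. \<psi> (enc z) = Some (enc (h (fst z) (fst (snd z)) (snd (snd z))))"
    using h unfolding computable_def by blast
  have \<psi>': "\<psi> (prod_encode (enc x, prod_encode (k, enc r))) = Some (enc (h x k r))" for x k r
    using \<psi>(2)[of "(x, k, r)"] by (simp add: enc_prod_def)
  have "rec_nat (\<phi> (enc x)) (\<lambda>k r. Option.bind r (\<lambda>v. \<psi> (prod_encode (enc x, prod_encode (k, v))))) m
      = Some (enc (rec_nat (i x) (\<lambda>k r. h x k r) m))" for x m
    by (induction m) (simp_all add: \<phi> \<psi>')
  then have "computable (\<lambda>p. rec_nat (i (fst p)) (\<lambda>k r. h (fst p) k r) (snd p))"
    by (intro computableI[OF partial_recursive.prim_rec[OF \<phi>(1) \<psi>(1)]]) (simp add: enc_prod_def)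
  from computable_comp[OF this computable_Pair[OF computable_ident n]] show ?thesis by simp
qed

lemma computable_eq_0: "computable (n :: 'a::coded \<Rightarrow> nat) \<Longrightarrow> computable (\<lambda>x. n x = 0)"
proof -
  assume "computable n"
  then have "computable (\<lambda>x. rec_nat (0::nat) (\<lambda>_ _. 1) (n x))"
    by (intro computable_intros)
  moreover have "rec_nat (0::nat) (\<lambda>_ _. 1) (n x) = enc (n x = 0)" for x
    by (cases "n x") (simp_all add: enc_bool_def)
  ultimately show ?thesis by (simp add: computable_enc_iff)
qed

text \<open>Truth is coded by 0, so a recursion on the code of the condition returns its start value
  for \<open>True\<close>, and runs one step that ignores the accumulator for
  \<open>False\<close>.\<close>

lemma computable_If [computable_intros]:
  assumes "computable b" "computable f" "computable g"
  shows "computable (\<lambda>x. if b x then f x else g x)"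
proof -
  have "computable (\<lambda>x. enc (b x))" using assms(1) by (simp add: computable_enc_iff)
  then have "computable (\<lambda>x. rec_nat (f x) (\<lambda>k _. g x) (enc (b x)))"
    using assms(2) computable_comp[OF assms(3) computable_fst[OF computable_ident]]
    by (intro computable_rec_nat)
  moreover have "rec_nat (f x) (\<lambda>k _. g x) (enc (b x)) = (if b x then f x else g x)" for x
    by (simp add: enc_bool_def)
  ultimately show ?thesis by simp
qed

lemma computable_conj [computable_intros]:
  assumes "computable P" "computable Q" shows "computable (\<lambda>x. P x \<and> Q x)"
  using computable_If[OF assms computable_const[of False]] by (simp add: if_bool_eq_conj conj_commute cong: conj_cong)

lemma computable_not [computable_intros]: "computable P \<Longrightarrow> computable (\<lambda>x. \<not> P x)"
  using computable_If[OF _ computable_const[of False] computable_const[of True], of P]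
  by (simp add: if_bool_eq_conj)

lemma computable_disj [computable_intros]:
  assumes "computable P" "computable Q" shows "computable (\<lambda>x. P x \<or> Q x)"
  using computable_not[OF computable_conj[OF computable_not computable_not, OF assms]] by simp

section \<open>Arithmetic, comparison and search on the natural numbers\<close>

lemma computable_plus_nat [computable_intros]:
  assumes "computable f" "computable g" shows "computable (\<lambda>x. f x + g x :: nat)"
proof -
  have "computable (\<lambda>x. rec_nat (f x) (\<lambda>k r. Suc r) (g x))"
    using assms by (intro computable_intros)
  moreover have "rec_nat a (\<lambda>k r. Suc r) b = a + b" for a b by (induction b) simp_all
  ultimately show ?thesis by simp
qed

lemma computable_mult_nat [computable_intros]:
  assumes "computable f" "computable g" shows "computable (\<lambda>x. f x * g x :: nat)"
proof -
  have "computable (\<lambda>x. rec_nat 0 (\<lambda>k r. r + f x) (g x))"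
    using assms(2) computable_comp[OF assms(1) computable_fst[OF computable_ident]]
    by (intro computable_intros)
  moreover have "rec_nat 0 (\<lambda>k r. r + a) b = a * b" for a b :: nat by (induction b) simp_all
  ultimately show ?thesis by simp
qed

lemma computable_diff_nat [computable_intros]:
  assumes "computable f" "computable g" shows "computable (\<lambda>x. f x - g x :: nat)"
proof -
  \<comment> \<open>The inner recursion is the predecessor: it forgets its accumulator and returns
    the last counter.\<close>
  have "computable (\<lambda>x. rec_nat (f x) (\<lambda>k r. rec_nat 0 (\<lambda>j _. j) r) (g x))"
    using assms by (intro computable_intros)
  moreover have "rec_nat 0 (\<lambda>j _. j) r = r - 1" for r :: nat by (cases r) simp_all
  moreover have "rec_nat a (\<lambda>k r. r - 1) b = a - b" for a b :: nat by (induction b) simp_all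
  ultimately show ?thesis by simp
qed

lemma computable_le_nat [computable_intros]:
  assumes "computable f" "computable g" shows "computable (\<lambda>x. f x \<le> (g x :: nat))"
  using computable_eq_0[OF computable_diff_nat, OF assms] by simp

lemma computable_less_nat [computable_intros]:
  assumes "computable f" "computable g" shows "computable (\<lambda>x. f x < (g x :: nat))"
  using computable_not[OF computable_le_nat, OF assms(2,1)] by (simp add: not_le)

text \<open>By injectivity of the coding, equality is a pair of inequalities between codes.\<close>

lemma computable_eq [computable_intros]:
  assumes "computable f" "computable g" shows "computable (\<lambda>x. f x = g x)"
proof -
  have "computable (\<lambda>x. enc (f x) \<le> enc (g x) \<and> enc (g x) \<le> enc (f x))"
    using assms by (intro computable_conj computable_le_nat) (simp_all add: computable_enc_iff)
  moreover have "(enc (f x) \<le> enc (g x) \<and> enc (g x) \<le> enc (f x)) = (f x = g x)" for x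
    unfolding order_eq_iff[symmetric] by simp
  ultimately show ?thesis by simp
qed

lemma computable_all_less [computable_intros]:
  fixes n :: "'a::coded \<Rightarrow> nat"
  assumes "computable n" and "computable (\<lambda>z. P (fst z) (snd z))"
  shows "computable (\<lambda>x. \<forall>k<n x. P x k)"
proof -
  have "computable (\<lambda>x. rec_nat True (\<lambda>k r. r \<and> P x k) (n x))"
    using assms(1) computable2[OF assms(2) computable_fst[OF computable_ident]
        computable_fst[OF computable_snd[OF computable_ident]]]
    by (intro computable_intros)
  moreover have "rec_nat True (\<lambda>k r. r \<and> Q k) m = (\<forall>k<m. Q k)" for Q and m
    by (induction m) (auto simp: less_Suc_eq)
  ultimately show ?thesis by simp
qed


text \<open>The only entrance of unbounded search. \<open>minimize\<close> demands that all values
  before the zero are defined, which holds because \<open>P\<close> is decided by a total function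
  on codes.\<close>

lemma partial_recursive_Least:
  assumes "computable (\<lambda>z. P (fst z) (snd z))"
  obtains \<phi> where "partial_recursive \<phi>"
    "\<And>x. \<exists>m. P x m \<Longrightarrow> \<phi> (enc x) = Some (LEAST m::nat. P x m)"
proof -
  obtain \<psi> where \<psi>: "partial_recursive \<psi>" "\<And>z. \<psi> (enc z) = Some (enc (P (fst z) (snd z)))"
    using assms unfolding computable_def by blast
  have *: "\<psi> (prod_encode (enc x, m)) = Some (enc (P x m))" for x m
    using \<psi>(2)[of "(x, m)"] by (simp add: enc_prod_def)
  have **: "\<psi> (prod_encode (enc x, m)) = Some 0 \<longleftrightarrow> P x m" for x m
    by (simp add: * enc_bool_def)
  show thesis
    by (rule that[OF partial_recursive.minimize[OF \<psi>(1)]]) (simp add: **, simp add: *)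
qed

lemma computable_Least:
  assumes "computable (\<lambda>z. P (fst z) (snd z))" "\<And>x. \<exists>m. P x m"
  shows "computable (\<lambda>x. LEAST m::nat. P x m)"
proof -
  obtain \<phi> where "partial_recursive \<phi>" "\<And>x. \<exists>m. P x m \<Longrightarrow> \<phi> (enc x) = Some (LEAST m. P x m)"
    using assms(1) by (rule partial_recursive_Least) blast
  then show ?thesis using assms(2) by (intro computableI[of \<phi>]) simp_all
qed

lemma computable_div_nat [computable_intros]:
  assumes "computable f" "computable g" shows "computable (\<lambda>x. f x div g x :: nat)"
proof -
  \<comment> \<open>The quotient is the least \<open>m\<close> with \<open>a < b * Suc m\<close>.
    The disjunct for \<open>b = 0\<close> makes the search total, and there the least
    \<open>m\<close> is 0, in accordance with \<open>a div 0 = 0\<close>.\<close>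
  have "computable (\<lambda>p::nat\<times>nat. LEAST m. snd p = 0 \<or> fst p < snd p * Suc m)"
  proof (rule computable_Least)
    show "computable (\<lambda>z. snd (fst z) = 0 \<or> fst (fst z) < snd (fst z) * Suc (snd z) :: bool)"
      by (intro computable_intros)
    show "\<exists>m. snd x = 0 \<or> fst x < snd x * Suc m" for x :: "nat \<times> nat"
      by (rule exI[of _ "fst x"]) (cases "snd x", auto)
  qed
  moreover have "(LEAST m. b = 0 \<or> a < b * Suc m) = a div b" for a b :: nat
  proof (cases "b = 0")
    case False
    then have "a < b * Suc m \<longleftrightarrow> a div b \<le> m" for m
      by (simp add: less_Suc_eq_le[symmetric] div_less_iff_less_mult mult.commute)
    then show ?thesis using False by (auto intro!: Least_equality)
  qed simp
  ultimately have "computable (\<lambda>p::nat\<times>nat. fst p div snd p)" by simp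
  from computable2[OF this assms] show ?thesis by simp
qed

lemma computable_mod_nat [computable_intros]:
  assumes "computable f" "computable g" shows "computable (\<lambda>x. f x mod g x :: nat)"
  unfolding minus_div_mult_eq_mod[symmetric] using assms by (intro computable_intros)

lemma computable_dvd_nat [computable_intros]:
  assumes "computable f" "computable g" shows "computable (\<lambda>x. f x dvd (g x :: nat))"
  unfolding dvd_eq_mod_eq_0 using assms by (intro computable_intros)

text \<open>A least-number search finds a greatest divisor when it counts down from
  \<open>a + b\<close>, which bounds the gcd. Starting there also gives the right answer when
  \<open>a\<close> or \<open>b\<close> is 0, where 0 divides only 0.\<close>

lemma computable_gcd_nat [computable_intros]:
  assumes "computable f" "computable g" shows "computable (\<lambda>x. gcd (f x) (g x :: nat))"
proof -
  let ?P = "\<lambda>(p::nat\<times>nat) m. fst p + snd p - m dvd fst p \<and> fst p + snd p - m dvd snd p"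
  have gle: "gcd a b \<le> a + b" for a b :: nat
    by (cases "a = 0") (simp_all add: trans_le_add1)
  have eq: "gcd a b = a + b - (LEAST m. ?P (a, b) m)" for a b
  proof -
    define g where "g = gcd a b"
    have g: "g dvd a" "g dvd b" by (simp_all add: g_def)
    have gle: "g \<le> a + b" unfolding g_def by (rule gle)
    have "(LEAST m. ?P (a, b) m) = a + b - g"
    proof (rule Least_equality)
      show "?P (a, b) (a + b - g)" using g gle by simp
    next
      fix m assume m: "?P (a, b) m"
      then have d: "a + b - m dvd g" by (simp add: g_def)
      show "a + b - g \<le> m"
      proof (cases "g = 0")
        case True
        then have "a = 0" "b = 0" by (simp_all add: g_def)
        then show ?thesis by simp
      next
        case False
        then have "a + b - m \<le> g" using d by (simp add: dvd_imp_le)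
        then show ?thesis by simp
      qed
    qed
    then show ?thesis using gle by (simp add: g_def)
  qed
  have "computable (\<lambda>p. LEAST m. ?P p m)"
  proof (rule computable_Least)
    show "computable (\<lambda>z. ?P (fst z) (snd z))" by (intro computable_intros)
    show "\<exists>m. ?P x m" for x
      by (rule exI[of _ "fst x + snd x - gcd (fst x) (snd x)"])
         (simp add: gle)
  qed
  then have "computable (\<lambda>p. fst p + snd p - (LEAST m. ?P p m))" by (intro computable_intros)
  then have "computable (\<lambda>p. gcd (fst p) (snd p :: nat))" by (simp add: eq)
  from computable2[OF this assms] show ?thesis by simp
qed


section \<open>Computability on integers, rationals, lists and polynomials\<close>

lemma int_encode_eq_if: "int_encode i = (if nat (- i) = 0 then 2 * nat i else 2 * nat (- i) - 1)"
  by (auto simp: int_encode_def sum_encode_def)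

lemma computable_nat [computable_intros]:
  assumes "computable i" shows "computable (\<lambda>x. nat (i x))"
proof -
  have "computable (\<lambda>n::nat. if n mod 2 = 0 then n div 2 else 0)"
    by (intro computable_intros)
  moreover have "computable (\<lambda>x. int_encode (i x))"
    using assms by (simp add: enc_int_def[symmetric] computable_enc_iff)
  ultimately have "computable (\<lambda>x. if int_encode (i x) mod 2 = 0 then int_encode (i x) div 2 else 0)"
    by (rule computable_comp)
  moreover have "(if int_encode j mod 2 = 0 then int_encode j div 2 else 0) = nat j" for j
    by (cases "nat (- j)") (simp_all add: int_encode_eq_if)
  ultimately show ?thesis by simp
qed

lemma computable_nat_uminus [computable_intros]:
  assumes "computable i" shows "computable (\<lambda>x. nat (- i x))"
proof -
  have "computable (\<lambda>n::nat. if n mod 2 = 0 then 0 else Suc n div 2)"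
    by (intro computable_intros)
  moreover have "computable (\<lambda>x. int_encode (i x))"
    using assms by (simp add: enc_int_def[symmetric] computable_enc_iff)
  ultimately have "computable (\<lambda>x. if int_encode (i x) mod 2 = 0 then 0 else Suc (int_encode (i x)) div 2)"
    by (rule computable_comp)
  moreover have "(if int_encode j mod 2 = 0 then 0 else Suc (int_encode j) div 2) = nat (- j)" for j
    by (cases "nat (- j)") (simp_all add: int_encode_eq_if)
  ultimately show ?thesis by simp
qed

lemma computable_int_diff:
  assumes "computable m" "computable n" shows "computable (\<lambda>x. int (m x) - int (n x))"
proof -
  have "computable (\<lambda>x. if n x - m x = 0 then 2 * (m x - n x) else 2 * (n x - m x) - 1)"
    using assms by (intro computable_intros)
  moreover have "(if b - a = 0 then 2 * (a - b) else 2 * (b - a) - 1) = enc (int a - int b)" for a b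
    by (auto simp: enc_int_def int_encode_eq_if nat_diff_distrib')
  ultimately show ?thesis by (simp add: computable_enc_iff)
qed

lemma computable_int [computable_intros]: "computable n \<Longrightarrow> computable (\<lambda>x. int (n x))"
  using computable_int_diff[OF _ computable_const[of 0]] by simp

lemma int_eq_nat_diff: "int (nat i) - int (nat (- i)) = i"
  by auto

lemma computable_plus_int [computable_intros]:
  assumes "computable i" "computable j" shows "computable (\<lambda>x. i x + j x :: int)"
proof -
  have "computable (\<lambda>x. int (nat (i x) + nat (j x)) - int (nat (- i x) + nat (- j x)))"
    using assms by (intro computable_int_diff computable_intros)
  moreover have "int (nat a + nat b) - int (nat (- a) + nat (- b)) = a + b" for a b by auto
  ultimately show ?thesis by simp
qed

lemma computable_uminus_int [computable_intros]:
  assumes "computable i" shows "computable (\<lambda>x. - i x :: int)"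
proof -
  have "computable (\<lambda>x. int (nat (- i x)) - int (nat (i x)))"
    using assms by (intro computable_int_diff computable_intros)
  moreover have "int (nat (- a)) - int (nat a) = - a" for a by auto
  ultimately show ?thesis by simp
qed

lemma computable_mult_int [computable_intros]:
  assumes "computable i" "computable j" shows "computable (\<lambda>x. i x * j x :: int)"
proof -
  have "computable (\<lambda>x. int (nat (i x) * nat (j x) + nat (- i x) * nat (- j x))
      - int (nat (i x) * nat (- j x) + nat (- i x) * nat (j x)))"
    using assms by (intro computable_int_diff computable_intros)
  moreover have "int (nat a * nat b + nat (- a) * nat (- b))
      - int (nat a * nat (- b) + nat (- a) * nat b) = a * b" for a b
  proof -
    have "a * b = (int (nat a) - int (nat (- a))) * (int (nat b) - int (nat (- b)))"
      by (simp only: int_eq_nat_diff)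
    also have "\<dots> = int (nat a * nat b + nat (- a) * nat (- b))
      - int (nat a * nat (- b) + nat (- a) * nat b)"
      by (simp only: of_nat_add of_nat_mult) (simp only: algebra_simps)
    finally show ?thesis by simp
  qed
  ultimately show ?thesis by simp
qed

section \<open>Rational numbers, through reduced fractions\<close>

lemma computable_normalize:
  assumes "computable i" "computable j"
  shows "computable (\<lambda>x. Rat.normalize (i x, j x))"
proof -
  define g where "g x = gcd (nat (i x) + nat (- i x)) (nat (j x) + nat (- j x))" for x
  have g: "computable g" unfolding g_def using assms by (intro computable_intros)
  \<comment> \<open>Zero and negative denominators are treated as in \<open>Rat.normalize\<close>,
    since the enumeration of the rationals will run through arbitrary pairs of integers.\<close>
  have "computable (\<lambda>x. if nat (j x) = 0 then if nat (- j x) = 0 then (0, 1)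
      else (int (nat (- i x) div g x) - int (nat (i x) div g x), int (nat (- j x) div g x))
      else (int (nat (i x) div g x) - int (nat (- i x) div g x), int (nat (j x) div g x)))"
    (is "computable ?f")
    using assms g by (intro computable_int_diff computable_intros)
  moreover have "?f x = Rat.normalize (i x, j x)" for x
  proof -
    have gi: "int (g x) = gcd (i x) (j x)"
    proof -
      have "nat a + nat (- a) = nat \<bar>a\<bar>" for a :: int by auto
      then show ?thesis by (simp only: g_def gcd_int_def)
    qed
    have div: "int (nat a div g x) - int (nat (- a) div g x) = a div gcd (i x) (j x)"
      if "gcd (i x) (j x) dvd a" for a
    proof (cases "a \<ge> 0")
      case True
      then show ?thesis by (simp add: zdiv_int gi)
    next
      case False
      then show ?thesis using that by (simp add: zdiv_int gi dvd_neg_div)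
    qed
    show ?thesis
      using div[of "i x"] div[of "j x"] div[of "- i x"] div[of "- j x"]
      by (auto simp: Rat.normalize_def Let_def dvd_div_neg)
  qed
  ultimately show ?thesis by simp
qed

text \<open>A rational has the same code as its reduced fraction, so that passing between the two is
  the identity on codes.\<close>

lemma computable_quotient_of [computable_intros]:
  assumes "computable q" shows "computable (\<lambda>x. quotient_of (q x))"
proof -
  have "enc (quotient_of p) = enc p" for p
    by (simp add: enc_rat_def code_rat_def enc_prod_def enc_int_def split: prod.split)
  then show ?thesis
    using assms computable_enc_iff[of "\<lambda>x. quotient_of (q x)"] computable_enc_iff[of q] by simp
qed

lemma computable_rat_of_quotient:
  assumes "computable (\<lambda>x. quotient_of (q x))" shows "computable q"
proof -
  have "enc (quotient_of p) = enc p" for p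
    by (simp add: enc_rat_def code_rat_def enc_prod_def enc_int_def split: prod.split)
  then show ?thesis
    using assms computable_enc_iff[of "\<lambda>x. quotient_of (q x)"] computable_enc_iff[of q] by simp
qed

lemma computable_plus_rat [computable_intros]:
  assumes "computable p" "computable q" shows "computable (\<lambda>x. p x + q x :: rat)"
proof (rule computable_rat_of_quotient)
  have "computable (\<lambda>x. Rat.normalize
      (fst (quotient_of (p x)) * snd (quotient_of (q x)) + fst (quotient_of (q x)) * snd (quotient_of (p x)),
       snd (quotient_of (p x)) * snd (quotient_of (q x))))"
    using assms by (intro computable_normalize computable_intros)
  then show "computable (\<lambda>x. quotient_of (p x + q x))"
    by (simp add: rat_plus_code case_prod_beta Let_def mult.commute)
qed

lemma computable_mult_rat [computable_intros]:
  assumes "computable p" "computable q" shows "computable (\<lambda>x. p x * q x :: rat)"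
proof (rule computable_rat_of_quotient)
  have "computable (\<lambda>x. Rat.normalize
      (fst (quotient_of (p x)) * fst (quotient_of (q x)), snd (quotient_of (p x)) * snd (quotient_of (q x))))"
    using assms by (intro computable_normalize computable_intros)
  then show "computable (\<lambda>x. quotient_of (p x * q x))"
    by (simp add: rat_times_code case_prod_beta Let_def)
qed

lemma computable_of_int_rat [computable_intros]:
  assumes "computable i" shows "computable (\<lambda>x. rat_of_int (i x))"
proof (rule computable_rat_of_quotient)
  show "computable (\<lambda>x. quotient_of (rat_of_int (i x)))"
    using assms by simp (intro computable_intros)
qed

section \<open>Lists\<close>

lemma computable_Cons [computable_intros]:
  assumes "computable f" "computable l" shows "computable (\<lambda>x. f x # l x)"
proof -
  have "computable (\<lambda>x. Suc (enc (f x, l x)))"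
    using assms by (intro computable_Suc) (simp add: computable_enc_iff computable_Pair)
  moreover have "Suc (enc (a, xs)) = enc (a # xs)" for a :: 'b and xs
    by (simp add: enc_prod_def enc_list_def)
  ultimately show ?thesis by (simp add: computable_enc_iff)
qed

text \<open>Lists are consumed by iterating the following function on a pair of a remaining list and an
  accumulator; the code of the list bounds its length.\<close>

definition list_step :: "('a \<Rightarrow> 'b \<Rightarrow> 'b) \<Rightarrow> 'a list \<times> 'b \<Rightarrow> 'a list \<times> 'b" where
  "list_step h s = (if fst s = [] then s else (tl (fst s), h (hd (fst s)) (snd s)))"

text \<open>The code of a nonempty list is the successor of the code of the pair of head and tail,
  so both are read off from the predecessor. The default \<open>d\<close> makes the function total;
  for \<open>hd\<close> it is taken to be \<open>hd []\<close>.\<close>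

lemma computable_hd_tl:
  fixes d :: "'a::coded"
  shows "computable (\<lambda>xs. if xs = [] then (d, []) else (hd xs, tl xs))"
proof -
  have *: "enc (a, xs) = enc (a # xs) - 1" for a :: 'a and xs
    by (simp add: enc_prod_def enc_list_def)
  have "computable (\<lambda>xs::'a list. if xs = [] then enc (d, []::'a list) else enc xs - 1)"
    by (intro computable_If computable_diff_nat computable_eq computable_ident computable_const)
       (simp add: computable_enc_iff computable_ident)
  moreover have "(if xs = [] then enc (d, []::'a list) else enc xs - 1)
      = enc (if xs = [] then (d, []) else (hd xs, tl xs))" for xs :: "'a list"
    using *[of "hd xs" "tl xs"] by (cases xs) simp_all
  ultimately show ?thesis by (simp add: computable_enc_iff)
qed

lemma computable_tl [computable_intros]:
  fixes l :: "'a::coded \<Rightarrow> 'b::coded list"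
  assumes "computable l" shows "computable (\<lambda>x. tl (l x))"
proof -
  have "computable (\<lambda>x. snd (if l x = [] then (undefined, []) else (hd (l x), tl (l x))))"
    by (rule computable_snd[OF computable_comp[OF computable_hd_tl assms]])
  moreover have "snd (if xs = [] then (undefined, []) else (hd xs, tl xs)) = tl xs" for xs :: "'b list"
    by simp
  ultimately show ?thesis by simp
qed

lemma computable_hd [computable_intros]:
  fixes l :: "'a::coded \<Rightarrow> 'b::coded list"
  assumes "computable l" shows "computable (\<lambda>x. hd (l x))"
proof -
  have "computable (\<lambda>x. fst (if l x = [] then (hd [], []) else (hd (l x), tl (l x))))"
    by (rule computable_fst[OF computable_comp[OF computable_hd_tl assms]])
  moreover have "fst (if xs = [] then (hd [], []) else (hd xs, tl xs)) = hd xs" for xs :: "'b list"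
    by simp
  ultimately show ?thesis by simp
qed

lemma length_le_enc: "length xs \<le> enc xs"
proof (induction xs)
  case (Cons a xs)
  have "enc xs \<le> prod_encode (enc a, enc xs)" by (rule le_prod_encode_2)
  then show ?case using Cons by (simp add: enc_list_def)
qed simp

lemma rec_nat_Suc_shift: "rec_nat s (\<lambda>_. f) (Suc m) = rec_nat (f s) (\<lambda>_. f) m"
  by (induction m) simp_all

text \<open>Once the list is exhausted \<open>list_step\<close> is stationary. Therefore any number
  of iterations above the length gives the fold, and primitive recursion applies although the length
  is not computable yet.\<close>

lemma list_step_iterate:
  "length xs \<le> n \<Longrightarrow> rec_nat (xs, a) (\<lambda>_. list_step h) n = ([], fold h xs a)"
proof (induction n arbitrary: xs a)
  case (Suc n)
  show ?case
  proof (cases xs)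
    case Nil
    have "list_step h ([], a) = ([], a)" by (simp add: list_step_def)
    then show ?thesis using Suc.IH[of "[]" a] Nil by (simp only: rec_nat_Suc_shift) simp
  next
    case (Cons b ys)
    have "list_step h (b # ys, a) = (ys, h b a)" by (simp add: list_step_def)
    then show ?thesis using Suc.IH[of ys "h b a"] Suc.prems Cons
      by (simp only: rec_nat_Suc_shift) simp
  qed
qed simp

lemma computable_fold [computable_intros]:
  assumes h: "computable (\<lambda>z. h (fst z) (fst (snd z)) (snd (snd z)))"
    and l: "computable l" and a: "computable a"
  shows "computable (\<lambda>x. fold (h x) (l x) (a x))"
proof -
  have "computable (\<lambda>z. (\<lambda>x (k::nat) s. list_step (h x) s) (fst z) (fst (snd z)) (snd (snd z)))"
    unfolding list_step_def using computable3[OF h]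
    by (intro computable_intros) (intro computable3[OF h] computable_intros)
  moreover have "computable (\<lambda>x. enc (l x))" using l by (simp add: computable_enc_iff)
  ultimately have "computable (\<lambda>x. snd (rec_nat (l x, a x) (\<lambda>_. list_step (h x)) (enc (l x))))"
    using l a by (intro computable_snd computable_rec_nat computable_Pair)
  then show ?thesis by (simp add: list_step_iterate length_le_enc)
qed

lemma computable_rev [computable_intros]:
  assumes "computable l" shows "computable (\<lambda>x. rev (l x))"
proof -
  have "computable (\<lambda>x. fold Cons (l x) [])" using assms by (intro computable_intros)
  then show ?thesis by (simp add: fold_Cons_rev)
qed

lemma computable_foldr [computable_intros]:
  assumes "computable (\<lambda>z. h (fst z) (fst (snd z)) (snd (snd z)))"
    and "computable l" and "computable a"
  shows "computable (\<lambda>x. foldr (h x) (l x) (a x))"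
  unfolding foldr_conv_fold using assms by (intro computable_intros)

lemma computable_map [computable_intros]:
  fixes f :: "'a::coded \<Rightarrow> 'b::coded \<Rightarrow> 'c::coded"
  assumes "computable (\<lambda>z. f (fst z) (snd z))" "computable l"
  shows "computable (\<lambda>x. map (f x) (l x))"
proof -
  have "computable (\<lambda>x. foldr (\<lambda>a r. f x a # r) (l x) [])"
    using assms(2) computable2[OF assms(1) computable_fst[OF computable_ident]
      computable_fst[OF computable_snd[OF computable_ident]]]
    by (intro computable_intros)
  moreover have "foldr (\<lambda>a r. g a # r) xs [] = map g xs" for g :: "'b \<Rightarrow> 'c" and xs
    by (induction xs) simp_all
  ultimately show ?thesis by simp
qed

lemma computable_append [computable_intros]:
  fixes l m :: "'a::coded \<Rightarrow> 'b::coded list"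
  assumes "computable l" "computable m" shows "computable (\<lambda>x. l x @ m x)"
proof -
  have "computable (\<lambda>x. foldr (\<lambda>a r. a # r) (l x) (m x))"
    using assms by (intro computable_intros)
  moreover have "foldr (\<lambda>a r. a # r) xs ys = xs @ ys" for xs ys :: "'b list"
    by (induction xs) simp_all
  ultimately show ?thesis by simp
qed

lemma computable_concat [computable_intros]:
  assumes "computable l" shows "computable (\<lambda>x. concat (l x))"
proof -
  have "computable (\<lambda>x. foldr (\<lambda>a r. a @ r) (l x) [])"
    using assms by (intro computable_intros)
  then show ?thesis by (simp add: concat_conv_foldr)
qed

lemma computable_length [computable_intros]:
  fixes l :: "'a::coded \<Rightarrow> 'b::coded list"
  assumes "computable l" shows "computable (\<lambda>x. length (l x))"
proof -
  have "computable (\<lambda>x. foldr (\<lambda>a r. Suc r) (l x) 0)"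
    using assms by (intro computable_intros)
  moreover have "foldr (\<lambda>a r. Suc r) xs 0 = length xs" for xs :: "'b list"
    by (induction xs) simp_all
  ultimately show ?thesis by simp
qed

lemma computable_list_all [computable_intros]:
  fixes P :: "'a::coded \<Rightarrow> 'b::coded \<Rightarrow> bool"
  assumes "computable (\<lambda>z. P (fst z) (snd z))" "computable l"
  shows "computable (\<lambda>x. \<forall>a\<in>set (l x). P x a)"
proof -
  have "computable (\<lambda>x. foldr (\<lambda>a r. P x a \<and> r) (l x) True)"
    using assms(2) computable2[OF assms(1) computable_fst[OF computable_ident]
      computable_fst[OF computable_snd[OF computable_ident]]]
    by (intro computable_intros)
  moreover have "foldr (\<lambda>a r. Q a \<and> r) xs True = (\<forall>a\<in>set xs. Q a)" for Q :: "'b \<Rightarrow> bool" and xs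
    by (induction xs) simp_all
  ultimately show ?thesis by simp
qed

lemma computable_drop [computable_intros]:
  fixes l :: "'a::coded \<Rightarrow> 'b::coded list"
  assumes "computable n" "computable l" shows "computable (\<lambda>x. drop (n x) (l x))"
proof -
  have "computable (\<lambda>x. rec_nat (l x) (\<lambda>_ r. tl r) (n x))" using assms by (intro computable_intros)
  moreover have "rec_nat xs (\<lambda>_ r. tl r) m = drop m xs" for xs :: "'b list" and m
    by (induction m) (simp_all add: tl_drop drop_Suc)
  ultimately show ?thesis by simp
qed

lemma computable_nth_default [computable_intros]:
  fixes l :: "'a::coded \<Rightarrow> 'b::coded list"
  assumes "computable n" "computable l" shows "computable (\<lambda>x. nth_default d (l x) (n x))"
proof -
  have "computable (\<lambda>x. if n x < length (l x) then hd (drop (n x) (l x)) else d)"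
    using assms by (intro computable_intros)
  moreover have "(if m < length xs then hd (drop m xs) else d) = nth_default d xs m" for m and xs :: "'b list"
    by (simp add: nth_default_def hd_drop_conv_nth)
  ultimately show ?thesis by simp
qed

lemma computable_upt [computable_intros]:
  assumes "computable n" shows "computable (\<lambda>x. [0..<n x])"
proof -
  have "computable (\<lambda>x. rec_nat [] (\<lambda>k r. r @ [k]) (n x))" using assms by (intro computable_intros)
  moreover have "rec_nat [] (\<lambda>k r. r @ [k]) m = [0..<m]" for m by (induction m) simp_all
  ultimately show ?thesis by simp
qed

section \<open>Polynomials with rational coefficients\<close>

lemma computable_coeffs [computable_intros]: "computable p \<Longrightarrow> computable (\<lambda>x. coeffs (p x))"
  using computable_enc_iff[of p] computable_enc_iff[of "\<lambda>x. coeffs (p x)"]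
  by (simp add: enc_poly_def)

lemma computable_of_coeffs: "computable (\<lambda>x. coeffs (p x)) \<Longrightarrow> computable p"
  using computable_enc_iff[of p] computable_enc_iff[of "\<lambda>x. coeffs (p x)"]
  by (simp add: enc_poly_def)

lemma computable_pCons [computable_intros]:
  fixes p :: "'a::coded \<Rightarrow> 'b::{zero,coded} poly"
  assumes "computable a" "computable p" shows "computable (\<lambda>x. pCons (a x) (p x))"
proof (rule computable_of_coeffs)
  have "computable (\<lambda>x. if a x = 0 \<and> p x = 0 then [] else a x # coeffs (p x))"
    using assms by (intro computable_intros)
  moreover have "(if c = 0 \<and> q = 0 then [] else c # coeffs q) = coeffs (pCons c q)" for c and q :: "'b poly"
    by (auto simp: cCons_def)
  ultimately show "computable (\<lambda>x. coeffs (pCons (a x) (p x)))" by simp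
qed

lemma computable_Poly [computable_intros]:
  fixes l :: "'a::coded \<Rightarrow> 'b::{zero,coded} list"
  assumes "computable l" shows "computable (\<lambda>x. Poly (l x))"
proof -
  have "computable (\<lambda>x. foldr (\<lambda>a r. pCons a r) (l x) 0)" using assms by (intro computable_intros)
  moreover have "foldr (\<lambda>a r. pCons a r) xs 0 = Poly xs" for xs :: "'b list"
    by (induction xs) simp_all
  ultimately show ?thesis by simp
qed

lemma computable_coeff [computable_intros]:
  assumes "computable p" "computable n" shows "computable (\<lambda>x. coeff (p x) (n x))"
  using computable_nth_default[OF assms(2) computable_coeffs[OF assms(1)], of 0]
  by (simp add: nth_default_coeffs_eq)

lemma computable_degree [computable_intros]:
  assumes "computable p" shows "computable (\<lambda>x. degree (p x))"
proof -
  have "computable (\<lambda>x. length (coeffs (p x)) - 1)" using assms by (intro computable_intros)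
  then show ?thesis by (simp add: degree_eq_length_coeffs)
qed

lemma computable_plus_poly_rat [computable_intros]:
  fixes p q :: "'a::coded \<Rightarrow> rat poly"
  assumes "computable p" "computable q" shows "computable (\<lambda>x. p x + q x)"
proof -
  \<comment> \<open>The sum of the lengths is a bound for the number of coefficients that needs no
    maximum; \<open>Poly\<close> strips the surplus zeros.\<close>
  have "computable (\<lambda>x. Poly (map (\<lambda>i. coeff (p x) i + coeff (q x) i)
      [0..<length (coeffs (p x)) + length (coeffs (q x))]))"
    using computable_comp[OF assms(1) computable_fst[OF computable_ident]]
      computable_comp[OF assms(2) computable_fst[OF computable_ident]] assms
    by (intro computable_intros)
  moreover have "Poly (map (\<lambda>i. coeff a i + coeff b i) [0..<length (coeffs a) + length (coeffs b)]) = a + b"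
    for a b :: "rat poly"
  proof (rule poly_eqI)
    fix n
    have "coeff a n = 0" "coeff b n = 0" if "length (coeffs a) + length (coeffs b) \<le> n"
      using that by (simp_all add: nth_default_coeffs_eq[symmetric] nth_default_def)
    then show "coeff (Poly (map (\<lambda>i. coeff a i + coeff b i)
        [0..<length (coeffs a) + length (coeffs b)])) n = coeff (a + b) n"
      by (auto simp: nth_default_def)
  qed
  ultimately show ?thesis by simp
qed

lemma computable_smult_rat [computable_intros]:
  fixes p :: "'a::coded \<Rightarrow> rat poly"
  assumes "computable c" "computable p" shows "computable (\<lambda>x. smult (c x) (p x))"
proof -
  have "computable (\<lambda>x. Poly (map (\<lambda>a. c x * a) (coeffs (p x))))"
    using computable_comp[OF assms(1) computable_fst[OF computable_ident]] assms
    by (intro computable_intros)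
  moreover have "Poly (map (\<lambda>a. d * a) (coeffs q)) = smult d q" for d and q :: "rat poly"
    by (rule poly_eqI) (simp add: coeff_Poly nth_default_map_eq[of "\<lambda>a. d * a" 0 0] nth_default_coeffs_eq)
  ultimately show ?thesis by simp
qed

lemma computable_mult_poly_rat [computable_intros]:
  fixes p q :: "'a::coded \<Rightarrow> rat poly"
  assumes "computable p" "computable q" shows "computable (\<lambda>x. p x * q x)"
proof -
  have "computable (\<lambda>x. foldr (\<lambda>a r. smult a (q x) + pCons 0 r) (coeffs (p x)) 0)"
    using computable_comp[OF assms(2) computable_fst[OF computable_ident]] assms
    by (intro computable_intros)
  moreover have "foldr (\<lambda>a r. smult a b + pCons 0 r) (coeffs a) 0 = a * b" for a b :: "rat poly"
    by (simp add: times_poly_def fold_coeffs_def)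
  ultimately show ?thesis by simp
qed

lemma computable_pcompose_rat [computable_intros]:
  fixes p q :: "'a::coded \<Rightarrow> rat poly"
  assumes "computable p" "computable q" shows "computable (\<lambda>x. pcompose (p x) (q x))"
proof -
  have "computable (\<lambda>x. foldr (\<lambda>a r. [:a:] + q x * r) (coeffs (p x)) 0)"
    using computable_comp[OF assms(2) computable_fst[OF computable_ident]] assms
    by (intro computable_intros)
  moreover have "foldr (\<lambda>a r. [:a:] + b * r) (coeffs a) 0 = pcompose a b" for a b :: "rat poly"
    by (simp add: pcompose_def fold_coeffs_def)
  ultimately show ?thesis by simp
qed

lemma computable_sum_less:
  fixes f :: "'a::coded \<Rightarrow> nat \<Rightarrow> 'b::{coded,comm_monoid_add}"
  assumes plus: "computable (\<lambda>p::'b\<times>'b. fst p + snd p)"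
    and "computable n" and "computable (\<lambda>z. f (fst z) (snd z))"
  shows "computable (\<lambda>x. \<Sum>k<n x. f x k)"
proof -
  have "computable (\<lambda>x. rec_nat 0 (\<lambda>k r. r + f x k) (n x))"
    using assms(2) computable2[OF assms(3) computable_fst[OF computable_ident]
        computable_fst[OF computable_snd[OF computable_ident]]]
    by (intro computable_intros computable2[OF plus])
  moreover have "rec_nat 0 (\<lambda>k r. r + g k) m = (\<Sum>k<m. g k)" for g :: "nat \<Rightarrow> 'b" and m
    by (induction m) simp_all
  ultimately show ?thesis by simp
qed

section \<open>Semidecidable predicates\<close>

text \<open>The enumeration does not have to invert the coding: for a search surjectivity suffices,
  and repetitions are harmless. This admits the enumeration of the rationals by all pairs of
  integers.\<close>

class enumerable = coded +
  fixes dec :: "nat \<Rightarrow> 'a"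
  assumes partial_recursive_dec: "\<exists>\<phi>. partial_recursive \<phi> \<and> (\<forall>n. \<phi> n = Some (enc (dec n)))"
    and dec_surj: "\<exists>n. dec n = x"

lemma computable_dec: "computable (dec :: nat \<Rightarrow> 'a::enumerable)"
  using partial_recursive_dec[where 'a = 'a] by (simp add: computable_def)

text \<open>Restates the first class axiom for instance proofs, where \<^const>\<open>computable\<close> on the new
  type is already meaningful.\<close>

lemma partial_recursive_decI:
  "computable d \<Longrightarrow> \<exists>\<phi>. partial_recursive \<phi> \<and> (\<forall>n. \<phi> n = Some (enc (d (n::nat))))"
  by (simp add: computable_def)

instantiation nat :: enumerable
begin
definition "dec n = (n :: nat)"
instance by standard (use partial_recursive_id in \<open>auto simp: dec_nat_def\<close>)
end

lemma computable_prod_decode [computable_intros]: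
  assumes "computable n" shows "computable (\<lambda>x. prod_decode (n x))"
proof -
  have "enc (prod_decode m) = m" for m
    by (simp add: enc_prod_def)
  then show ?thesis using assms computable_enc_iff[of "\<lambda>x. prod_decode (n x)"] by simp
qed

lemma computable_list_decode [computable_intros]:
  assumes "computable n" shows "computable (\<lambda>x. list_decode (n x))"
proof -
  have "enc (list_decode m) = m" for m
    by (simp add: enc_list_def map_idI)
  then show ?thesis using assms computable_enc_iff[of "\<lambda>x. list_decode (n x)"] by simp
qed

instantiation int :: enumerable
begin
definition "dec n = int_decode n"
instance
proof
  have "enc (int_decode m) = m" for m by (simp add: enc_int_def)
  then have "computable (dec :: nat \<Rightarrow> int)"
    using computable_enc_iff[of "dec :: nat \<Rightarrow> int"] by (simp add: dec_int_def[abs_def] computable_ident)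
  then show "\<exists>\<phi>. partial_recursive \<phi> \<and> (\<forall>n. \<phi> n = Some (enc (dec n :: int)))"
    by (rule partial_recursive_decI)
  show "\<exists>n. dec n = x" for x :: int
    by (rule exI[of _ "int_encode x"]) (simp add: dec_int_def)
qed
end

instantiation prod :: (enumerable, enumerable) enumerable
begin
definition "dec n = (dec (fst (prod_decode n)), dec (snd (prod_decode n)))"
instance
proof
  have "computable (dec :: nat \<Rightarrow> 'a \<times> 'b)"
    unfolding dec_prod_def[abs_def]
    by (intro computable_comp[OF computable_dec] computable_Pair computable_fst computable_snd
        computable_prod_decode computable_ident)
  then show "\<exists>\<phi>. partial_recursive \<phi> \<and> (\<forall>n. \<phi> n = Some (enc (dec n :: 'a \<times> 'b)))"
    by (rule partial_recursive_decI)
  show "\<exists>n. dec n = x" for x :: "'a \<times> 'b"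
  proof -
    obtain m n where "dec m = fst x" "dec n = snd x" using dec_surj by metis
    then have "dec (prod_encode (m, n)) = x" by (simp add: dec_prod_def)
    then show ?thesis ..
  qed
qed
end

instantiation list :: (enumerable) enumerable
begin
definition "dec n = map dec (list_decode n)"
instance
proof
  have "computable (dec :: nat \<Rightarrow> 'a list)"
    unfolding dec_list_def[abs_def]
    by (intro computable_map computable_comp[OF computable_dec] computable_snd
        computable_list_decode computable_ident)
  then show "\<exists>\<phi>. partial_recursive \<phi> \<and> (\<forall>n. \<phi> n = Some (enc (dec n :: 'a list)))"
    by (rule partial_recursive_decI)
  show "\<exists>n. dec n = xs" for xs :: "'a list"
  proof -
    obtain g :: "'a \<Rightarrow> nat" where g: "\<And>x. dec (g x) = x" using dec_surj by metis
    have "dec (list_encode (map g xs)) = xs"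
      by (simp add: dec_list_def g o_def)
    then show ?thesis ..
  qed
qed
end

instantiation rat :: enumerable
begin
definition "dec n = (let p = dec n in Rat.Fract (fst p) (snd p))"
instance
proof
  have "computable (\<lambda>n::nat. Rat.normalize (fst (dec n), snd (dec n)))"
    by (intro computable_normalize computable_fst computable_snd computable_dec)
  then have "computable (dec :: nat \<Rightarrow> rat)"
    by (intro computable_rat_of_quotient) (simp add: dec_rat_def Let_def quotient_of_Fract del: prod.collapse)
  then show "\<exists>\<phi>. partial_recursive \<phi> \<and> (\<forall>n. \<phi> n = Some (enc (dec n :: rat)))"
    by (rule partial_recursive_decI)
  show "\<exists>n. dec n = q" for q :: rat
  proof (cases q rule: Rat_cases)
    case (Fract a b)
    obtain n where "dec n = (a, b)" using dec_surj by metis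
    then have "dec n = q" by (simp add: dec_rat_def Fract)
    then show ?thesis ..
  qed
qed
end

instantiation poly :: ("{zero,enumerable}") enumerable
begin
definition "dec n = Poly (dec n)"
instance
proof
  have "computable (dec :: nat \<Rightarrow> 'a poly)"
    unfolding dec_poly_def[abs_def] by (intro computable_Poly computable_dec)
  then show "\<exists>\<phi>. partial_recursive \<phi> \<and> (\<forall>n. \<phi> n = Some (enc (dec n :: 'a poly)))"
    by (rule partial_recursive_decI)
  show "\<exists>n. dec n = p" for p :: "'a poly"
  proof -
    obtain n where "dec n = coeffs p" using dec_surj by metis
    then have "dec n = p" by (simp add: dec_poly_def)
    then show ?thesis ..
  qed
qed
end

text \<open>Negation is missing from the closure rules below. Certificates only combine equations,
  divisibilities and irreducibility by conjunction, bounded universal and unbounded existential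
  quantification.\<close>

definition semi :: "('a::coded \<Rightarrow> bool) \<Rightarrow> bool" where
  "semi P \<longleftrightarrow> (\<exists>R. computable (\<lambda>z. R (fst z) (snd z)) \<and> (\<forall>x. P x \<longleftrightarrow> (\<exists>m::nat. R x m)))"

named_theorems semi_intros

lemma semiE:
  assumes "semi P"
  obtains R where "computable (\<lambda>z. R (fst z) (snd z))" "\<And>x. P x \<longleftrightarrow> (\<exists>m::nat. R x m)"
  using assms unfolding semi_def by blast

lemma semi_computable: "computable P \<Longrightarrow> semi P"
  unfolding semi_def
  by (rule exI[of _ "\<lambda>x _. P x"]) (simp add: computable_comp[of P fst] computable_fst[OF computable_ident])

lemma semi_comp:
  assumes "semi P" "computable f" shows "semi (\<lambda>x. P (f x))"
proof -
  obtain R where R: "computable (\<lambda>z. R (fst z) (snd z))" "\<And>x. P x \<longleftrightarrow> (\<exists>m::nat. R x m)"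
    using assms(1) by (rule semiE) blast
  have "computable (\<lambda>z. R (f (fst z)) (snd z))"
    by (rule computable2[OF R(1) computable_comp[OF assms(2)]]) (intro computable_intros)+
  then show ?thesis unfolding semi_def R(2) by (intro exI[of _ "\<lambda>x m. R (f x) m"]) simp
qed

lemma semi_conj [semi_intros]:
  assumes "semi P" "semi Q" shows "semi (\<lambda>x. P x \<and> Q x)"
proof -
  obtain R where R: "computable (\<lambda>z. R (fst z) (snd z))" "\<And>x. P x \<longleftrightarrow> (\<exists>m::nat. R x m)"
    using assms(1) by (rule semiE) blast
  obtain S where S: "computable (\<lambda>z. S (fst z) (snd z))" "\<And>x. Q x \<longleftrightarrow> (\<exists>m::nat. S x m)"
    using assms(2) by (rule semiE) blast
  have "computable (\<lambda>z. R (fst z) (fst (prod_decode (snd z))) \<and> S (fst z) (snd (prod_decode (snd z))))"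
    by (intro computable_conj computable2[OF R(1)] computable2[OF S(1)] computable_intros)
  moreover have "P x \<and> Q x \<longleftrightarrow> (\<exists>m. R x (fst (prod_decode m)) \<and> S x (snd (prod_decode m)))" for x
    unfolding R(2) S(2) by (metis fst_conv snd_conv prod_encode_inverse)
  ultimately show ?thesis
    unfolding semi_def
    by (intro exI[of _ "\<lambda>x m. R x (fst (prod_decode m)) \<and> S x (snd (prod_decode m))"]) simp
qed

text \<open>A witness for the existential statement is a pair: an index of \<open>y\<close> in the
  enumeration and a witness for that \<open>y\<close>.\<close>

lemma semi_ex [semi_intros]:
  fixes P :: "'a::coded \<Rightarrow> 'b::enumerable \<Rightarrow> bool"
  assumes "semi (\<lambda>z. P (fst z) (snd z))" shows "semi (\<lambda>x. \<exists>y. P x y)"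
proof -
  obtain R where R: "computable (\<lambda>z. R (fst z) (snd z))"
      "\<And>z. P (fst z) (snd z) \<longleftrightarrow> (\<exists>m::nat. R z m)"
    using assms by (rule semiE) blast
  have "computable (\<lambda>z. R (fst z, dec (fst (prod_decode (snd z)))) (snd (prod_decode (snd z))))"
    by (intro computable2[OF R(1)] computable_Pair computable_comp[OF computable_dec] computable_intros)
  moreover have "(\<exists>y. P x y) \<longleftrightarrow> (\<exists>m. R (x, dec (fst (prod_decode m))) (snd (prod_decode m)))" for x
  proof
    assume "\<exists>y. P x y"
    then obtain y m where "R (x, y) m" using R(2)[of "(x, _)"] by auto
    moreover obtain k where "dec k = y" using dec_surj by blast
    ultimately have "R (x, dec (fst (prod_decode (prod_encode (k, m))))) (snd (prod_decode (prod_encode (k, m))))"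
      by simp
    then show "\<exists>m. R (x, dec (fst (prod_decode m))) (snd (prod_decode m))" ..
  next
    assume "\<exists>m. R (x, dec (fst (prod_decode m))) (snd (prod_decode m))"
    then show "\<exists>y. P x y" using R(2)[of "(x, _)"] by auto
  qed
  ultimately show ?thesis
    unfolding semi_def
    by (intro exI[of _ "\<lambda>x m. R (x, dec (fst (prod_decode m))) (snd (prod_decode m))"]) simp
qed

text \<open>Finitely many witnesses, one for each \<open>k\<close>, are collected in one coded
  list.\<close>

lemma semi_all_less [semi_intros]:
  fixes n :: "'a::coded \<Rightarrow> nat"
  assumes "computable n" and "semi (\<lambda>z. P (fst z) (snd z))"
  shows "semi (\<lambda>x. \<forall>k<n x. P x k)"
proof -
  obtain R where R: "computable (\<lambda>z. R (fst z) (snd z))"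
      "\<And>z. P (fst z) (snd z) \<longleftrightarrow> (\<exists>m::nat. R z m)"
    using assms(2) by (rule semiE) blast
  have P: "P x k \<longleftrightarrow> (\<exists>m. R (x, k) m)" for x k
    using R(2)[of "(x, k)"] by simp
  define S where "S x m \<longleftrightarrow> (\<forall>k<n x. R (x, k) (nth_default 0 (list_decode m) k))" for x m
  have "computable (\<lambda>z. S (fst z) (snd z))"
    unfolding S_def
    by (intro computable_all_less computable2[OF R(1)] computable_Pair
        computable_comp[OF assms(1)] computable_intros)
  moreover have "(\<forall>k<n x. P x k) \<longleftrightarrow> (\<exists>m. S x m)" for x
  proof
    assume "\<forall>k<n x. P x k"
    then obtain m where m: "\<forall>k<n x. R (x, k) (m k)" unfolding P by metis
    then have "S x (list_encode (map m [0..<n x]))"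
      by (simp add: S_def nth_default_nth)
    then show "\<exists>m. S x m" ..
  qed (auto simp: S_def P)
  ultimately show ?thesis unfolding semi_def by (intro exI[of _ S]) simp
qed

text \<open>Looking for a witness of each candidate in turn could get stuck at a wrong one. A single
  minimisation over pairs of a candidate and a witness avoids this; it finds some valid
  \<open>y\<close>, which is all that the procedure needs.\<close>

lemma semi_search:
  fixes P :: "'a::coded \<Rightarrow> 'b::enumerable \<Rightarrow> bool"
  assumes "semi (\<lambda>z. P (fst z) (snd z))"
  obtains \<phi> where "partial_recursive \<phi>"
    "\<And>x. \<exists>y. P x y \<Longrightarrow> \<exists>y. P x y \<and> \<phi> (enc x) = Some (enc y)"
proof -
  obtain R where R: "computable (\<lambda>z. R (fst z) (snd z))"
      "\<And>z. P (fst z) (snd z) \<longleftrightarrow> (\<exists>m::nat. R z m)"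
    using assms by (rule semiE) blast
  define S where "S x m \<longleftrightarrow> R (x, dec (fst (prod_decode m))) (snd (prod_decode m))" for x m
  have "computable (\<lambda>z. S (fst z) (snd z))"
    unfolding S_def
    by (intro computable2[OF R(1)] computable_Pair computable_comp[OF computable_dec] computable_intros)
  then obtain \<psi> where \<psi>: "partial_recursive \<psi>"
      "\<And>x. \<exists>m. S x m \<Longrightarrow> \<psi> (enc x) = Some (LEAST m. S x m)"
    by (rule partial_recursive_Least) blast
  have "computable (\<lambda>m. dec (fst (prod_decode m)) :: 'b)"
    by (intro computable_comp[OF computable_dec] computable_intros)
  then obtain \<chi> where \<chi>: "partial_recursive \<chi>" "\<And>m. \<chi> (enc m) = Some (enc (dec (fst (prod_decode m)) :: 'b))"
    unfolding computable_def by blast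
  show thesis
  proof (rule that[OF partial_recursive.comp[OF \<chi>(1) \<psi>(1)]])
    fix x
    assume "\<exists>y. P x y"
    then obtain y m where "R (x, y) m" using R(2)[of "(x, _)"] by auto
    moreover obtain k where "dec k = y" using dec_surj by blast
    ultimately have "S x (prod_encode (k, m))" by (simp add: S_def)
    then have ex: "\<exists>m. S x m" ..
    define m where "m = (LEAST m. S x m)"
    have "S x m" using LeastI_ex[OF ex] by (simp add: m_def)
    then have "P x (dec (fst (prod_decode m)))"
      using R(2)[of "(x, dec (fst (prod_decode m)))"] by (auto simp: S_def)
    moreover have "Option.bind (\<psi> (enc x)) \<chi> = Some (enc (dec (fst (prod_decode m)) :: 'b))"
      using \<psi>(2)[OF ex] \<chi>(2)[of m] by (simp add: m_def)
    ultimately show "\<exists>y. P x y \<and> Option.bind (\<psi> (enc x)) \<chi> = Some (enc y)" by blast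
  qed
qed

section \<open>Irreducibility over the rationals is semidecidable\<close>

text \<open>A crude integral form of Mignotte's bound: the Mahler measure and the leading
  coefficient are both replaced by the sum of squares, the binomial coefficients by a power of 2,
  and the last factor 2 adds the two summands. Only ring operations remain, so computability is
  immediate.\<close>

definition factor_coeff_bound :: "int list \<Rightarrow> int" where
  "factor_coeff_bound xs = 2 ^ Suc (length xs) * foldr (\<lambda>a r. a * a + r) xs 0"

lemma foldr_squares: "foldr (\<lambda>a r. a * a + r) xs (0 :: int) = (\<Sum>a\<leftarrow>xs. a * a)"
  by (induction xs) simp_all

lemma square_le_sum_squares: "a \<in> set xs \<Longrightarrow> a * a \<le> (\<Sum>a\<leftarrow>xs. a * a :: int)"
proof (induction xs)
  case (Cons b xs)
  have "0 \<le> (\<Sum>a\<leftarrow>xs. a * a)" by (rule sum_list_nonneg) auto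
  then show ?case using Cons by (auto intro: add_increasing)
qed simp

lemma abs_coeff_le_factor_coeff_bound:
  fixes f g :: "int poly"
  assumes "f \<noteq> 0" "g dvd f" "xs = coeffs f"
  shows "\<bar>coeff g k\<bar> \<le> factor_coeff_bound xs"
proof -
  define S where "S = (\<Sum>a\<leftarrow>coeffs f. a * a)"
  define n where "n = degree f"
  have lc: "lead_coeff f * lead_coeff f \<le> S"
    unfolding S_def using assms(1) by (intro square_le_sum_squares) (simp add: lead_coeff_list_def coeff_in_coeffs)
  \<comment> \<open>Integrality is what permits removing the square root: the Euclidean norm of
    Landau's inequality is at most its own square \<open>S\<close>.\<close>
  have sq: "\<bar>a\<bar> \<le> a * a" for a :: int
    by (cases "a = 0") (use abs_mult_self_eq[of a] mult_left_mono[of 1 "\<bar>a\<bar>" "\<bar>a\<bar>"] in auto)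
  have abs_lc: "\<bar>lead_coeff f\<bar> \<le> S" using lc sq order_trans by blast
  have "\<bar>lead_coeff f\<bar> > 0" using assms(1) by simp
  then have "S \<ge> 1" using abs_lc by linarith
  then have "S \<le> S * S" using sq[of S] by simp
  then have "real_of_int S \<le> real_of_int S * real_of_int S" by (metis of_int_le_iff of_int_mult)
  then have "sqrt (real_of_int S) \<le> real_of_int S"
    using \<open>S \<ge> 1\<close> by (intro real_le_lsqrt) (simp_all add: power2_eq_square)
  then have mm: "mahler_measure f \<le> S"
    using Landau_inequality_mahler_measure[of f] unfolding S_def by linarith
  have choose: "real (n - 1 choose j) \<le> 2 ^ length xs" for j
  proof -
    have "(n - 1 choose j) \<le> 2 ^ (n - 1)" by (rule binomial_le_pow2)
    also have "\<dots> \<le> 2 ^ length xs"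
      using assms by (intro power_increasing) (simp_all add: n_def length_coeffs_degree)
    finally have "real (n - 1 choose j) \<le> real (2 ^ length xs)" by (rule of_nat_mono)
    then show ?thesis by simp
  qed
  have deg: "degree g \<le> n" using assms(1,2) by (simp add: n_def dvd_imp_degree_le)
  have m0: "0 \<le> mahler_measure f" by (rule mahler_measure_ge_0)
  have "real_of_int \<bar>coeff g k\<bar> \<le> real (n - 1 choose k) * mahler_measure f
      + real (min k 1 * (n - 1 choose (k - 1))) * \<bar>lead_coeff f\<bar>"
  proof -
    have "real_of_int \<bar>coeff g k\<bar> \<le> real_of_int (\<lfloor>real (n - 1 choose k) * mahler_measure f\<rfloor>
        + int (min k 1 * (n - 1 choose (k - 1))) * \<bar>lead_coeff f\<bar>)"
      using mignotte_bound_main[OF assms(1,2) deg, of k] by (simp only: of_int_le_iff)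
    also have "\<dots> \<le> real (n - 1 choose k) * mahler_measure f
        + real (min k 1 * (n - 1 choose (k - 1))) * \<bar>lead_coeff f\<bar>"
      by (simp only: of_int_add of_int_mult of_int_of_nat_eq) (intro add_right_mono of_int_floor_le)
    finally show ?thesis .
  qed
  also have "\<dots> \<le> 2 ^ length xs * real_of_int S + 2 ^ length xs * real_of_int S"
  proof (rule add_mono)
    show "real (n - 1 choose k) * mahler_measure f \<le> 2 ^ length xs * real_of_int S"
      using choose mm m0 by (intro mult_mono) simp_all
    have "real (min k 1 * (n - 1 choose (k - 1))) \<le> 2 ^ length xs"
      using choose[of "k - 1"] by (cases k) simp_all
    then show "real (min k 1 * (n - 1 choose (k - 1))) * \<bar>lead_coeff f\<bar> \<le> 2 ^ length xs * real_of_int S"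
      using abs_lc by (intro mult_mono) simp_all
  qed
  also have "\<dots> = real_of_int (factor_coeff_bound xs)"
    by (simp add: factor_coeff_bound_def foldr_squares S_def assms(3))
  finally show ?thesis by linarith
qed

definition int_range :: "int \<Rightarrow> int list" where
  "int_range b = map (\<lambda>i. int i + - b) [0..<nat (b + b + 1)]"

lemma set_int_range: "a \<in> set (int_range b) \<longleftrightarrow> \<bar>a\<bar> \<le> b"
proof
  assume "\<bar>a\<bar> \<le> b"
  then have "a = int (nat (a + b)) + - b" "nat (a + b) < nat (b + b + 1)" by auto
  then show "a \<in> set (int_range b)" unfolding int_range_def set_map set_upt
    by (intro image_eqI[of _ _ "nat (a + b)"]) auto
qed (auto simp: int_range_def)

text \<open>For \<open>xs\<close> with a nonzero last entry these lists, trailing zeros allowed,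
  represent polynomials of degree strictly below that of \<open>xs\<close>; hence the length is one
  less.\<close>

definition small_factors :: "int list \<Rightarrow> int list list" where
  "small_factors xs = List.n_lists (length xs - 1) (int_range (factor_coeff_bound xs))"

text \<open>\<open>xs\<close> lists the coefficients of an integral multiple of \<open>g\<close>,
  which may have a nontrivial content: only factorisations into two factors of smaller degree are
  excluded, and by Gauss's lemma their absence over the integers gives irreducibility over the
  rationals.\<close>

definition irreducible_test :: "rat poly \<Rightarrow> int list \<Rightarrow> nat \<Rightarrow> bool" where
  "irreducible_test g xs m \<longleftrightarrow> m \<noteq> 0 \<and> 2 \<le> length xs \<and> hd (rev xs) \<noteq> 0 \<and>
     Poly (map rat_of_int xs) = smult (rat_of_int (int m)) g \<and>
     (\<forall>u\<in>set (small_factors xs). \<forall>v\<in>set (small_factors xs).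
        Poly (map rat_of_int u) * Poly (map rat_of_int v) \<noteq> Poly (map rat_of_int xs))"

lemma of_int_poly_Poly: "of_int_poly (Poly xs) = (Poly (map of_int xs) :: 'a::ring_char_0 poly)"
  by (rule poly_eqI) (simp add: coeff_map_poly nth_default_map_eq)

lemma irreducible_testD:
  assumes "irreducible_test g xs m" shows "irreducible g"
proof -
  define P where "P = Poly xs"
  have m: "m \<noteq> 0" and len: "2 \<le> length xs" and last: "hd (rev xs) \<noteq> 0"
    and P: "of_int_poly P = smult (of_nat m) g"
    and no: "\<And>u v. u \<in> set (small_factors xs) \<Longrightarrow> v \<in> set (small_factors xs) \<Longrightarrow>
      Poly (map rat_of_int u) * Poly (map rat_of_int v) \<noteq> Poly (map rat_of_int xs)"
    using assms by (auto simp: irreducible_test_def P_def of_int_poly_Poly)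
  have coeffs: "coeffs P = xs"
    using last len by (simp add: P_def strip_while_def) (metis dropWhile_eq_self_iff rev_rev_ident)
  have deg: "degree P = length xs - 1" by (simp add: degree_eq_length_coeffs coeffs)
  have P0: "P \<noteq> 0" using coeffs len by force
  have lists: "\<exists>u\<in>set (small_factors xs). q = Poly u" if "q dvd P" "degree q < degree P" for q
  proof -
    define u where "u = map (coeff q) [0..<length xs - 1]"
    have "q = Poly u"
      using that(2) by (intro poly_eqI) (auto simp: u_def nth_default_def deg coeff_eq_0)
    moreover have "u \<in> set (small_factors xs)"
      using abs_coeff_le_factor_coeff_bound[OF P0 that(1) coeffs[symmetric]]
      by (auto simp: small_factors_def set_n_lists u_def set_int_range)
    ultimately show ?thesis by blast
  qed
  have "irreducible\<^sub>d P"
  proof (rule irreducible\<^sub>dI)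
    show "degree P > 0" using len deg by simp
    fix q r
    assume d: "degree q < degree P" "degree r < degree P" and eq: "P = q * r"
    obtain u v where uv: "u \<in> set (small_factors xs)" "q = Poly u" "v \<in> set (small_factors xs)" "r = Poly v"
      using lists[OF _ d(1)] lists[OF _ d(2)] eq by (metis dvd_triv_left dvd_triv_right)
    have "Poly (map rat_of_int u) * Poly (map rat_of_int v) = of_int_poly (q * r)"
      by (simp add: of_int_poly_hom.hom_mult uv of_int_poly_Poly)
    also have "\<dots> = Poly (map rat_of_int xs)" by (simp add: eq[symmetric] P_def of_int_poly_Poly)
    finally show False using no uv by blast
  qed
  then have "irreducible\<^sub>d (map_poly rat_of_int P)" by (rule irreducible\<^sub>d_int_rat)
  then have "irreducible (smult (of_nat m) g)" unfolding P irreducible_connect_field .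
  then show ?thesis using m by simp
qed

lemma irreducible_test_ex:
  assumes "irreducible g" shows "\<exists>xs m. irreducible_test g xs m"
proof -
  obtain d P where dP: "rat_to_int_poly g = (d, P)" by force
  have g: "g = smult (inverse (of_int d)) (of_int_poly P)" and d: "d > 0"
    using rat_to_int_poly[OF dP] by auto
  define m where "m = nat d"
  have P: "of_int_poly P = smult (rat_of_int (int m)) g"
    using d by (subst g) (simp add: m_def)
  have degP: "degree P = degree g" by (subst g) (use d in simp)
  have "irreducible\<^sub>d g" using assms by simp
  then have dg: "degree g > 0" by auto
  have "P \<noteq> 0" using degP dg by force
  have len: "length (coeffs P) = Suc (degree g)"
    using \<open>P \<noteq> 0\<close> by (simp add: length_coeffs_degree degP)
  have irr: "irreducible (of_int_poly P :: rat poly)"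
    unfolding P using assms d by (simp add: m_def)
  have "irreducible_test g (coeffs P) m"
    unfolding irreducible_test_def
  proof (intro conjI ballI)
    show "m \<noteq> 0" using d by (simp add: m_def)
    show "2 \<le> length (coeffs P)" using len dg by simp
    show "hd (rev (coeffs P)) \<noteq> 0"
      using \<open>P \<noteq> 0\<close> by (simp add: hd_rev last_coeffs_eq_coeff_degree)
    show eq: "Poly (map rat_of_int (coeffs P)) = smult (rat_of_int (int m)) g"
      using P of_int_poly_Poly[of "coeffs P", where 'a = rat] by simp
    fix u v
    assume uv: "u \<in> set (small_factors (coeffs P))" "v \<in> set (small_factors (coeffs P))"
    show "Poly (map rat_of_int u) * Poly (map rat_of_int v) \<noteq> Poly (map rat_of_int (coeffs P))"
    proof
      assume "Poly (map rat_of_int u) * Poly (map rat_of_int v) = Poly (map rat_of_int (coeffs P))"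
      then have f: "of_int_poly P = Poly (map rat_of_int u) * Poly (map rat_of_int v)"
        using of_int_poly_Poly[of "coeffs P", where 'a = rat] by simp
      moreover have "degree (Poly (map rat_of_int w)) < degree g" if "w \<in> set (small_factors (coeffs P))" for w
      proof -
        have "length w = degree g" using that len by (simp add: small_factors_def set_n_lists)
        then show ?thesis using dg
          by (intro degree_lessI) (auto simp: nth_default_def)
      qed
      moreover have "degree (of_int_poly P :: rat poly) = degree g" by (simp add: degP)
      ultimately show False
        using irr f uv unfolding irreducible_connect_field[symmetric] irreducible\<^sub>d_def by metis
    qed
  qed
  then show ?thesis by blast
qed

lemma n_lists_rec: "List.n_lists n xs = rec_nat [[]] (\<lambda>_ L. concat (map (\<lambda>ys. map (\<lambda>y. y # ys) xs) L)) n"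
  by (induction n) simp_all

lemma computable_power_2 [computable_intros]:
  assumes "computable n" shows "computable (\<lambda>x. 2 ^ n x :: int)"
proof -
  have "computable (\<lambda>x. rec_nat 1 (\<lambda>_ r. 2 * r) (n x) :: int)" using assms by (intro computable_intros)
  moreover have "rec_nat 1 (\<lambda>_ r. 2 * r) m = (2 ^ m :: int)" for m by (induction m) simp_all
  ultimately show ?thesis by simp
qed

lemma computable_small_factors: "computable small_factors"
proof -
  have b: "computable factor_coeff_bound"
    unfolding factor_coeff_bound_def[abs_def] by (intro computable_intros)
  have r: "computable int_range"
    unfolding int_range_def[abs_def] by (intro computable_intros)
  have br: "computable (\<lambda>x. int_range (factor_coeff_bound x))" by (rule computable_comp[OF r b])
  show ?thesis
    unfolding small_factors_def[abs_def] n_lists_rec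
    by (intro computable_intros computable_comp[OF br])
qed

lemma semi_irreducible [semi_intros]:
  assumes "computable g" shows "semi (\<lambda>x. irreducible (g x :: rat poly))"
proof -
  have "computable (\<lambda>z. irreducible_test (fst z) (fst (snd z)) (snd (snd z)))"
    unfolding irreducible_test_def
    by (intro computable_intros computable_comp[OF computable_small_factors])
  \<comment> \<open>The integral multiple is searched for together with its factor \<open>m\<close>
    instead of being computed by clearing denominators.\<close>
  then have "semi (\<lambda>g. \<exists>xs. \<exists>m::nat. irreducible_test g xs m)"
    by (intro semi_ex semi_computable)
       (rule computable3, assumption, (intro computable_intros)+)
  moreover have "(\<exists>xs m. irreducible_test p xs m) \<longleftrightarrow> irreducible p" for p
    using irreducible_testD irreducible_test_ex by blast
  ultimately have "semi (\<lambda>g :: rat poly. irreducible g)" by simp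
  from semi_comp[OF this assms] show ?thesis .
qed

section \<open>Linear algebra over a subfield\<close>

text \<open>Stated for any ambient field, so that the linear algebra serves both the rationals, as
  \<open>UNIV\<close>, and subfields of the complex numbers.\<close>

definition is_subfield :: "'a::field set \<Rightarrow> bool" where
  "is_subfield F \<longleftrightarrow> 0 \<in> F \<and> 1 \<in> F \<and>
     (\<forall>x\<in>F. \<forall>y\<in>F. x + y \<in> F \<and> x * y \<in> F) \<and> (\<forall>x\<in>F. - x \<in> F \<and> inverse x \<in> F)"

lemma is_subfield_UNIV: "is_subfield UNIV"
  by (simp add: is_subfield_def)

lemma complex_subfield_iff: "complex_subfield F \<longleftrightarrow> is_subfield F"
  by (simp add: complex_subfield_def is_subfield_def)

context
  fixes F :: "'a::field set"
  assumes F: "is_subfield F"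
begin

lemma subfield_0: "0 \<in> F" and subfield_1: "1 \<in> F"
  and subfield_add: "x \<in> F \<Longrightarrow> y \<in> F \<Longrightarrow> x + y \<in> F"
  and subfield_mult: "x \<in> F \<Longrightarrow> y \<in> F \<Longrightarrow> x * y \<in> F"
  and subfield_uminus: "x \<in> F \<Longrightarrow> - x \<in> F"
  and subfield_inverse: "x \<in> F \<Longrightarrow> inverse x \<in> F"
  using F by (auto simp: is_subfield_def)

lemma subfield_diff: "x \<in> F \<Longrightarrow> y \<in> F \<Longrightarrow> x - y \<in> F"
  using subfield_add[of x "- y"] subfield_uminus by simp

lemma subfield_divide: "x \<in> F \<Longrightarrow> y \<in> F \<Longrightarrow> x / y \<in> F"
  by (simp add: divide_inverse subfield_mult subfield_inverse)

lemma subfield_sum: "(\<And>i. i \<in> A \<Longrightarrow> f i \<in> F) \<Longrightarrow> sum f A \<in> F"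
  by (induction A rule: infinite_finite_induct) (simp_all add: subfield_0 subfield_add)

lemma subfield_prod: "(\<And>i. i \<in> A \<Longrightarrow> f i \<in> F) \<Longrightarrow> prod f A \<in> F"
  by (induction A rule: infinite_finite_induct) (simp_all add: subfield_1 subfield_mult)

lemma subfield_power: "x \<in> F \<Longrightarrow> x ^ n \<in> F"
  by (induction n) (simp_all add: subfield_1 subfield_mult)

lemma subfield_of_nat: "of_nat n \<in> F"
  by (induction n) (simp_all add: subfield_0 subfield_1 subfield_add)

lemma subfield_of_int: "of_int i \<in> F"
  by (cases i rule: int_cases2) (simp_all add: subfield_of_nat subfield_uminus)

lemmas subfield_intros = subfield_0 subfield_1 subfield_add subfield_mult subfield_uminus
  subfield_inverse subfield_diff subfield_divide subfield_sum subfield_prod subfield_power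
  subfield_of_nat subfield_of_int

text \<open>A factorisation \<open>M = B C\<close> in which injectivity of \<open>B\<close> and
  surjectivity of \<open>C\<close> are expressed by one-sided inverses \<open>L\<close> and
  \<open>R\<close>. Such equations make rank statements checkable by a certificate.\<close>

definition rank_factors ::
    "nat \<Rightarrow> nat \<Rightarrow> (nat \<Rightarrow> nat \<Rightarrow> 'a) \<Rightarrow> nat \<Rightarrow> (nat \<Rightarrow> nat \<Rightarrow> 'a) \<Rightarrow> (nat \<Rightarrow> nat \<Rightarrow> 'a)
      \<Rightarrow> (nat \<Rightarrow> nat \<Rightarrow> 'a) \<Rightarrow> (nat \<Rightarrow> nat \<Rightarrow> 'a) \<Rightarrow> bool" where
  "rank_factors m n M r B C L R \<longleftrightarrow>
    (\<forall>i<m. \<forall>k<r. B i k \<in> F) \<and> (\<forall>k<r. \<forall>j<n. C k j \<in> F) \<and>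
    (\<forall>k<r. \<forall>i<m. L k i \<in> F) \<and> (\<forall>j<n. \<forall>k<r. R j k \<in> F) \<and>
    (\<forall>i<m. \<forall>j<n. M i j = (\<Sum>k<r. B i k * C k j)) \<and>
    (\<forall>k<r. \<forall>l<r. (\<Sum>i<m. L k i * B i l) = (if k = l then 1 else 0)) \<and>
    (\<forall>k<r. \<forall>l<r. (\<Sum>j<n. C k j * R j l) = (if k = l then 1 else 0))"

text \<open>Split off the rank one matrix through a nonzero entry \<open>(p, q)\<close>; what remains has a zero row
  \<open>p\<close> and a zero column \<open>q\<close>.\<close>

lemma full_rank_factorization:
  fixes M :: "nat \<Rightarrow> nat \<Rightarrow> 'a"
  assumes "\<forall>i<m. \<forall>j<n. M i j \<in> F"
  shows "\<exists>r B C L R. rank_factors m n M r B C L R"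
  using assms
proof (induction "card {i. i < m \<and> (\<exists>j<n. M i j \<noteq> 0)}" arbitrary: M rule: less_induct)
  case less
  show ?case
  proof (cases "\<exists>p<m. \<exists>q<n. M p q \<noteq> 0")
    case False
    then have "rank_factors m n M 0 B C L R" for B C L R by (auto simp: rank_factors_def)
    then show ?thesis by blast
  next
    case True
    then obtain p q where pq: "p < m" "q < n" "M p q \<noteq> 0" by blast
    define c where "c = M p q"
    define N where "N i j = M i j - M i q * inverse c * M p j" for i j
    have c: "c \<noteq> 0" "c \<in> F" using pq less.prems by (auto simp: c_def)
    have row: "N p j = 0" for j using c by (simp add: N_def c_def)
    have col: "N i q = 0" for i using c by (simp add: N_def c_def)
    have NF: "\<forall>i<m. \<forall>j<n. N i j \<in> F"
      using less.prems pq c by (auto simp: N_def intro!: subfield_intros)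
    have "{i. i < m \<and> (\<exists>j<n. N i j \<noteq> 0)} \<subset> {i. i < m \<and> (\<exists>j<n. M i j \<noteq> 0)}"
    proof (rule psubsetI)
      have "p \<notin> {i. i < m \<and> (\<exists>j<n. N i j \<noteq> 0)}" using row by simp
      then show "{i. i < m \<and> (\<exists>j<n. N i j \<noteq> 0)} \<noteq> {i. i < m \<and> (\<exists>j<n. M i j \<noteq> 0)}"
        using pq by blast
      show "{i. i < m \<and> (\<exists>j<n. N i j \<noteq> 0)} \<subseteq> {i. i < m \<and> (\<exists>j<n. M i j \<noteq> 0)}"
        using pq by (auto simp: N_def) (metis diff_zero mult_zero_left)
    qed
    then have smaller: "card {i. i < m \<and> (\<exists>j<n. N i j \<noteq> 0)} < card {i. i < m \<and> (\<exists>j<n. M i j \<noteq> 0)}"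
      by (intro psubset_card_mono) auto
    obtain r B C L R where rank: "rank_factors m n N r B C L R"
      using less.hyps[OF smaller NF] by blast
    have mem: "\<forall>i<m. \<forall>k<r. B i k \<in> F" "\<forall>k<r. \<forall>j<n. C k j \<in> F"
        "\<forall>k<r. \<forall>i<m. L k i \<in> F" "\<forall>j<n. \<forall>k<r. R j k \<in> F"
      and BC: "\<And>i j. i < m \<Longrightarrow> j < n \<Longrightarrow> N i j = (\<Sum>k<r. B i k * C k j)"
      and LB: "\<And>k l. k < r \<Longrightarrow> l < r \<Longrightarrow> (\<Sum>i<m. L k i * B i l) = (if k = l then 1 else 0)"
      and CR: "\<And>k l. k < r \<Longrightarrow> l < r \<Longrightarrow> (\<Sum>j<n. C k j * R j l) = (if k = l then 1 else 0)"
      using rank by (simp_all add: rank_factors_def)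
    \<comment> \<open>Row \<open>p\<close> of \<open>N = B C\<close> vanishes; multiplying it by the
      right inverse of \<open>C\<close> shows that row \<open>p\<close> of \<open>B\<close>
      vanishes. Column \<open>q\<close> of \<open>C\<close> is treated dually.\<close>
    have Bp: "B p l = 0" if "l < r" for l
    proof -
      have "0 = (\<Sum>j<n. N p j * R j l)" by (simp add: row)
      also have "\<dots> = (\<Sum>j<n. \<Sum>k<r. B p k * (C k j * R j l))"
        using pq by (simp add: BC sum_distrib_right mult.assoc)
      also have "\<dots> = (\<Sum>k<r. B p k * (\<Sum>j<n. C k j * R j l))"
        by (subst sum.swap) (simp add: sum_distrib_left)
      also have "\<dots> = B p l" using that by (simp add: CR if_distrib cong: if_cong)
      finally show ?thesis by simp
    qed
    have Cq: "C k q = 0" if "k < r" for k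
    proof -
      have "0 = (\<Sum>i<m. L k i * N i q)" by (simp add: col)
      also have "\<dots> = (\<Sum>i<m. \<Sum>l<r. L k i * B i l * C l q)"
        using pq by (simp add: BC sum_distrib_left mult.assoc)
      also have "\<dots> = (\<Sum>l<r. (\<Sum>i<m. L k i * B i l) * C l q)"
        by (subst sum.swap) (simp add: sum_distrib_right)
      also have "\<dots> = (\<Sum>l<r. if l = k then C l q else 0)"
        using that by (intro sum.cong) (auto simp: LB)
      also have "\<dots> = C k q" using that by simp
      finally show ?thesis by simp
    qed
    \<comment> \<open>The new column of \<open>B'\<close> is column \<open>q\<close> of
      \<open>M\<close>, the new row of \<open>C'\<close> is row \<open>p\<close> divided by the
      pivot. \<open>L\<close> is altered only at the index \<open>p\<close>, where \<open>B\<close>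
      vanishes, so that it kills the new column and still inverts the old ones; \<open>R\<close> is
      altered in the same way at \<open>q\<close>.\<close>
    define B' where "B' i k = (if k < r then B i k else M i q)" for i k
    define C' where "C' k j = (if k < r then C k j else inverse c * M p j)" for k j
    define L' where "L' k i = (if k < r then L k i - (if i = p then (\<Sum>i<m. L k i * M i q) * inverse c else 0)
      else if i = p then inverse c else 0)" for k i
    define R' where "R' j k = (if k < r then R j k - (if j = q then inverse c * (\<Sum>j<n. M p j * R j k) else 0)
      else if j = q then 1 else 0)" for j k
    have delta_p: "(\<Sum>i<m. (if i = p then x else 0) * f i) = x * f p" for x and f :: "nat \<Rightarrow> 'a"
      using pq(1) by (simp add: if_distrib[of "\<lambda>y. y * _"] cong: if_cong)
    have delta_q: "(\<Sum>j<n. f j * (if j = q then x else 0)) = f q * x" for x and f :: "nat \<Rightarrow> 'a"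
      using pq(2) by (simp add: if_distrib[of "\<lambda>y. _ * y"] cong: if_cong)
    have "\<forall>i<m. \<forall>k<Suc r. B' i k \<in> F" "\<forall>k<Suc r. \<forall>j<n. C' k j \<in> F"
      "\<forall>k<Suc r. \<forall>i<m. L' k i \<in> F" "\<forall>j<n. \<forall>k<Suc r. R' j k \<in> F"
      using mem less.prems pq c
      by (auto simp: B'_def C'_def L'_def R'_def intro!: subfield_intros)
    moreover have "\<forall>i<m. \<forall>j<n. M i j = (\<Sum>k<Suc r. B' i k * C' k j)"
    proof (intro allI impI)
      fix i j assume "i < m" "j < n"
      then have "(\<Sum>k<r. B i k * C k j) = M i j - M i q * inverse c * M p j"
        using BC by (simp add: N_def)
      then show "M i j = (\<Sum>k<Suc r. B' i k * C' k j)" by (simp add: B'_def C'_def)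
    qed
    moreover have "\<forall>k<Suc r. \<forall>l<Suc r. (\<Sum>i<m. L' k i * B' i l) = (if k = l then 1 else 0)"
    proof (intro allI impI)
      fix k l assume kl: "k < Suc r" "l < Suc r"
      show "(\<Sum>i<m. L' k i * B' i l) = (if k = l then 1 else 0)"
      proof (cases "k < r")
        case True
        have "(\<Sum>i<m. L' k i * B' i l)
            = (\<Sum>i<m. L k i * B' i l) - (\<Sum>i<m. L k i * M i q) * inverse c * B' p l"
          using True by (simp add: L'_def left_diff_distrib sum_subtractf delta_p)
        also have "\<dots> = (if k = l then 1 else 0)"
        proof (cases "l < r")
          case True
          then show ?thesis using \<open>k < r\<close> Bp by (simp add: B'_def LB)
        next
          case False
          then show ?thesis using \<open>k < r\<close> kl c by (simp add: B'_def c_def[symmetric])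
        qed
        finally show ?thesis .
      next
        case False
        then have "(\<Sum>i<m. L' k i * B' i l) = inverse c * B' p l"
          by (simp add: L'_def delta_p)
        also have "\<dots> = (if k = l then 1 else 0)"
          using False kl Bp c by (auto simp: B'_def c_def[symmetric])
        finally show ?thesis .
      qed
    qed
    moreover have "\<forall>k<Suc r. \<forall>l<Suc r. (\<Sum>j<n. C' k j * R' j l) = (if k = l then 1 else 0)"
    proof (intro allI impI)
      fix k l assume kl: "k < Suc r" "l < Suc r"
      show "(\<Sum>j<n. C' k j * R' j l) = (if k = l then 1 else 0)"
      proof (cases "l < r")
        case True
        have "(\<Sum>j<n. C' k j * R' j l)
            = (\<Sum>j<n. C' k j * R j l) - C' k q * (inverse c * (\<Sum>j<n. M p j * R j l))"
          using True by (simp add: R'_def right_diff_distrib sum_subtractf delta_q)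
        also have "\<dots> = (if k = l then 1 else 0)"
        proof (cases "k < r")
          case True
          then show ?thesis using \<open>l < r\<close> Cq by (simp add: C'_def CR)
        next
          case False
          then show ?thesis using \<open>l < r\<close> kl c
            by (simp add: C'_def c_def[symmetric] sum_distrib_left mult.assoc)
        qed
        finally show ?thesis .
      next
        case False
        then have "(\<Sum>j<n. C' k j * R' j l) = C' k q"
          by (simp add: R'_def delta_q)
        also have "\<dots> = (if k = l then 1 else 0)"
          using False kl Cq c by (auto simp: C'_def c_def[symmetric])
        finally show ?thesis .
      qed
    qed
    ultimately have "rank_factors m n M (Suc r) B' C' L' R'" unfolding rank_factors_def by blast
    then show ?thesis by blast
  qed
qed

text \<open>For \<open>M = B C\<close> take \<open>G = R L\<close>: then
  \<open>M G M = B (C R) (L B) C = B C\<close>.\<close>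

lemma generalized_inverse:
  fixes M :: "nat \<Rightarrow> nat \<Rightarrow> 'a"
  assumes "\<forall>i<m. \<forall>j<n. M i j \<in> F"
  obtains G where "\<forall>j<n. \<forall>i<m. G j i \<in> F"
    "\<And>i j. i < m \<Longrightarrow> j < n \<Longrightarrow> (\<Sum>k<n. M i k * (\<Sum>l<m. G k l * M l j)) = M i j"
proof -
  obtain r B C L R where rank: "rank_factors m n M r B C L R"
    using full_rank_factorization[OF assms] by blast
  have mem: "\<forall>i<m. \<forall>k<r. B i k \<in> F" "\<forall>k<r. \<forall>j<n. C k j \<in> F"
      "\<forall>k<r. \<forall>i<m. L k i \<in> F" "\<forall>j<n. \<forall>k<r. R j k \<in> F"
    and BC: "\<And>i j. i < m \<Longrightarrow> j < n \<Longrightarrow> M i j = (\<Sum>k<r. B i k * C k j)"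
    and LB: "\<And>k l. k < r \<Longrightarrow> l < r \<Longrightarrow> (\<Sum>i<m. L k i * B i l) = (if k = l then 1 else 0)"
    and CR: "\<And>k l. k < r \<Longrightarrow> l < r \<Longrightarrow> (\<Sum>j<n. C k j * R j l) = (if k = l then 1 else 0)"
    using rank by (simp_all add: rank_factors_def)
  define G where "G j i = (\<Sum>k<r. R j k * L k i)" for j i
  have LM: "(\<Sum>l<m. L k l * M l j) = C k j" if "k < r" "j < n" for k j
  proof -
    have "(\<Sum>l<m. L k l * M l j) = (\<Sum>l<m. \<Sum>i<r. L k l * B l i * C i j)"
      using that by (simp add: BC sum_distrib_left mult.assoc)
    also have "\<dots> = (\<Sum>i<r. (\<Sum>l<m. L k l * B l i) * C i j)"
      by (subst sum.swap) (simp add: sum_distrib_right)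
    also have "\<dots> = (\<Sum>i<r. if i = k then C i j else 0)"
      using that by (intro sum.cong) (auto simp: LB)
    finally show ?thesis using that by simp
  qed
  have GM: "(\<Sum>l<m. G k l * M l j) = (\<Sum>i<r. R k i * C i j)" if "j < n" for k j
  proof -
    have "(\<Sum>l<m. G k l * M l j) = (\<Sum>l<m. \<Sum>i<r. R k i * (L i l * M l j))"
      by (simp add: G_def sum_distrib_right mult.assoc)
    also have "\<dots> = (\<Sum>i<r. R k i * (\<Sum>l<m. L i l * M l j))"
      by (subst sum.swap) (simp add: sum_distrib_left)
    finally show ?thesis using that by (simp add: LM)
  qed
  have MR: "(\<Sum>k<n. M i k * R k l) = B i l" if "i < m" "l < r" for i l
  proof -
    have "(\<Sum>k<n. M i k * R k l) = (\<Sum>k<n. \<Sum>h<r. B i h * (C h k * R k l))"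
      using that by (simp add: BC sum_distrib_right mult.assoc)
    also have "\<dots> = (\<Sum>h<r. B i h * (\<Sum>k<n. C h k * R k l))"
      by (subst sum.swap) (simp add: sum_distrib_left)
    finally show ?thesis using that by (simp add: CR if_distrib cong: if_cong)
  qed
  show thesis
  proof (rule that[of G])
    show "\<forall>j<n. \<forall>i<m. G j i \<in> F"
      using mem(3,4) by (auto simp: G_def intro!: subfield_intros)
    fix i j assume ij: "i < m" "j < n"
    have "(\<Sum>k<n. M i k * (\<Sum>l<m. G k l * M l j)) = (\<Sum>k<n. \<Sum>h<r. M i k * R k h * C h j)"
      using ij by (simp add: GM sum_distrib_left mult.assoc)
    also have "\<dots> = (\<Sum>h<r. (\<Sum>k<n. M i k * R k h) * C h j)"
      by (subst sum.swap) (simp add: sum_distrib_right)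
    also have "\<dots> = (\<Sum>h<r. B i h * C h j)" using ij by (simp add: MR)
    also have "\<dots> = M i j" using ij by (simp add: BC)
    finally show "(\<Sum>k<n. M i k * (\<Sum>l<m. G k l * M l j)) = M i j" .
  qed
qed

text \<open>From \<open>M G M = M\<close> the columns of \<open>G M - 1\<close> lie in the kernel of
  \<open>M\<close>. They have entries in \<open>F\<close>, so injectivity on such vectors already
  makes them vanish.\<close>

lemma left_inverse_exists:
  fixes M :: "nat \<Rightarrow> nat \<Rightarrow> 'a"
  assumes M: "\<forall>i<m. \<forall>j<n. M i j \<in> F"
    and indep: "\<And>x. (\<forall>j<n. x j \<in> F) \<Longrightarrow> (\<forall>i<m. (\<Sum>j<n. M i j * x j) = 0) \<Longrightarrow> \<forall>j<n. x j = 0"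
  obtains L where "\<forall>k<n. \<forall>i<m. L k i \<in> F"
    "\<And>k l. k < n \<Longrightarrow> l < n \<Longrightarrow> (\<Sum>i<m. L k i * M i l) = (if k = l then 1 else 0)"
proof -
  obtain G where G: "\<forall>j<n. \<forall>i<m. G j i \<in> F"
    "\<And>i j. i < m \<Longrightarrow> j < n \<Longrightarrow> (\<Sum>k<n. M i k * (\<Sum>l<m. G k l * M l j)) = M i j"
    using generalized_inverse[OF M] by blast
  show thesis
  proof (rule that[OF G(1)])
    fix k l assume kl: "k < n" "l < n"
    define x where "x k = (\<Sum>i<m. G k i * M i l) - (if k = l then 1 else 0)" for k
    have "\<forall>j<n. x j \<in> F" using G(1) M kl by (auto simp: x_def intro!: subfield_intros)
    moreover have "(\<Sum>j<n. M i j * x j) = 0" if "i < m" for i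
      using that kl G(2) by (simp add: x_def right_diff_distrib sum_subtractf if_distrib[of "\<lambda>y. _ * y"] cong: if_cong)
    ultimately have "x k = 0" using indep[of x] kl by blast
    then show "(\<Sum>i<m. G k i * M i l) = (if k = l then 1 else 0)" by (simp add: x_def)
  qed
qed

text \<open>\<open>1 - G M\<close> projects onto the kernel, and the columns of its left rank factor
  \<open>B\<close> form a basis. The identity \<open>B U + V M = 1\<close> certifies spanning: a
  vector \<open>x\<close> of the kernel equals \<open>B (U x)\<close>.\<close>

lemma kernel_basis_exists:
  fixes M :: "nat \<Rightarrow> nat \<Rightarrow> 'a"
  assumes M: "\<forall>i<m. \<forall>j<n. M i j \<in> F"
  obtains r :: nat and B U L V where "\<forall>j<n. \<forall>k<r. B j k \<in> F" "\<forall>k<r. \<forall>j<n. U k j \<in> F"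
    "\<forall>k<r. \<forall>j<n. L k j \<in> F" "\<forall>j<n. \<forall>i<m. V j i \<in> F"
    "\<And>i k. i < m \<Longrightarrow> k < r \<Longrightarrow> (\<Sum>j<n. M i j * B j k) = 0"
    "\<And>k l. k < r \<Longrightarrow> l < r \<Longrightarrow> (\<Sum>j<n. L k j * B j l) = (if k = l then 1 else 0)"
    "\<And>j l. j < n \<Longrightarrow> l < n \<Longrightarrow>
      (\<Sum>k<r. B j k * U k l) + (\<Sum>i<m. V j i * M i l) = (if j = l then 1 else 0)"
proof -
  obtain G where G: "\<forall>j<n. \<forall>i<m. G j i \<in> F"
    "\<And>i j. i < m \<Longrightarrow> j < n \<Longrightarrow> (\<Sum>k<n. M i k * (\<Sum>l<m. G k l * M l j)) = M i j"
    using generalized_inverse[OF M] by blast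
  define P where "P j l = (if j = l then 1 else 0) - (\<Sum>i<m. G j i * M i l)" for j l
  have PF: "\<forall>j<n. \<forall>l<n. P j l \<in> F" using G(1) M by (auto simp: P_def intro!: subfield_intros)
  have MP: "(\<Sum>j<n. M i j * P j l) = 0" if "i < m" "l < n" for i l
    using that G(2) by (simp add: P_def right_diff_distrib sum_subtractf if_distrib[of "\<lambda>y. _ * y"] cong: if_cong)
  obtain r B C L R where rank: "rank_factors n n P r B C L R"
    using full_rank_factorization[OF PF] by blast
  have mem: "\<forall>i<n. \<forall>k<r. B i k \<in> F" "\<forall>k<r. \<forall>j<n. C k j \<in> F"
      "\<forall>k<r. \<forall>i<n. L k i \<in> F" "\<forall>j<n. \<forall>k<r. R j k \<in> F"
    and BC: "\<And>i j. i < n \<Longrightarrow> j < n \<Longrightarrow> P i j = (\<Sum>k<r. B i k * C k j)"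
    and LB: "\<And>k l. k < r \<Longrightarrow> l < r \<Longrightarrow> (\<Sum>i<n. L k i * B i l) = (if k = l then 1 else 0)"
    and CR: "\<And>k l. k < r \<Longrightarrow> l < r \<Longrightarrow> (\<Sum>j<n. C k j * R j l) = (if k = l then 1 else 0)"
    using rank by (simp_all add: rank_factors_def)
  have PR: "(\<Sum>k<n. P i k * R k l) = B i l" if "i < n" "l < r" for i l
  proof -
    have "(\<Sum>k<n. P i k * R k l) = (\<Sum>k<n. \<Sum>h<r. B i h * (C h k * R k l))"
      using that by (simp add: BC sum_distrib_right mult.assoc)
    also have "\<dots> = (\<Sum>h<r. B i h * (\<Sum>k<n. C h k * R k l))"
      by (subst sum.swap) (simp add: sum_distrib_left)
    finally show ?thesis using that by (simp add: CR if_distrib cong: if_cong)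
  qed
  show thesis
  proof (rule that[OF mem(1,2,3) G(1)])
    fix i k assume ik: "i < m" "k < r"
    have "(\<Sum>j<n. M i j * B j k) = (\<Sum>j<n. \<Sum>h<n. M i j * P j h * R h k)"
      using ik by (simp add: PR[symmetric] sum_distrib_left mult.assoc)
    also have "\<dots> = (\<Sum>h<n. (\<Sum>j<n. M i j * P j h) * R h k)"
      by (subst sum.swap) (simp add: sum_distrib_right)
    finally show "(\<Sum>j<n. M i j * B j k) = 0" using ik by (simp add: MP)
  next
    fix j l assume "j < n" "l < n"
    then show "(\<Sum>k<r. B j k * C k l) + (\<Sum>i<m. G j i * M i l) = (if j = l then 1 else 0)"
      by (simp add: BC[symmetric] P_def)
  qed (rule LB)
qed

end

section \<open>Polynomials over a subfield\<close>

definition polys_over :: "'a::field set \<Rightarrow> 'a poly set" where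
  "polys_over S = {p. \<forall>i. coeff p i \<in> S}"

context
  fixes S :: "'a::field set"
  assumes S: "is_subfield S"
begin

lemma polys_over_0: "0 \<in> polys_over S"
  and polys_over_1: "1 \<in> polys_over S"
  and polys_over_const: "c \<in> S \<Longrightarrow> [:c:] \<in> polys_over S"
  and polys_over_monom: "c \<in> S \<Longrightarrow> monom c n \<in> polys_over S"
  and polys_over_add: "p \<in> polys_over S \<Longrightarrow> q \<in> polys_over S \<Longrightarrow> p + q \<in> polys_over S"
  and polys_over_diff: "p \<in> polys_over S \<Longrightarrow> q \<in> polys_over S \<Longrightarrow> p - q \<in> polys_over S"
  and polys_over_uminus: "p \<in> polys_over S \<Longrightarrow> - p \<in> polys_over S"
  and polys_over_mult: "p \<in> polys_over S \<Longrightarrow> q \<in> polys_over S \<Longrightarrow> p * q \<in> polys_over S"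
  and polys_over_smult: "c \<in> S \<Longrightarrow> p \<in> polys_over S \<Longrightarrow> smult c p \<in> polys_over S"
  and polys_over_pCons: "c \<in> S \<Longrightarrow> p \<in> polys_over S \<Longrightarrow> pCons c p \<in> polys_over S"
  by (auto simp: polys_over_def coeff_mult coeff_1 coeff_pCons split: nat.splits
      intro!: subfield_intros[OF S])

lemmas polys_over_intros = polys_over_0 polys_over_1 polys_over_const polys_over_monom polys_over_add
  polys_over_diff polys_over_uminus polys_over_mult polys_over_smult polys_over_pCons

lemma polys_over_sum: "(\<And>i. i \<in> A \<Longrightarrow> f i \<in> polys_over S) \<Longrightarrow> sum f A \<in> polys_over S"
  by (induction A rule: infinite_finite_induct) (simp_all add: polys_over_0 polys_over_add)

lemma polys_over_prod: "(\<And>i. i \<in> A \<Longrightarrow> f i \<in> polys_over S) \<Longrightarrow> prod f A \<in> polys_over S"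
  by (induction A rule: infinite_finite_induct) (simp_all add: polys_over_1 polys_over_mult)

lemma polys_over_pcompose: "p \<in> polys_over S \<Longrightarrow> q \<in> polys_over S \<Longrightarrow> pcompose p q \<in> polys_over S"
proof (induction p)
  case (pCons a p)
  have "coeff (pCons a p) (Suc i) \<in> S" for i using pCons.prems by (simp only: polys_over_def mem_Collect_eq)
  then have "p \<in> polys_over S" by (simp add: polys_over_def)
  moreover have "coeff (pCons a p) 0 \<in> S" using pCons.prems by (simp only: polys_over_def mem_Collect_eq)
  ultimately show ?case using pCons by (simp add: pcompose_pCons polys_over_intros)
qed (simp add: polys_over_0)

lemma poly_in_subfield: "p \<in> polys_over S \<Longrightarrow> x \<in> S \<Longrightarrow> poly p x \<in> S"
  by (simp add: poly_altdef polys_over_def subfield_intros[OF S])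

end

context
  fixes S :: "'a::{field,field_gcd} set"
  assumes S: "is_subfield S"
begin

text \<open>Long division divides only by the leading coefficient of \<open>b\<close>, so quotient
  and remainder formed in the ambient field already have coefficients in \<open>S\<close>.\<close>

lemma polys_over_div_mod:
  assumes "a \<in> polys_over S" "b \<in> polys_over S"
  shows "a div b \<in> polys_over S \<and> a mod b \<in> polys_over S"
  using assms(1)
proof (induction "degree a" arbitrary: a rule: less_induct)
  case less
  show ?case
  proof (cases "b = 0 \<or> degree a < degree b")
    case True
    then show ?thesis using less.prems
      by (auto simp: mod_poly_less div_poly_less polys_over_0[OF S])
  next
    case False
    then have b: "b \<noteq> 0" "degree b \<le> degree a" by auto
    define t where "t = monom (lead_coeff a / lead_coeff b) (degree a - degree b)"
    define a' where "a' = a - t * b"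
    have t: "t \<in> polys_over S"
      using less.prems assms(2) by (auto simp: t_def polys_over_def intro!: subfield_intros[OF S])
    then have a': "a' \<in> polys_over S"
      using less.prems assms(2) by (simp add: a'_def polys_over_intros[OF S])
    have a: "a = a' + t * b" by (simp add: a'_def)
    have "a' div b \<in> polys_over S \<and> a' mod b \<in> polys_over S"
    proof (cases "a' = 0")
      case False
      have "degree (t * b) \<le> degree a"
        using degree_mult_le[of t b] degree_monom_le[of "lead_coeff a / lead_coeff b" "degree a - degree b"] b
        unfolding t_def by linarith
      then have "degree a' \<le> degree a" unfolding a'_def by (intro degree_diff_le) simp_all
      moreover have "coeff (t * b) (degree a) = lead_coeff a"
        using b by (simp add: t_def coeff_monom_mult)
      then have "coeff a' (degree a) = 0" by (simp add: a'_def)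
      then have "degree a' \<noteq> degree a" using False leading_coeff_neq_0 by metis
      ultimately show ?thesis using less.hyps[OF _ a'] by simp
    qed (simp add: polys_over_0[OF S])
    moreover have "a div b = t + a' div b" "a mod b = a' mod b"
      using b(1) by (subst a, simp)+
    ultimately show ?thesis using t by (simp add: polys_over_intros[OF S])
  qed
qed

lemma minimal_polynomial_over:
  assumes "p \<in> polys_over S" "p \<noteq> 0" "poly p x = 0"
  obtains m where "m \<in> polys_over S" "lead_coeff m = 1" "poly m x = 0" "degree m > 0"
    "\<And>q. q \<in> polys_over S \<Longrightarrow> poly q x = 0 \<Longrightarrow> m dvd q"
proof -
  let ?P = "\<lambda>p. p \<in> polys_over S \<and> p \<noteq> 0 \<and> poly p x = 0"
  obtain l where l: "?P l" and least: "\<And>q. ?P q \<Longrightarrow> degree l \<le> degree q"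
    using ex_has_least_nat[of ?P p degree] assms by blast
  define m where "m = smult (inverse (lead_coeff l)) l"
  have lc: "lead_coeff l \<in> S" "lead_coeff l \<noteq> 0" using l by (auto simp: polys_over_def)
  have m: "m \<in> polys_over S" "lead_coeff m = 1" "poly m x = 0" and deg: "degree m = degree l"
    using l lc by (auto simp: m_def polys_over_smult[OF S] subfield_intros[OF S])
  have m0: "m \<noteq> 0" using m(2) by auto
  show thesis
  proof (rule that[OF m])
    show "degree m > 0"
    proof (rule ccontr)
      assume "\<not> degree m > 0"
      then obtain c where "m = [:c:]" using degree_eq_zeroE by blast
      then show False using m(3) m0 by simp
    qed
    fix q assume q: "q \<in> polys_over S" "poly q x = 0"
    have "poly (q mod m) x = poly q x - poly (q div m * m) x"
      by (metis add_diff_cancel_left' div_mult_mod_eq poly_add)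
    then have "poly (q mod m) x = 0" using q m by simp
    moreover have "q mod m \<in> polys_over S" using polys_over_div_mod[OF q(1) m(1)] by simp
    ultimately have "q mod m = 0"
      using least[of "q mod m"] degree_mod_less[OF m0, of q] deg by force
    then show "m dvd q" by auto
  qed
qed

end

section \<open>Number fields\<close>

lemma val_hom: "comm_ring_hom (val \<theta>)"
proof -
  interpret of_rat_poly: map_poly_comm_ring_hom "of_rat :: rat \<Rightarrow> complex" ..
  show ?thesis
    by unfold_locales (simp_all add: val_def of_rat_poly.hom_add of_rat_poly.hom_mult)
qed

interpretation val_hom: comm_ring_hom "val \<theta>" for \<theta>
  by (rule val_hom)

lemma val_const [simp]: "val \<theta> [:c:] = of_rat c"
  by (simp add: val_def of_rat_hom.map_poly_pCons_hom)

lemma val_X [simp]: "val \<theta> (pCons 0 1) = \<theta>"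
  by (simp add: val_def of_rat_hom.map_poly_pCons_hom)

lemma val_smult [simp]: "val \<theta> (smult c p) = of_rat c * val \<theta> p"
  using val_hom.hom_mult[of \<theta> "[:c:]" p] by simp

lemma val_monom: "val \<theta> (monom c n) = of_rat c * \<theta> ^ n"
  by (simp add: val_def map_poly_monom poly_monom)

lemma val_altdef: "val \<theta> p = (\<Sum>i\<le>degree p. of_rat (coeff p i) * \<theta> ^ i)"
  by (simp add: val_def poly_altdef coeff_map_poly)

lemma val_pcompose: "val \<eta> (pcompose p h) = val (val \<eta> h) p"
  by (simp add: val_def of_rat_hom.map_poly_pcompose poly_pcompose)

text \<open>An irreducible \<open>f\<close> that does not divide \<open>p\<close> is coprime to it,
  and a Bezout identity has no common root. In this way an identity in the number field becomes a
  divisibility, which is semidecidable and does not mention the root.\<close>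

lemma val_eq_0_iff:
  assumes "presents f \<theta>" shows "val \<theta> p = 0 \<longleftrightarrow> f dvd p"
proof
  assume p: "val \<theta> p = 0"
  show "f dvd p"
  proof (rule ccontr)
    assume "\<not> f dvd p"
    then have "gcd f p = 1"
      using assms by (metis presents_def irreducible_imp_prime_elem_gcd prime_elem_imp_coprime coprime_iff_gcd_eq_1)
    then have "fst (bezout_coefficients f p) * f + snd (bezout_coefficients f p) * p = 1"
      using bezout_coefficients_fst_snd[of f p] by simp
    then have "val \<theta> (fst (bezout_coefficients f p) * f + snd (bezout_coefficients f p) * p) = 1"
      by simp
    then show False using p assms by (simp add: val_hom.hom_add val_hom.hom_mult presents_def)
  qed
qed (use assms in \<open>auto simp: presents_def val_hom.hom_mult\<close>)

lemma presents_dvd_transfer: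
  assumes "presents f \<theta>\<^sub>1" "presents f \<theta>" "val \<theta>\<^sub>1 p = 0" shows "val \<theta> p = 0"
  using assms val_eq_0_iff by blast

lemma presents_exists:
  assumes "p \<noteq> 0" "val x p = 0" obtains f where "presents f x"
proof -
  let ?P = "\<lambda>p. p \<noteq> 0 \<and> val x p = 0"
  obtain f where f: "?P f" and least: "\<And>q. ?P q \<Longrightarrow> degree f \<le> degree q"
    using ex_has_least_nat[of ?P p degree] assms by blast
  have "irreducible\<^sub>d f"
  proof (rule irreducible\<^sub>dI)
    show "degree f > 0"
    proof (rule ccontr)
      assume "\<not> degree f > 0"
      then obtain c where "f = [:c:]" using degree_eq_zeroE by blast
      then show False using f by simp
    qed
    fix q r assume d: "degree q < degree f" "degree r < degree f" "f = q * r"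
    then have "val x q = 0 \<or> val x r = 0" using f by (simp add: val_hom.hom_mult)
    moreover have "q \<noteq> 0" "r \<noteq> 0" using d f by auto
    ultimately show False using least[of q] least[of r] d by auto
  qed
  then have "presents f x" using f by (simp add: presents_def)
  then show thesis by (rule that)
qed

lemma subfield_of_rat:
  assumes "is_subfield (S :: complex set)" shows "of_rat q \<in> S"
  by (cases q) (simp add: of_rat_rat subfield_intros[OF assms])

lemma val_in_subfield:
  assumes "is_subfield S" "\<theta> \<in> S" shows "val \<theta> p \<in> S"
  by (simp add: val_altdef subfield_of_rat subfield_intros assms)

lemma Q_adjoin_mem [simp]: "val \<theta> p \<in> Q_adjoin \<theta>"
  by (simp add: Q_adjoin_def)

lemma Q_adjoin_gen: "\<theta> \<in> Q_adjoin \<theta>"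
  using Q_adjoin_mem[of \<theta> "[:0, 1:]"] by simp

lemma Q_adjoin_subset: "is_subfield S \<Longrightarrow> \<theta> \<in> S \<Longrightarrow> Q_adjoin \<theta> \<subseteq> S"
  by (auto simp: Q_adjoin_def val_in_subfield)

lemma is_subfield_Q_adjoin:
  assumes "presents f \<theta>" shows "is_subfield (Q_adjoin \<theta>)"
  unfolding is_subfield_def
proof (intro conjI ballI)
  fix x assume "x \<in> Q_adjoin \<theta>"
  then obtain p where x: "x = val \<theta> p" by (auto simp: Q_adjoin_def)
  show "- x \<in> Q_adjoin \<theta>" using Q_adjoin_mem[of \<theta> "- p"] by (simp add: x val_hom.hom_uminus)
  show "inverse x \<in> Q_adjoin \<theta>"
  proof (cases "x = 0")
    case True
    then show ?thesis using Q_adjoin_mem[of \<theta> 0] by simp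
  next
    case False
    then have "\<not> f dvd p" using val_eq_0_iff[OF assms] x by blast
    then have "gcd f p = 1"
      using assms by (metis presents_def irreducible_imp_prime_elem_gcd prime_elem_imp_coprime coprime_iff_gcd_eq_1)
    then have "fst (bezout_coefficients f p) * f + snd (bezout_coefficients f p) * p = 1"
      using bezout_coefficients_fst_snd[of f p] by simp
    then have "val \<theta> (fst (bezout_coefficients f p) * f + snd (bezout_coefficients f p) * p) = 1"
      by simp
    then have "val \<theta> (snd (bezout_coefficients f p)) * x = 1"
      using assms by (simp add: val_hom.hom_add val_hom.hom_mult presents_def x)
    then have "inverse x = val \<theta> (snd (bezout_coefficients f p))"
      using inverse_unique mult.commute by metis
    then show ?thesis by simp
  qed
  fix y assume "y \<in> Q_adjoin \<theta>"
  then obtain q where y: "y = val \<theta> q" by (auto simp: Q_adjoin_def)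
  show "x + y \<in> Q_adjoin \<theta>" using Q_adjoin_mem[of \<theta> "p + q"] by (simp add: x y val_hom.hom_add)
  show "x * y \<in> Q_adjoin \<theta>" using Q_adjoin_mem[of \<theta> "p * q"] by (simp add: x y val_hom.hom_mult)
next
  show "0 \<in> Q_adjoin \<theta>" using Q_adjoin_mem[of \<theta> 0] by simp
  show "1 \<in> Q_adjoin \<theta>" using Q_adjoin_mem[of \<theta> 1] by simp
qed

section \<open>Number fields as finite-dimensional vector spaces over the rationals\<close>

interpretation qvs: vector_space "\<lambda>(q::rat) (x::complex). of_rat q * x"
  by unfold_locales (simp_all add: algebra_simps of_rat_add of_rat_mult)

lemma number_field_iff: "number_field K \<longleftrightarrow> is_subfield K \<and> (\<exists>B. finite B \<and> K = qvs.span B)"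
  by (simp add: number_field_def complex_subfield_iff)

lemma number_field_Q_adjoin:
  assumes "presents f \<theta>" shows "number_field (Q_adjoin \<theta>)"
proof -
  have sub: "is_subfield (Q_adjoin \<theta>)" by (rule is_subfield_Q_adjoin[OF assms])
  have f0: "f \<noteq> 0" using assms by (auto simp: presents_def)
  define B where "B = (\<lambda>i. \<theta> ^ i) ` {..degree f}"
  have "Q_adjoin \<theta> = qvs.span B"
  proof
    show "Q_adjoin \<theta> \<subseteq> qvs.span B"
    proof
      fix x assume "x \<in> Q_adjoin \<theta>"
      then obtain p where x: "x = val \<theta> p" by (auto simp: Q_adjoin_def)
      have "val \<theta> p = val \<theta> (p div f * f + p mod f)" by simp
      also have "\<dots> = val \<theta> (p mod f)"
        unfolding val_hom.hom_add val_hom.hom_mult using assms by (simp add: presents_def)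
      also have "\<dots> = (\<Sum>i\<le>degree (p mod f). of_rat (coeff (p mod f) i) * \<theta> ^ i)" by (rule val_altdef)
      finally have x': "x = (\<Sum>i\<le>degree (p mod f). of_rat (coeff (p mod f) i) * \<theta> ^ i)" by (simp add: x)
      have "degree (p mod f) \<le> degree f" using degree_mod_less[OF f0, of p] by auto
      then show "x \<in> qvs.span B" unfolding x'
        by (intro qvs.span_sum qvs.span_scale qvs.span_base) (auto simp: B_def)
    qed
    show "qvs.span B \<subseteq> Q_adjoin \<theta>"
    proof (rule qvs.span_minimal)
      show "B \<subseteq> Q_adjoin \<theta>" by (auto simp: B_def intro!: subfield_power[OF sub] Q_adjoin_gen)
      show "qvs.subspace (Q_adjoin \<theta>)"
        by (auto simp: qvs.subspace_def intro!: subfield_intros[OF sub] subfield_of_rat[OF sub])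
    qed
  qed
  then show ?thesis using sub by (auto simp: number_field_iff B_def)
qed

text \<open>One more power of \<open>x\<close> than there are spanning elements cannot be
  independent.\<close>

lemma algebraic_of_span:
  assumes "finite B" "\<And>i. x ^ i \<in> qvs.span B"
  obtains p where "p \<noteq> 0" "val x p = 0"
proof -
  define n where "n = card B"
  define S where "S = (\<lambda>i. x ^ i) ` {..n}"
  show thesis
  proof (cases "inj_on (\<lambda>i. x ^ i) {..n}")
    \<comment> \<open>Linear dependence is a property of the set of powers and would miss a
      repetition, so two coinciding powers are turned into a polynomial separately.\<close>
    case False
    then obtain i j where ij: "i \<noteq> j" "x ^ i = x ^ j" by (auto simp: inj_on_def)
    then have "coeff (monom (1::rat) i - monom 1 j) i = 1" by simp
    then have "monom (1::rat) i - monom 1 j \<noteq> 0" by force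
    moreover have "val x (monom 1 i - monom 1 j) = 0" using ij by (simp add: val_hom.hom_minus val_monom)
    ultimately show ?thesis by (rule that)
  next
    case True
    then have card: "card S = Suc n" by (simp add: S_def card_image)
    have "S \<subseteq> qvs.span B" using assms(2) by (auto simp: S_def)
    then have "qvs.dependent S"
      using qvs.independent_span_bound[OF assms(1), of S] card n_def by auto
    moreover have "finite S" by (simp add: S_def)
    ultimately obtain u where u: "\<exists>v\<in>S. u v \<noteq> 0" "(\<Sum>v\<in>S. of_rat (u v) * v) = 0"
      using qvs.dependent_finite by blast
    define p where "p = (\<Sum>i\<le>n. monom (u (x ^ i)) i)"
    obtain i where i: "i \<le> n" "u (x ^ i) \<noteq> 0" using u(1) by (auto simp: S_def)
    have "coeff p i = u (x ^ i)" using i by (simp add: p_def coeff_sum)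
    then have "p \<noteq> 0" using i by auto
    moreover have "val x p = (\<Sum>i\<le>n. of_rat (u (x ^ i)) * x ^ i)"
      by (simp add: p_def val_hom.hom_sum val_monom)
    then have "val x p = 0" using u(2) by (simp add: S_def sum.reindex[OF True] o_def)
    ultimately show ?thesis by (rule that)
  qed
qed

lemma number_field_algebraic:
  assumes "number_field K" "x \<in> K" obtains f where "presents f x"
proof -
  obtain B where B: "finite B" "K = qvs.span B" and K: "is_subfield K"
    using assms(1) by (auto simp: number_field_iff)
  have "x ^ i \<in> qvs.span B" for i using subfield_power[OF K assms(2)] B(2) by simp
  then obtain p where "p \<noteq> 0" "val x p = 0" using algebraic_of_span[OF B(1)] by blast
  then show thesis using presents_exists that by blast
qed

text \<open>A finite-dimensional algebra without zero divisors is a field: every nonzero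
  \<open>x\<close> is algebraic, and its inverse is a rational polynomial in
  \<open>x\<close>.\<close>

lemma number_fieldI_subring:
  assumes B: "finite B" "K = qvs.span B" and "1 \<in> K" and mult: "\<And>x y. x \<in> K \<Longrightarrow> y \<in> K \<Longrightarrow> x * y \<in> K"
  shows "number_field K"
proof -
  have pow: "x ^ i \<in> K" if "x \<in> K" for x i
    using that assms(3) mult by (induction i) simp_all
  have "inverse x \<in> K" if x: "x \<in> K" for x
  proof (cases "x = 0")
    case True
    then show ?thesis using B(2) by (simp add: qvs.span_zero)
  next
    case False
    obtain p where "p \<noteq> 0" "val x p = 0"
      using algebraic_of_span[OF B(1), of x] pow[OF x] B(2) by blast
    then obtain f where f: "presents f x" using presents_exists by blast
    have "\<not> f dvd [:0, 1:]" using val_eq_0_iff[OF f, of "[:0, 1:]"] False by simp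
    have "is_subfield (Q_adjoin x)" by (rule is_subfield_Q_adjoin[OF f])
    then have "inverse x \<in> Q_adjoin x" using subfield_inverse Q_adjoin_gen by blast
    then obtain q where "inverse x = val x q" by (auto simp: Q_adjoin_def)
    also have "\<dots> \<in> K" unfolding val_altdef B(2)
      by (intro qvs.span_sum qvs.span_scale) (use pow[OF x] B(2) in simp)
    finally show ?thesis .
  qed
  then have "is_subfield K"
    unfolding is_subfield_def using assms
    by (auto simp: qvs.span_zero intro: qvs.span_add qvs.span_neg)
  then show ?thesis using B by (auto simp: number_field_iff)
qed

text \<open>The ring \<open>F[z]\<close> is enough, since finite dimension over the rationals makes
  it a field. Reduction modulo the minimal polynomial of \<open>z\<close> shows that products of
  generators of \<open>F\<close> with finitely many powers of \<open>z\<close> span it.\<close>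

lemma number_field_adjoin:
  assumes F: "number_field F" and z: "z \<in> algebraic_closure_of F"
  obtains K where "number_field K" "F \<subseteq> K" "z \<in> K"
proof -
  obtain B where B: "finite B" "F = qvs.span B" and sub: "is_subfield F"
    using F by (auto simp: number_field_iff)
  obtain p where p: "p \<noteq> 0" "set (coeffs p) \<subseteq> F" "poly p z = 0"
    using z by (auto simp: algebraic_closure_of_def)
  have "range (coeff p) \<subseteq> F" using p(2) subfield_0[OF sub] by (simp add: range_coeff)
  then have "p \<in> polys_over F" by (auto simp: polys_over_def)
  then obtain m where m: "m \<in> polys_over F" "lead_coeff m = 1" "poly m z = 0" "degree m > 0"
    using minimal_polynomial_over[OF sub _ p(1,3)] by blast
  define K where "K = (\<lambda>p. poly p z) ` polys_over F"
  define B' where "B' = (\<lambda>(b, i). b * z ^ i) ` (B \<times> {..degree m})"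
  have subspace: "qvs.subspace K"
    unfolding qvs.subspace_def
  proof (intro conjI ballI allI)
    show "0 \<in> K" using polys_over_0[OF sub] by (force simp: K_def)
    fix x assume "x \<in> K"
    then obtain p where p: "p \<in> polys_over F" "x = poly p z" by (auto simp: K_def)
    show "of_rat c * x \<in> K" for c
      unfolding K_def using p polys_over_smult[OF sub subfield_of_rat[OF sub, of c] p(1)]
      by (intro image_eqI[of _ _ "smult (of_rat c) p"]) simp_all
    fix y assume "y \<in> K"
    then obtain q where q: "q \<in> polys_over F" "y = poly q z" by (auto simp: K_def)
    show "x + y \<in> K" unfolding K_def using p q polys_over_add[OF sub p(1) q(1)]
      by (intro image_eqI[of _ _ "p + q"]) simp_all
  qed
  have mult: "x * y \<in> K" if xy: "x \<in> K" "y \<in> K" for x y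
  proof -
    obtain p q where p: "p \<in> polys_over F" "x = poly p z" and q: "q \<in> polys_over F" "y = poly q z"
      using xy by (auto simp: K_def)
    show ?thesis unfolding K_def using p q polys_over_mult[OF sub p(1) q(1)]
      by (intro image_eqI[of _ _ "p * q"]) simp_all
  qed
  have FK: "F \<subseteq> K"
  proof
    fix c assume "c \<in> F"
    then show "c \<in> K" unfolding K_def
      by (intro image_eqI[of _ _ "[:c:]"]) (simp_all add: polys_over_const[OF sub])
  qed
  have zK: "z \<in> K" unfolding K_def
    by (intro image_eqI[of _ _ "[:0, 1:]"]) (simp_all add: polys_over_intros[OF sub] subfield_intros[OF sub])
  have powK: "z ^ i \<in> K" for i
    using subfield_1[OF sub] FK mult zK by (induction i) auto
  have "K = qvs.span B'"
  proof
    show "K \<subseteq> qvs.span B'"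
    proof
      fix x assume "x \<in> K"
      then obtain p where p: "p \<in> polys_over F" "x = poly p z" by (auto simp: K_def)
      have "poly p z = poly (p div m * m + p mod m) z" by simp
      also have "\<dots> = poly (p mod m) z" unfolding poly_add poly_mult using m(3) by simp
      also have "\<dots> = (\<Sum>i\<le>degree (p mod m). coeff (p mod m) i * z ^ i)" by (rule poly_altdef)
      finally have x: "x = (\<Sum>i\<le>degree (p mod m). coeff (p mod m) i * z ^ i)" by (simp add: p)
      have c: "coeff (p mod m) i \<in> F" for i
        using polys_over_div_mod[OF sub p(1) m(1)] by (simp add: polys_over_def)
      have "m \<noteq> 0" using m by auto
      then have deg: "degree (p mod m) \<le> degree m" using degree_mod_less[of m p] by auto
      show "x \<in> qvs.span B'" unfolding x
      proof (rule qvs.span_sum)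
        fix i assume i: "i \<in> {..degree (p mod m)}"
        obtain u where "coeff (p mod m) i = (\<Sum>b\<in>B. of_rat (u b) * b)"
          using c[of i] B qvs.span_finite[OF B(1)] by auto
        then have "coeff (p mod m) i * z ^ i = (\<Sum>b\<in>B. of_rat (u b) * (b * z ^ i))"
          by (simp add: sum_distrib_right mult.assoc)
        also have "\<dots> \<in> qvs.span B'" using i deg
          by (intro qvs.span_sum qvs.span_scale qvs.span_base) (force simp: B'_def)
        finally show "coeff (p mod m) i * z ^ i \<in> qvs.span B'" .
      qed
    qed
    show "qvs.span B' \<subseteq> K"
    proof (rule qvs.span_minimal[OF _ subspace])
      show "B' \<subseteq> K" using qvs.span_superset[of B] B(2) FK
        by (auto simp: B'_def intro!: mult powK)
    qed
  qed
  moreover have "finite B'" using B by (simp add: B'_def)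
  moreover have "1 \<in> K" using subfield_1[OF sub] FK by auto
  ultimately have "number_field K" using mult by (intro number_fieldI_subring)
  then show thesis using FK zK by (rule that)
qed

lemma number_field_adjoin_finite:
  assumes F: "number_field F" and "finite S" "S \<subseteq> algebraic_closure_of F"
  obtains K where "number_field K" "F \<subseteq> K" "S \<subseteq> K"
proof -
  have "\<exists>K. number_field K \<and> F \<subseteq> K \<and> S \<subseteq> K"
    using assms(2,3)
  proof (induction S)
    case (insert z S)
    then obtain K where K: "number_field K" "F \<subseteq> K" "S \<subseteq> K" by auto
    have "z \<in> algebraic_closure_of K"
      using insert.prems K(2) by (auto simp: algebraic_closure_of_def) blast
    then obtain K' where "number_field K'" "K \<subseteq> K'" "z \<in> K'"
      using number_field_adjoin[OF K(1)] by blast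
    then show ?case using K by blast
  qed (use F in auto)
  then show thesis using that by blast
qed

section \<open>Separability and primitive elements\<close>

lemma irreducible_rat_rsquarefree:
  assumes "irreducible (f :: rat poly)" shows "rsquarefree (map_poly of_rat f :: complex poly)"
proof -
  have deg: "degree f > 0" using assms unfolding irreducible_connect_field[symmetric] by auto
  have "\<not> f dvd pderiv f"
  proof
    assume "f dvd pderiv f"
    moreover have "pderiv f \<noteq> 0" using deg by (simp add: pderiv_eq_0_iff)
    ultimately have "degree f \<le> degree (pderiv f)" by (rule dvd_imp_degree_le)
    then show False using deg by (simp add: degree_pderiv)
  qed
  then have "gcd f (pderiv f) = 1"
    using assms by (metis irreducible_imp_prime_elem_gcd prime_elem_imp_coprime coprime_iff_gcd_eq_1)
  then have bez: "fst (bezout_coefficients f (pderiv f)) * f + snd (bezout_coefficients f (pderiv f)) * pderiv f = 1"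
    using bezout_coefficients_fst_snd[of f "pderiv f"] by simp
  \<comment> \<open>The rational Bezout identity of \<open>f\<close> and its derivative remains
    valid at every complex number, so no complex root is multiple.\<close>
  have "\<not> (val a f = 0 \<and> val a (pderiv f) = 0)" for a
    using arg_cong[OF bez, of "val a"] by (auto simp: val_hom.hom_add val_hom.hom_mult)
  then show ?thesis unfolding rsquarefree_roots by (simp add: val_def of_rat_hom.map_poly_pderiv)
qed

lemma rsquarefree_dvd: "rsquarefree q \<Longrightarrow> p dvd q \<Longrightarrow> rsquarefree p"
  unfolding rsquarefree_def by (metis dvd_0_left_iff dvd_imp_order_le le_zero_eq le_SucE One_nat_def)

lemma map_of_rat_polys_over: "is_subfield S \<Longrightarrow> map_poly complex_of_rat p \<in> polys_over S"
  by (simp add: polys_over_def coeff_map_poly subfield_of_rat)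

text \<open>The element is \<open>z = x + c y\<close>, with a natural number \<open>c\<close> off
  the finite set of quotients \<open>(a - x) / (y - b)\<close> of differences of conjugates. The
  minimal polynomial of \<open>y\<close> over the field of \<open>z\<close> divides both
  \<open>g\<close> and \<open>f(z - c T)\<close>. By the choice of \<open>c\<close> these have no
  common root except \<open>y\<close>, and separability makes the degree 1, so \<open>y\<close> is
  in the field of \<open>z\<close>.\<close>

lemma primitive_element_pair:
  assumes K: "number_field K" and x: "x \<in> K" and y: "y \<in> K"
  obtains z where "z \<in> K" "x \<in> Q_adjoin z" "y \<in> Q_adjoin z"
proof -
  have sub: "is_subfield K" using K by (simp add: number_field_iff)
  obtain f g where f: "presents f x" and g: "presents g y"
    using number_field_algebraic[OF K] x y by metis
  have f0: "f \<noteq> 0" and g0: "g \<noteq> 0" using f g by (auto simp: presents_def)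
  define X where "X = {a. val a f = 0}"
  define Y where "Y = {b. val b g = 0}"
  have fin: "finite X" "finite Y" using f0 g0 by (simp_all add: X_def Y_def val_def poly_roots_finite)
  define E where "E = (\<lambda>(a, b). (a - x) / (y - b)) ` (X \<times> Y)"
  have "finite E" using fin by (simp add: E_def)
  then have "finite {n::nat. of_nat n \<in> E}"
    using finite_vimageI[of E "of_nat :: nat \<Rightarrow> complex"] by (simp add: inj_on_def vimage_def)
  then obtain n :: nat where n: "of_nat n \<notin> E"
    using infinite_UNIV_nat by (metis (mono_tags, lifting) UNIV_eq_I mem_Collect_eq)
  define c where "c = rat_of_nat n"
  define z where "z = x + of_rat c * y"
  have z: "z \<in> K" using x y by (auto simp: z_def c_def intro!: subfield_intros[OF sub])
  obtain h where h: "presents h z" using number_field_algebraic[OF K z] .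
  have S: "is_subfield (Q_adjoin z)" by (rule is_subfield_Q_adjoin[OF h])
  define a where "a = pcompose (map_poly of_rat f) [:z, - of_rat c:]"
  have a: "a \<in> polys_over (Q_adjoin z)"
    unfolding a_def
    by (intro polys_over_pcompose[OF S] map_of_rat_polys_over[OF S] polys_over_pCons[OF S] Q_adjoin_gen
        polys_over_0[OF S] subfield_uminus[OF S] subfield_of_rat[OF S])
  have b: "map_poly of_rat g \<in> polys_over (Q_adjoin z)" by (rule map_of_rat_polys_over[OF S])
  have ay: "poly a y = 0" using f by (simp add: a_def poly_pcompose z_def val_def[symmetric] presents_def)
  have gy: "poly (map_poly of_rat g) y = 0" using g by (simp add: presents_def val_def)
  obtain m where m: "m \<in> polys_over (Q_adjoin z)" "lead_coeff m = 1" "poly m y = 0"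
    and dvd: "\<And>q. q \<in> polys_over (Q_adjoin z) \<Longrightarrow> poly q y = 0 \<Longrightarrow> m dvd q"
    using minimal_polynomial_over[OF S b _ gy] g0 by auto
  have roots: "{w. poly m w = 0} = {y}"
  proof (intro equalityI subsetI)
    fix w assume "w \<in> {w. poly m w = 0}"
    then have w: "poly m w = 0" by simp
    have "val w g = 0" using dvd[OF b gy] w by (auto simp: val_def elim!: dvdE)
    moreover have "poly a w = 0" using dvd[OF a ay] w by (auto elim!: dvdE)
    then have "val (z - of_rat c * w) f = 0" by (simp add: a_def poly_pcompose val_def algebra_simps)
    ultimately have "(z - of_rat c * w - x) / (y - w) \<in> E" by (force simp: E_def X_def Y_def)
    moreover have "z - of_rat c * w - x = of_nat n * (y - w)" by (simp add: z_def c_def algebra_simps)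
    ultimately show "w \<in> {y}" using n by (cases "w = y") auto
  qed (use m in auto)
  have "rsquarefree m"
    using irreducible_rat_rsquarefree[of g] g dvd[OF b gy] by (auto simp: presents_def intro: rsquarefree_dvd)
  moreover have "m \<noteq> 0" using m by auto
  ultimately have "degree m = 1" using rsquarefree_card_degree[of m] roots by simp
  then have "m = [:coeff m 0, 1:]" using m(2)
    by (intro poly_eqI) (auto simp: coeff_pCons coeff_eq_0 split: nat.splits)
  then have "y = - coeff m 0" using m(3) by (metis add_eq_0_iff poly_pCons poly_0 mult.right_neutral mult_zero_right add.right_neutral neg_eq_iff_add_eq_0)
  then have y': "y \<in> Q_adjoin z" using m(1) subfield_uminus[OF S] by (simp add: polys_over_def)
  have "x = z - of_rat c * y" by (simp add: z_def)
  then have "x \<in> Q_adjoin z" using y' Q_adjoin_gen[of z]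
    by (metis subfield_diff[OF S] subfield_mult[OF S] subfield_of_rat[OF S])
  then show thesis using that z y' by blast
qed

theorem primitive_element:
  assumes K: "number_field K" obtains \<eta> f where "presents f \<eta>" "K = Q_adjoin \<eta>"
proof -
  obtain B where B: "finite B" "K = qvs.span B" and sub: "is_subfield K"
    using K by (auto simp: number_field_iff)
  have "finite C \<Longrightarrow> C \<subseteq> K \<Longrightarrow> \<exists>z\<in>K. C \<subseteq> Q_adjoin z" for C
  proof (induction C rule: finite_induct)
    case empty
    then show ?case using subfield_0[OF sub] by blast
  next
    case (insert y C)
    then obtain z where z: "z \<in> K" "C \<subseteq> Q_adjoin z" by auto
    obtain z' where z': "z' \<in> K" "z \<in> Q_adjoin z'" "y \<in> Q_adjoin z'"
      using primitive_element_pair[OF K z(1), of y] insert.prems by auto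
    obtain h where "presents h z'" using number_field_algebraic[OF K z'(1)] .
    then have "Q_adjoin z \<subseteq> Q_adjoin z'"
      using Q_adjoin_subset[OF is_subfield_Q_adjoin z'(2)] by blast
    then show ?case using z z' by blast
  qed
  then obtain \<eta> where \<eta>: "\<eta> \<in> K" "B \<subseteq> Q_adjoin \<eta>"
    using B qvs.span_superset[of B] by blast
  obtain f where f: "presents f \<eta>" using number_field_algebraic[OF K \<eta>(1)] .
  have S: "is_subfield (Q_adjoin \<eta>)" by (rule is_subfield_Q_adjoin[OF f])
  have "qvs.subspace (Q_adjoin \<eta>)"
    by (auto simp: qvs.subspace_def intro!: subfield_intros[OF S] subfield_of_rat[OF S])
  then have "K \<subseteq> Q_adjoin \<eta>" using qvs.span_minimal[OF \<eta>(2)] B by simp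
  moreover have "Q_adjoin \<eta> \<subseteq> K" by (rule Q_adjoin_subset[OF sub \<eta>(1)])
  ultimately show thesis using that f by blast
qed

section \<open>Embeddings of number fields\<close>

definition field_embedding :: "complex set \<Rightarrow> complex set \<Rightarrow> (complex \<Rightarrow> complex) \<Rightarrow> bool" where
  "field_embedding F K \<sigma> \<longleftrightarrow>
     (\<forall>x\<in>K. \<forall>y\<in>K. \<sigma> (x + y) = \<sigma> x + \<sigma> y \<and> \<sigma> (x * y) = \<sigma> x * \<sigma> y) \<and> (\<forall>x\<in>F. \<sigma> x = x)"

context
  fixes F K :: "complex set" and \<sigma>
  assumes F: "is_subfield F" and K: "is_subfield K" and FK: "F \<subseteq> K" and \<sigma>: "field_embedding F K \<sigma>"
begin

lemma embedding_fix: "x \<in> F \<Longrightarrow> \<sigma> x = x"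
  and embedding_add: "x \<in> K \<Longrightarrow> y \<in> K \<Longrightarrow> \<sigma> (x + y) = \<sigma> x + \<sigma> y"
  and embedding_mult: "x \<in> K \<Longrightarrow> y \<in> K \<Longrightarrow> \<sigma> (x * y) = \<sigma> x * \<sigma> y"
  using \<sigma> by (auto simp: field_embedding_def)

lemma embedding_0: "\<sigma> 0 = 0" and embedding_1: "\<sigma> 1 = 1"
  using embedding_fix subfield_0[OF F] subfield_1[OF F] by auto

lemma embedding_of_rat: "\<sigma> (of_rat q) = of_rat q"
  by (rule embedding_fix[OF subfield_of_rat[OF F]])

lemma embedding_sum:
  "(\<And>i. i \<in> A \<Longrightarrow> f i \<in> K) \<Longrightarrow> \<sigma> (sum f A) = (\<Sum>i\<in>A. \<sigma> (f i))"
  by (induction A rule: infinite_finite_induct)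
     (simp_all add: embedding_0 embedding_add subfield_sum[OF K])

lemma embedding_prod:
  "(\<And>i. i \<in> A \<Longrightarrow> f i \<in> K) \<Longrightarrow> \<sigma> (prod f A) = (\<Prod>i\<in>A. \<sigma> (f i))"
  by (induction A rule: infinite_finite_induct)
     (simp_all add: embedding_1 embedding_mult subfield_prod[OF K])

lemma embedding_inverse: "x \<in> K \<Longrightarrow> \<sigma> (inverse x) = inverse (\<sigma> x)"
proof (cases "x = 0")
  case False
  assume x: "x \<in> K"
  have "\<sigma> x * \<sigma> (inverse x) = \<sigma> (x * inverse x)"
    by (simp only: embedding_mult[OF x subfield_inverse[OF K x]])
  then have "\<sigma> x * \<sigma> (inverse x) = 1" using False by (simp add: embedding_1)
  then show ?thesis by (metis inverse_unique)
qed (simp add: embedding_0)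

lemma embedding_eq_0D: "x \<in> K \<Longrightarrow> \<sigma> x = 0 \<Longrightarrow> x = 0"
  using embedding_mult[of x "inverse x"] subfield_inverse[OF K, of x] embedding_1
  by (metis mult_zero_left right_inverse zero_neq_one)

lemma embedding_inj: "x \<in> K \<Longrightarrow> y \<in> K \<Longrightarrow> \<sigma> x = \<sigma> y \<Longrightarrow> x = y"
proof -
  assume *: "x \<in> K" "y \<in> K" "\<sigma> x = \<sigma> y"
  have "\<sigma> y + \<sigma> (x - y) = \<sigma> x"
    using embedding_add[of y "x - y"] * subfield_diff[OF K] by simp
  then show "x = y" using embedding_eq_0D[of "x - y"] * subfield_diff[OF K] by simp
qed

lemma embedding_power: "x \<in> K \<Longrightarrow> \<sigma> (x ^ n) = \<sigma> x ^ n"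
  by (induction n) (simp_all add: embedding_1 embedding_mult subfield_power[OF K])

lemma embedding_power_int: "x \<in> K \<Longrightarrow> \<sigma> (x powi n) = \<sigma> x powi n"
  by (simp add: power_int_def embedding_power embedding_inverse subfield_intros[OF K])

lemma embedding_poly:
  "p \<in> polys_over K \<Longrightarrow> x \<in> K \<Longrightarrow> \<sigma> (poly p x) = poly (map_poly \<sigma> p) (\<sigma> x)"
proof (induction p)
  case (pCons a p)
  have "coeff (pCons a p) (Suc i) \<in> K" for i
    using pCons.prems by (simp only: polys_over_def mem_Collect_eq)
  then have p: "p \<in> polys_over K" by (simp add: polys_over_def)
  have "coeff (pCons a p) 0 \<in> K" using pCons.prems by (simp only: polys_over_def mem_Collect_eq)
  then have a: "a \<in> K" by simp
  have "map_poly \<sigma> (pCons a p) = pCons (\<sigma> a) (map_poly \<sigma> p)"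
    by (rule poly_eqI) (simp add: coeff_map_poly embedding_0 coeff_pCons split: nat.split)
  then show ?case
    using pCons a p poly_in_subfield[OF K p]
    by (simp add: embedding_add embedding_mult subfield_mult[OF K])
qed (simp add: embedding_0)

lemma embedding_poly_fixed:
  assumes "p \<in> polys_over F" "x \<in> K" shows "\<sigma> (poly p x) = poly p (\<sigma> x)"
proof -
  have "p \<in> polys_over K" using assms(1) FK by (auto simp: polys_over_def)
  moreover have "map_poly \<sigma> p = p"
    using assms(1) by (intro poly_eqI) (simp add: coeff_map_poly embedding_0 embedding_fix polys_over_def)
  ultimately show ?thesis using embedding_poly[OF _ assms(2)] by simp
qed

end

text \<open>Dividing a squarefree polynomial, the minimal polynomial has as many roots as its degree
  says. This count of conjugates is what descent to \<open>S\<close> rests on.\<close>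

lemma rational_minimal_polynomial_over:
  assumes S: "is_subfield S" and g: "presents g \<eta>"
  obtains m where "m \<in> polys_over S" "lead_coeff m = 1" "poly m \<eta> = 0" "degree m > 0"
    "m dvd map_poly of_rat g" "card {w. poly m w = 0} = degree m"
    "\<And>q. q \<in> polys_over S \<Longrightarrow> poly q \<eta> = 0 \<Longrightarrow> m dvd q"
proof -
  have gp: "map_poly of_rat g \<in> polys_over S" by (rule map_of_rat_polys_over[OF S])
  have g0: "poly (map_poly of_rat g) \<eta> = 0" "map_poly complex_of_rat g \<noteq> 0"
    using g by (auto simp: presents_def val_def)
  then obtain m where m: "m \<in> polys_over S" "lead_coeff m = 1" "poly m \<eta> = 0" "degree m > 0"
    and dvd: "\<And>q. q \<in> polys_over S \<Longrightarrow> poly q \<eta> = 0 \<Longrightarrow> m dvd q"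
    using minimal_polynomial_over[OF S gp] by blast
  have mg: "m dvd map_poly of_rat g" using dvd[OF gp] g0(1) by blast
  have "rsquarefree m"
    using irreducible_rat_rsquarefree[of g] g mg by (auto simp: presents_def intro: rsquarefree_dvd)
  moreover have "m \<noteq> 0" using m by auto
  ultimately have "card {w. poly m w = 0} = degree m" using rsquarefree_card_degree[of m] by simp
  from that[OF m mg this dvd] show thesis by blast
qed

text \<open>Write \<open>y = r(\<eta>)\<close> with the degree of \<open>r\<close> below that of the
  minimal polynomial \<open>m\<close>. Each root \<open>w\<close> of \<open>m\<close> gives an
  embedding that sends \<eta> to \<open>w\<close> and fixes \<open>y\<close>, so \<open>r\<close>
  takes the value \<open>y\<close> at as many points as \<open>m\<close> has degree. Hence
  \<open>r\<close> is the constant \<open>y\<close>, with coefficient in \<open>F\<close>.\<close>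

theorem embedding_descent:
  assumes F: "is_subfield F" and K: "number_field K" and FK: "F \<subseteq> K" and y: "y \<in> K"
    and fixed: "\<And>\<sigma>. field_embedding F K \<sigma> \<Longrightarrow> \<sigma> y = y"
  shows "y \<in> F"
proof -
  obtain \<eta> g where g: "presents g \<eta>" and K\<eta>: "K = Q_adjoin \<eta>" using primitive_element[OF K] .
  obtain m where m: "m \<in> polys_over F" "lead_coeff m = 1" "poly m \<eta> = 0" "degree m > 0"
    "card {w. poly m w = 0} = degree m"
    and dvd: "\<And>q. q \<in> polys_over F \<Longrightarrow> poly q \<eta> = 0 \<Longrightarrow> m dvd q"
    using rational_minimal_polynomial_over[OF F g] by blast
  have m0: "m \<noteq> 0" using m by auto
  have ex: "\<exists>q\<in>polys_over F. poly q \<eta> = x" if "x \<in> K" for x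
    using that map_of_rat_polys_over[OF F] by (auto simp: K\<eta> Q_adjoin_def val_def)
  obtain q where q: "q \<in> polys_over F" "poly q \<eta> = y" using ex[OF y] by blast
  define r where "r = q mod m"
  have r: "r \<in> polys_over F" using polys_over_div_mod[OF F q(1) m(1)] by (simp add: r_def)
  have "poly q \<eta> = poly (q div m * m + r) \<eta>" by (simp add: r_def)
  then have ry: "poly r \<eta> = y" using m(3) q(2) by simp
  have const: "poly r w = y" if w: "poly m w = 0" for w
  proof -
    \<comment> \<open>The choice of a representing polynomial is harmless, because two
      representatives differ by a multiple of \<open>m\<close>, which vanishes at
      \<open>w\<close>.\<close>
    define \<sigma> where "\<sigma> x = poly (SOME q. q \<in> polys_over F \<and> poly q \<eta> = x) w" for x
    have \<sigma>: "\<sigma> (poly p \<eta>) = poly p w" if p: "p \<in> polys_over F" for p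
    proof -
      define p' where "p' = (SOME q. q \<in> polys_over F \<and> poly q \<eta> = poly p \<eta>)"
      have p': "p' \<in> polys_over F \<and> poly p' \<eta> = poly p \<eta>"
        unfolding p'_def by (rule someI[of _ p]) (simp add: p)
      have "m dvd p' - p" using p p' by (intro dvd) (simp_all add: polys_over_diff[OF F])
      then obtain k where "p' - p = m * k" by (elim dvdE)
      then have "poly (p' - p) w = poly (m * k) w" by (rule arg_cong)
      then show ?thesis using w by (simp add: \<sigma>_def p'_def)
    qed
    have "field_embedding F K \<sigma>"
      unfolding field_embedding_def
    proof (intro conjI ballI)
      fix x assume "x \<in> F"
      then show "\<sigma> x = x" using \<sigma>[of "[:x:]"] by (simp add: polys_over_const[OF F])
    next
      fix x y assume "x \<in> K" "y \<in> K"
      then obtain p q where pq: "p \<in> polys_over F" "x = poly p \<eta>" "q \<in> polys_over F" "y = poly q \<eta>"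
        using ex by metis
      show "\<sigma> (x + y) = \<sigma> x + \<sigma> y"
        using \<sigma>[of "p + q"] \<sigma>[of p] \<sigma>[of q] pq by (simp add: polys_over_add[OF F])
      show "\<sigma> (x * y) = \<sigma> x * \<sigma> y"
        using \<sigma>[of "p * q"] \<sigma>[of p] \<sigma>[of q] pq by (simp add: polys_over_mult[OF F])
    qed
    then have "\<sigma> y = y" by (rule fixed)
    then show ?thesis using \<sigma>[OF r] ry by simp
  qed
  have "r - [:y:] = 0"
  proof (rule ccontr)
    assume ne: "r - [:y:] \<noteq> 0"
    have "card {w. poly m w = 0} \<le> card {w. poly (r - [:y:]) w = 0}"
      using const poly_roots_finite[OF ne] by (intro card_mono) auto
    also have "\<dots> \<le> degree (r - [:y:])" by (rule card_poly_roots_bound[OF ne])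
    also have "\<dots> < degree m"
      using degree_mod_less[OF m0, of q] m(4) by (intro degree_diff_less) (auto simp: r_def)
    finally show False using m(5) by simp
  qed
  then have "y = coeff r 0" by (metis coeff_pCons_0 eq_iff_diff_eq_0)
  then show ?thesis using r by (simp add: polys_over_def)
qed

text \<open>The polynomial identities over \<open>\<rat>(\<theta>\<^sub>1)\<close> that express \<open>g(\<eta>) = 0\<close> and \<open>h(\<eta>) = \<theta>\<^sub>1\<close> are lifted to
  polynomials with coefficients in \<open>\<rat>[x]\<close> and specialised at the conjugate \<open>\<theta>\<close>.\<close>

lemma conjugate_lift:
  assumes f1: "presents f (val \<eta> h)" and f: "presents f \<theta>" and g: "presents g \<eta>"
  obtains \<eta>' where "val \<eta>' g = 0" "val \<eta>' h = \<theta>"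
proof -
  define \<theta>\<^sub>1 where "\<theta>\<^sub>1 = val \<eta> h"
  define S where "S = Q_adjoin \<theta>\<^sub>1"
  have S: "is_subfield S" using is_subfield_Q_adjoin[OF f1] by (simp add: S_def \<theta>\<^sub>1_def)
  obtain m where m: "m \<in> polys_over S" "lead_coeff m = 1" "degree m > 0"
    and dvd: "\<And>q. q \<in> polys_over S \<Longrightarrow> poly q \<eta> = 0 \<Longrightarrow> m dvd q"
    using rational_minimal_polynomial_over[OF S g] by blast
  interpret ev1: map_poly_comm_ring_hom "val \<theta>\<^sub>1" ..
  interpret ev: map_poly_comm_ring_hom "val \<theta>" ..
  have lift: "\<exists>P. map_poly (val \<theta>\<^sub>1) P = p" if "p \<in> polys_over S" for p
  proof -
    have "\<forall>i. \<exists>c. val \<theta>\<^sub>1 c = coeff p i" using that by (simp add: polys_over_def S_def Q_adjoin_def image_iff) metis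
    then obtain c where c: "\<And>i. val \<theta>\<^sub>1 (c i) = coeff p i" by metis
    have "map_poly (val \<theta>\<^sub>1) (\<Sum>i\<le>degree p. monom (c i) i) = p"
      by (simp add: ev1.hom_sum map_poly_monom c poly_as_sum_of_monoms)
    then show ?thesis by blast
  qed
  have "m - monom 1 (degree m) \<in> polys_over S"
    using m(1) by (intro polys_over_diff[OF S] polys_over_monom[OF S] subfield_1[OF S])
  then obtain M0 where M0: "map_poly (val \<theta>\<^sub>1) M0 = m - monom 1 (degree m)" using lift by blast
  \<comment> \<open>The coefficient of \<open>M0\<close> at the degree of \<open>m\<close> has value
    0 at \<open>\<theta>\<^sub>1\<close> and is removed, so that this coefficient of
    \<open>M\<close> is literally 1. The specialisation at \<theta> then keeps a positive degree and
    has a root.\<close>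
  define M where "M = monom 1 (degree m) + (M0 - monom (coeff M0 (degree m)) (degree m))"
  have "coeff (map_poly (val \<theta>\<^sub>1) M0) (degree m) = 0" using m(2) by (simp add: M0)
  then have "val \<theta>\<^sub>1 (coeff M0 (degree m)) = 0" by (simp add: coeff_map_poly)
  then have M: "map_poly (val \<theta>\<^sub>1) M = m"
    by (simp add: M_def ev1.hom_add ev1.hom_minus map_poly_monom M0)
  have "coeff (map_poly (val \<theta>) M) (degree m) = 1"
    by (simp add: coeff_map_poly M_def)
  then have "degree (map_poly (val \<theta>) M) \<ge> degree m" by (intro le_degree) simp
  then have "degree (map_poly (val \<theta>) M) > 0" using m(3) by simp
  then obtain \<eta>' where \<eta>': "poly (map_poly (val \<theta>) M) \<eta>' = 0"
    using alg_closed_imp_poly_has_root by blast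
  have transfer: "poly (map_poly (val \<theta>) P) \<eta>' = 0" if P: "poly (map_poly (val \<theta>\<^sub>1) P) \<eta> = 0" for P
  proof -
    have PS: "map_poly (val \<theta>\<^sub>1) P \<in> polys_over S" by (simp add: polys_over_def coeff_map_poly S_def)
    obtain q where q: "map_poly (val \<theta>\<^sub>1) P div m = q" by blast
    then have "q \<in> polys_over S" using polys_over_div_mod[OF S PS m(1)] by blast
    then obtain Q where Q: "map_poly (val \<theta>\<^sub>1) Q = q" using lift by blast
    have "map_poly (val \<theta>\<^sub>1) P = m * q" using dvd[OF PS P] q by auto
    then have "map_poly (val \<theta>\<^sub>1) (P - M * Q) = 0"
      by (simp add: ev1.hom_minus ev1.hom_mult M Q)
    then have "val \<theta>\<^sub>1 (coeff (P - M * Q) i) = 0" for i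
      using arg_cong[of _ _ "\<lambda>p. coeff p i"] by (metis coeff_0 coeff_map_poly val_hom.hom_zero)
    \<comment> \<open>Vanishing at one root means divisibility of the coefficient by
      \<open>f\<close>, a statement that does not depend on the root.\<close>
    then have "val \<theta> (coeff (P - M * Q) i) = 0" for i
      using presents_dvd_transfer[OF _ f] f1 by (simp add: \<theta>\<^sub>1_def)
    then have "map_poly (val \<theta>) (P - M * Q) = 0" by (intro poly_eqI) (simp add: coeff_map_poly)
    then have "map_poly (val \<theta>) P = map_poly (val \<theta>) M * map_poly (val \<theta>) Q"
      by (simp add: ev.hom_minus ev.hom_mult)
    then show ?thesis using \<eta>' by simp
  qed
  have const: "map_poly (val t) (map_poly (\<lambda>c. [:c:]) p) = map_poly of_rat p" for t and p :: "rat poly"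
    by (intro poly_eqI) (simp add: coeff_map_poly)
  have "val \<eta>' g = 0"
    using transfer[of "map_poly (\<lambda>c. [:c:]) g"] g unfolding const by (simp add: presents_def val_def)
  moreover have "val \<eta>' h = \<theta>"
  proof -
    have *: "map_poly (val t) (map_poly (\<lambda>c. [:c:]) h - [:[:0, 1:]:]) = map_poly of_rat h - [:t:]" for t
      by (intro poly_eqI) (simp add: coeff_map_poly coeff_pCons val_hom.hom_minus split: nat.split)
    show ?thesis
      using transfer[of "map_poly (\<lambda>c. [:c:]) h - [:[:0, 1:]:]"] unfolding *
      by (simp add: val_def \<theta>\<^sub>1_def)
  qed
  ultimately show thesis by (rule that)
qed

text \<open>The interpolation polynomial of an equivariant function is fixed by all embeddings, by
  uniqueness.\<close>

lemma equivariant_interpolation: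
  assumes F: "is_subfield F" and K: "number_field K" and FK: "F \<subseteq> K"
    and \<chi>: "\<chi> \<in> polys_over F" "\<chi> \<noteq> 0" and Z: "Z = {z. poly \<chi> z = 0}" "Z \<subseteq> K"
    and \<zeta>: "\<And>z. z \<in> Z \<Longrightarrow> \<zeta> z \<in> K"
    and equi: "\<And>\<sigma> z. field_embedding F K \<sigma> \<Longrightarrow> \<sigma> ` Z = Z \<Longrightarrow> inj_on \<sigma> Z \<Longrightarrow> z \<in> Z \<Longrightarrow> \<sigma> (\<zeta> z) = \<zeta> (\<sigma> z)"
  obtains r where "r \<in> polys_over F" "\<And>z. z \<in> Z \<Longrightarrow> poly r z = \<zeta> z"
proof (cases "Z = {}")
  case True
  then show thesis using that[of 0] polys_over_0[OF F] by simp
next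
  case False
  have sub: "is_subfield K" using K by (simp add: number_field_iff)
  have fin: "finite Z" using \<chi>(2) Z(1) by (simp add: poly_roots_finite)
  define L where "L z = (\<Prod>w\<in>Z - {z}. [:- w, 1:])" for z
  define r where "r = (\<Sum>z\<in>Z. smult (\<zeta> z * inverse (poly (L z) z)) (L z))"
  have L: "L z \<in> polys_over K" for z
    using Z(2) unfolding L_def
    by (intro polys_over_prod[OF sub] polys_over_pCons[OF sub] subfield_uminus[OF sub] subfield_1[OF sub]
        polys_over_0[OF sub]) auto
  have Lz: "poly (L z) z \<noteq> 0" for z using fin by (auto simp: L_def poly_prod)
  have Lw: "poly (L z) w = 0" if "w \<in> Z" "w \<noteq> z" for z w
    using fin that by (auto simp: L_def poly_prod intro!: prod_zero)
  have rK: "r \<in> polys_over K"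
    unfolding r_def using Z(2) \<zeta>
    by (intro polys_over_sum[OF sub] polys_over_smult[OF sub] L subfield_mult[OF sub] subfield_inverse[OF sub]
        poly_in_subfield[OF sub]) auto
  have r: "poly r w = \<zeta> w" if "w \<in> Z" for w
  proof -
    have "poly r w = (\<Sum>z\<in>Z. if z = w then \<zeta> w else 0)"
      unfolding r_def poly_sum using Lw[OF that] Lz by (intro sum.cong) auto
    then show ?thesis using fin that by simp
  qed
  have degL: "degree (L z) < card Z" if "z \<in> Z" for z
  proof -
    have "degree (L z) \<le> (\<Sum>w\<in>Z - {z}. degree [:- w, 1:])"
      unfolding L_def using degree_prod_sum_le[of "Z - {z}" "\<lambda>w. [:- w, 1:]"] fin by (simp add: o_def)
    also have "\<dots> < card Z" using that fin card_gt_0_iff[of Z] by auto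
    finally show ?thesis .
  qed
  have deg: "degree r < card Z"
    unfolding r_def using fin False degL
    by (intro degree_sum_less) (auto simp: card_gt_0_iff intro: le_less_trans[OF degree_smult_le])
  have "r \<in> polys_over F"
    unfolding polys_over_def mem_Collect_eq
  proof
    fix i
    show "coeff r i \<in> F"
    proof (rule embedding_descent[OF F K FK])
      show "coeff r i \<in> K" using rK by (simp add: polys_over_def)
      fix \<sigma> assume \<sigma>: "field_embedding F K \<sigma>"
      note emb = F sub FK \<sigma>
      have inj: "inj_on \<sigma> Z" using Z(2) embedding_inj[OF emb] by (auto simp: inj_on_def)
      have "\<sigma> ` Z \<subseteq> Z"
        using embedding_poly_fixed[OF emb \<chi>(1)] embedding_0[OF emb] Z by fastforce
      then have surj: "\<sigma> ` Z = Z" using inj fin by (simp add: endo_inj_surj)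
      have "map_poly \<sigma> r = r"
      proof (rule poly_eqI_degree[of Z])
        fix w assume "w \<in> Z"
        then obtain z where z: "z \<in> Z" "w = \<sigma> z" using surj by blast
        have "poly (map_poly \<sigma> r) w = \<sigma> (poly r z)"
          using embedding_poly[OF emb rK] z Z(2) by auto
        also have "\<dots> = \<zeta> w" using r equi[OF \<sigma> surj inj] z by simp
        finally show "poly (map_poly \<sigma> r) w = poly r w" using r[OF \<open>w \<in> Z\<close>] by simp
      next
        show "card Z > degree r" by (rule deg)
        show "card Z > degree (map_poly \<sigma> r)" using degree_map_poly_le[of \<sigma> r] deg by simp
      qed
      then show "\<sigma> (coeff r i) = coeff r i"
        using coeff_map_poly[of \<sigma> r i] embedding_0[OF emb] by simp
    qed
  qed
  then show thesis using r by (rule that)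
qed

section \<open>The orthogonal projection along the rational relations\<close>

text \<open>Indexing by the distinct eigenvalues themselves, and not by positions in a list, lets
  conjugations act by permuting \<open>Z\<close>. Values outside \<open>Z\<close> are
  unconstrained.\<close>

definition relations :: "complex set \<Rightarrow> (complex \<Rightarrow> rat) set" where
  "relations Z = {\<epsilon>. (\<Sum>z\<in>Z. of_rat (\<epsilon> z) * z) = 0}"

lemma relations_comb:
  "a \<in> relations Z \<Longrightarrow> b \<in> relations Z \<Longrightarrow> (\<lambda>z. a z + c * b z) \<in> relations Z"
proof -
  assume ab: "a \<in> relations Z" "b \<in> relations Z"
  have "(\<Sum>z\<in>Z. of_rat (a z + c * b z) * z)
      = (\<Sum>z\<in>Z. of_rat (a z) * z) + of_rat c * (\<Sum>z\<in>Z. of_rat (b z) * z)"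
    unfolding sum_distrib_left sum.distrib[symmetric]
    by (intro sum.cong) (simp_all add: of_rat_add of_rat_mult algebra_simps)
  then show ?thesis using ab by (simp add: relations_def)
qed

text \<open>Gram-Schmidt over the rationals. That \<open>v\<close> lies in the span of
  \<open>B\<close> is expressed dually: whatever is orthogonal to \<open>B\<close> is orthogonal to
  \<open>v\<close>. In the induction \<open>w\<close> is the part of the new vector orthogonal to
  \<open>B\<close>. If its square is 0, positivity makes it vanish on \<open>Z\<close>, and no
  correction is necessary.\<close>

lemma orthogonal_decomposition:
  fixes Z :: "complex set" and V :: "(complex \<Rightarrow> rat) set"
  assumes "finite Z" and V: "\<And>a b c. a \<in> V \<Longrightarrow> b \<in> V \<Longrightarrow> (\<lambda>z. a z + c * b z) \<in> V" "(\<lambda>_. 0) \<in> V"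
    and "finite B" "B \<subseteq> V"
  shows "\<exists>v\<in>V. (\<forall>u. (\<forall>b\<in>B. (\<Sum>z\<in>Z. u z * b z) = 0) \<longrightarrow> (\<Sum>z\<in>Z. u z * v z) = 0) \<and>
    (\<forall>b\<in>B. (\<Sum>z\<in>Z. (x z - v z) * b z) = 0)"
  using assms(4,5)
proof (induction B arbitrary: x)
  case empty
  show ?case using V(2) by (intro bexI[of _ "\<lambda>_. 0"]) auto
next
  case (insert b B)
  let ?dot = "\<lambda>u v. \<Sum>z\<in>Z. u z * v z :: rat"
  obtain v0 where v0: "v0 \<in> V" "\<And>u. (\<forall>b\<in>B. ?dot u b = 0) \<Longrightarrow> ?dot u v0 = 0"
      "\<forall>b'\<in>B. ?dot (\<lambda>z. b z - v0 z) b' = 0"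
    using insert.IH[of b] insert.prems by blast
  obtain v where v: "v \<in> V" "\<And>u. (\<forall>b\<in>B. ?dot u b = 0) \<Longrightarrow> ?dot u v = 0"
      "\<forall>b'\<in>B. ?dot (\<lambda>z. x z - v z) b' = 0"
    using insert.IH[of x] insert.prems by blast
  define w where "w z = b z - v0 z" for z
  define c where "c = ?dot (\<lambda>z. x z - v z) w / ?dot w w"
  define v' where "v' z = v z + c * w z" for z
  have wV: "w \<in> V" using V(1)[of b v0 "-1"] insert.prems v0(1) by (simp add: w_def[abs_def])
  have v'V: "v' \<in> V" using V(1)[OF v(1) wV, of c] by (simp add: v'_def[abs_def])
  have B: "?dot (\<lambda>z. x z - v' z) b' = 0" if "b' \<in> B" for b'
  proof -
    have "?dot (\<lambda>z. x z - v' z) b' = ?dot (\<lambda>z. x z - v z) b' - c * ?dot w b'"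
      by (simp add: v'_def sum_subtractf[symmetric] sum_distrib_left algebra_simps)
    then show ?thesis using v(3) v0(3) that by (simp add: w_def)
  qed
  have w: "?dot (\<lambda>z. x z - v' z) w = 0"
  proof -
    have eq: "?dot (\<lambda>z. x z - v' z) w = ?dot (\<lambda>z. x z - v z) w - c * ?dot w w"
      by (simp add: v'_def sum_subtractf[symmetric] sum_distrib_left algebra_simps)
    show ?thesis
    proof (cases "?dot w w = 0")
      case True
      then have "\<forall>z\<in>Z. w z = 0" using assms(1) by (simp add: sum_nonneg_eq_0_iff)
      then show ?thesis by simp
    qed (simp add: eq c_def)
  qed
  have b: "?dot (\<lambda>z. x z - v' z) b = 0"
  proof -
    have "?dot (\<lambda>z. x z - v' z) b = ?dot (\<lambda>z. x z - v' z) v0 + ?dot (\<lambda>z. x z - v' z) w"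
      by (simp add: w_def sum.distrib[symmetric] algebra_simps)
    then show ?thesis using v0(2)[of "\<lambda>z. x z - v' z"] B w by simp
  qed
  have orth: "?dot u v' = 0" if u: "\<forall>b'\<in>insert b B. ?dot u b' = 0" for u
  proof -
    have "?dot u v' = ?dot u v + c * (?dot u b - ?dot u v0)"
      by (simp add: v'_def w_def sum_subtractf[symmetric] sum.distrib[symmetric] sum_distrib_left algebra_simps)
    then show ?thesis using u v(2)[of u] v0(2)[of u] by simp
  qed
  show ?case using v'V orth B b by (intro bexI[of _ v']) auto
qed

text \<open>Row \<open>z\<close> of \<open>p\<close> is the orthogonal projection of the unit vector
  at \<open>z\<close> onto the complement of the relations, for the standard inner product on
  \<open>Z\<close>. This inner product is invariant under permutations of \<open>Z\<close>, the
  source of the equivariance.\<close>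

definition relation_projection :: "complex set \<Rightarrow> (complex \<Rightarrow> complex \<Rightarrow> rat) \<Rightarrow> bool" where
  "relation_projection Z p \<longleftrightarrow>
     (\<forall>z\<in>Z. (\<lambda>w. (if w = z then 1 else 0) - p z w) \<in> relations Z \<and>
       (\<forall>v\<in>relations Z. (\<Sum>w\<in>Z. p z w * v w) = 0))"

text \<open>\<open>gen\<close> is the dual form of the statement that the finite set
  \<open>B\<close> spans the relations.\<close>

lemma relation_projection_exists:
  assumes "finite Z" "finite B" "B \<subseteq> relations Z"
    and gen: "\<And>u v. (\<forall>b\<in>B. (\<Sum>z\<in>Z. u z * b z) = 0) \<Longrightarrow> v \<in> relations Z \<Longrightarrow> (\<Sum>z\<in>Z. u z * v z) = (0 :: rat)"
  obtains p where "relation_projection Z p"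
proof -
  have "\<exists>v\<in>relations Z. \<forall>b\<in>B. (\<Sum>w\<in>Z. ((if w = z then 1 else 0) - v w) * b w) = 0" for z
    using orthogonal_decomposition[of Z "relations Z" B "\<lambda>w. if w = z then 1 else 0"] assms relations_comb
    by (force simp: relations_def)
  then obtain v where v: "\<And>z. v z \<in> relations Z"
    "\<And>z b. b \<in> B \<Longrightarrow> (\<Sum>w\<in>Z. ((if w = z then 1 else 0) - v z w) * b w) = 0" by metis
  have "relation_projection Z (\<lambda>z w. (if w = z then 1 else 0) - v z w)"
    unfolding relation_projection_def using v gen by simp
  then show thesis by (rule that)
qed

context
  fixes Z p
  assumes fin: "finite Z" and p: "relation_projection Z p"
begin

lemma projection_orth: "z \<in> Z \<Longrightarrow> v \<in> relations Z \<Longrightarrow> (\<Sum>w\<in>Z. p z w * v w) = 0"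
  and projection_compl: "z \<in> Z \<Longrightarrow> (\<lambda>w. (if w = z then 1 else 0) - p z w) \<in> relations Z"
  using p by (auto simp: relation_projection_def)

text \<open>Both entries equal the inner product of the rows of \<open>z\<close> and
  \<open>w\<close>.\<close>

lemma projection_sym:
  assumes "z \<in> Z" "w \<in> Z" shows "p z w = p w z"
proof -
  have "(\<Sum>u\<in>Z. p z u * p w u) = p z w" if zw: "z \<in> Z" "w \<in> Z" for z w
  proof -
    have "(\<Sum>u\<in>Z. p z u * ((if u = w then 1 else 0) - p w u)) = 0"
      using projection_orth[OF zw(1) projection_compl[OF zw(2)]] .
    then show ?thesis
      using fin zw by (simp add: right_diff_distrib sum_subtractf if_distrib[of "\<lambda>y. _ * y"] cong: if_cong)
  qed
  from this[OF assms] this[OF assms(2,1)] show ?thesis by (simp add: mult.commute)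
qed

text \<open>The difference between a unit vector and its projection is a relation, hence pairs to 0
  with \<beta>. The values of \<beta> may be complex because only the pairing with rational vectors
  is involved.\<close>

lemma projection_fixes:
  assumes \<beta>: "\<And>v. v \<in> relations Z \<Longrightarrow> (\<Sum>w\<in>Z. of_rat (v w) * \<beta> w) = (0 :: complex)" and z: "z \<in> Z"
  shows "(\<Sum>w\<in>Z. of_rat (p z w) * \<beta> w) = \<beta> z"
  using \<beta>[OF projection_compl[OF z]] fin z
  by (simp add: of_rat_diff left_diff_distrib sum_subtractf if_distrib[of of_rat]
      if_distrib[of "\<lambda>y. y * _"] cong: if_cong)

text \<open>\<sigma> permutes \<open>Z\<close> and carries relations to relations in both
  directions. The difference \<open>d\<close> between a row of \<open>p\<close> and its conjugate is
  therefore both a relation and orthogonal to all relations, and positivity of the inner product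
  forces \<open>d = 0\<close> on \<open>Z\<close>.\<close>

lemma projection_equivariant:
  assumes F: "is_subfield F" and K: "is_subfield K" and FK: "F \<subseteq> K" and \<sigma>: "field_embedding F K \<sigma>"
    and ZK: "Z \<subseteq> K" and surj: "\<sigma> ` Z = Z" and z: "z \<in> Z" and w: "w \<in> Z"
  shows "p (\<sigma> z) (\<sigma> w) = p z w"
proof -
  note emb = F K FK \<sigma>
  have inj: "inj_on \<sigma> Z" using fin surj by (simp add: eq_card_imp_inj_on)
  have img: "\<sigma> u \<in> Z" if "u \<in> Z" for u using that surj by blast
  have reindex: "(\<Sum>u\<in>Z. f (\<sigma> u)) = sum f Z" for f :: "complex \<Rightarrow> 'x::comm_monoid_add"
    using sum.reindex[OF inj, of f] surj by (simp add: o_def)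
  have emb_sum: "\<sigma> (\<Sum>u\<in>Z. of_rat (v u) * u) = (\<Sum>u\<in>Z. of_rat (v u) * \<sigma> u)" for v
  proof -
    have "\<sigma> (of_rat (v u) * u) = of_rat (v u) * \<sigma> u" if "u \<in> Z" for u
      using embedding_mult[OF emb subfield_of_rat[OF K, of "v u"], of u] embedding_of_rat[OF emb] that ZK
      by auto
    then show ?thesis using ZK
      by (subst embedding_sum[OF emb]) (auto intro!: subfield_mult[OF K] subfield_of_rat[OF K])
  qed
  have comp: "(\<lambda>u. v (\<sigma> u)) \<in> relations Z" if "v \<in> relations Z" for v
  proof -
    have "\<sigma> (\<Sum>u\<in>Z. of_rat (v (\<sigma> u)) * u) = (\<Sum>u\<in>Z. of_rat (v u) * u)"
      unfolding emb_sum by (rule reindex)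
    also have "\<dots> = 0" using that by (simp add: relations_def)
    finally have "\<sigma> (\<Sum>u\<in>Z. of_rat (v (\<sigma> u)) * u) = 0" .
    moreover have "(\<Sum>u\<in>Z. of_rat (v (\<sigma> u)) * u) \<in> K"
      using ZK by (intro subfield_sum[OF K] subfield_mult[OF K] subfield_of_rat[OF K]) auto
    ultimately have "(\<Sum>u\<in>Z. of_rat (v (\<sigma> u)) * u) = 0"
      using embedding_eq_0D[OF emb] by blast
    then show ?thesis by (simp add: relations_def)
  qed
  have comp_inv: "(\<lambda>u. v (inv_into Z \<sigma> u)) \<in> relations Z" if "v \<in> relations Z" for v
  proof -
    have "(\<Sum>u\<in>Z. of_rat (v (inv_into Z \<sigma> u)) * u) = (\<Sum>u\<in>Z. of_rat (v u) * \<sigma> u)"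
      using reindex[of "\<lambda>u. of_rat (v (inv_into Z \<sigma> u)) * u"] inj by (simp cong: sum.cong)
    also have "\<dots> = \<sigma> 0" using that by (simp add: emb_sum[symmetric] relations_def)
    finally show ?thesis by (simp add: relations_def embedding_0[OF emb])
  qed
  define d where "d u = p (\<sigma> z) (\<sigma> u) - p z u" for u
  have "(\<lambda>u. ((if u = z then 1 else 0) - p z u) + (- 1) * ((if \<sigma> u = \<sigma> z then 1 else 0) - p (\<sigma> z) (\<sigma> u)))
      \<in> relations Z" (is "?d \<in> _")
    using relations_comb[OF projection_compl[OF z] comp[OF projection_compl[OF img[OF z]]], of "-1"] .
  moreover have "?d u = d u" if "u \<in> Z" for u
    using inj_on_eq_iff[OF inj that z] by (simp add: d_def)
  ultimately have dV: "d \<in> relations Z" by (simp add: relations_def cong: sum.cong)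
  have orth: "(\<Sum>u\<in>Z. d u * v u) = 0" if "v \<in> relations Z" for v
  proof -
    have "(\<Sum>u\<in>Z. p (\<sigma> z) (\<sigma> u) * v u) = (\<Sum>u\<in>Z. p (\<sigma> z) u * v (inv_into Z \<sigma> u))"
      using reindex[of "\<lambda>u. p (\<sigma> z) u * v (inv_into Z \<sigma> u)"] inj by (simp cong: sum.cong)
    also have "\<dots> = 0" by (rule projection_orth[OF img[OF z] comp_inv[OF that]])
    finally show ?thesis
      using projection_orth[OF z that] by (simp add: d_def left_diff_distrib sum_subtractf)
  qed
  have "(\<Sum>u\<in>Z. d u * d u) = 0" by (rule orth[OF dV])
  then have "d w = 0" using fin w by (simp add: sum_nonneg_eq_0_iff)
  then show ?thesis by (simp add: d_def)
qed

end

section \<open>Polynomial functions of matrices\<close>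

lemma poly_funs_sum:
  assumes "0 \<in> F" "\<And>k. k < (m::nat) \<Longrightarrow> f k \<in> poly_funs n F"
  shows "(\<lambda>A. \<Sum>k<m. f k A) \<in> poly_funs n F"
  using assms(2)
proof (induction m)
  case 0
  then show ?case using poly_funs.const[OF assms(1)] by simp
next
  case (Suc m)
  then show ?case using poly_funs.add[of "\<lambda>A. \<Sum>k<m. f k A" n F "f m"] by simp
qed

lemma poly_funs_power: "1 \<in> F \<Longrightarrow> p \<in> poly_funs n F \<Longrightarrow> (\<lambda>A. p A ^ m) \<in> poly_funs n F"
  by (induction m) (simp_all add: poly_funs.const poly_funs.mult)

lemma poly_funs_prod:
  assumes "1 \<in> F" "finite I" "\<And>k. k \<in> I \<Longrightarrow> f k \<in> poly_funs n F"
  shows "(\<lambda>A. \<Prod>k\<in>I. f k A) \<in> poly_funs n F"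
  using assms(2,3) by (induction I) (simp_all add: poly_funs.const[OF assms(1)] poly_funs.mult)

lemma poly_funs_diff:
  assumes "-1 \<in> F" "p \<in> poly_funs n F" "q \<in> poly_funs n F"
  shows "(\<lambda>A. p A - q A) \<in> poly_funs n F"
  using poly_funs.add[OF assms(2) poly_funs.mult[OF poly_funs.const[OF assms(1)] assms(3)]] by simp

lemma poly_funs_mono: "p \<in> poly_funs n F \<Longrightarrow> F \<subseteq> K \<Longrightarrow> p \<in> poly_funs n K"
  by (induction rule: poly_funs.induct) (auto intro: poly_funs.intros)

lemma mult_carrier_square:
  "A \<in> carrier_mat n n \<Longrightarrow> B \<in> carrier_mat n n \<Longrightarrow> A * B \<in> carrier_mat n n"
  by simp

lemma mult_assoc_square:
  "A \<in> carrier_mat n n \<Longrightarrow> B \<in> carrier_mat n n \<Longrightarrow> C \<in> carrier_mat n n \<Longrightarrow> A * B * C = A * (B * C)"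
  by (rule assoc_mult_mat)

lemma mult_entry:
  "A \<in> carrier_mat n n \<Longrightarrow> B \<in> carrier_mat n n \<Longrightarrow> i < n \<Longrightarrow> j < n \<Longrightarrow>
    (A * B) $$ (i, j) = (\<Sum>k<n. A $$ (i, k) * B $$ (k, j))"
  by (auto simp: scalar_prod_def atLeast0LessThan)

lemma mats_entry: "A \<in> mats n F \<Longrightarrow> i < n \<Longrightarrow> j < n \<Longrightarrow> A $$ (i, j) \<in> F"
proof -
  assume "A \<in> mats n F" "i < n" "j < n"
  moreover from this have "A $$ (i, j) \<in> elements_mat A"
    by (intro elements_matI[of A n n]) (auto simp: mats_def)
  ultimately show ?thesis by (auto simp: mats_def)
qed

lemma poly_funs_value:
  assumes F: "is_subfield F" and "p \<in> poly_funs n F" "A \<in> mats n F" shows "p A \<in> F"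
  using assms(2)
proof (induction rule: poly_funs.induct)
  case (coord i j)
  then show ?case using mats_entry[OF assms(3)] by blast
qed (use subfield_intros[OF F] in auto)


lemma matsI: "A \<in> carrier_mat n n \<Longrightarrow> (\<And>i j. i < n \<Longrightarrow> j < n \<Longrightarrow> A $$ (i, j) \<in> F) \<Longrightarrow> A \<in> mats n F"
  by (auto simp: mats_def elements_mat_def)

lemma mats_carrier: "A \<in> mats n F \<Longrightarrow> A \<in> carrier_mat n n"
  by (simp add: mats_def)

lemma poly_funs_left_translate:
  assumes F: "is_subfield F" and "p \<in> poly_funs n F" and g: "g \<in> mats n F"
  shows "\<exists>q\<in>poly_funs n F. \<forall>A\<in>carrier_mat n n. q A = p (g * A)"
  using assms(2)
proof (induction rule: poly_funs.induct)
  case (const c)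
  then show ?case by (intro bexI[of _ "\<lambda>_. c"] poly_funs.const) auto
next
  case (coord i j)
  have "(\<lambda>A. \<Sum>k<n. g $$ (i, k) * A $$ (k, j)) \<in> poly_funs n F"
    using coord mats_entry[OF g] subfield_0[OF F]
    by (intro poly_funs_sum poly_funs.mult poly_funs.const poly_funs.coord) auto
  then show ?case
    using coord mats_carrier[OF g]
    by (intro bexI[of _ "\<lambda>A. \<Sum>k<n. g $$ (i, k) * A $$ (k, j)"])
       (auto simp: scalar_prod_def atLeast0LessThan)
next
  case (add p q)
  then obtain p' q' where "p' \<in> poly_funs n F" "q' \<in> poly_funs n F"
    "\<forall>A\<in>carrier_mat n n. p' A = p (g * A)" "\<forall>A\<in>carrier_mat n n. q' A = q (g * A)" by blast
  then show ?case by (intro bexI[of _ "\<lambda>A. p' A + q' A"] poly_funs.add) auto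
next
  case (mult p q)
  then obtain p' q' where "p' \<in> poly_funs n F" "q' \<in> poly_funs n F"
    "\<forall>A\<in>carrier_mat n n. p' A = p (g * A)" "\<forall>A\<in>carrier_mat n n. q' A = q (g * A)" by blast
  then show ?case by (intro bexI[of _ "\<lambda>A. p' A * q' A"] poly_funs.mult) auto
qed

text \<open>The derivative of \<open>p\<close> along the left invariant vector field of \<open>X\<close> is again a polynomial
  function over \<open>F\<close>.\<close>

lemma poly_funs_invariant_derivative:
  assumes F: "is_subfield F" and "p \<in> poly_funs n F" and X: "X \<in> mats n F"
  shows "\<exists>q\<in>poly_funs n F. \<forall>g\<in>carrier_mat n n.
    ((\<lambda>s. p (g * (1\<^sub>m n + s \<cdot>\<^sub>m X))) has_field_derivative q g) (at 0)"
  using assms(2)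
proof (induction rule: poly_funs.induct)
  case (const c)
  then show ?case using subfield_0[OF F] by (intro bexI[of _ "\<lambda>_. 0"] poly_funs.const) auto
next
  case (coord i j)
  have q: "(\<lambda>g. \<Sum>k<n. g $$ (i, k) * X $$ (k, j)) \<in> poly_funs n F"
    using coord mats_entry[OF X] subfield_0[OF F]
    by (intro poly_funs_sum poly_funs.mult poly_funs.const poly_funs.coord) auto
  have D: "((\<lambda>s. (g * (1\<^sub>m n + s \<cdot>\<^sub>m X)) $$ (i, j)) has_field_derivative (\<Sum>k<n. g $$ (i, k) * X $$ (k, j))) (at 0)"
    if g: "g \<in> carrier_mat n n" for g
  proof -
    have "(g * (1\<^sub>m n + s \<cdot>\<^sub>m X)) $$ (i, j)
        = (\<Sum>k<n. g $$ (i, k) * ((if k = j then 1 else 0) + s * X $$ (k, j)))" for s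
      using g mats_carrier[OF X] coord by (simp add: scalar_prod_def atLeast0LessThan)
    then show ?thesis by (auto intro!: derivative_eq_intros simp: mult.commute)
  qed
  show ?case by (rule bexI[OF _ q], rule ballI, rule D)
next
  case (add p q)
  then obtain p' q' where "p' \<in> poly_funs n F" "q' \<in> poly_funs n F"
    "\<forall>g\<in>carrier_mat n n. ((\<lambda>s. p (g * (1\<^sub>m n + s \<cdot>\<^sub>m X))) has_field_derivative p' g) (at 0)"
    "\<forall>g\<in>carrier_mat n n. ((\<lambda>s. q (g * (1\<^sub>m n + s \<cdot>\<^sub>m X))) has_field_derivative q' g) (at 0)" by blast
  then show ?case
    by (intro bexI[of _ "\<lambda>A. p' A + q' A"] poly_funs.add) (auto intro: DERIV_add)
next
  case (mult p q)
  then obtain p' q' where *: "p' \<in> poly_funs n F" "q' \<in> poly_funs n F"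
    "\<forall>g\<in>carrier_mat n n. ((\<lambda>s. p (g * (1\<^sub>m n + s \<cdot>\<^sub>m X))) has_field_derivative p' g) (at 0)"
    "\<forall>g\<in>carrier_mat n n. ((\<lambda>s. q (g * (1\<^sub>m n + s \<cdot>\<^sub>m X))) has_field_derivative q' g) (at 0)" by blast
  have one: "1\<^sub>m n + 0 \<cdot>\<^sub>m X = 1\<^sub>m n" using mats_carrier[OF X] by (intro eq_matI) auto
  have "g * (1\<^sub>m n + 0 \<cdot>\<^sub>m X) = g" if "g \<in> carrier_mat n n" for g
    unfolding one using that by simp
  then have "((\<lambda>s. p (g * (1\<^sub>m n + s \<cdot>\<^sub>m X)) * q (g * (1\<^sub>m n + s \<cdot>\<^sub>m X)))
      has_field_derivative (p' g * q g + q' g * p g)) (at 0)" if "g \<in> carrier_mat n n" for g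
    using DERIV_mult[of _ "p' g" 0 UNIV _ "q' g"] * that by force
  then show ?case
    using * mult.hyps by (intro bexI[of _ "\<lambda>g. p' g * q g + q' g * p g"] poly_funs.add poly_funs.mult) auto
qed

text \<open>A shortest representation of a complex polynomial as a combination of polynomials over \<open>F\<close>
  has coefficients that are linearly independent over \<open>F\<close>.\<close>

lemma poly_funs_decompose:
  assumes F: "is_subfield F" and "q \<in> poly_funs n UNIV"
  obtains N :: nat and \<kappa> r where "\<And>i. i < N \<Longrightarrow> r i \<in> poly_funs n F" "\<And>A. q A = (\<Sum>i<N. \<kappa> i * r i A)"
    "\<And>a i. (\<forall>i<N. a i \<in> F) \<Longrightarrow> (\<Sum>i<N. a i * \<kappa> i) = 0 \<Longrightarrow> i < N \<Longrightarrow> a i = 0"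
proof -
  define rep where "rep N q \<longleftrightarrow> (\<exists>\<kappa> r. (\<forall>i<N. r i \<in> poly_funs n F) \<and> (\<forall>A. q A = (\<Sum>i<N. \<kappa> i * r i A)))"
    for N :: nat and q :: "complex mat \<Rightarrow> complex"
  have ex: "\<exists>L. set (map snd L) \<subseteq> poly_funs n F \<and> (\<forall>A. q A = (\<Sum>(c, p)\<leftarrow>L. c * p A))"
    using assms(2)
  proof (induction rule: poly_funs.induct)
    case (const c)
    show ?case using poly_funs.const[OF subfield_1[OF F]]
      by (intro exI[of _ "[(c, \<lambda>_. 1)]"]) simp
  next
    case (coord i j)
    then show ?case using poly_funs.coord
      by (intro exI[of _ "[(1, \<lambda>A. A $$ (i, j))]"]) simp
  next
    case (add p q)
    then obtain L M where "set (map snd L) \<subseteq> poly_funs n F \<and> (\<forall>A. p A = (\<Sum>(c, p)\<leftarrow>L. c * p A))"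
      "set (map snd M) \<subseteq> poly_funs n F \<and> (\<forall>A. q A = (\<Sum>(c, p)\<leftarrow>M. c * p A))" by blast
    then show ?case by (intro exI[of _ "L @ M"]) simp
  next
    case (mult p q)
    then obtain L M where LM: "set (map snd L) \<subseteq> poly_funs n F \<and> (\<forall>A. p A = (\<Sum>(c, p)\<leftarrow>L. c * p A))"
      "set (map snd M) \<subseteq> poly_funs n F \<and> (\<forall>A. q A = (\<Sum>(c, p)\<leftarrow>M. c * p A))" by blast
    define LM' where "LM' = concat (map (\<lambda>(c, p). map (\<lambda>(c', p'). (c * c', \<lambda>A. p A * p' A)) M) L)"
    have "set (map snd LM') \<subseteq> poly_funs n F"
      using LM by (force simp: LM'_def intro: poly_funs.mult)
    moreover have "(\<Sum>(c, p)\<leftarrow>LM'. c * p A) = (\<Sum>(c, p)\<leftarrow>L. c * p A) * (\<Sum>(c, p)\<leftarrow>M. c * p A)" for A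
      unfolding LM'_def
      by (induction L) (auto simp: ring_distribs sum_list_const_mult[symmetric] o_def case_prod_beta algebra_simps)
    ultimately show ?case using LM by (intro exI[of _ LM']) simp
  qed
  then obtain L where L: "set (map snd L) \<subseteq> poly_funs n F" "\<forall>A. q A = (\<Sum>(c, p)\<leftarrow>L. c * p A)" by blast
  have "rep (length L) q"
    unfolding rep_def
    by (rule exI[of _ "\<lambda>i. fst (L ! i)"], rule exI[of _ "\<lambda>i. snd (L ! i)"])
       (use L in \<open>auto simp: sum_list_sum_nth atLeast0LessThan case_prod_beta\<close>)
  then obtain N where N: "rep N q" and least: "\<And>M. rep M q \<Longrightarrow> N \<le> M"
    using ex_has_least_nat[of "\<lambda>N. rep N q" _ "\<lambda>N. N"] by blast
  then obtain \<kappa> r where r: "\<And>i. i < N \<Longrightarrow> r i \<in> poly_funs n F" "\<And>A. q A = (\<Sum>i<N. \<kappa> i * r i A)"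
    unfolding rep_def by blast
  show thesis
  proof (rule that[OF r])
    fix a i assume a: "\<forall>i<N. a i \<in> F" "(\<Sum>i<N. a i * \<kappa> i) = 0" and i: "i < N"
    show "a i = 0"
    proof (rule ccontr)
      assume ai: "a i \<noteq> 0"
      define \<pi> where "\<pi> j = (if j < i then j else Suc j)" for j
      have bij: "bij_betw \<pi> {..<N - 1} ({..<N} - {i})"
      proof (rule bij_betw_imageI)
        show "inj_on \<pi> {..<N - 1}" by (auto simp: inj_on_def \<pi>_def split: if_splits)
        show "\<pi> ` {..<N - 1} = {..<N} - {i}"
        proof (intro equalityI subsetI)
          fix x assume x: "x \<in> {..<N} - {i}"
          show "x \<in> \<pi> ` {..<N - 1}"
            using x i by (intro image_eqI[of _ _ "if x < i then x else x - 1"]) (auto simp: \<pi>_def)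
        qed (use i in \<open>auto simp: \<pi>_def\<close>)
      qed
      define b where "b j = a j / a i" for j
      have bF: "b j \<in> F" if "j < N" for j using a(1) i that by (simp add: b_def subfield_divide[OF F])
      \<comment> \<open>A nontrivial relation over \<open>F\<close> expresses
        \<open>\<kappa> i\<close> by the others. Absorbing it into the functions \<open>r j\<close>
        gives a representation with one term less, against the choice of \<open>N\<close>.\<close>
      have "a i * \<kappa> i = - (\<Sum>j\<in>{..<N} - {i}. a j * \<kappa> j)"
        using a(2) i by (subst (asm) sum.remove[of _ i]) (auto simp: add_eq_0_iff2)
      then have \<kappa>i: "\<kappa> i = - (\<Sum>j\<in>{..<N} - {i}. b j * \<kappa> j)"
        using ai by (simp add: b_def sum_divide_distrib[symmetric] field_simps)
      have "q A = (\<Sum>j<N - 1. \<kappa> (\<pi> j) * (r (\<pi> j) A - b (\<pi> j) * r i A))" for A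
      proof -
        have "q A = \<kappa> i * r i A + (\<Sum>j\<in>{..<N} - {i}. \<kappa> j * r j A)"
          using i by (simp add: r(2) sum.remove[of _ i])
        also have "\<dots> = (\<Sum>j\<in>{..<N} - {i}. \<kappa> j * (r j A - b j * r i A))"
          by (simp add: \<kappa>i right_diff_distrib sum_subtractf sum_distrib_left sum_distrib_right mult_ac)
        also have "\<dots> = (\<Sum>j<N - 1. \<kappa> (\<pi> j) * (r (\<pi> j) A - b (\<pi> j) * r i A))"
          by (rule sum.reindex_bij_betw[OF bij, symmetric])
        finally show ?thesis .
      qed
      moreover have "(\<lambda>A. r (\<pi> j) A - b (\<pi> j) * r i A) \<in> poly_funs n F" if "j < N - 1" for j
      proof -
        have "\<pi> j < N" using that by (auto simp: \<pi>_def)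
        then show ?thesis using r(1) i bF subfield_uminus[OF F subfield_1[OF F]]
          by (intro poly_funs_diff poly_funs.mult poly_funs.const) auto
      qed
      ultimately have "rep (N - 1) q"
        unfolding rep_def
        by (intro exI[of _ "\<lambda>j. \<kappa> (\<pi> j)"] exI[of _ "\<lambda>j A. r (\<pi> j) A - b (\<pi> j) * r i A"]) blast
      then show False using least[of "N - 1"] i by simp
    qed
  qed
qed

text \<open>In \<open>q = \<Sum> \<kappa>\<^sub>i r\<^sub>i\<close> each \<open>r\<^sub>i\<close>
  takes values in \<open>F\<close> on \<open>G\<close>, so independence of the \<kappa>'s over
  \<open>F\<close> makes every \<open>r\<^sub>i\<close> vanish on \<open>G\<close>. Complex
  equations of a group of matrices over \<open>F\<close> thus follow from its equations over
  \<open>F\<close>, for points and for tangent vectors.\<close>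

lemma vanishing_over_subfield:
  assumes F: "is_subfield F" and G: "G \<subseteq> mats n F" and q: "q \<in> poly_funs n UNIV"
    and van: "\<And>g. g \<in> G \<Longrightarrow> q g = 0"
  shows "(\<And>p. p \<in> poly_funs n F \<Longrightarrow> (\<And>g. g \<in> G \<Longrightarrow> p g = 0) \<Longrightarrow> p B = 0) \<Longrightarrow> q B = 0"
    and "A \<in> Lie n F G \<Longrightarrow> ((\<lambda>t. q (1\<^sub>m n + t \<cdot>\<^sub>m A)) has_field_derivative 0) (at 0)"
proof -
  obtain N :: nat and \<kappa> r where r: "\<And>i. i < N \<Longrightarrow> r i \<in> poly_funs n F"
      "\<And>A. q A = (\<Sum>i<N. \<kappa> i * r i A)"
    and ind: "\<And>a i. (\<forall>i<N. a i \<in> F) \<Longrightarrow> (\<Sum>i<N. a i * \<kappa> i) = 0 \<Longrightarrow> i < N \<Longrightarrow> a i = 0"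
    by (rule poly_funs_decompose[OF F q]) blast
  have r0: "r i g = 0" if "i < N" "g \<in> G" for i g
  proof (rule ind[OF _ _ that(1)])
    show "\<forall>i<N. r i g \<in> F" using r(1) poly_funs_value[OF F] G that(2) by blast
    show "(\<Sum>i<N. r i g * \<kappa> i) = 0" using r(2)[of g] van[OF that(2)] by (simp add: mult.commute)
  qed
  {
    assume "\<And>p. p \<in> poly_funs n F \<Longrightarrow> (\<And>g. g \<in> G \<Longrightarrow> p g = 0) \<Longrightarrow> p B = 0"
    then have "r i B = 0" if "i < N" for i using r(1) r0 that by blast
    then show "q B = 0" by (simp add: r(2))
  next
    assume "A \<in> Lie n F G"
    then have "((\<lambda>t. r i (1\<^sub>m n + t \<cdot>\<^sub>m A)) has_field_derivative 0) (at 0)" if "i < N" for i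
      using r(1) r0 that by (auto simp: Lie_def)
    then have "((\<lambda>t. \<Sum>i<N. \<kappa> i * r i (1\<^sub>m n + t \<cdot>\<^sub>m A)) has_field_derivative (\<Sum>i<N. \<kappa> i * 0)) (at 0)"
      by (intro DERIV_sum DERIV_cmult) auto
    then show "((\<lambda>t. q (1\<^sub>m n + t \<cdot>\<^sub>m A)) has_field_derivative 0) (at 0)" by (simp add: r(2))
  }
qed

lemma derivative_prod_at_one:
  assumes "finite I" "\<And>k. k \<in> I \<Longrightarrow> (g k has_field_derivative a k) (at 0)" "\<And>k. k \<in> I \<Longrightarrow> g k 0 = 1"
  shows "((\<lambda>s. \<Prod>k\<in>I. g k s) has_field_derivative (\<Sum>k\<in>I. a k)) (at (0 :: complex))"
  using assms
proof (induction I)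
  case (insert k I)
  have "(\<Prod>k\<in>I. g k 0) = 1" using insert.prems by simp
  then show ?case
    using DERIV_mult[OF insert.prems(1)[of k] insert.IH] insert by (simp add: mult.commute add.commute)
qed simp

section \<open>Diagonalizable matrices\<close>

definition mdiag :: "nat \<Rightarrow> (nat \<Rightarrow> complex) \<Rightarrow> complex mat" where
  "mdiag n f = mat n n (\<lambda>(i, j). if i = j then f i else 0)"

lemma mdiag_carrier [simp]: "mdiag n f \<in> carrier_mat n n"
  by (simp add: mdiag_def)

lemma mdiag_mult: "mdiag n f * mdiag n g = mdiag n (\<lambda>k. f k * g k)"
proof (rule eq_matI)
  fix i j assume ij: "i < dim_row (mdiag n (\<lambda>k. f k * g k))" "j < dim_col (mdiag n (\<lambda>k. f k * g k))"
  then have "(mdiag n f * mdiag n g) $$ (i, j)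
      = (\<Sum>k<n. (if k = i then f i else 0) * (if k = j then g j else 0))"
    by (auto simp: mdiag_def scalar_prod_def atLeast0LessThan intro!: sum.cong)
  also have "\<dots> = mdiag n (\<lambda>k. f k * g k) $$ (i, j)"
    using ij by (simp add: mdiag_def if_distrib[of "\<lambda>y. y * _"] cong: if_cong)
  finally show "(mdiag n f * mdiag n g) $$ (i, j) = mdiag n (\<lambda>k. f k * g k) $$ (i, j)" .
qed (simp_all add: mdiag_def)

locale diagonalized =
  fixes n :: nat and X P Q :: "complex mat" and d :: "nat \<Rightarrow> complex"
  assumes P: "P \<in> carrier_mat n n" and Q: "Q \<in> carrier_mat n n"
    and PQ: "P * Q = 1\<^sub>m n" and QP: "Q * P = 1\<^sub>m n" and X_eq: "X = P * mdiag n d * Q"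
begin

text \<open>The conjugated diagonal matrices form a commutative algebra that contains
  \<open>X\<close>. All elements of the hull and of its group are of this form, so matrix identities
  reduce to pointwise ones.\<close>

definition tor :: "(nat \<Rightarrow> complex) \<Rightarrow> complex mat" where
  "tor f = P * mdiag n f * Q"

lemma tor_carrier [simp]: "tor f \<in> carrier_mat n n"
  using P Q by (simp add: tor_def mult_carrier_square)

lemma tor_cong: "(\<And>k. k < n \<Longrightarrow> f k = g k) \<Longrightarrow> tor f = tor g"
proof -
  assume "\<And>k. k < n \<Longrightarrow> f k = g k"
  then have "mdiag n f = mdiag n g" by (intro eq_matI) (auto simp: mdiag_def)
  then show "tor f = tor g" by (simp add: tor_def)
qed

lemma tor_entry:
  assumes "i < n" "j < n" shows "tor f $$ (i, j) = (\<Sum>k<n. P $$ (i, k) * Q $$ (k, j) * f k)"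
proof -
  have "(P * mdiag n f) $$ (i, k) = P $$ (i, k) * f k" if "k < n" for k
    using P assms that
    by (simp add: mdiag_def scalar_prod_def atLeast0LessThan if_distrib[of "\<lambda>y. _ * y"] cong: if_cong)
  then show ?thesis
    unfolding tor_def using mult_entry[OF mult_carrier_square[OF P mdiag_carrier] Q assms]
    by (simp add: mult_ac)
qed

lemma tor_mult: "tor f * tor g = tor (\<lambda>k. f k * g k)"
proof -
  have "tor f * tor g = P * mdiag n f * (Q * (P * (mdiag n g * Q)))"
    using P Q by (simp only: tor_def mult_assoc_square[of _ n] mult_carrier_square[of _ n] mdiag_carrier)
  also have "Q * (P * (mdiag n g * Q)) = (Q * P) * (mdiag n g * Q)"
    using P Q by (simp only: mult_assoc_square[of _ n] mult_carrier_square[of _ n] mdiag_carrier)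
  also have "\<dots> = mdiag n g * Q" by (simp only: QP left_mult_one_mat[OF mult_carrier_square[OF mdiag_carrier Q]])
  also have "P * mdiag n f * (mdiag n g * Q) = P * (mdiag n f * mdiag n g) * Q"
    using P Q by (simp only: mult_assoc_square[of _ n] mult_carrier_square[of _ n] mdiag_carrier)
  finally show ?thesis by (simp add: mdiag_mult tor_def)
qed

lemma tor_one: "tor (\<lambda>_. 1) = 1\<^sub>m n"
proof -
  have "mdiag n (\<lambda>_. 1) = 1\<^sub>m n" by (intro eq_matI) (auto simp: mdiag_def)
  then show ?thesis using P by (simp add: tor_def PQ)
qed

lemma tor_add: "tor f + tor g = tor (\<lambda>k. f k + g k)"
  by (rule eq_matI) (simp_all add: tor_entry ring_distribs sum.distrib carrier_matD[OF tor_carrier])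

lemma tor_smult: "c \<cdot>\<^sub>m tor f = tor (\<lambda>k. c * f k)"
  by (rule eq_matI) (simp_all add: tor_entry sum_distrib_left mult_ac carrier_matD[OF tor_carrier])

lemma X_tor: "X = tor d"
  by (simp add: X_eq tor_def)

lemma X_carrier: "X \<in> carrier_mat n n"
  by (simp add: X_tor)

lemma X_pow: "X ^\<^sub>m i = tor (\<lambda>k. d k ^ i)"
  by (induction i) (simp_all add: tor_one X_tor tor_mult mult.commute carrier_matD[OF tor_carrier])

text \<open>The entries of \<open>Q A P\<close>, as linear functions of \<open>A\<close>.\<close>

definition conj_entry :: "nat \<Rightarrow> nat \<Rightarrow> complex mat \<Rightarrow> complex" where
  "conj_entry k l A = (\<Sum>i<n. \<Sum>j<n. Q $$ (k, i) * P $$ (j, l) * A $$ (i, j))"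

lemma conj_entry_eq:
  assumes "A \<in> carrier_mat n n" "k < n" "l < n" shows "conj_entry k l A = (Q * A * P) $$ (k, l)"
proof -
  have "(Q * A * P) $$ (k, l) = (\<Sum>j<n. (\<Sum>i<n. Q $$ (k, i) * A $$ (i, j)) * P $$ (j, l))"
    using mult_entry[OF mult_carrier_square[OF Q assms(1)] P assms(2,3)]
    by (simp add: mult_entry[OF Q assms(1,2)])
  also have "\<dots> = (\<Sum>j<n. \<Sum>i<n. Q $$ (k, i) * P $$ (j, l) * A $$ (i, j))"
    by (simp add: sum_distrib_left sum_distrib_right mult_ac)
  finally show ?thesis unfolding conj_entry_def by (subst sum.swap) simp
qed

lemma conj_entry_tor:
  assumes "k < n" "l < n" shows "conj_entry k l (tor f) = (if k = l then f k else 0)"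
proof -
  have "Q * tor f * P = Q * (P * (mdiag n f * (Q * P)))"
    using P Q by (simp only: tor_def mult_assoc_square[of _ n] mult_carrier_square[of _ n] mdiag_carrier)
  also have "\<dots> = Q * (P * mdiag n f)"
    by (simp only: QP right_mult_one_mat[OF mdiag_carrier])
  also have "\<dots> = (Q * P) * mdiag n f" by (rule mult_assoc_square[OF Q P mdiag_carrier, symmetric])
  finally have "Q * tor f * P = mdiag n f" by (simp only: QP left_mult_one_mat[OF mdiag_carrier])
  then show ?thesis using assms by (simp add: conj_entry_eq mdiag_def)
qed

lemma conj_entry_add_smult:
  assumes "A \<in> carrier_mat n n" "B \<in> carrier_mat n n"
  shows "conj_entry k l (A + t \<cdot>\<^sub>m B) = conj_entry k l A + t * conj_entry k l B"
  using assms by (simp add: conj_entry_def ring_distribs sum.distrib sum_distrib_left mult_ac)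

lemma tor_of_conj_entry:
  assumes A: "A \<in> carrier_mat n n" and off: "\<And>k l. k < n \<Longrightarrow> l < n \<Longrightarrow> k \<noteq> l \<Longrightarrow> conj_entry k l A = 0"
  shows "A = tor (\<lambda>k. conj_entry k k A)"
proof -
  have "Q * A * P = mdiag n (\<lambda>k. conj_entry k k A)"
    using P Q A off by (intro eq_matI) (auto simp: mdiag_def conj_entry_eq[OF A, symmetric] simp del: index_mult_mat(1) assoc_mult_mat)
  then have "tor (\<lambda>k. conj_entry k k A) = P * (Q * A * P) * Q" by (simp add: tor_def)
  also have "\<dots> = (P * Q) * A * (P * Q)"
    using P Q A by (simp only: mult_assoc_square[of _ n] mult_carrier_square[of _ n])
  also have "\<dots> = A" using A by (simp add: PQ)
  finally show ?thesis by simp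
qed

lemma conj_entry_poly_fun: "k < n \<Longrightarrow> l < n \<Longrightarrow> conj_entry k l \<in> poly_funs n UNIV"
  unfolding conj_entry_def[abs_def]
  by (intro poly_funs_sum poly_funs.mult poly_funs.const poly_funs.coord) auto

lemma tor_inj: "tor f = tor g \<Longrightarrow> k < n \<Longrightarrow> f k = g k"
  using conj_entry_tor[of k k f] conj_entry_tor[of k k g] by simp

lemma det_tor: "det (tor f) \<noteq> 0 \<longleftrightarrow> (\<forall>k<n. f k \<noteq> 0)"
proof -
  have "det (mdiag n f) = prod_list (diag_mat (mdiag n f))"
    by (rule det_upper_triangular[of _ n]) (auto simp: mdiag_def upper_triangular_def)
  also have "\<dots> = 0 \<longleftrightarrow> (\<exists>k<n. f k = 0)"
    by (auto simp: diag_mat_def prod_list_zero_iff mdiag_def)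
  finally have "det (mdiag n f) = 0 \<longleftrightarrow> (\<exists>k<n. f k = 0)" .
  moreover have "det P * det Q = 1" using det_mult[OF P Q] by (simp add: PQ)
  then have "det P \<noteq> 0" "det Q \<noteq> 0" by auto
  moreover have "det (tor f) = det P * det (mdiag n f) * det Q"
    using P Q by (simp add: tor_def det_mult[of _ n])
  ultimately show ?thesis by auto
qed

text \<open>On the torus a polynomial function is a combination of monomials, here a list of
  coefficients and exponents.\<close>

definition monomials :: "(complex \<times> (nat \<Rightarrow> nat)) list \<Rightarrow> (nat \<Rightarrow> complex) \<Rightarrow> complex" where
  "monomials L f = (\<Sum>(c, m)\<leftarrow>L. c * (\<Prod>k<n. f k ^ m k))"

lemma poly_funs_tor:
  assumes "p \<in> poly_funs n UNIV" shows "\<exists>L. \<forall>f. p (tor f) = monomials L f"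
  using assms
proof (induction rule: poly_funs.induct)
  case (const c)
  show ?case by (rule exI[of _ "[(c, \<lambda>_. 0)]"]) (simp add: monomials_def)
next
  case (coord i j)
  have "tor f $$ (i, j) = monomials (map (\<lambda>k. (P $$ (i, k) * Q $$ (k, j), \<lambda>l. if l = k then 1 else 0)) [0..<n]) f" for f
  proof -
    have "(\<Prod>l<n. f l ^ (if l = k then 1 else 0)) = f k" if "k < n" for k
      using that prod.delta[of "{..<n}" k f] by (simp add: if_distrib cong: if_cong)
    then show ?thesis
      using coord by (simp add: monomials_def tor_entry o_def interv_sum_list_conv_sum_set_nat atLeast0LessThan)
  qed
  then show ?case by blast
next
  case (add p q)
  then obtain L M where "\<forall>f. p (tor f) = monomials L f" "\<forall>f. q (tor f) = monomials M f" by blast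
  then show ?case by (intro exI[of _ "L @ M"]) (simp add: monomials_def)
next
  case (mult p q)
  then obtain L M where LM: "\<forall>f. p (tor f) = monomials L f" "\<forall>f. q (tor f) = monomials M f" by blast
  have "monomials (concat (map (\<lambda>(c, m). map (\<lambda>(c', m'). (c * c', \<lambda>k. m k + m' k)) M) L)) f
      = monomials L f * monomials M f" for f
    unfolding monomials_def
    by (induction L) (auto simp: ring_distribs sum_list_const_mult[symmetric] o_def case_prod_beta
        power_add prod.distrib mult_ac)
  then show ?case using LM by (metis (no_types, lifting))
qed

lemma monomials_derivative:
  assumes "\<And>k. k < n \<Longrightarrow> ((\<lambda>s. f s k) has_field_derivative a k) (at 0)" "\<And>k. k < n \<Longrightarrow> f 0 k = 1"
  shows "((\<lambda>s. monomials L (f s)) has_field_derivative (\<Sum>(c, m)\<leftarrow>L. c * (\<Sum>k<n. of_nat (m k) * a k))) (at 0)"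
proof (induction L)
  case (Cons cm L)
  obtain c m where cm: "cm = (c, m)" by force
  have "((\<lambda>s. f s k ^ m k) has_field_derivative of_nat (m k) * a k) (at 0)" if "k < n" for k
    using DERIV_power[OF assms(1)[OF that], of "m k"] assms(2)[OF that] by (simp add: mult_ac)
  then have "((\<lambda>s. \<Prod>k<n. f s k ^ m k) has_field_derivative (\<Sum>k<n. of_nat (m k) * a k)) (at 0)"
    using assms(2) by (intro derivative_prod_at_one) auto
  from DERIV_add[OF DERIV_cmult[OF this, of c] Cons] show ?case by (simp add: monomials_def cm)
qed (simp add: monomials_def)

end

section \<open>Interpolation, moments, denominators and rationality of polynomials in
  \<open>X\<close>\<close>

lemma interpolation_exists:
  assumes "finite Z" shows "\<exists>r. \<forall>z\<in>Z. poly r z = (f z :: 'a::field)"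
  using assms
proof (induction Z)
  case (insert z Z)
  then obtain r where r: "\<forall>z\<in>Z. poly r z = f z" by blast
  define q where "q = (\<Prod>w\<in>Z. [:- w, 1:])"
  have "poly q z \<noteq> 0" "\<forall>w\<in>Z. poly q w = 0"
    using insert.hyps by (auto simp: q_def poly_prod)
  then have "\<forall>w\<in>insert z Z. poly (r + smult ((f z - poly r z) / poly q z) q) w = f w"
    using r by simp
  then show ?case by blast
qed simp

text \<open>On the finitely many values \<open>w m\<close> any function agrees with a polynomial,
  and the hypothesis kills every power. This is the passage from the eigenvalues of the derivation
  by \<open>X\<close> to those belonging to another element of the hull.\<close>

lemma moments_zero:
  fixes L :: "('b \<times> 'c) list" and w :: "'c \<Rightarrow> complex"
  assumes "\<And>k. (\<Sum>(c, m)\<leftarrow>L. of_c c * w m ^ k) = 0"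
  shows "(\<Sum>(c, m)\<leftarrow>L. of_c c * \<Phi> (w m)) = (0 :: complex)"
proof -
  have "finite (w ` snd ` set L)" by simp
  then obtain r where r: "\<forall>z\<in>w ` snd ` set L. poly r z = \<Phi> z" using interpolation_exists by blast
  have "(\<Sum>(c, m)\<leftarrow>L. of_c c * \<Phi> (w m)) = (\<Sum>(c, m)\<leftarrow>L. of_c c * poly r (w m))"
    using r by (intro arg_cong[of _ _ sum_list] map_cong) auto
  also have "\<dots> = (\<Sum>(c, m)\<leftarrow>L. \<Sum>k\<le>degree r. coeff r k * (of_c c * w m ^ k))"
    by (simp add: poly_altdef sum_distrib_left mult_ac case_prod_unfold)
  also have "\<dots> = (\<Sum>k\<le>degree r. coeff r k * (\<Sum>(c, m)\<leftarrow>L. of_c c * w m ^ k))"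
    by (induction L) (auto simp: sum.distrib ring_distribs case_prod_unfold)
  also have "\<dots> = 0" using assms by simp
  finally show ?thesis .
qed

lemma common_denominator:
  assumes "finite S" shows "\<exists>N::int. N > 0 \<and> (\<forall>q\<in>S. \<exists>i::int. of_int N * q = (of_int i :: rat))"
  using assms
proof (induction S)
  case empty
  show ?case by (rule exI[of _ 1]) simp
next
  case (insert q S)
  then obtain N where N: "N > 0" "\<forall>q\<in>S. \<exists>i::int. of_int N * q = (of_int i :: rat)" by blast
  obtain a b where ab: "q = of_int a / of_int b" "b > 0" by (metis quotient_of_denom_pos quotient_of_div surj_pair)
  have "of_int (N * b) * q = of_int (N * a)" using ab by simp
  moreover have "\<exists>i::int. of_int (N * b) * x = (of_int i :: rat)" if x: "x \<in> S" for x
  proof -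
    obtain i :: int where "of_int N * x = (of_int i :: rat)" using N x by blast
    then have "of_int (N * b) * x = (of_int (b * i) :: rat)" by (simp add: mult_ac)
    then show ?thesis by blast
  qed
  moreover have "N * b > 0" using N ab by simp
  ultimately show ?case by blast
qed

lemma power_int_nat_split: "x \<noteq> 0 \<Longrightarrow> (x :: complex) powi e = x ^ nat e / x ^ nat (- e)"
  by (cases "e \<ge> 0") (simp_all add: power_int_def field_simps)

text \<open>Points over \<open>F\<close> are available only for parameters in \<open>F\<close>; the
  rational sequence tending to 0 is enough to read off a derivative that is known to exist.\<close>

lemma derivative_zero_of_zeros:
  fixes \<phi> :: "complex \<Rightarrow> complex"
  assumes D: "(\<phi> has_field_derivative D) (at 0)" and 0: "\<phi> 0 = 0"
    and ev: "eventually (\<lambda>j. \<phi> (inverse (of_nat (Suc j))) = 0) sequentially"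
  shows "D = 0"
proof -
  have "((\<lambda>h. (\<phi> h - \<phi> 0) / h) \<longlongrightarrow> D) (at 0)" using D by (simp add: DERIV_def)
  moreover have "filterlim (\<lambda>j. inverse (of_nat (Suc j)) :: complex) (at 0) sequentially"
    using LIMSEQ_Suc[OF lim_inverse_n[where 'a = complex]]
    by (simp add: filterlim_at del: of_nat_Suc)
  ultimately have "((\<lambda>j. (\<phi> (inverse (of_nat (Suc j))) - \<phi> 0) / inverse (of_nat (Suc j))) \<longlongrightarrow> D) sequentially"
    by (rule filterlim_compose)
  moreover have "((\<lambda>j. (\<phi> (inverse (of_nat (Suc j))) - \<phi> 0) / inverse (of_nat (Suc j))) \<longlongrightarrow> 0) sequentially"
    using ev by (intro tendsto_eventually) (auto simp: 0 elim: eventually_mono simp del: of_nat_Suc)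
  ultimately show "D = 0" using LIMSEQ_unique by blast
qed

lemma det_polys_over:
  assumes F: "is_subfield F" and A: "A \<in> carrier_mat n n"
    and ent: "\<And>i j. i < n \<Longrightarrow> j < n \<Longrightarrow> A $$ (i, j) \<in> polys_over F"
  shows "det A \<in> polys_over F"
proof -
  have "signof \<pi> * (\<Prod>i = 0..<n. A $$ (i, \<pi> i)) \<in> polys_over F" if "\<pi> permutes {0..<n}" for \<pi>
  proof (rule polys_over_mult[OF F])
    show "signof \<pi> \<in> polys_over F"
      by (simp add: sign_def polys_over_1[OF F] polys_over_uminus[OF F])
    show "(\<Prod>i = 0..<n. A $$ (i, \<pi> i)) \<in> polys_over F"
      using that permutes_in_image[OF that] by (intro polys_over_prod[OF F] ent) auto
  qed
  then show ?thesis using A by (auto simp: det_def intro!: polys_over_sum[OF F])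
qed

lemma char_poly_polys_over:
  assumes F: "is_subfield F" and A: "A \<in> mats n F" shows "char_poly A \<in> polys_over F"
proof -
  have "[:0, 1:] \<in> polys_over F"
    by (intro polys_over_pCons[OF F] polys_over_0[OF F] subfield_0[OF F] subfield_1[OF F])
  then show ?thesis
    unfolding char_poly_def
    using mats_carrier[OF A] mats_entry[OF A]
    by (intro det_polys_over[OF F, of _ n])
       (auto simp: char_poly_matrix_def polys_over_const[OF F] polys_over_0[OF F] polys_over_1[OF F] subfield_uminus[OF F]
         intro!: polys_over_add[OF F] polys_over_uminus[OF F] polys_over_pCons[OF F] subfield_1[OF F] subfield_0[OF F])
qed

lemma mat_comb_carrier [simp]: "mat_comb n cs Ms \<in> carrier_mat n n"
  by (simp add: mat_comb_def)

context diagonalized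
begin

lemma mat_comb_powers:
  assumes "length cs = t + 1"
  shows "mat_comb n cs (powers X t) = tor (\<lambda>k. \<Sum>l\<le>t. cs ! l * d k ^ l)"
proof (rule eq_matI)
  fix i j assume "i < dim_row (tor (\<lambda>k. \<Sum>l\<le>t. cs ! l * d k ^ l))" "j < dim_col (tor (\<lambda>k. \<Sum>l\<le>t. cs ! l * d k ^ l))"
  then have ij: "i < n" "j < n" using tor_carrier by (metis carrier_matD)+
  have "mat_comb n cs (powers X t) $$ (i, j) = (\<Sum>l<t + 1. cs ! l * tor (\<lambda>k. d k ^ l) $$ (i, j))"
    using ij by (simp add: mat_comb_def powers_def X_pow del: upt_Suc)
  also have "\<dots> = (\<Sum>l<t + 1. \<Sum>k<n. P $$ (i, k) * Q $$ (k, j) * (cs ! l * d k ^ l))"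
    using ij by (simp add: tor_entry sum_distrib_left mult_ac)
  also have "\<dots> = (\<Sum>k<n. P $$ (i, k) * Q $$ (k, j) * (\<Sum>l<t + 1. cs ! l * d k ^ l))"
    by (subst sum.swap) (simp only: sum_distrib_left)
  finally show "mat_comb n cs (powers X t) $$ (i, j) = tor (\<lambda>k. \<Sum>l\<le>t. cs ! l * d k ^ l) $$ (i, j)"
    using ij by (simp add: tor_entry lessThan_Suc_atMost)
qed (simp_all add: carrier_matD[OF tor_carrier] carrier_matD[OF mat_comb_carrier])

text \<open>The matrix is \<open>r(X)\<close>, evaluated by Horner's scheme over
  \<open>F\<close>.\<close>

lemma tor_poly_mats:
  assumes F: "is_subfield F" and X: "X \<in> mats n F" and r: "r \<in> polys_over F"
  shows "tor (\<lambda>k. poly r (d k)) \<in> mats n F"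
  using r
proof (induction r)
  case 0
  show ?case by (rule matsI) (simp_all add: tor_entry subfield_0[OF F])
next
  case (pCons a r)
  have "coeff (pCons a r) (Suc i) \<in> F" for i
    using pCons.prems by (simp only: polys_over_def mem_Collect_eq)
  then have r: "tor (\<lambda>k. poly r (d k)) \<in> mats n F" using pCons by (simp add: polys_over_def)
  have "coeff (pCons a r) 0 \<in> F" using pCons.prems by (simp only: polys_over_def mem_Collect_eq)
  then have a: "a \<in> F" by simp
  have eq: "tor (\<lambda>k. poly (pCons a r) (d k)) = a \<cdot>\<^sub>m 1\<^sub>m n + X * tor (\<lambda>k. poly r (d k))"
    by (simp add: X_tor tor_mult tor_one[symmetric] tor_smult tor_add)
  show ?case
    unfolding eq using a r mats_entry[OF r] mats_entry[OF X] X_carrier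
    by (intro matsI) (auto simp: mult_entry[of _ n] carrier_matD[OF tor_carrier] subfield_0[OF F]
        simp del: index_mult_mat(1) intro!: subfield_add[OF F] subfield_sum[OF F] subfield_mult[OF F])
qed

lemma char_poly_X: "char_poly X = (\<Prod>a\<leftarrow>map d [0..<n]. [:- a, 1:])"
proof -
  have "similar_mat_wit X (mdiag n d) P Q"
    using P Q X_eq PQ QP X_carrier by (simp add: similar_mat_wit_def Let_def)
  then have "char_poly X = char_poly (mdiag n d)"
    by (metis char_poly_similar similar_mat_def)
  also have "\<dots> = (\<Prod>a\<leftarrow>diag_mat (mdiag n d). [:- a, 1:])"
    by (rule char_poly_upper_triangular[of _ n]) (auto simp: mdiag_def upper_triangular_def)
  also have "diag_mat (mdiag n d) = map d [0..<n]"
    by (auto simp: diag_mat_def mdiag_def)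
  finally show ?thesis .
qed

lemma char_poly_roots: "{z. poly (char_poly X) z = 0} = d ` {..<n}"
  unfolding char_poly_X by (auto simp: poly_prod_list prod_list_zero_iff)

end

section \<open>The algebraic hull of a semisimple matrix\<close>

locale hull_setup = diagonalized +
  fixes F K :: "complex set" and Z :: "complex set" and t :: nat
  assumes F: "is_subfield F" and K: "number_field K" and FK: "F \<subseteq> K" and XF: "X \<in> mats n F"
    and Z: "Z = d ` {..<n}" and ZK: "Z \<subseteq> K"
    and basis: "mat_basis n F (assoc_algebra n F X) (powers X t)"
begin

lemma finZ: "finite Z"
  by (simp add: Z)

lemma dZ: "k < n \<Longrightarrow> d k \<in> Z"
  by (simp add: Z)

lemma subK: "is_subfield K"
  using K by (simp add: number_field_iff)

lemma power_reduces: "\<exists>a. (\<forall>i\<le>t. a i \<in> F) \<and> (\<forall>z\<in>Z. z ^ j = (\<Sum>i\<le>t. a i * z ^ i))"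
proof -
  have "X ^\<^sub>m j \<in> assoc_algebra n F X"
  proof (induction j)
    case 0
    show ?case using X_carrier assoc_algebra.one by simp
  qed (simp add: assoc_algebra.intros)
  then obtain cs where cs: "length cs = length (powers X t)" "set cs \<subseteq> F" "X ^\<^sub>m j = mat_comb n cs (powers X t)"
    using basis by (auto simp: mat_basis_def mat_span_def)
  then have len: "length cs = t + 1" by (simp add: powers_def)
  have "tor (\<lambda>k. d k ^ j) = tor (\<lambda>k. \<Sum>l\<le>t. cs ! l * d k ^ l)"
    using cs(3) unfolding mat_comb_powers[OF len] X_pow .
  then have "d k ^ j = (\<Sum>l\<le>t. cs ! l * d k ^ l)" if "k < n" for k
    using tor_inj that by fastforce
  then show ?thesis using cs(2) len by (intro exI[of _ "\<lambda>l. cs ! l"]) (auto simp: Z)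
qed

text \<open>A complex solution of the linear system \<open>\<Sum> c\<^sub>l X\<^sup>l = A\<close> over \<open>F\<close> is found by a left inverse over
  \<open>F\<close>, hence lies in \<open>F\<close>.\<close>

lemma tor_coefficients:
  assumes A: "tor (\<lambda>k. \<zeta> (d k)) \<in> mats n F"
  obtains \<gamma> where "\<forall>i\<le>t. \<gamma> i \<in> F" "\<And>z. z \<in> Z \<Longrightarrow> \<zeta> z = (\<Sum>i\<le>t. \<gamma> i * z ^ i)"
proof -
  obtain r where r: "\<forall>z\<in>Z. poly r z = \<zeta> z" using interpolation_exists[OF finZ] by blast
  obtain a where a: "\<And>j. \<forall>i\<le>t. a j i \<in> F" "\<And>j z. z \<in> Z \<Longrightarrow> z ^ j = (\<Sum>i\<le>t. a j i * z ^ i)"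
    using power_reduces by metis
  define c where "c i = (\<Sum>j\<le>degree r. coeff r j * a j i)" for i
  have \<zeta>: "\<zeta> z = (\<Sum>i\<le>t. c i * z ^ i)" if z: "z \<in> Z" for z
  proof -
    have "\<zeta> z = (\<Sum>j\<le>degree r. coeff r j * z ^ j)" using r z by (simp add: poly_altdef)
    also have "\<dots> = (\<Sum>j\<le>degree r. \<Sum>i\<le>t. coeff r j * a j i * z ^ i)"
      by (intro sum.cong refl, subst a(2)[OF z]) (simp add: sum_distrib_left mult.assoc)
    also have "\<dots> = (\<Sum>i\<le>t. c i * z ^ i)"
      by (subst sum.swap) (simp add: c_def sum_distrib_right)
    finally show ?thesis .
  qed
  \<comment> \<open>Matrices are flattened to vectors of length \<open>n * n\<close>, with row
    \<open>idx div n\<close> and column \<open>idx mod n\<close>.\<close>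
  define M where "M idx l = (X ^\<^sub>m l) $$ (idx div n, idx mod n)" for idx l
  have XlF: "X ^\<^sub>m l \<in> mats n F" for l
    using tor_poly_mats[OF F XF, of "monom 1 l"]
    by (simp add: X_pow poly_monom polys_over_monom[OF F] subfield_1[OF F])
  have idx: "idx div n < n" "idx mod n < n" if "idx < n * n" for idx
    using that by (auto simp: less_mult_imp_div_less) (metis mod_less_divisor mult_is_0 neq0_conv not_less_zero)
  have MF: "\<forall>idx<n * n. \<forall>l<t + 1. M idx l \<in> F"
    using mats_entry[OF XlF] idx by (simp add: M_def)
  have comb: "(\<Sum>l<t + 1. M idx l * x l) = tor (\<lambda>k. \<Sum>l\<le>t. x l * d k ^ l) $$ (idx div n, idx mod n)"
    if "idx < n * n" for idx x
  proof -
    have "mat_comb n (map x [0..<t + 1]) (powers X t) $$ (idx div n, idx mod n) = (\<Sum>l<t + 1. x l * M idx l)"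
      using idx[OF that] by (simp add: mat_comb_def powers_def M_def del: upt_Suc)
    moreover have "(\<Sum>l\<le>t. map x [0..<t + 1] ! l * d k ^ l) = (\<Sum>l\<le>t. x l * d k ^ l)" for k
      by (intro sum.cong) (simp_all del: upt_Suc)
    ultimately show ?thesis by (simp add: mat_comb_powers mult.commute del: upt_Suc)
  qed
  obtain L where L: "\<forall>k<t + 1. \<forall>idx<n * n. L k idx \<in> F"
    "\<And>k l. k < t + 1 \<Longrightarrow> l < t + 1 \<Longrightarrow> (\<Sum>idx<n * n. L k idx * M idx l) = (if k = l then 1 else 0)"
  proof (rule left_inverse_exists[OF F MF])
    fix x assume x: "\<forall>j<t + 1. x j \<in> F" "\<forall>i<n * n. (\<Sum>j<t + 1. M i j * x j) = 0"
    have "mat_comb n (map x [0..<t + 1]) (powers X t) = 0\<^sub>m n n"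
    proof (rule eq_matI)
      fix i j assume ij: "i < dim_row (0\<^sub>m n n)" "j < dim_col (0\<^sub>m n n)"
      then have "i * n + j < n * n" "(i * n + j) div n = i" "(i * n + j) mod n = j"
        using mult_le_mono1[of "Suc i" n n] by auto
      then have "tor (\<lambda>k. \<Sum>l\<le>t. x l * d k ^ l) $$ (i, j) = 0"
        using comb[of "i * n + j" x] x(2) by simp
      moreover have "(\<Sum>l\<le>t. map x [0..<t + 1] ! l * d k ^ l) = (\<Sum>l\<le>t. x l * d k ^ l)" for k
        by (intro sum.cong) (simp_all del: upt_Suc)
      ultimately show "mat_comb n (map x [0..<t + 1]) (powers X t) $$ (i, j) = 0\<^sub>m n n $$ (i, j)"
        using ij by (simp add: mat_comb_powers del: upt_Suc)
    qed (simp_all add: mat_comb_def)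
    moreover have "length (map x [0..<t + 1]) = length (powers X t)" "set (map x [0..<t + 1]) \<subseteq> F"
      using x(1) by (auto simp: powers_def simp del: upt_Suc)
    ultimately have "set (map x [0..<t + 1]) \<subseteq> {0}"
      using basis unfolding mat_basis_def by blast
    then have "x ` {0..<t + 1} \<subseteq> {0}" by (simp only: set_map set_upt)
    then show "\<forall>j<t + 1. x j = 0" by (simp only: image_subset_iff atLeastLessThan_iff) simp
  qed blast
  have "c k \<in> F" if k: "k \<le> t" for k
  proof -
    have "tor (\<lambda>k. \<zeta> (d k)) = tor (\<lambda>k. \<Sum>l\<le>t. c l * d k ^ l)"
      using \<zeta> dZ by (intro tor_cong) auto
    then have "(\<Sum>idx<n * n. L k idx * tor (\<lambda>k. \<zeta> (d k)) $$ (idx div n, idx mod n))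
        = (\<Sum>idx<n * n. \<Sum>l<t + 1. L k idx * M idx l * c l)"
      by (intro sum.cong) (simp_all add: comb[symmetric] sum_distrib_left mult.assoc distrib_left)
    also have "\<dots> = (\<Sum>l<t + 1. (\<Sum>idx<n * n. L k idx * M idx l) * c l)"
      by (subst sum.swap) (simp only: sum_distrib_right)
    also have "\<dots> = (\<Sum>l<t + 1. if l = k then c l else 0)"
      using k L(2) by (intro sum.cong) auto
    also have "\<dots> = c k" using k by simp
    finally have "c k = (\<Sum>idx<n * n. L k idx * tor (\<lambda>k. \<zeta> (d k)) $$ (idx div n, idx mod n))" by simp
    also have "\<dots> \<in> F"
      using L(1) k idx mats_entry[OF A] by (intro subfield_sum[OF F] subfield_mult[OF F]) auto
    finally show ?thesis .
  qed
  then show thesis using that[of c] \<zeta> by blast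
qed

text \<open>Taking \<zeta> as a function of the eigenvalue makes \<open>A\<close> a polynomial in
  \<open>X\<close>. Orthogonality to the relations says that \<zeta> is the restriction of a
  \<rat>-linear map on the span of \<open>Z\<close>; such matrices are known as the replicas of a
  semisimple \<open>X\<close>.\<close>

definition alg_hull :: "complex mat set" where
  "alg_hull = {A \<in> mats n F. \<exists>\<zeta>. A = tor (\<lambda>k. \<zeta> (d k)) \<and>
     (\<forall>\<epsilon>\<in>relations Z. (\<Sum>z\<in>Z. of_rat (\<epsilon> z) * \<zeta> z) = 0)}"

lemma fiber_sum: "(\<Sum>z\<in>Z. (\<Sum>k\<in>{k. k < n \<and> d k = z}. a k) * g z) = (\<Sum>k<n. a k * g (d k))"
  for a g :: "_ \<Rightarrow> complex"
proof -
  have "(\<Sum>z\<in>Z. (\<Sum>k\<in>{k. k < n \<and> d k = z}. a k) * g z) = (\<Sum>z\<in>Z. \<Sum>k\<in>{k \<in> {..<n}. d k = z}. a k * g (d k))"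
    by (intro sum.cong) (auto simp: sum_distrib_right)
  also have "\<dots> = (\<Sum>k<n. a k * g (d k))" using dZ by (intro sum.group finZ) auto
  finally show ?thesis .
qed

lemma hull_minimal:
  assumes G: "algebraic_group n F G" and X: "X \<in> Lie n F G"
  shows "alg_hull \<subseteq> Lie n F G"
proof
  fix A assume "A \<in> alg_hull"
  then obtain \<zeta> where A: "A \<in> mats n F" "A = tor (\<lambda>k. \<zeta> (d k))"
    and \<zeta>: "\<And>\<epsilon>. \<epsilon> \<in> relations Z \<Longrightarrow> (\<Sum>z\<in>Z. of_rat (\<epsilon> z) * \<zeta> z) = 0"
    by (auto simp: alg_hull_def)
  have sub: "subgroup G (GL n F)" using G by (simp add: algebraic_group_def)
  have GF: "G \<subseteq> mats n F" using subgroup.subset[OF sub] by (auto simp: GL_def)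
  have Gmult: "g * h \<in> G" if "g \<in> G" "h \<in> G" for g h
    using subgroup.m_closed[OF sub that] by (simp add: GL_def)
  have Gone: "1\<^sub>m n \<in> G" using subgroup.one_closed[OF sub] by (simp add: GL_def)
  define V where "V = {p \<in> poly_funs n F. \<forall>g\<in>G. p g = 0}"
  define der where "der p q \<longleftrightarrow> (\<forall>g\<in>carrier_mat n n.
    ((\<lambda>s. p (g * (1\<^sub>m n + s \<cdot>\<^sub>m X))) has_field_derivative q g) (at 0))" for p q
  \<comment> \<open>Translating \<open>p\<close> by an element \<open>g\<close> of the group again
    gives a function vanishing on \<open>G\<close>, whose derivative at 1 along \<open>X\<close> is
    0. That derivative is the value at \<open>g\<close> of the derived function.\<close>
  have step: "\<exists>q\<in>V. der p q" if p: "p \<in> V" for p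
  proof -
    have pF: "p \<in> poly_funs n F" using p by (simp add: V_def)
    obtain q where q: "q \<in> poly_funs n F" "der p q"
      using poly_funs_invariant_derivative[OF F pF XF] by (auto simp: der_def)
    have "q g = 0" if g: "g \<in> G" for g
    proof -
      have gF: "g \<in> mats n F" using GF g by blast
      obtain p2 where p2: "p2 \<in> poly_funs n F" "\<forall>A\<in>carrier_mat n n. p2 A = p (g * A)"
        using poly_funs_left_translate[OF F pF gF] by blast
      have "p2 h = 0" if "h \<in> G" for h
      proof -
        have "p2 h = p (g * h)" using p2(2) GF that mats_carrier by blast
        then show ?thesis using p Gmult[OF g that] by (simp add: V_def)
      qed
      then have "((\<lambda>s. p2 (1\<^sub>m n + s \<cdot>\<^sub>m X)) has_field_derivative 0) (at 0)"
        using X p2(1) by (auto simp: Lie_def)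
      then have "((\<lambda>s. p (g * (1\<^sub>m n + s \<cdot>\<^sub>m X))) has_field_derivative 0) (at 0)"
        using p2(2) X_carrier by simp
      moreover have "((\<lambda>s. p (g * (1\<^sub>m n + s \<cdot>\<^sub>m X))) has_field_derivative q g) (at 0)"
        using q(2) mats_carrier[OF gF] by (simp add: der_def)
      ultimately show "q g = 0" using DERIV_unique by blast
    qed
    then show ?thesis using q by (auto simp: V_def)
  qed
  define \<omega> where "\<omega> m = (\<Sum>k<n. of_nat (m k) * d k)" for m :: "nat \<Rightarrow> nat"
  \<comment> \<open>Along the curve \<open>f k * (1 + s * d k)\<close> each monomial is an
    eigenvector of the derivation.\<close>
  have der_monomials: "q (tor f) = monomials (map (\<lambda>(c, m). (c * \<omega> m, m)) L) f"
    if pq: "der p q" and L: "\<And>f. p (tor f) = monomials L f" for p q L f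
  proof -
    have eq: "tor f * (1\<^sub>m n + s \<cdot>\<^sub>m X) = tor (\<lambda>k. f k * (1 + s * d k))" for s
      by (simp add: X_tor tor_one[symmetric] tor_smult tor_add tor_mult)
    have "((\<lambda>s. p (tor f * (1\<^sub>m n + s \<cdot>\<^sub>m X))) has_field_derivative q (tor f)) (at 0)"
      using pq tor_carrier unfolding der_def by blast
    then have "((\<lambda>s. monomials L (\<lambda>k. f k * (1 + s * d k))) has_field_derivative q (tor f)) (at 0)"
      unfolding eq L .
    moreover have "((\<lambda>s. monomials L (\<lambda>k. f k * (1 + s * d k)))
        has_field_derivative monomials (map (\<lambda>(c, m). (c * \<omega> m, m)) L) f) (at 0)"
    proof -
      have "monomials L (\<lambda>k. f k * (1 + s * d k))
          = monomials (map (\<lambda>(c, m). (c * (\<Prod>k<n. f k ^ m k), m)) L) (\<lambda>k. 1 + s * d k)" for s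
        by (simp add: monomials_def o_def case_prod_unfold power_mult_distrib prod.distrib mult_ac)
      moreover have "((\<lambda>s. monomials (map (\<lambda>(c, m). (c * (\<Prod>k<n. f k ^ m k), m)) L) (\<lambda>k. 1 + s * d k))
          has_field_derivative
            (\<Sum>(c, m)\<leftarrow>map (\<lambda>(c, m). (c * (\<Prod>k<n. f k ^ m k), m)) L. c * (\<Sum>k<n. of_nat (m k) * d k))) (at 0)"
        by (rule monomials_derivative) (auto intro!: derivative_eq_intros)
      ultimately show ?thesis
        by (simp add: monomials_def o_def case_prod_unfold \<omega>_def mult_ac)
    qed
    ultimately show ?thesis using DERIV_unique by blast
  qed
  have "((\<lambda>s. p (1\<^sub>m n + s \<cdot>\<^sub>m A)) has_field_derivative 0) (at 0)"
    if p: "p \<in> poly_funs n F" "\<forall>g\<in>G. p g = 0" for p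
  proof -
    have "p \<in> poly_funs n UNIV" using p poly_funs_mono by blast
    then obtain L where L: "\<And>f. p (tor f) = monomials L f" using poly_funs_tor by blast
    have iter: "\<exists>q\<in>V. \<forall>f. q (tor f) = monomials (map (\<lambda>(c, m). (c * \<omega> m ^ j, m)) L) f" for j
    proof (induction j)
      case 0
      show ?case using p L by (intro bexI[of _ p]) (simp_all add: V_def)
    next
      case (Suc j)
      then obtain q where q: "q \<in> V" "\<And>f. q (tor f) = monomials (map (\<lambda>(c, m). (c * \<omega> m ^ j, m)) L) f" by blast
      obtain q' where q': "q' \<in> V" "der q q'" using step[OF q(1)] by blast
      show ?case
        using der_monomials[OF q'(2) q(2)] q'(1)
        by (intro bexI[of _ q']) (simp_all add: o_def case_prod_unfold mult_ac)
    qed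
    \<comment> \<open>All iterated derivatives remain in the ideal and vanish at the identity, where
      every monomial takes the value 1: these are the moments.\<close>
    have "monomials (map (\<lambda>(c, m). (c * \<omega> m ^ j, m)) L) (\<lambda>_. 1) = 0" for j
    proof -
      obtain q where q: "q \<in> V" "\<And>f. q (tor f) = monomials (map (\<lambda>(c, m). (c * \<omega> m ^ j, m)) L) f"
        using iter[of j] by blast
      have "q (tor (\<lambda>_. 1)) = 0" using q(1) Gone by (simp add: V_def tor_one)
      then show ?thesis by (simp only: q(2))
    qed
    then have mom: "(\<Sum>(c, m)\<leftarrow>L. c * \<omega> m ^ j) = 0" for j
      by (simp add: monomials_def o_def case_prod_unfold)
    define \<beta> where "\<beta> m = (\<Sum>k<n. of_nat (m k) * \<zeta> (d k))" for m :: "nat \<Rightarrow> nat"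
    have \<beta>\<omega>: "\<beta> m = \<beta> m'" if eq: "\<omega> m = \<omega> m'" for m m'
    proof -
      \<comment> \<open>If two monomials have the same scalar \<omega>, the difference of their
        exponents, summed over equal eigenvalues, is a relation. Orthogonality of \<zeta> to it
        gives the same \<beta>.\<close>
      define \<epsilon> where "\<epsilon> z = (\<Sum>k\<in>{k. k < n \<and> d k = z}. of_nat (m k) - of_nat (m' k) :: rat)" for z
      have \<epsilon>: "of_rat (\<epsilon> z) = (\<Sum>k\<in>{k. k < n \<and> d k = z}. of_nat (m k) - of_nat (m' k) :: complex)" for z
        by (simp add: \<epsilon>_def of_rat_sum of_rat_diff)
      have "(\<Sum>z\<in>Z. of_rat (\<epsilon> z) * z) = \<omega> m - \<omega> m'"
        unfolding \<epsilon> fiber_sum by (simp add: \<omega>_def left_diff_distrib sum_subtractf)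
      then have "(\<Sum>z\<in>Z. of_rat (\<epsilon> z) * \<zeta> z) = 0" using eq by (intro \<zeta>) (simp add: relations_def)
      moreover have "(\<Sum>z\<in>Z. of_rat (\<epsilon> z) * \<zeta> z) = \<beta> m - \<beta> m'"
        unfolding \<epsilon> fiber_sum by (simp add: \<beta>_def left_diff_distrib sum_subtractf)
      ultimately show ?thesis by simp
    qed
    \<comment> \<open>A representative exponent presents \<beta> as a function of \<omega>, the form
      to which the moment argument applies.\<close>
    have "(\<Sum>(c, m)\<leftarrow>L. c * \<beta> (SOME m'. \<omega> m' = \<omega> m)) = 0"
      using moments_zero[of "\<lambda>c. c" \<omega> L "\<lambda>w. \<beta> (SOME m'. \<omega> m' = w)"] mom by simp
    moreover have "\<beta> (SOME m'. \<omega> m' = \<omega> m) = \<beta> m" for m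
      by (rule \<beta>\<omega>, rule someI[of "\<lambda>m'. \<omega> m' = \<omega> m" m]) simp
    ultimately have sum0: "(\<Sum>(c, m)\<leftarrow>L. c * \<beta> m) = 0" by simp
    have "1\<^sub>m n + s \<cdot>\<^sub>m A = tor (\<lambda>k. 1 + s * \<zeta> (d k))" for s
      by (simp add: A(2) tor_one[symmetric] tor_smult tor_add)
    then have "p (1\<^sub>m n + s \<cdot>\<^sub>m A) = monomials L (\<lambda>k. 1 + s * \<zeta> (d k))" for s by (simp add: L)
    moreover have "((\<lambda>s. monomials L (\<lambda>k. 1 + s * \<zeta> (d k))) has_field_derivative
        (\<Sum>(c, m)\<leftarrow>L. c * (\<Sum>k<n. of_nat (m k) * \<zeta> (d k)))) (at 0)"
      by (rule monomials_derivative) (auto intro!: derivative_eq_intros)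
    ultimately show ?thesis using sum0 by (simp add: \<beta>_def)
  qed
  then show "A \<in> Lie n F G" using A(1) by (simp add: Lie_def)
qed

end

section \<open>The torus of the relations and its Lie algebra\<close>

lemma GL_simps [simp]:
  "carrier (GL n F) = {g \<in> mats n F. det g \<noteq> 0}"
  "x \<otimes>\<^bsub>GL n F\<^esub> y = x * y" "\<one>\<^bsub>GL n F\<^esub> = 1\<^sub>m n"
  by (simp_all add: GL_def)

lemma prod_power_int: "(\<Prod>z\<in>A. f z) powi e = (\<Prod>z\<in>A. f z powi e)" for f :: "'a \<Rightarrow> complex"
  by (induction A rule: infinite_finite_induct) (simp_all add: power_int_mult_distrib)

lemma one_mats: "is_subfield F \<Longrightarrow> 1\<^sub>m n \<in> mats n F"
  by (rule matsI) (auto simp: subfield_0 subfield_1)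

lemma mult_mats:
  assumes F: "is_subfield F" and A: "A \<in> mats n F" and B: "B \<in> mats n F" shows "A * B \<in> mats n F"
proof (rule matsI)
  show "A * B \<in> carrier_mat n n" using mats_carrier[OF A] mats_carrier[OF B] by simp
  fix i j assume ij: "i < n" "j < n"
  show "(A * B) $$ (i, j) \<in> F"
    unfolding mult_entry[OF mats_carrier[OF A] mats_carrier[OF B] ij]
    using mats_entry[OF A] mats_entry[OF B] ij by (intro subfield_sum[OF F] subfield_mult[OF F]) auto
qed

text \<open>An inverse over the complex numbers makes \<open>g\<close> injective, so
  \<open>g\<close> has a left inverse over \<open>F\<close>, and this coincides with
  \<open>h\<close>.\<close>

lemma inverse_mats:
  assumes F: "is_subfield F" and g: "g \<in> mats n F" and h: "h \<in> carrier_mat n n"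
    and gh: "g * h = 1\<^sub>m n" and hg: "h * g = 1\<^sub>m n"
  shows "h \<in> mats n F"
proof -
  have gF: "\<forall>i<n. \<forall>j<n. g $$ (i, j) \<in> F" using mats_entry[OF g] by blast
  obtain L where L: "\<forall>k<n. \<forall>i<n. L k i \<in> F"
    "\<And>k l. k < n \<Longrightarrow> l < n \<Longrightarrow> (\<Sum>i<n. L k i * g $$ (i, l)) = (if k = l then 1 else 0)"
  proof (rule left_inverse_exists[OF F gF])
    fix x :: "nat \<Rightarrow> complex" assume x: "\<forall>i<n. (\<Sum>j<n. g $$ (i, j) * x j) = 0"
    show "\<forall>j<n. x j = 0"
    proof (intro allI impI)
      fix k assume k: "k < n"
      have "x k = (\<Sum>j<n. (if k = j then 1 else 0) * x j)"
        using k by (simp add: if_distrib[of "\<lambda>y. y * _"] cong: if_cong)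
      also have "\<dots> = (\<Sum>j<n. (h * g) $$ (k, j) * x j)" using k by (simp add: hg)
      also have "\<dots> = (\<Sum>j<n. \<Sum>i<n. h $$ (k, i) * (g $$ (i, j) * x j))"
        using k by (simp add: mult_entry[OF h mats_carrier[OF g]] sum_distrib_right mult.assoc)
      also have "\<dots> = (\<Sum>i<n. h $$ (k, i) * (\<Sum>j<n. g $$ (i, j) * x j))"
        by (subst sum.swap) (simp add: sum_distrib_left)
      finally show "x k = 0" using x by simp
    qed
  qed blast
  define M where "M = mat n n (\<lambda>(k, i). L k i)"
  have M: "M \<in> carrier_mat n n" by (simp add: M_def)
  have "(M * g) $$ (k, l) = (if k = l then 1 else 0)" if "k < n" "l < n" for k l
    unfolding mult_entry[OF M mats_carrier[OF g] that] using that L(2) by (simp add: M_def)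
  then have "M * g = 1\<^sub>m n"
    using M mats_carrier[OF g] by (intro eq_matI) (simp_all del: index_mult_mat(1))
  then have "h = M * g * h" using h by simp
  also have "\<dots> = M" using mult_assoc_square[OF M mats_carrier[OF g] h] M by (simp add: gh)
  finally show ?thesis using L(1) by (auto simp: M_def intro!: matsI)
qed

context hull_setup
begin

definition int_relations :: "(complex \<Rightarrow> int) set" where
  "int_relations = {\<epsilon>. (\<Sum>z\<in>Z. of_int (\<epsilon> z) * z) = 0}"

definition torus :: "complex mat set" where
  "torus = {g \<in> mats n F. \<exists>\<zeta>. (\<forall>z\<in>Z. \<zeta> z \<noteq> 0) \<and> g = tor (\<lambda>k. \<zeta> (d k)) \<and>
     (\<forall>\<epsilon>\<in>int_relations. (\<Prod>z\<in>Z. \<zeta> z powi \<epsilon> z) = 1)}"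

lemma torusI:
  "tor (\<lambda>k. \<zeta> (d k)) \<in> mats n F \<Longrightarrow> (\<And>z. z \<in> Z \<Longrightarrow> \<zeta> z \<noteq> 0) \<Longrightarrow>
    (\<And>\<epsilon>. \<epsilon> \<in> int_relations \<Longrightarrow> (\<Prod>z\<in>Z. \<zeta> z powi \<epsilon> z) = 1) \<Longrightarrow> tor (\<lambda>k. \<zeta> (d k)) \<in> torus"
  unfolding torus_def by blast

lemma torusE:
  assumes "g \<in> torus"
  obtains \<zeta> where "g \<in> mats n F" "\<forall>z\<in>Z. \<zeta> z \<noteq> 0" "g = tor (\<lambda>k. \<zeta> (d k))"
    "\<forall>\<epsilon>\<in>int_relations. (\<Prod>z\<in>Z. \<zeta> z powi \<epsilon> z) = 1"
  using assms unfolding torus_def by blast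

lemma torus_subgroup: "subgroup torus (GL n F)"
proof
  show "torus \<subseteq> carrier (GL n F)"
  proof
    fix g assume "g \<in> torus"
    then obtain \<zeta> where "g \<in> mats n F" "\<forall>z\<in>Z. \<zeta> z \<noteq> 0" "g = tor (\<lambda>k. \<zeta> (d k))"
      by (rule torusE) blast
    then show "g \<in> carrier (GL n F)" using det_tor[of "\<lambda>k. \<zeta> (d k)"] dZ by auto
  qed
  show "\<one>\<^bsub>GL n F\<^esub> \<in> torus"
    using torusI[of "\<lambda>_. 1"] one_mats[OF F] by (simp add: tor_one)
  fix g assume g: "g \<in> torus"
  obtain \<zeta> where gF: "g \<in> mats n F" and \<zeta>: "\<forall>z\<in>Z. \<zeta> z \<noteq> 0" "g = tor (\<lambda>k. \<zeta> (d k))"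
    "\<forall>\<epsilon>\<in>int_relations. (\<Prod>z\<in>Z. \<zeta> z powi \<epsilon> z) = 1"
    using g by (rule torusE) blast
  define h where "h = tor (\<lambda>k. inverse (\<zeta> (d k)))"
  have "tor (\<lambda>k. \<zeta> (d k) * inverse (\<zeta> (d k))) = tor (\<lambda>_. 1)"
    using \<zeta>(1) dZ by (intro tor_cong) simp
  then have gh: "g * h = 1\<^sub>m n" by (simp add: h_def \<zeta>(2) tor_mult tor_one)
  have "tor (\<lambda>k. inverse (\<zeta> (d k)) * \<zeta> (d k)) = tor (\<lambda>_. 1)"
    using \<zeta>(1) dZ by (intro tor_cong) simp
  then have hg: "h * g = 1\<^sub>m n" by (simp add: h_def \<zeta>(2) tor_mult tor_one)
  have hc: "h \<in> carrier_mat n n" by (simp add: h_def)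
  have hF: "h \<in> mats n F" by (rule inverse_mats[OF F gF hc gh hg])
  have "(\<Prod>z\<in>Z. inverse (\<zeta> z powi \<epsilon> z)) = inverse (\<Prod>z\<in>Z. \<zeta> z powi \<epsilon> z)" for \<epsilon>
    using prod_inversef[of "\<lambda>z. \<zeta> z powi \<epsilon> z" Z] by (simp add: o_def)
  then have ht: "h \<in> torus"
    using torusI[of "\<lambda>z. inverse (\<zeta> z)"] hF \<zeta> by (simp add: h_def power_int_inverse)
  have "det h \<noteq> 0" using \<zeta>(1) dZ by (simp add: h_def det_tor)
  \<comment> \<open>The inverse in \<open>GL n F\<close> is a definite description, hence uniqueness
    has to be shown along with existence.\<close>
  then have "inv\<^bsub>GL n F\<^esub> g = h"
    unfolding m_inv_def
  proof (intro the_equality)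
    fix y assume y: "y \<in> carrier (GL n F) \<and> g \<otimes>\<^bsub>GL n F\<^esub> y = \<one>\<^bsub>GL n F\<^esub> \<and> y \<otimes>\<^bsub>GL n F\<^esub> g = \<one>\<^bsub>GL n F\<^esub>"
    then have yc: "y \<in> carrier_mat n n" by (auto dest: mats_carrier)
    have "y = y * (g * h)" using yc by (simp add: gh)
    also have "\<dots> = (y * g) * h" by (rule mult_assoc_square[OF yc mats_carrier[OF gF] hc, symmetric])
    also have "\<dots> = h" using y hc by simp
    finally show "y = h" .
  qed (use hF gh hg in simp)
  then show "inv\<^bsub>GL n F\<^esub> g \<in> torus" using ht by simp
  fix g' assume "g' \<in> torus"
  then obtain \<xi> where g'F: "g' \<in> mats n F" and \<xi>: "\<forall>z\<in>Z. \<xi> z \<noteq> 0" "g' = tor (\<lambda>k. \<xi> (d k))"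
    "\<forall>\<epsilon>\<in>int_relations. (\<Prod>z\<in>Z. \<xi> z powi \<epsilon> z) = 1"
    by (rule torusE) blast
  show "g \<otimes>\<^bsub>GL n F\<^esub> g' \<in> torus"
    using torusI[of "\<lambda>z. \<zeta> z * \<xi> z"] mult_mats[OF F gF g'F] \<zeta> \<xi>
    by (simp add: tor_mult power_int_mult_distrib prod.distrib)
qed

definition index :: "complex \<Rightarrow> nat" where
  "index z = (SOME k. k < n \<and> d k = z)"

lemma index: "z \<in> Z \<Longrightarrow> index z < n \<and> d (index z) = z"
  unfolding index_def by (rule someI_ex) (auto simp: Z)

text \<open>The multiplicative relation with its negative exponents moved to the other side, which
  makes it a polynomial equation. Each eigenvalue of the matrix is read at one chosen position of
  that eigenvalue of \<open>X\<close>.\<close>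

definition relation_poly :: "(complex \<Rightarrow> int) \<Rightarrow> complex mat \<Rightarrow> complex" where
  "relation_poly \<epsilon> A = (\<Prod>z\<in>Z. conj_entry (index z) (index z) A ^ nat (\<epsilon> z))
     - (\<Prod>z\<in>Z. conj_entry (index z) (index z) A ^ nat (- \<epsilon> z))"

lemma relation_poly_fun: "relation_poly \<epsilon> \<in> poly_funs n UNIV"
  unfolding relation_poly_def[abs_def]
  using index by (intro poly_funs_diff poly_funs_prod poly_funs_power conj_entry_poly_fun finZ) auto

lemma conj_diff_poly_fun:
  "k < n \<Longrightarrow> l < n \<Longrightarrow> (\<lambda>A. conj_entry k k A - conj_entry l l A) \<in> poly_funs n UNIV"
  by (intro poly_funs_diff conj_entry_poly_fun) auto

lemma relation_poly_iff:
  assumes "\<And>z. z \<in> Z \<Longrightarrow> \<zeta> z \<noteq> 0"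
  shows "(\<Prod>z\<in>Z. \<zeta> z ^ nat (\<epsilon> z)) - (\<Prod>z\<in>Z. \<zeta> z ^ nat (- \<epsilon> z)) = 0 \<longleftrightarrow> (\<Prod>z\<in>Z. \<zeta> z powi \<epsilon> z) = (1 :: complex)"
proof -
  have "(\<Prod>z\<in>Z. \<zeta> z powi \<epsilon> z) = (\<Prod>z\<in>Z. \<zeta> z ^ nat (\<epsilon> z)) / (\<Prod>z\<in>Z. \<zeta> z ^ nat (- \<epsilon> z))"
    using assms by (simp add: power_int_nat_split prod_dividef)
  moreover have "(\<Prod>z\<in>Z. \<zeta> z ^ nat (- \<epsilon> z)) \<noteq> 0" using assms finZ by simp
  ultimately show ?thesis by (simp add: divide_eq_1_iff) 
qed

text \<open>These three families cut out the torus among invertible matrices over \<open>F\<close>: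
  diagonality after conjugation, dependence on the eigenvalue of \<open>X\<close> alone, and the
  integral relations. Their coefficients are complex, since \<open>P\<close> and \<open>Q\<close>
  are.\<close>

lemma torus_vanishing:
  assumes "g \<in> torus"
  shows "k < n \<Longrightarrow> l < n \<Longrightarrow> k \<noteq> l \<Longrightarrow> conj_entry k l g = 0"
    and "k < n \<Longrightarrow> l < n \<Longrightarrow> d k = d l \<Longrightarrow> conj_entry k k g - conj_entry l l g = 0"
    and "\<epsilon> \<in> int_relations \<Longrightarrow> relation_poly \<epsilon> g = 0"
proof -
  obtain \<zeta> where \<zeta>: "\<forall>z\<in>Z. \<zeta> z \<noteq> 0" "g = tor (\<lambda>k. \<zeta> (d k))"
    "\<forall>\<epsilon>\<in>int_relations. (\<Prod>z\<in>Z. \<zeta> z powi \<epsilon> z) = 1"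
    using assms by (rule torusE) blast
  show "k < n \<Longrightarrow> l < n \<Longrightarrow> k \<noteq> l \<Longrightarrow> conj_entry k l g = 0"
    "k < n \<Longrightarrow> l < n \<Longrightarrow> d k = d l \<Longrightarrow> conj_entry k k g - conj_entry l l g = 0"
    by (simp_all add: \<zeta>(2) conj_entry_tor)
  assume "\<epsilon> \<in> int_relations"
  then have "(\<Prod>z\<in>Z. \<zeta> z ^ nat (\<epsilon> z)) - (\<Prod>z\<in>Z. \<zeta> z ^ nat (- \<epsilon> z)) = 0"
    using \<zeta> by (subst relation_poly_iff) auto
  then show "relation_poly \<epsilon> g = 0"
    using index by (simp add: relation_poly_def \<zeta>(2) conj_entry_tor)
qed

lemma torus_mats: "torus \<subseteq> mats n F"
  by (auto simp: torus_def)

text \<open>The natural equations are not over \<open>F\<close>. Therefore the whole ideal over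
  \<open>F\<close> is taken as the defining set; a point annihilated by it satisfies the complex
  equations as well, by \<open>vanishing_over_subfield\<close>.\<close>

lemma torus_algebraic: "algebraic_group n F torus"
  unfolding algebraic_group_def
proof (intro conjI exI)
  show "subgroup torus (GL n F)" by (rule torus_subgroup)
  let ?P = "{p \<in> poly_funs n F. \<forall>g\<in>torus. p g = 0}"
  show "?P \<subseteq> poly_funs n F" by blast
  show "torus = {g \<in> carrier (GL n F). \<forall>p\<in>?P. p g = 0}"
  proof (intro equalityI subsetI)
    fix g assume "g \<in> torus"
    then show "g \<in> {g \<in> carrier (GL n F). \<forall>p\<in>?P. p g = 0}"
      using subgroup.subset[OF torus_subgroup] by auto
  next
    fix g assume g: "g \<in> {g \<in> carrier (GL n F). \<forall>p\<in>?P. p g = 0}"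
    then have gF: "g \<in> mats n F" and det: "det g \<noteq> 0" by auto
    have van: "q g = 0" if "q \<in> poly_funs n UNIV" "\<And>g. g \<in> torus \<Longrightarrow> q g = 0" for q
      using vanishing_over_subfield(1)[OF F torus_mats that] g by blast
    define \<zeta> where "\<zeta> z = conj_entry (index z) (index z) g" for z
    have "g = tor (\<lambda>k. conj_entry k k g)"
      using van[OF conj_entry_poly_fun] torus_vanishing(1)
      by (intro tor_of_conj_entry mats_carrier[OF gF]) blast
    also have "\<dots> = tor (\<lambda>k. \<zeta> (d k))"
    proof (rule tor_cong)
      fix k assume k: "k < n"
      then show "conj_entry k k g = \<zeta> (d k)"
        using van[OF conj_diff_poly_fun[of k "index (d k)"]] torus_vanishing(2) index[OF dZ[OF k]]
        by (simp add: \<zeta>_def)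
    qed
    finally have g\<zeta>: "g = tor (\<lambda>k. \<zeta> (d k))" .
    have nz: "\<zeta> z \<noteq> 0" if "z \<in> Z" for z
      using det det_tor[of "\<lambda>k. \<zeta> (d k)"] g\<zeta> index[OF that] by metis
    have "(\<Prod>z\<in>Z. \<zeta> z powi \<epsilon> z) = 1" if \<epsilon>: "\<epsilon> \<in> int_relations" for \<epsilon>
    proof -
      have "relation_poly \<epsilon> g = 0" using van[OF relation_poly_fun] torus_vanishing(3)[OF _ \<epsilon>] by blast
      then show ?thesis using relation_poly_iff[OF nz] by (simp add: relation_poly_def \<zeta>_def)
    qed
    then show "g \<in> torus" using gF nz g\<zeta> torusI[of \<zeta>] by simp
  qed
qed

lemma int_relation_scale:
  assumes "\<epsilon> \<in> relations Z"
  obtains N :: int and e where "N > 0" "e \<in> int_relations" "\<And>z. z \<in> Z \<Longrightarrow> of_int N * \<epsilon> z = of_int (e z)"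
proof -
  obtain N :: int where N: "N > 0" "\<forall>q\<in>\<epsilon> ` Z. \<exists>i::int. of_int N * q = (of_int i :: rat)"
    using common_denominator[of "\<epsilon> ` Z"] finZ by blast
  have "\<forall>z. \<exists>i::int. z \<in> Z \<longrightarrow> of_int N * \<epsilon> z = (of_int i :: rat)" using N(2) by blast
  then obtain e :: "complex \<Rightarrow> int" where e: "\<And>z. z \<in> Z \<Longrightarrow> of_int N * \<epsilon> z = of_int (e z)"
    by metis
  have "of_int (e z) = of_int N * (of_rat (\<epsilon> z) :: complex)" if "z \<in> Z" for z
    using arg_cong[OF e[OF that], of "of_rat :: rat \<Rightarrow> complex"] by (simp add: of_rat_mult)
  then have "(\<Sum>z\<in>Z. of_int (e z) * z) = of_int N * (\<Sum>z\<in>Z. of_rat (\<epsilon> z) * z)"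
    by (simp add: sum_distrib_left mult.assoc)
  then have "e \<in> int_relations" using assms by (simp add: int_relations_def relations_def)
  then show thesis using that N e by blast
qed

text \<open>The complex equations of the torus may be differentiated too. The linear ones put
  \<open>A\<close> into the form \<open>tor\<close>, and the derivative of a multiplicative relation
  at 1 is the additive relation with the same exponents.\<close>

lemma Lie_torus_subset: "Lie n F torus \<subseteq> alg_hull"
proof
  fix A assume A: "A \<in> Lie n F torus"
  then have AF: "A \<in> mats n F" by (simp add: Lie_def)
  note Ac = mats_carrier[OF AF]
  have lin: "conj_entry k l (1\<^sub>m n + s \<cdot>\<^sub>m A) = (if k = l then 1 else 0) + s * conj_entry k l A"
    if "k < n" "l < n" for k l s
    using conj_entry_add_smult[of "1\<^sub>m n" A k l s] Ac conj_entry_tor[OF that, of "\<lambda>_. 1"]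
    by (simp add: tor_one)
  have der: "D = 0" if "q \<in> poly_funs n UNIV" "\<And>g. g \<in> torus \<Longrightarrow> q g = 0"
    "((\<lambda>s. q (1\<^sub>m n + s \<cdot>\<^sub>m A)) has_field_derivative D) (at 0)" for q D
    using vanishing_over_subfield(2)[OF F torus_mats that(1,2) A] that(3) DERIV_unique by blast
  have off: "conj_entry k l A = 0" if kl: "k < n" "l < n" "k \<noteq> l" for k l
  proof (rule der[OF conj_entry_poly_fun[OF kl(1,2)] torus_vanishing(1)[OF _ kl]])
    show "((\<lambda>s. conj_entry k l (1\<^sub>m n + s \<cdot>\<^sub>m A)) has_field_derivative conj_entry k l A) (at 0)"
      unfolding lin[OF kl(1,2)] using kl(3) by (auto intro!: derivative_eq_intros)
  qed
  have diag: "conj_entry k k A = conj_entry l l A" if kl: "k < n" "l < n" "d k = d l" for k l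
  proof -
    have "conj_entry k k A - conj_entry l l A = 0"
    proof (rule der[OF conj_diff_poly_fun[OF kl(1,2)] torus_vanishing(2)[OF _ kl]])
      show "((\<lambda>s. conj_entry k k (1\<^sub>m n + s \<cdot>\<^sub>m A) - conj_entry l l (1\<^sub>m n + s \<cdot>\<^sub>m A))
          has_field_derivative conj_entry k k A - conj_entry l l A) (at 0)"
        unfolding lin[OF kl(1,1)] lin[OF kl(2,2)] by (auto intro!: derivative_eq_intros)
    qed
    then show ?thesis by simp
  qed
  define \<zeta> where "\<zeta> z = conj_entry (index z) (index z) A" for z
  have "A = tor (\<lambda>k. conj_entry k k A)" by (rule tor_of_conj_entry[OF Ac off])
  also have "\<dots> = tor (\<lambda>k. \<zeta> (d k))"
  proof (rule tor_cong)
    fix k assume k: "k < n"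
    have "index (d k) < n" "d k = d (index (d k))" using index[OF dZ[OF k]] by simp_all
    then show "conj_entry k k A = \<zeta> (d k)" unfolding \<zeta>_def by (rule diag[OF k])
  qed
  finally have A\<zeta>: "A = tor (\<lambda>k. \<zeta> (d k))" .
  have pow: "((\<lambda>s. \<Prod>z\<in>Z. (1 + s * \<zeta> z) ^ m z) has_field_derivative (\<Sum>z\<in>Z. of_nat (m z) * \<zeta> z)) (at 0)"
    for m :: "complex \<Rightarrow> nat"
    by (rule derivative_prod_at_one[OF finZ]) (auto intro!: derivative_eq_intros)
  have int: "(\<Sum>z\<in>Z. of_int (e z) * \<zeta> z) = 0" if e: "e \<in> int_relations" for e
  proof -
    have "relation_poly e (1\<^sub>m n + s \<cdot>\<^sub>m A)
        = (\<Prod>z\<in>Z. (1 + s * \<zeta> z) ^ nat (e z)) - (\<Prod>z\<in>Z. (1 + s * \<zeta> z) ^ nat (- e z))" for s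
      using index lin by (simp add: relation_poly_def \<zeta>_def)
    then have "((\<lambda>s. relation_poly e (1\<^sub>m n + s \<cdot>\<^sub>m A)) has_field_derivative
        (\<Sum>z\<in>Z. of_nat (nat (e z)) * \<zeta> z) - (\<Sum>z\<in>Z. of_nat (nat (- e z)) * \<zeta> z)) (at 0)"
      using DERIV_diff[OF pow pow] by simp
    then have "(\<Sum>z\<in>Z. of_nat (nat (e z)) * \<zeta> z) - (\<Sum>z\<in>Z. of_nat (nat (- e z)) * \<zeta> z) = 0"
      by (intro der[OF relation_poly_fun torus_vanishing(3)[OF _ e]])
    moreover have "(of_int i :: complex) = of_nat (nat i) - of_nat (nat (- i))" for i
      by (cases "i \<ge> 0") simp_all
    ultimately show ?thesis by (simp add: left_diff_distrib sum_subtractf)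
  qed
  have "(\<Sum>z\<in>Z. of_rat (\<epsilon> z) * \<zeta> z) = 0" if \<epsilon>: "\<epsilon> \<in> relations Z" for \<epsilon>
  proof -
    obtain N :: int and e where N: "N > 0" and e: "e \<in> int_relations"
      and Ne: "\<And>z. z \<in> Z \<Longrightarrow> of_int N * \<epsilon> z = of_int (e z)"
      using int_relation_scale[OF \<epsilon>] by blast
    have "of_int (e z) = of_int N * (of_rat (\<epsilon> z) :: complex)" if "z \<in> Z" for z
      using arg_cong[OF Ne[OF that], of "of_rat :: rat \<Rightarrow> complex"] by (simp add: of_rat_mult)
    then have "of_int N * (\<Sum>z\<in>Z. of_rat (\<epsilon> z) * \<zeta> z) = (\<Sum>z\<in>Z. of_int (e z) * \<zeta> z)"
      by (simp add: sum_distrib_left mult.assoc)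
    then show ?thesis using int[OF e] N by simp
  qed
  then show "A \<in> alg_hull" using AF A\<zeta> by (auto simp: alg_hull_def)
qed

text \<open>Rational points near the identity: the exponents are a multiple of the orthogonal projection
  onto the complement of the relations, so the relations hold, and the Galois equivariance of the
  projection makes the matrix rational over \<open>F\<close>.\<close>

lemma torus_curve:
  assumes p: "relation_projection Z p"
    and \<pi>: "\<And>z w. z \<in> Z \<Longrightarrow> w \<in> Z \<Longrightarrow> of_int N * p z w = of_int (\<pi> z w)" and N: "N > 0"
    and u: "u \<in> polys_over F" "\<And>z. z \<in> Z \<Longrightarrow> poly u z \<noteq> 0"
  shows "tor (\<lambda>k. \<Prod>w\<in>Z. poly u w powi \<pi> (d k) w) \<in> torus"
proof (rule torusI)
  define \<zeta> where "\<zeta> z = (\<Prod>w\<in>Z. poly u w powi \<pi> z w)" for z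
  have uK: "u \<in> polys_over K" using u(1) FK by (auto simp: polys_over_def)
  have uwK: "poly u w \<in> K" if "w \<in> Z" for w using poly_in_subfield[OF subK uK] that ZK by blast
  have powK: "x powi e \<in> K" if "x \<in> K" for x e
    using that by (simp add: power_int_def subfield_intros[OF subK])
  have roots: "Z = {z. poly (char_poly X) z = 0}" by (simp add: char_poly_roots Z)
  have "char_poly X \<noteq> 0" using degree_monic_char_poly[OF X_carrier] by auto
  obtain r where r: "r \<in> polys_over F" "\<And>z. z \<in> Z \<Longrightarrow> poly r z = \<zeta> z"
  proof (rule equivariant_interpolation[OF F K FK char_poly_polys_over[OF F XF] \<open>char_poly X \<noteq> 0\<close> roots ZK])
    show "\<zeta> z \<in> K" if "z \<in> Z" for z
      unfolding \<zeta>_def by (intro subfield_prod[OF subK] powK uwK)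
    fix \<sigma> z
    assume \<sigma>: "field_embedding F K \<sigma>" and surj: "\<sigma> ` Z = Z" and inj: "inj_on \<sigma> Z" and z: "z \<in> Z"
    note emb = F subK FK \<sigma>
    have img: "\<sigma> w \<in> Z" if "w \<in> Z" for w using surj that by blast
    have "\<pi> (\<sigma> z) (\<sigma> w) = \<pi> z w" if w: "w \<in> Z" for w
    proof -
      have "(of_int (\<pi> (\<sigma> z) (\<sigma> w)) :: rat) = of_int (\<pi> z w)"
        using \<pi>[OF img[OF z] img[OF w]] \<pi>[OF z w]
          projection_equivariant[OF finZ p emb ZK surj z w] by simp
      then show ?thesis by (simp only: of_int_eq_iff)
    qed
    then have "\<sigma> (\<zeta> z) = (\<Prod>w\<in>Z. poly u (\<sigma> w) powi \<pi> (\<sigma> z) (\<sigma> w))"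
      unfolding \<zeta>_def using ZK uwK powK
      by (subst embedding_prod[OF emb])
         (auto simp: embedding_power_int[OF emb] embedding_poly_fixed[OF emb u(1)] intro!: prod.cong)
    also have "\<dots> = \<zeta> (\<sigma> z)"
      using prod.reindex[OF inj, of "\<lambda>w. poly u w powi \<pi> (\<sigma> z) w"] by (simp add: surj \<zeta>_def o_def)
    finally show "\<sigma> (\<zeta> z) = \<zeta> (\<sigma> z)" .
  qed blast
  have "tor (\<lambda>k. poly r (d k)) = tor (\<lambda>k. \<zeta> (d k))" using r(2) dZ by (intro tor_cong) simp
  then show "tor (\<lambda>k. \<Prod>w\<in>Z. poly u w powi \<pi> (d k) w) \<in> mats n F"
    using tor_poly_mats[OF F XF r(1)] by (simp add: \<zeta>_def)
  show "(\<Prod>w\<in>Z. poly u w powi \<pi> z w) \<noteq> 0" if "z \<in> Z" for z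
    using finZ u(2) by simp
  fix \<epsilon> assume \<epsilon>: "\<epsilon> \<in> int_relations"
  \<comment> \<open>The exponent of a fixed factor runs through a column of the projection. Symmetry
    turns it into a row, which is orthogonal to the relation.\<close>
  have "(\<Sum>z\<in>Z. \<epsilon> z * \<pi> z w) = 0" if w: "w \<in> Z" for w
  proof -
    have "(\<lambda>z. of_int (\<epsilon> z)) \<in> relations Z" using \<epsilon> by (simp add: int_relations_def relations_def)
    then have "(\<Sum>z\<in>Z. p w z * of_int (\<epsilon> z)) = 0" by (rule projection_orth[OF finZ p w])
    then have "(\<Sum>z\<in>Z. of_int N * p z w * of_int (\<epsilon> z)) = (0 :: rat)"
      using projection_sym[OF finZ p _ w] by (simp add: mult.assoc sum_distrib_left[symmetric])
    then have "of_int (\<Sum>z\<in>Z. \<epsilon> z * \<pi> z w) = (0 :: rat)"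
      using \<pi>[OF _ w] by (simp add: mult.commute cong: sum.cong)
    then show ?thesis by (simp only: of_int_eq_0_iff)
  qed
  moreover have "(\<Prod>z\<in>Z. (poly u w powi \<pi> z w) powi \<epsilon> z) = poly u w powi (\<Sum>z\<in>Z. \<epsilon> z * \<pi> z w)"
    if "w \<in> Z" for w
  proof -
    have pm: "(poly u w powi a) powi b = poly u w powi (b * a)" for a b
      by (simp add: power_int_mult[symmetric] mult.commute)
    show ?thesis using finZ u(2)[OF that]
      by (induction Z rule: finite_induct) (simp_all add: power_int_add pm)
  qed
  ultimately have "(\<Prod>w\<in>Z. \<Prod>z\<in>Z. (poly u w powi \<pi> z w) powi \<epsilon> z) = 1" by simp
  then show "(\<Prod>z\<in>Z. (\<Prod>w\<in>Z. poly u w powi \<pi> z w) powi \<epsilon> z) = 1"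
    by (subst (asm) prod.swap) (simp add: prod_power_int)
qed

lemma hull_subset_Lie_torus:
  assumes p: "relation_projection Z p"
  shows "alg_hull \<subseteq> Lie n F torus"
proof
  fix A assume "A \<in> alg_hull"
  then obtain \<zeta> where A: "A \<in> mats n F" "A = tor (\<lambda>k. \<zeta> (d k))"
    and \<zeta>: "\<And>\<epsilon>. \<epsilon> \<in> relations Z \<Longrightarrow> (\<Sum>z\<in>Z. of_rat (\<epsilon> z) * \<zeta> z) = 0"
    by (auto simp: alg_hull_def)
  obtain \<gamma> where \<gamma>: "\<forall>i\<le>t. \<gamma> i \<in> F" "\<And>z. z \<in> Z \<Longrightarrow> \<zeta> z = (\<Sum>i\<le>t. \<gamma> i * z ^ i)"
    by (rule tor_coefficients[OF A(1)[unfolded A(2)]]) blast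
  define v where "v = (\<Sum>i\<le>t. monom (\<gamma> i) i)"
  have v: "v \<in> polys_over F" using \<gamma>(1) unfolding v_def
    by (intro polys_over_sum[OF F] polys_over_monom[OF F]) auto
  have vz: "poly v z = \<zeta> z" if "z \<in> Z" for z using \<gamma>(2)[OF that] by (simp add: v_def poly_sum poly_monom)
  obtain N :: int where N: "N > 0" "\<forall>q\<in>(\<lambda>(z, w). p z w) ` (Z \<times> Z). \<exists>i::int. of_int N * q = (of_int i :: rat)"
    using common_denominator[of "(\<lambda>(z, w). p z w) ` (Z \<times> Z)"] finZ by blast
  have "\<forall>z w. \<exists>i::int. z \<in> Z \<longrightarrow> w \<in> Z \<longrightarrow> of_int N * p z w = (of_int i :: rat)"
    using N(2) by force
  then obtain \<pi> :: "complex \<Rightarrow> complex \<Rightarrow> int"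
    where \<pi>: "\<And>z w. z \<in> Z \<Longrightarrow> w \<in> Z \<Longrightarrow> of_int N * p z w = of_int (\<pi> z w)" by metis
  have "((\<lambda>s. q (1\<^sub>m n + s \<cdot>\<^sub>m A)) has_field_derivative 0) (at 0)"
    if q: "q \<in> poly_funs n F" "\<forall>g\<in>torus. q g = 0" for q
  proof -
    have "q \<in> poly_funs n UNIV" using q poly_funs_mono by blast
    then obtain L where L: "\<And>f. q (tor f) = monomials L f" using poly_funs_tor by blast
    define D where "D = (\<Sum>(c, m)\<leftarrow>L. c * (\<Sum>k<n. of_nat (m k) * \<zeta> (d k)))"
    have "1\<^sub>m n + s \<cdot>\<^sub>m A = tor (\<lambda>k. 1 + s * \<zeta> (d k))" for s
      by (simp add: A(2) tor_one[symmetric] tor_smult tor_add)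
    then have eq: "q (1\<^sub>m n + s \<cdot>\<^sub>m A) = monomials L (\<lambda>k. 1 + s * \<zeta> (d k))" for s by (simp add: L)
    have qD: "((\<lambda>s. q (1\<^sub>m n + s \<cdot>\<^sub>m A)) has_field_derivative D) (at 0)"
      unfolding eq D_def by (rule monomials_derivative) (auto intro!: derivative_eq_intros)
    \<comment> \<open>\<open>q\<close> along the curve of rational points. As the projection fixes
      \<zeta>, the logarithmic derivative of the \<open>k\<close>-th eigenvalue at 0 is
      \<open>N * \<zeta> (d k)\<close>, so \<phi> has \<open>N\<close> times the derivative of
      \<open>q\<close> along \<open>A\<close>.\<close>
    define \<phi> where "\<phi> s = monomials L (\<lambda>k. \<Prod>w\<in>Z. (1 + s * \<zeta> w) powi \<pi> (d k) w)" for s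
    have "(\<phi> has_field_derivative (\<Sum>(c, m)\<leftarrow>L. c * (\<Sum>k<n. of_nat (m k) * (of_int N * \<zeta> (d k))))) (at 0)"
      unfolding \<phi>_def
    proof (rule monomials_derivative)
      fix k assume k: "k < n"
      have pw: "((\<lambda>s. (1 + s * \<zeta> w) powi e) has_field_derivative of_int e * \<zeta> w) (at 0)" for w e
        by (auto intro!: derivative_eq_intros)
      have "((\<lambda>s. \<Prod>w\<in>Z. (1 + s * \<zeta> w) powi \<pi> (d k) w) has_field_derivative
          (\<Sum>w\<in>Z. of_int (\<pi> (d k) w) * \<zeta> w)) (at 0)"
        by (rule derivative_prod_at_one[OF finZ pw]) simp
      moreover have "(\<Sum>w\<in>Z. of_int (\<pi> (d k) w) * \<zeta> w) = of_int N * \<zeta> (d k)"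
      proof -
        have "of_int (\<pi> (d k) w) = of_int N * (of_rat (p (d k) w) :: complex)" if "w \<in> Z" for w
          using arg_cong[OF \<pi>[OF dZ[OF k] that], of "of_rat :: rat \<Rightarrow> complex"] by (simp add: of_rat_mult)
        then have "(\<Sum>w\<in>Z. of_int (\<pi> (d k) w) * \<zeta> w) = of_int N * (\<Sum>w\<in>Z. of_rat (p (d k) w) * \<zeta> w)"
          by (simp add: sum_distrib_left mult.assoc)
        then show ?thesis using projection_fixes[OF finZ p \<zeta> dZ[OF k]] by simp
      qed
      ultimately show "((\<lambda>s. \<Prod>w\<in>Z. (1 + s * \<zeta> w) powi \<pi> (d k) w) has_field_derivative
          of_int N * \<zeta> (d k)) (at 0)" by simp
    qed simp
    moreover have "(\<Sum>(c, m)\<leftarrow>L. c * (\<Sum>k<n. of_nat (m k) * (of_int N * \<zeta> (d k)))) = of_int N * D"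
      by (simp add: D_def sum_list_const_mult[symmetric] sum_distrib_left mult_ac case_prod_unfold)
    ultimately have \<phi>D: "(\<phi> has_field_derivative of_int N * D) (at 0)" by simp
    \<comment> \<open>For \<open>s\<close> in \<open>F\<close> the factor
      \<open>1 + s * \<zeta> w\<close> is the value at \<open>w\<close> of the polynomial
      \<open>1 + s v\<close> over \<open>F\<close>, as \<open>torus_curve\<close> requires. The
      finitely many factors are nonzero for all small \<open>s\<close>.\<close>
    have zero: "\<phi> s = 0" if s: "s \<in> F" "\<And>z. z \<in> Z \<Longrightarrow> 1 + s * \<zeta> z \<noteq> 0" for s
    proof -
      define u where "u = 1 + smult s v"
      have u: "u \<in> polys_over F" using s(1) v by (simp add: u_def polys_over_intros[OF F])
      have uz: "poly u z = 1 + s * \<zeta> z" if "z \<in> Z" for z using vz[OF that] by (simp add: u_def)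
      have "tor (\<lambda>k. \<Prod>w\<in>Z. poly u w powi \<pi> (d k) w) \<in> torus"
        using uz s(2) by (intro torus_curve[OF p \<pi> N(1) u]) auto
      then have "q (tor (\<lambda>k. \<Prod>w\<in>Z. poly u w powi \<pi> (d k) w)) = 0" using q(2) by blast
      then show ?thesis using uz by (simp add: L \<phi>_def cong: prod.cong)
    qed
    have "\<phi> 0 = 0" by (rule zero) (simp_all add: subfield_0[OF F])
    moreover have "eventually (\<lambda>j. \<phi> (inverse (of_nat (Suc j))) = 0) sequentially"
    proof -
      have "eventually (\<lambda>j. 1 + inverse (of_nat (Suc j)) * \<zeta> z \<noteq> 0) sequentially" for z
      proof -
        have "((\<lambda>j. 1 + inverse (of_nat (Suc j)) * \<zeta> z) \<longlongrightarrow> 1 + 0 * \<zeta> z) sequentially"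
          by (intro tendsto_intros LIMSEQ_Suc[OF lim_inverse_n[where 'a = complex]])
        then show ?thesis
          by (rule tendsto_imp_eventually_ne) simp
      qed
      then have "eventually (\<lambda>j. \<forall>z\<in>Z. 1 + inverse (of_nat (Suc j)) * \<zeta> z \<noteq> 0) sequentially"
        by (simp add: eventually_ball_finite_distrib finZ del: of_nat_Suc)
      then show ?thesis
        by (rule eventually_mono) (intro zero, auto simp: subfield_intros[OF F] simp del: of_nat_Suc)
    qed
    ultimately have "of_int N * D = 0" by (rule derivative_zero_of_zeros[OF \<phi>D])
    then show ?thesis using qD N(1) by simp
  qed
  then show "A \<in> Lie n F torus" using A(1) by (simp add: Lie_def)
qed

lemma alg_hull_lie_subalgebra: "lie_subalgebra n F alg_hull"
  unfolding lie_subalgebra_def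
proof (intro conjI ballI)
  show "alg_hull \<subseteq> mats n F" by (auto simp: alg_hull_def)
  have z: "0\<^sub>m n n = tor (\<lambda>k. 0)" by (rule eq_matI) (simp_all add: tor_entry carrier_matD[OF tor_carrier])
  have zF: "0\<^sub>m n n \<in> mats n F" by (rule matsI) (simp_all add: subfield_0[OF F])
  show zero: "0\<^sub>m n n \<in> alg_hull"
    unfolding alg_hull_def using z zF by (auto intro!: exI[of _ "\<lambda>_. 0"])
  fix A assume "A \<in> alg_hull"
  then obtain \<zeta> where A: "A \<in> mats n F" "A = tor (\<lambda>k. \<zeta> (d k))"
    and \<zeta>: "\<And>\<epsilon>. \<epsilon> \<in> relations Z \<Longrightarrow> (\<Sum>z\<in>Z. of_rat (\<epsilon> z) * \<zeta> z) = 0"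
    by (auto simp: alg_hull_def)
  {
    fix c assume c: "c \<in> F"
    have "c \<cdot>\<^sub>m A \<in> mats n F"
      using mats_carrier[OF A(1)] mats_entry[OF A(1)] c by (intro matsI) (auto simp: subfield_mult[OF F])
    moreover have "c \<cdot>\<^sub>m A = tor (\<lambda>k. c * \<zeta> (d k))" by (simp add: A(2) tor_smult)
    moreover have "(\<Sum>z\<in>Z. of_rat (\<epsilon> z) * (c * \<zeta> z)) = c * (\<Sum>z\<in>Z. of_rat (\<epsilon> z) * \<zeta> z)" for \<epsilon>
      by (simp add: sum_distrib_left mult_ac)
    ultimately show "c \<cdot>\<^sub>m A \<in> alg_hull"
      using \<zeta> unfolding alg_hull_def by (auto intro!: exI[of _ "\<lambda>z. c * \<zeta> z"])
  }
  fix B assume "B \<in> alg_hull"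
  then obtain \<xi> where B: "B \<in> mats n F" "B = tor (\<lambda>k. \<xi> (d k))"
    and \<xi>: "\<And>\<epsilon>. \<epsilon> \<in> relations Z \<Longrightarrow> (\<Sum>z\<in>Z. of_rat (\<epsilon> z) * \<xi> z) = 0"
    by (auto simp: alg_hull_def)
  have "A + B \<in> mats n F"
    using mats_carrier[OF A(1)] mats_carrier[OF B(1)] mats_entry[OF A(1)] mats_entry[OF B(1)]
    by (intro matsI) (auto simp: subfield_add[OF F])
  moreover have "A + B = tor (\<lambda>k. \<zeta> (d k) + \<xi> (d k))" by (simp add: A(2) B(2) tor_add)
  ultimately show "A + B \<in> alg_hull"
    using \<zeta> \<xi> unfolding alg_hull_def
    by (auto intro!: exI[of _ "\<lambda>z. \<zeta> z + \<xi> z"] simp: distrib_left sum.distrib)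
  have "A * B = B * A" by (simp add: A(2) B(2) tor_mult mult.commute)
  then have "A * B - B * A = 0\<^sub>m n n"
    using mats_carrier[OF A(1)] mats_carrier[OF B(1)] by simp
  then show "A * B - B * A \<in> alg_hull" using zero by simp
qed

theorem alg_hull_is_algebraic_hull:
  assumes p: "relation_projection Z p" and S: "X \<in> S" "S \<subseteq> alg_hull"
  shows "is_algebraic_hull n F S alg_hull"
proof -
  have "Lie n F torus = alg_hull"
    using Lie_torus_subset hull_subset_Lie_torus[OF p] by blast
  then have "algebraic_lie_algebra n F alg_hull"
    using alg_hull_lie_subalgebra torus_algebraic by (auto simp: algebraic_lie_algebra_def)
  then show ?thesis
    using S hull_minimal by (auto simp: is_algebraic_hull_def algebraic_lie_algebra_def)
qed

end

section \<open>Relations among the eigenvalues listed with multiplicity\<close>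

lemma sum_fibers:
  fixes a :: "nat \<Rightarrow> 'a::comm_semiring_0"
  assumes "finite Z" "\<And>k. k < n \<Longrightarrow> f k \<in> Z"
  shows "(\<Sum>z\<in>Z. (\<Sum>k\<in>{k. k < n \<and> f k = z}. a k) * g z) = (\<Sum>k<n. a k * g (f k))"
proof -
  have "(\<Sum>z\<in>Z. (\<Sum>k\<in>{k. k < n \<and> f k = z}. a k) * g z) = (\<Sum>z\<in>Z. \<Sum>k\<in>{k \<in> {..<n}. f k = z}. a k * g (f k))"
    by (intro sum.cong) (auto simp: sum_distrib_right)
  also have "\<dots> = (\<Sum>k<n. a k * g (f k))" using assms by (intro sum.group) auto
  finally show ?thesis .
qed

text \<open>Relations among the eigenvalues with multiplicity against relations among the distinct
  eigenvalues: the former push forward, the latter lift to the first occurrences.\<close>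

definition push_forward :: "complex list \<Rightarrow> rat vec \<Rightarrow> complex \<Rightarrow> rat" where
  "push_forward \<alpha> e z = (\<Sum>k\<in>{k. k < length \<alpha> \<and> \<alpha> ! k = z}. e $ k)"

definition lift_relation :: "complex list \<Rightarrow> (complex \<Rightarrow> rat) \<Rightarrow> rat vec" where
  "lift_relation \<alpha> v = vec (length \<alpha>) (\<lambda>k. if \<forall>j<k. \<alpha> ! j \<noteq> \<alpha> ! k then v (\<alpha> ! k) else 0)"

lemma sum_push_forward:
  "(\<Sum>z\<in>set \<alpha>. of_rat (push_forward \<alpha> e z) * g z) = (\<Sum>k<length \<alpha>. of_rat (e $ k) * g (\<alpha> ! k) :: complex)"
  unfolding push_forward_def of_rat_sum by (rule sum_fibers) auto

lemma sum_push_forward_rat: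
  "(\<Sum>z\<in>set \<alpha>. push_forward \<alpha> e z * g z) = (\<Sum>k<length \<alpha>. e $ k * g (\<alpha> ! k))"
  unfolding push_forward_def by (rule sum_fibers) auto

lemma push_forward_lift:
  assumes "z \<in> set \<alpha>" shows "push_forward \<alpha> (lift_relation \<alpha> v) z = v z"
proof -
  define j where "j = (LEAST k. k < length \<alpha> \<and> \<alpha> ! k = z)"
  have ex: "\<exists>k. k < length \<alpha> \<and> \<alpha> ! k = z" using assms by (simp add: in_set_conv_nth)
  have j: "j < length \<alpha>" "\<alpha> ! j = z" using LeastI_ex[OF ex] by (simp_all add: j_def)
  have least: "j \<le> k" if "k < length \<alpha>" "\<alpha> ! k = z" for k
    unfolding j_def using that by (intro Least_le) simp
  have "push_forward \<alpha> (lift_relation \<alpha> v) z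
      = (\<Sum>k\<in>{k. k < length \<alpha> \<and> \<alpha> ! k = z}. if k = j then v z else 0)"
    unfolding push_forward_def
  proof (rule sum.cong)
    fix k assume k: "k \<in> {k. k < length \<alpha> \<and> \<alpha> ! k = z}"
    have "(\<forall>i<k. \<alpha> ! i \<noteq> \<alpha> ! k) \<longleftrightarrow> k = j"
    proof
      assume "\<forall>i<k. \<alpha> ! i \<noteq> \<alpha> ! k"
      then show "k = j" using k j least[of k] by (metis (mono_tags, lifting) le_neq_implies_less mem_Collect_eq)
    next
      assume "k = j"
      then show "\<forall>i<k. \<alpha> ! i \<noteq> \<alpha> ! k" using j least by (metis less_trans not_less)
    qed
    then show "lift_relation \<alpha> v $ k = (if k = j then v z else 0)" using k by (auto simp: lift_relation_def)
  qed simp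
  also have "\<dots> = v z" using j by simp
  finally show ?thesis .
qed

lemma Lambda_push_forward:
  assumes "length \<alpha> = n" "e \<in> Lambda n \<alpha>" shows "push_forward \<alpha> e \<in> relations (set \<alpha>)"
  using assms sum_push_forward[of \<alpha> e "\<lambda>z. z"] by (simp add: relations_def Lambda_def)

lemma lift_relation_Lambda:
  assumes "length \<alpha> = n" "v \<in> relations (set \<alpha>)" shows "lift_relation \<alpha> v \<in> Lambda n \<alpha>"
  using assms sum_push_forward[of \<alpha> "lift_relation \<alpha> v" "\<lambda>z. z"]
  by (simp add: relations_def Lambda_def push_forward_lift) (simp add: lift_relation_def)

text \<open>The pairings agree along the push-forward, and every relation on the distinct
  eigenvalues is the push-forward of its lift, so neither side contains more conditions than the
  other.\<close>

lemma Lambda_orthogonal_iff: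
  assumes "length \<alpha> = n"
  shows "(\<forall>e\<in>Lambda n \<alpha>. (\<Sum>k<n. of_rat (e $ k) * \<zeta> (\<alpha> ! k)) = 0) \<longleftrightarrow>
    (\<forall>v\<in>relations (set \<alpha>). (\<Sum>z\<in>set \<alpha>. of_rat (v z) * \<zeta> z) = (0 :: complex))"
proof (intro iffI ballI)
  fix v assume "\<forall>e\<in>Lambda n \<alpha>. (\<Sum>k<n. of_rat (e $ k) * \<zeta> (\<alpha> ! k)) = 0" "v \<in> relations (set \<alpha>)"
  then have "(\<Sum>k<n. of_rat (lift_relation \<alpha> v $ k) * \<zeta> (\<alpha> ! k)) = 0"
    using lift_relation_Lambda[OF assms] by blast
  then show "(\<Sum>z\<in>set \<alpha>. of_rat (v z) * \<zeta> z) = 0"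
    using sum_push_forward[of \<alpha> "lift_relation \<alpha> v" \<zeta>] assms by (simp add: push_forward_lift)
next
  fix e assume "\<forall>v\<in>relations (set \<alpha>). (\<Sum>z\<in>set \<alpha>. of_rat (v z) * \<zeta> z) = 0" "e \<in> Lambda n \<alpha>"
  then have "(\<Sum>z\<in>set \<alpha>. of_rat (push_forward \<alpha> e z) * \<zeta> z) = 0"
    using Lambda_push_forward[OF assms] by blast
  then show "(\<Sum>k<n. of_rat (e $ k) * \<zeta> (\<alpha> ! k)) = 0" using sum_push_forward[of \<alpha> e \<zeta>] assms by simp
qed

text \<open>The push-forwards of a basis of \<Lambda> span the relations, as each relation lifts to
  \<Lambda>. Thus the basis from step 2 provides the finiteness behind the projection.\<close>

lemma Lambda_projection_exists:
  assumes len: "length \<alpha> = n" and bs: "Lambda_step n \<alpha> bs"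
  obtains p where "relation_projection (set \<alpha>) p"
proof -
  have basis: "set bs \<subseteq> Lambda n \<alpha>"
    "Lambda n \<alpha> = {vec_comb n cs bs |cs. length cs = length bs \<and> set cs \<subseteq> UNIV}"
    using bs unfolding Lambda_step_def vec_basis_def by blast+
  show thesis
  proof (rule relation_projection_exists[of "set \<alpha>" "push_forward \<alpha> ` set bs"])
    show "push_forward \<alpha> ` set bs \<subseteq> relations (set \<alpha>)" using basis(1) Lambda_push_forward[OF len] by blast
    fix u v assume u: "\<forall>b\<in>push_forward \<alpha> ` set bs. (\<Sum>z\<in>set \<alpha>. u z * b z) = 0" and v: "v \<in> relations (set \<alpha>)"
    obtain cs where cs: "lift_relation \<alpha> v = vec_comb n cs bs"
      using lift_relation_Lambda[OF len v] basis(2) by auto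
    have "(\<Sum>z\<in>set \<alpha>. u z * v z) = (\<Sum>z\<in>set \<alpha>. push_forward \<alpha> (lift_relation \<alpha> v) z * u z)"
      by (simp add: push_forward_lift mult.commute)
    also have "\<dots> = (\<Sum>k<n. vec_comb n cs bs $ k * u (\<alpha> ! k))"
      by (simp add: sum_push_forward_rat len cs)
    also have "\<dots> = (\<Sum>k<n. \<Sum>i<length bs. cs ! i * ((bs ! i) $ k * u (\<alpha> ! k)))"
      by (simp add: vec_comb_def sum_distrib_right mult.assoc)
    also have "\<dots> = (\<Sum>i<length bs. cs ! i * (\<Sum>k<n. (bs ! i) $ k * u (\<alpha> ! k)))"
      by (subst sum.swap) (simp add: sum_distrib_left)
    also have "\<dots> = (\<Sum>i<length bs. cs ! i * (\<Sum>z\<in>set \<alpha>. u z * push_forward \<alpha> (bs ! i) z))"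
      using sum_push_forward_rat[of \<alpha> _ u, unfolded len]
      by (intro sum.cong refl arg_cong2[of _ _ _ _ "(*)"]) (metis (no_types, lifting) mult.commute sum.cong)
    also have "\<dots> = 0" using u by (intro sum.neutral) auto
    finally show "(\<Sum>z\<in>set \<alpha>. u z * v z) = 0" .
  qed (auto intro: that)
qed

text \<open>After an exchange of sums, \<gamma> enters only through the values of the polynomial
  with coefficients \<gamma> at the eigenvalues: these values are the \<zeta> of the hull.\<close>

lemma Upsilon_iff:
  assumes len: "length \<alpha> = n" and \<gamma>: "\<gamma> \<in> carrier_vec (t + 1)"
  shows "\<gamma> \<in> Upsilon n F \<alpha> t \<longleftrightarrow> (\<forall>i\<le>t. \<gamma> $ i \<in> F) \<and>
    (\<forall>v\<in>relations (set \<alpha>). (\<Sum>z\<in>set \<alpha>. of_rat (v z) * (\<Sum>i\<le>t. \<gamma> $ i * z ^ i)) = 0)"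
proof -
  have "(\<Sum>i\<le>t. \<Delta> n \<alpha> i e * \<gamma> $ i) = (\<Sum>k<n. of_rat (e $ k) * (\<Sum>i\<le>t. \<gamma> $ i * (\<alpha> ! k) ^ i))" for e
    unfolding \<Delta>_def sum_distrib_left sum_distrib_right by (subst sum.swap) (simp add: mult_ac)
  moreover have "set\<^sub>v \<gamma> \<subseteq> F \<longleftrightarrow> (\<forall>i\<le>t. \<gamma> $ i \<in> F)"
    using \<gamma> by (auto simp: vec_set_def less_Suc_eq_le)
  ultimately show ?thesis
    using \<gamma> Lambda_orthogonal_iff[OF len, of "\<lambda>z. \<Sum>i\<le>t. \<gamma> $ i * z ^ i"] by (simp add: Upsilon_def)
qed

section \<open>From valid results of the steps to a basis of the hull\<close>

lemma semisimple_diagonalized: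
  assumes "semisimple n F X"
  obtains P Q d where "diagonalized n X P Q d" "P \<in> mats n (algebraic_closure_of F)"
    "Q \<in> mats n (algebraic_closure_of F)" "\<forall>k<n. d k \<in> algebraic_closure_of F"
proof -
  obtain P Q D where PQD: "P \<in> mats n (algebraic_closure_of F)" "Q \<in> mats n (algebraic_closure_of F)"
    "D \<in> mats n (algebraic_closure_of F)" "diagonal_mat D" "similar_mat_wit X D P Q"
    and X: "X \<in> mats n F"
    using assms by (auto simp: semisimple_def)
  have D: "D = mdiag n (\<lambda>k. D $$ (k, k))"
    using PQD(4) mats_carrier[OF PQD(3)] by (intro eq_matI) (auto simp: mdiag_def diagonal_mat_def)
  have "P * Q = 1\<^sub>m n" "Q * P = 1\<^sub>m n" "X = P * D * Q"
    using similar_mat_witD2[OF mats_carrier[OF X] PQD(5)] by auto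
  then have "diagonalized n X P Q (\<lambda>k. D $$ (k, k))"
    using D mats_carrier[OF PQD(1)] mats_carrier[OF PQD(2)] by unfold_locales simp_all
  then show thesis using that PQD(1,2) mats_entry[OF PQD(3)] by blast
qed

lemma (in diagonalized) eigenvalue_set:
  assumes "char_poly X = (\<Prod>a\<leftarrow>\<alpha>. [:- a, 1:])" shows "set \<alpha> = d ` {..<n}"
  using char_poly_roots unfolding assms by (auto simp: poly_prod_list prod_list_zero_iff)

lemma mat_comb_comb:
  assumes len: "length cs = length \<gamma>s" and \<gamma>s: "set \<gamma>s \<subseteq> carrier_vec (t + 1)"
  shows "mat_comb n cs (map (\<lambda>\<gamma>. mat_comb n (list_of_vec \<gamma>) (powers X t)) \<gamma>s)
    = mat_comb n (list_of_vec (vec_comb (t + 1) cs \<gamma>s)) (powers X t)"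
proof (rule eq_matI)
  fix i j
  assume "i < dim_row (mat_comb n (list_of_vec (vec_comb (t + 1) cs \<gamma>s)) (powers X t))"
    "j < dim_col (mat_comb n (list_of_vec (vec_comb (t + 1) cs \<gamma>s)) (powers X t))"
  then have ij: "i < n" "j < n" by (simp_all add: mat_comb_def)
  define E where "E l = (powers X t ! l) $$ (i, j)" for l
  have lenp: "length (powers X t) = t + 1" by (simp add: powers_def)
  have entry: "mat_comb n (list_of_vec v) (powers X t) $$ (i, j) = (\<Sum>l<t + 1. v $ l * E l)"
    if "v \<in> carrier_vec (t + 1)" for v
    using ij that by (simp add: mat_comb_def lenp E_def list_of_vec_index cong: sum.cong del: sum.lessThan_Suc)
  have car: "\<gamma>s ! k \<in> carrier_vec (t + 1)" if "k < length \<gamma>s" for k using \<gamma>s that nth_mem by blast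
  have "mat_comb n cs (map (\<lambda>\<gamma>. mat_comb n (list_of_vec \<gamma>) (powers X t)) \<gamma>s) $$ (i, j)
      = (\<Sum>k<length \<gamma>s. cs ! k * mat_comb n (list_of_vec (\<gamma>s ! k)) (powers X t) $$ (i, j))"
    using ij by (simp add: mat_comb_def[of n cs])
  also have "\<dots> = (\<Sum>k<length \<gamma>s. \<Sum>l<t + 1. cs ! k * (\<gamma>s ! k) $ l * E l)"
    using car by (simp add: entry sum_distrib_left mult.assoc del: sum.lessThan_Suc)
  also have "\<dots> = (\<Sum>l<t + 1. vec_comb (t + 1) cs \<gamma>s $ l * E l)"
    by (subst sum.swap) (simp add: vec_comb_def sum_distrib_right del: sum.lessThan_Suc)
  also have "\<dots> = mat_comb n (list_of_vec (vec_comb (t + 1) cs \<gamma>s)) (powers X t) $$ (i, j)"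
    by (rule entry[symmetric]) (simp add: vec_comb_def)
  finally show "mat_comb n cs (map (\<lambda>\<gamma>. mat_comb n (list_of_vec \<gamma>) (powers X t)) \<gamma>s) $$ (i, j)
    = mat_comb n (list_of_vec (vec_comb (t + 1) cs \<gamma>s)) (powers X t) $$ (i, j)" .
qed (simp_all add: mat_comb_def)

context hull_setup
begin

text \<open>The substantial inclusion is that every element of the hull is reached: its coefficients
  in the powers of \<open>X\<close> exist over the complex numbers and lie in \<open>F\<close> by
  \<open>tor_coefficients\<close>.\<close>

lemma hull_eq_Upsilon_image:
  assumes \<alpha>: "length \<alpha> = n" "set \<alpha> = Z"
  shows "alg_hull = (\<lambda>\<gamma>. mat_comb n (list_of_vec \<gamma>) (powers X t)) ` Upsilon n F \<alpha> t"
proof -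
  have comb: "mat_comb n (list_of_vec \<gamma>) (powers X t) = tor (\<lambda>k. \<Sum>l\<le>t. \<gamma> $ l * d k ^ l)"
    if "\<gamma> \<in> carrier_vec (t + 1)" for \<gamma>
  proof -
    have "(\<Sum>l\<le>t. list_of_vec \<gamma> ! l * d k ^ l) = (\<Sum>l\<le>t. \<gamma> $ l * d k ^ l)" for k
      using that by (intro sum.cong) (auto simp: list_of_vec_index)
    then show ?thesis using that by (simp add: mat_comb_powers)
  qed
  show ?thesis
  proof (intro equalityI subsetI)
    fix A assume "A \<in> alg_hull"
    then obtain \<zeta> where A: "A \<in> mats n F" "A = tor (\<lambda>k. \<zeta> (d k))"
      and \<zeta>: "\<And>\<epsilon>. \<epsilon> \<in> relations Z \<Longrightarrow> (\<Sum>z\<in>Z. of_rat (\<epsilon> z) * \<zeta> z) = 0"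
      by (auto simp: alg_hull_def)
    obtain c where c: "\<forall>i\<le>t. c i \<in> F" "\<And>z. z \<in> Z \<Longrightarrow> \<zeta> z = (\<Sum>i\<le>t. c i * z ^ i)"
      by (rule tor_coefficients[OF A(1)[unfolded A(2)]]) blast
    define \<gamma> where "\<gamma> = vec (t + 1) c"
    have \<gamma>: "\<gamma> \<in> carrier_vec (t + 1)" by (simp add: \<gamma>_def)
    have \<gamma>z: "(\<Sum>i\<le>t. \<gamma> $ i * z ^ i) = \<zeta> z" if "z \<in> Z" for z
      using c(2)[OF that] by (simp add: \<gamma>_def)
    have "\<gamma> \<in> Upsilon n F \<alpha> t"
      unfolding Upsilon_iff[OF \<alpha>(1) \<gamma>] \<alpha>(2) using c(1) \<zeta> \<gamma>z by (simp add: \<gamma>_def)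
    moreover have "A = mat_comb n (list_of_vec \<gamma>) (powers X t)"
      unfolding comb[OF \<gamma>] A(2) using \<gamma>z dZ by (intro tor_cong) simp
    ultimately show "A \<in> (\<lambda>\<gamma>. mat_comb n (list_of_vec \<gamma>) (powers X t)) ` Upsilon n F \<alpha> t" by blast
  next
    fix A assume "A \<in> (\<lambda>\<gamma>. mat_comb n (list_of_vec \<gamma>) (powers X t)) ` Upsilon n F \<alpha> t"
    then obtain \<gamma> where A: "A = mat_comb n (list_of_vec \<gamma>) (powers X t)" and \<gamma>U: "\<gamma> \<in> Upsilon n F \<alpha> t" by blast
    have \<gamma>: "\<gamma> \<in> carrier_vec (t + 1)" using \<gamma>U by (simp add: Upsilon_def)
    have U: "\<forall>i\<le>t. \<gamma> $ i \<in> F"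
      "\<forall>v\<in>relations Z. (\<Sum>z\<in>Z. of_rat (v z) * (\<Sum>i\<le>t. \<gamma> $ i * z ^ i)) = 0"
      using \<gamma>U unfolding Upsilon_iff[OF \<alpha>(1) \<gamma>] \<alpha>(2) by blast+
    have "(\<Sum>i\<le>t. monom (\<gamma> $ i) i) \<in> polys_over F"
      using U(1) by (intro polys_over_sum[OF F] polys_over_monom[OF F]) auto
    from tor_poly_mats[OF F XF this] have "A \<in> mats n F"
      by (simp add: A comb[OF \<gamma>] poly_sum poly_monom)
    then show "A \<in> alg_hull"
      using U(2) A comb[OF \<gamma>] unfolding alg_hull_def
      by (intro CollectI conjI exI[of _ "\<lambda>z. \<Sum>i\<le>t. \<gamma> $ i * z ^ i"]) simp_all
  qed
qed

lemma returned_basis: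
  assumes \<alpha>: "length \<alpha> = n" "set \<alpha> = Z" and \<gamma>s: "vec_basis (t + 1) F (Upsilon n F \<alpha> t) \<gamma>s"
  shows "mat_basis n F alg_hull (returned_matrices n X t \<gamma>s)"
proof -
  define M where "M \<gamma> = mat_comb n (list_of_vec \<gamma>) (powers X t)" for \<gamma>
  have U: "set \<gamma>s \<subseteq> Upsilon n F \<alpha> t"
    "Upsilon n F \<alpha> t = {vec_comb (t + 1) cs \<gamma>s |cs. length cs = length \<gamma>s \<and> set cs \<subseteq> F}"
    "\<And>cs. length cs = length \<gamma>s \<Longrightarrow> set cs \<subseteq> F \<Longrightarrow> vec_comb (t + 1) cs \<gamma>s = 0\<^sub>v (t + 1) \<Longrightarrow> set cs \<subseteq> {0}"
    using \<gamma>s unfolding vec_basis_def by blast+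
  have car: "set \<gamma>s \<subseteq> carrier_vec (t + 1)" using U(1) by (auto simp: Upsilon_def)
  have hull: "alg_hull = M ` Upsilon n F \<alpha> t" using hull_eq_Upsilon_image[OF \<alpha>] by (simp add: M_def)
  have comb: "mat_comb n cs (returned_matrices n X t \<gamma>s) = M (vec_comb (t + 1) cs \<gamma>s)"
    if "length cs = length \<gamma>s" for cs
    unfolding returned_matrices_def M_def by (rule mat_comb_comb[OF that car])
  have len: "length (returned_matrices n X t \<gamma>s) = length \<gamma>s" by (simp add: returned_matrices_def)
  show ?thesis
    unfolding mat_basis_def
  proof (intro conjI allI impI)
    show "set (returned_matrices n X t \<gamma>s) \<subseteq> alg_hull"
      using U(1) by (auto simp: hull returned_matrices_def M_def)
    show "alg_hull = mat_span n F (returned_matrices n X t \<gamma>s)"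
      unfolding mat_span_def hull len
    proof (intro equalityI subsetI)
      fix A assume "A \<in> M ` Upsilon n F \<alpha> t"
      then obtain cs where "length cs = length \<gamma>s" "set cs \<subseteq> F" "A = M (vec_comb (t + 1) cs \<gamma>s)"
        using U(2) by auto
      then have "A = mat_comb n cs (returned_matrices n X t \<gamma>s)" "length cs = length \<gamma>s" "set cs \<subseteq> F"
        by (simp_all add: comb)
      then show "A \<in> {mat_comb n cs (returned_matrices n X t \<gamma>s) |cs. length cs = length \<gamma>s \<and> set cs \<subseteq> F}"
        by blast
    next
      fix A assume "A \<in> {mat_comb n cs (returned_matrices n X t \<gamma>s) |cs. length cs = length \<gamma>s \<and> set cs \<subseteq> F}"
      then obtain cs where cs: "A = M (vec_comb (t + 1) cs \<gamma>s)" "length cs = length \<gamma>s" "set cs \<subseteq> F"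
        using comb by auto
      then have "vec_comb (t + 1) cs \<gamma>s \<in> Upsilon n F \<alpha> t" using U(2) by blast
      then show "A \<in> M ` Upsilon n F \<alpha> t" using cs(1) by blast
    qed
    fix cs assume cs: "length cs = length (returned_matrices n X t \<gamma>s) \<and> set cs \<subseteq> F \<and>
      mat_comb n cs (returned_matrices n X t \<gamma>s) = 0\<^sub>m n n"
    then have cs': "length cs = length \<gamma>s" "set cs \<subseteq> F" by (simp_all add: len)
    define \<gamma> where "\<gamma> = vec_comb (t + 1) cs \<gamma>s"
    have "\<gamma> \<in> Upsilon n F \<alpha> t" using cs' U(2) unfolding \<gamma>_def by blast
    then have \<gamma>: "\<gamma> \<in> carrier_vec (t + 1)" "set\<^sub>v \<gamma> \<subseteq> F" by (simp_all add: Upsilon_def)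
    have "M \<gamma> = 0\<^sub>m n n" using cs comb[OF cs'(1)] by (simp add: \<gamma>_def)
    moreover have "length (list_of_vec \<gamma>) = length (powers X t)" "set (list_of_vec \<gamma>) \<subseteq> F"
      using \<gamma> by (simp_all add: powers_def vec_set_def set_list_of_vec)
    \<comment> \<open>Independence of the powers of \<open>X\<close> makes the passage from
      coefficient vectors to matrices injective, so independence in \<Upsilon> is inherited.\<close>
    ultimately have "set (list_of_vec \<gamma>) \<subseteq> {0}" using basis by (auto simp: mat_basis_def M_def)
    then have "\<gamma> = 0\<^sub>v (t + 1)"
      using \<gamma>(1) by (intro eq_vecI) (auto simp: vec_set_def set_list_of_vec)
    then show "set cs \<subseteq> {0}" using U(3)[OF cs'] by (simp add: \<gamma>_def)
  qed
qed

end

lemma hull_correct: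
  assumes F: "number_field F" and n: "0 < n" and ss: "semisimple n F X" and eig: "eigenvalue_step n F X K \<alpha>"
    and Lam: "Lambda_step n \<alpha> bs" and Ups: "Upsilon_step n F X \<alpha> t \<gamma>s"
  shows "\<exists>H. is_algebraic_hull n F (mat_span n F [X]) H \<and> mat_basis n F H (returned_matrices n X t \<gamma>s)"
proof -
  obtain P Q d where diag: "diagonalized n X P Q d" by (rule semisimple_diagonalized[OF ss])
  interpret diagonalized n X P Q d by (rule diag)
  have \<alpha>: "length \<alpha> = n" "set \<alpha> \<subseteq> K" "number_field K" "F \<subseteq> K" "char_poly X = (\<Prod>a\<leftarrow>\<alpha>. [:- a, 1:])"
    using eig by (simp_all add: eigenvalue_step_def)
  have subF: "is_subfield F" using F by (simp add: number_field_iff)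
  have XF: "X \<in> mats n F" using ss by (simp add: semisimple_def)
  have Z: "set \<alpha> = d ` {..<n}" by (rule eigenvalue_set[OF \<alpha>(5)])
  interpret hull_setup n X P Q d F K "set \<alpha>" t
    using subF \<alpha> XF Z Ups by unfold_locales (simp_all add: Upsilon_step_def)
  obtain p where p: "relation_projection (set \<alpha>) p" by (rule Lambda_projection_exists[OF \<alpha>(1) Lam])
  \<comment> \<open>Here \<zeta> is the identity, for which orthogonality is the definition of a
    relation.\<close>
  have Xhull: "X \<in> alg_hull"
    using XF X_tor by (auto simp: alg_hull_def relations_def intro!: exI[of _ "\<lambda>z. z"])
  have comb1: "mat_comb n [c] [X] = c \<cdot>\<^sub>m X" for c
    using X_carrier by (intro eq_matI) (simp_all add: mat_comb_def)
  have sm: "c \<cdot>\<^sub>m X \<in> alg_hull" if "c \<in> F" for c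
    using alg_hull_lie_subalgebra Xhull that by (simp add: lie_subalgebra_def)
  have span: "mat_span n F [X] = {c \<cdot>\<^sub>m X |c. c \<in> F}"
    unfolding mat_span_def
  proof (intro equalityI subsetI)
    fix A assume "A \<in> {mat_comb n cs [X] |cs. length cs = length [X] \<and> set cs \<subseteq> F}"
    then obtain cs where "A = mat_comb n cs [X]" "length cs = 1" "set cs \<subseteq> F" by auto
    then show "A \<in> {c \<cdot>\<^sub>m X |c. c \<in> F}" using comb1 by (cases cs) auto
  next
    fix A assume "A \<in> {c \<cdot>\<^sub>m X |c. c \<in> F}"
    then obtain c where "A = mat_comb n [c] [X]" "c \<in> F" using comb1 by auto
    then show "A \<in> {mat_comb n cs [X] |cs. length cs = length [X] \<and> set cs \<subseteq> F}"
      by (intro CollectI exI[of _ "[c]"]) simp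
  qed
  have "1 \<cdot>\<^sub>m X = X" by (rule eq_matI) simp_all
  then have "X \<in> mat_span n F [X]" unfolding span using subfield_1[OF subF] by force
  moreover have "mat_span n F [X] \<subseteq> alg_hull" unfolding span using sm by blast
  ultimately have "is_algebraic_hull n F (mat_span n F [X]) alg_hull"
    by (rule alg_hull_is_algebraic_hull[OF p])
  moreover have "mat_basis n F alg_hull (returned_matrices n X t \<gamma>s)"
    using returned_basis[OF \<alpha>(1) refl] Ups by (simp add: Upsilon_step_def)
  ultimately show ?thesis by blast
qed

section \<open>Computing with tables of rational polynomials\<close>

lemma computable_sum_rat [computable_intros]:
  fixes n :: "'a::coded \<Rightarrow> nat"
  assumes "computable n" "computable (\<lambda>z. f (fst z) (snd z) :: rat)"
  shows "computable (\<lambda>x. \<Sum>k<n x. f x k)"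
  by (rule computable_sum_less[OF _ assms]) (intro computable_intros)

lemma computable_sum_poly_rat [computable_intros]:
  fixes n :: "'a::coded \<Rightarrow> nat"
  assumes "computable n" "computable (\<lambda>z. f (fst z) (snd z) :: rat poly)"
  shows "computable (\<lambda>x. \<Sum>k<n x. f x k)"
  by (rule computable_sum_less[OF _ assms]) (intro computable_intros)

lemma computable_minus_poly_rat [computable_intros]:
  fixes p q :: "'a::coded \<Rightarrow> rat poly"
  assumes "computable p" "computable q" shows "computable (\<lambda>x. p x - q x)"
proof -
  have "computable (\<lambda>x. p x + smult (-1) (q x))" using assms by (intro computable_intros)
  then show ?thesis by simp
qed

lemma computable_power_poly_rat [computable_intros]:
  fixes p :: "'a::coded \<Rightarrow> rat poly"
  assumes "computable p" "computable k" shows "computable (\<lambda>x. p x ^ k x)"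
proof -
  have "computable (\<lambda>x. rec_nat 1 (\<lambda>_ r. p x * r) (k x))"
    using assms(2) computable_comp[OF assms(1) computable_fst[OF computable_ident]]
    by (intro computable_intros)
  moreover have "rec_nat 1 (\<lambda>_ r. q * r) m = q ^ m" for q :: "rat poly" and m
    by (induction m) simp_all
  ultimately show ?thesis by simp
qed

text \<open>A search for the cofactor is sufficient: divisibilities occur only as positive parts of
  certificates.\<close>

lemma semi_dvd [semi_intros]:
  fixes p q :: "'a::coded \<Rightarrow> rat poly"
  assumes "computable p" "computable q" shows "semi (\<lambda>x. p x dvd q x)"
  unfolding dvd_def
  by (intro semi_ex semi_computable computable_eq computable_mult_poly_rat
      computable_comp[OF assms(1)] computable_comp[OF assms(2)] computable_intros)

text \<open>Defaults make access total, so that tables of any shape can be enumerated and tested;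
  certificates fix the lengths wherever the shape matters.\<close>

definition ent :: "'a::zero list list \<Rightarrow> nat \<Rightarrow> nat \<Rightarrow> 'a" where
  "ent M i j = nth_default 0 (nth_default [] M i) j"

definition tab :: "nat \<Rightarrow> nat \<Rightarrow> (nat \<Rightarrow> nat \<Rightarrow> 'a) \<Rightarrow> 'a list list" where
  "tab m n f = map (\<lambda>i. map (f i) [0..<n]) [0..<m]"

lemma ent_tab [simp]: "i < m \<Longrightarrow> j < n \<Longrightarrow> ent (tab m n f) i j = f i j"
  by (simp add: ent_def tab_def nth_default_nth)

lemma length_tab [simp]: "length (tab m n f) = m"
  by (simp add: tab_def)

lemma ent_mat_to_list [simp]:
  "A \<in> carrier_mat n n \<Longrightarrow> i < n \<Longrightarrow> j < n \<Longrightarrow> ent (mat_to_list A) i j = A $$ (i, j)"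
  by (auto simp: ent_def mat_to_list_def nth_default_nth)

lemma length_mat_to_list: "length (mat_to_list A) = dim_row A"
  by (simp add: mat_to_list_def)

lemma computable_ent [computable_intros]:
  fixes M :: "'a::coded \<Rightarrow> 'b::{zero,coded} list list"
  assumes "computable M" "computable i" "computable j" shows "computable (\<lambda>x. ent (M x) (i x) (j x))"
  unfolding ent_def using assms by (intro computable_intros)

lemma computable_tab [computable_intros]:
  fixes f :: "'a::coded \<Rightarrow> nat \<Rightarrow> nat \<Rightarrow> 'b::coded"
  assumes "computable m" "computable n" "computable (\<lambda>z. f (fst (fst z)) (snd (fst z)) (snd z))"
  shows "computable (\<lambda>x. tab (m x) (n x) (f x))"
  unfolding tab_def using assms computable_comp[OF assms(2) computable_fst[OF computable_ident]]
  by (intro computable_intros)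

text \<open>The powers are formed in the polynomial ring without reduction modulo \<open>f\<close>.
  Only values at \<theta>, or divisibility by \<open>f\<close>, are ever compared.\<close>

definition mpow :: "nat \<Rightarrow> rat poly list list \<Rightarrow> nat \<Rightarrow> rat poly list list" where
  "mpow n A l = rec_nat (tab n n (\<lambda>i j. if i = j then 1 else 0))
     (\<lambda>_ M. tab n n (\<lambda>i j. \<Sum>k<n. ent M i k * ent A k j)) l"

lemma computable_mpow [computable_intros]:
  fixes n l :: "'a::coded \<Rightarrow> nat"
  assumes "computable n" "computable A" "computable l" shows "computable (\<lambda>x. mpow (n x) (A x) (l x))"
proof -
  have "computable (\<lambda>p. mpow (fst (fst p)) (snd (fst p)) (snd p))"
    unfolding mpow_def by (intro computable_intros)
  from computable_comp[OF this computable_Pair[OF computable_Pair[OF assms(1,2)] assms(3)]]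
  show ?thesis by simp
qed

lemma val_mpow:
  assumes A: "A \<in> carrier_mat n n" and ij: "i < n" "j < n"
  shows "val \<theta> (ent (mpow n (mat_to_list A) l) i j) = (map_mat (val \<theta>) A ^\<^sub>m l) $$ (i, j)"
  using ij
proof (induction l arbitrary: i j)
  case 0
  then show ?case using A by (simp add: mpow_def)
next
  case (Suc l)
  have A': "map_mat (val \<theta>) A \<in> carrier_mat n n" using A by simp
  have "ent (mpow n (mat_to_list A) (Suc l)) i j
      = (\<Sum>k<n. ent (mpow n (mat_to_list A) l) i k * ent (mat_to_list A) k j)"
    using Suc.prems by (simp add: mpow_def)
  then show ?case
    using Suc A by (simp add: mult_entry[OF pow_carrier_mat[OF A'] A'] val_hom.hom_sum val_hom.hom_mult del: index_mult_mat(1))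
qed

section \<open>The prescribed codes as values of \<open>enc\<close>\<close>

lemma code_poly_enc: "code_poly = enc"
  by (simp add: fun_eq_iff code_poly_def enc_poly_def enc_list_def enc_rat_def[abs_def] cong: map_cong)

lemma code_rat_enc: "code_rat = enc"
  by (simp add: fun_eq_iff enc_rat_def)

lemma code_list_enc: "code_list enc xs = enc xs"
  by (simp add: code_list_def enc_list_def)

lemma code_vec_enc: "code_vec enc v = enc (list_of_vec v)"
  by (simp add: code_vec_def code_list_enc)

lemma code_mat_enc: "code_mat enc A = enc (mat_to_list A)"
  unfolding code_mat_def code_list_def by (simp add: enc_list_def cong: map_cong)

lemma code_list_map:
  assumes "\<And>x. c x = enc (h x)" shows "code_list c xs = enc (map h xs)"
proof -
  have "c = (\<lambda>x. enc (h x))" using assms by blast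
  then show ?thesis by (simp add: code_list_def enc_list_def o_def)
qed

lemma code_input_enc: "code_input f A = enc (f, mat_to_list A)"
  by (simp add: code_input_def code_poly_enc code_mat_enc enc_prod_def)

lemma code_eigenvalues_enc: "code_eigenvalues g h as = enc (g, h, as)"
  by (simp add: code_eigenvalues_def code_poly_enc code_list_enc enc_prod_def)

lemma code_Lambda_enc: "code_Lambda bs = enc (map list_of_vec bs)"
  unfolding code_Lambda_def by (rule code_list_map) (simp add: code_rat_enc code_vec_enc)

lemma code_Upsilon_enc: "code_Upsilon t cs = enc (t, map list_of_vec cs)"
proof -
  have "code_list (code_vec code_poly) cs = enc (map list_of_vec cs)"
    by (rule code_list_map) (simp add: code_poly_enc code_vec_enc)
  then show ?thesis by (simp add: code_Upsilon_def enc_prod_def)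
qed

text \<open>Later steps receive a list of codes of all earlier data. \<open>s\<close> selects and
  regroups these numbers into the code that a search expects, without decoding their
  contents.\<close>

lemma precompose_list:
  assumes "partial_recursive \<phi>" "computable (s :: nat list \<Rightarrow> 'b::coded)"
  obtains \<psi> where "partial_recursive \<psi>" "\<And>l. \<psi> (list_encode l) = \<phi> (enc (s l))"
proof -
  obtain \<sigma> where \<sigma>: "partial_recursive \<sigma>" "\<And>l. \<sigma> (enc l) = Some (enc (s l))"
    using assms(2) unfolding computable_def by blast
  have "enc l = list_encode l" for l :: "nat list"
    unfolding enc_list_def by (simp cong: map_cong)
  then show thesis
    using \<sigma>(2) by (intro that[OF partial_recursive.comp[OF assms(1) \<sigma>(1)]]) (metis bind.bind_lunit)
qed

lemma poly_table:
  assumes "\<And>i j. i < m \<Longrightarrow> j < n \<Longrightarrow> M i j \<in> Q_adjoin \<theta>"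
  obtains T where "\<And>i j. i < m \<Longrightarrow> j < n \<Longrightarrow> val \<theta> (ent T i j) = M i j" "length T = m"
    "\<And>i. i < m \<Longrightarrow> length (nth_default [] T i) = n"
proof -
  define r where "r i j = (SOME p. val \<theta> p = M i j)" for i j
  have "val \<theta> (r i j) = M i j" if "i < m" "j < n" for i j
    unfolding r_def by (rule someI_ex) (use assms[OF that] in \<open>auto simp: Q_adjoin_def\<close>)
  then show thesis by (intro that[of "tab m n r"]) (simp_all add: tab_def nth_default_nth ent_def)
qed

lemma poly_row:
  assumes "\<And>i. i < n \<Longrightarrow> c i \<in> Q_adjoin \<theta>"
  obtains ps where "length ps = n" "\<And>i. i < n \<Longrightarrow> val \<theta> (nth_default 0 ps i) = c i"
proof -
  define r where "r i = (SOME p. val \<theta> p = c i)" for i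
  have "val \<theta> (r i) = c i" if "i < n" for i
    unfolding r_def by (rule someI_ex) (use assms[OF that] in \<open>auto simp: Q_adjoin_def\<close>)
  then show thesis by (intro that[of "map r [0..<n]"]) (simp_all add: nth_default_nth)
qed

section \<open>Computing the eigenvalues\<close>

text \<open>At a root of \<open>g\<close>, the value of \<open>h\<close> is a root of
  \<open>f\<close>; substituting \<open>h\<close> rewrites the entries of the matrix in the new
  generator. The other conditions say \<open>X P = P diag(as)\<close> and \<open>P Q = 1\<close>.
  The field described by \<open>g\<close> may be larger than the one generated by the
  eigenvalues.\<close>

definition eigen_cert where
  "eigen_cert f A g h as PM QM \<longleftrightarrow> irreducible (g :: rat poly) \<and> g dvd pcompose f h \<and>
     length as = length A \<and>
     (\<forall>i<length A. \<forall>j<length A.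
        g dvd (\<Sum>k<length A. pcompose (ent A i k) h * ent PM k j) - ent PM i j * nth_default 0 as j) \<and>
     (\<forall>i<length A. \<forall>j<length A.
        g dvd (\<Sum>k<length A. ent PM i k * ent QM k j) - (if i = j then 1 else 0))"

lemma semi_eigen_cert:
  "semi (\<lambda>z. \<exists>PM QM. eigen_cert (fst (fst z)) (snd (fst z)) (fst (snd z)) (fst (snd (snd z))) (snd (snd (snd z))) PM QM)"
  unfolding eigen_cert_def
  by (intro semi_intros computable_intros) (rule semi_computable, intro computable_intros)+

lemma mdiag_mult_entry:
  "P \<in> carrier_mat n n \<Longrightarrow> i < n \<Longrightarrow> j < n \<Longrightarrow> (P * mdiag n d) $$ (i, j) = P $$ (i, j) * d j"
  by (subst mult_entry) (auto simp: mdiag_def if_distrib[of "\<lambda>y. _ * y"] cong: if_cong)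

lemma diagonalized_entries:
  assumes X: "X \<in> carrier_mat n n"
    and XP: "\<And>i j. i < n \<Longrightarrow> j < n \<Longrightarrow> (\<Sum>k<n. X $$ (i, k) * p k j) = p i j * d j"
    and PQ: "\<And>i j. i < n \<Longrightarrow> j < n \<Longrightarrow> (\<Sum>k<n. p i k * q k j) = (if i = j then 1 else 0)"
  shows "\<exists>P Q. diagonalized n X P Q d"
proof -
  define P Q where "P = mat n n (\<lambda>(i, j). p i j)" and "Q = mat n n (\<lambda>(i, j). q i j)"
  have P: "P \<in> carrier_mat n n" and Q: "Q \<in> carrier_mat n n" by (simp_all add: P_def Q_def)
  have PQ1: "P * Q = 1\<^sub>m n"
    using P Q PQ by (intro eq_matI) (simp_all add: mult_entry[OF P Q] del: index_mult_mat(1), simp_all add: P_def Q_def)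
  have "X * P = P * mdiag n d"
  proof (rule eq_matI)
    fix i j assume "i < dim_row (P * mdiag n d)" "j < dim_col (P * mdiag n d)"
    then have ij: "i < n" "j < n" using P by (simp_all add: mdiag_def)
    show "(X * P) $$ (i, j) = (P * mdiag n d) $$ (i, j)"
      using ij XP by (simp add: mult_entry[OF X P] mdiag_mult_entry[OF P]) (simp add: P_def)
  qed (use X P in \<open>simp_all add: mdiag_def\<close>)
  then have "P * mdiag n d * Q = X * (P * Q)"
    using X P Q by (metis mult_assoc_square)
  then have "diagonalized n X P Q d"
    using P Q PQ1 X mat_mult_left_right_inverse[OF P Q PQ1] by unfold_locales simp_all
  then show ?thesis by blast
qed

lemma irreducible_root:
  assumes "irreducible g" obtains \<eta> where "presents g \<eta>"
proof -
  have "degree g > 0" using assms by (metis irreducible\<^sub>dD(1) irreducible_connect_field)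
  then have "\<not> constant (poly (map_poly of_rat g :: complex poly))"
    by (simp add: constant_degree)
  then obtain \<eta> where "poly (map_poly of_rat g :: complex poly) \<eta> = 0"
    using fundamental_theorem_of_algebra by blast
  then show thesis using assms that by (simp add: presents_def val_def)
qed

text \<open>An arbitrary root of \<open>g\<close> yields only some conjugate of \<theta> as value of
  \<open>h\<close>. \<open>conjugate_lift\<close> supplies a root \<eta> of \<open>g\<close> at
  which \<open>h\<close> has the value \<theta> itself, and divisibility by \<open>g\<close> makes
  all identities hold there.\<close>

lemma eigen_cert_sound:
  assumes f: "presents f \<theta>" and A: "A \<in> carrier_mat n n"
    and cert: "eigen_cert f (mat_to_list A) g h as PM QM"
  shows "\<exists>\<eta>. valid_eigenvalues \<theta> n A g \<eta> h as"
proof -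
  have len: "length (mat_to_list A) = n" using A by (simp add: length_mat_to_list)
  obtain \<eta>\<^sub>0 where \<eta>\<^sub>0: "presents g \<eta>\<^sub>0" using cert irreducible_root by (auto simp: eigen_cert_def)
  have "val \<eta>\<^sub>0 (pcompose f h) = 0" using cert val_eq_0_iff[OF \<eta>\<^sub>0] by (simp add: eigen_cert_def)
  then have "presents f (val \<eta>\<^sub>0 h)" using f by (simp add: presents_def val_pcompose)
  then obtain \<eta> where \<eta>: "val \<eta> g = 0" "val \<eta> h = \<theta>" using conjugate_lift[OF _ f \<eta>\<^sub>0] by blast
  have g: "presents g \<eta>" using \<eta> \<eta>\<^sub>0 by (simp add: presents_def)
  let ?X = "map_mat (val \<theta>) A"
  have X: "?X \<in> carrier_mat n n" using A by simp
  have "val \<eta> ((\<Sum>k<n. pcompose (ent (mat_to_list A) i k) h * ent PM k j) - ent PM i j * nth_default 0 as j) = 0"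
    "val \<eta> ((\<Sum>k<n. ent PM i k * ent QM k j) - (if i = j then 1 else 0)) = 0"
    if "i < n" "j < n" for i j
    using cert that by (simp_all add: val_eq_0_iff[OF g] eigen_cert_def len)
  note this[unfolded val_hom.hom_minus val_hom.hom_sum val_hom.hom_mult val_pcompose \<eta>(2)]
  then have "(\<Sum>k<n. ?X $$ (i, k) * val \<eta> (ent PM k j)) = val \<eta> (ent PM i j) * val \<eta> (nth_default 0 as j)"
    "(\<Sum>k<n. val \<eta> (ent PM i k) * val \<eta> (ent QM k j)) = (if i = j then 1 else 0)"
    if "i < n" "j < n" for i j
    using that A by (auto split: if_splits)
  then obtain P Q where diag: "diagonalized n ?X P Q (\<lambda>j. val \<eta> (nth_default 0 as j))"
    using diagonalized_entries[OF X, of "\<lambda>i j. val \<eta> (ent PM i j)" "\<lambda>j. val \<eta> (nth_default 0 as j)"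
      "\<lambda>i j. val \<eta> (ent QM i j)"] by blast
  have "length as = n" using cert by (simp add: eigen_cert_def len)
  then have "map (\<lambda>j. val \<eta> (nth_default 0 as j)) [0..<n] = map (val \<eta>) as"
    by (intro nth_equalityI) (simp_all add: nth_default_nth)
  then have "char_poly ?X = (\<Prod>a\<leftarrow>map (val \<eta>) as. [:- a, 1:])"
    using diagonalized.char_poly_X[OF diag] by simp
  moreover have "Q_adjoin \<theta> \<subseteq> Q_adjoin \<eta>"
    using Q_adjoin_subset[OF is_subfield_Q_adjoin[OF g]] \<eta>(2) by (metis Q_adjoin_mem)
  ultimately have "valid_eigenvalues \<theta> n A g \<eta> h as"
    using g \<eta>(2) number_field_Q_adjoin[OF g] \<open>length as = n\<close>
    by (auto simp: valid_eigenvalues_def eigenvalue_step_def)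
  then show ?thesis ..
qed

text \<open>All entries of diagonalising matrices and all eigenvalues are adjoined to the field of
  \<theta>. The result is again a number field, and a primitive element of it provides
  \<open>g\<close> and \<open>h\<close>.\<close>

lemma eigen_cert_complete:
  assumes valid: "valid_input f \<theta> n A"
  shows "\<exists>g h as PM QM. eigen_cert f (mat_to_list A) g h as PM QM"
proof -
  let ?F = "Q_adjoin \<theta>" and ?X = "map_mat (val \<theta>) A"
  have f: "presents f \<theta>" and A: "A \<in> carrier_mat n n" and ss: "semisimple n ?F ?X"
    using valid by (auto simp: valid_input_def)
  have X: "?X \<in> carrier_mat n n" using A by simp
  have len: "length (mat_to_list A) = n" using A by (simp add: length_mat_to_list)
  obtain P Q d where diag: "diagonalized n ?X P Q d"
    and alg: "P \<in> mats n (algebraic_closure_of ?F)" "Q \<in> mats n (algebraic_closure_of ?F)"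
      "\<forall>k<n. d k \<in> algebraic_closure_of ?F"
    by (rule semisimple_diagonalized[OF ss])
  interpret diagonalized n ?X P Q d by (rule diag)
  define S where "S = (\<lambda>(i, j). P $$ (i, j)) ` ({..<n} \<times> {..<n}) \<union> (\<lambda>(i, j). Q $$ (i, j)) ` ({..<n} \<times> {..<n}) \<union> d ` {..<n}"
  have S: "finite S" "S \<subseteq> algebraic_closure_of ?F"
    using mats_entry[OF alg(1)] mats_entry[OF alg(2)] alg(3) by (auto simp: S_def)
  obtain K where K: "number_field K" "?F \<subseteq> K" "S \<subseteq> K"
    by (rule number_field_adjoin_finite[OF number_field_Q_adjoin[OF f] S])
  obtain \<eta> g where g: "presents g \<eta>" "K = Q_adjoin \<eta>" by (rule primitive_element[OF K(1)])
  have "\<theta> \<in> Q_adjoin \<eta>" using K(2) g(2) Q_adjoin_gen by blast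
  then obtain h where h: "val \<eta> h = \<theta>" by (auto simp: Q_adjoin_def)
  have mem: "P $$ (i, j) \<in> Q_adjoin \<eta>" "Q $$ (i, j) \<in> Q_adjoin \<eta>" "d i \<in> Q_adjoin \<eta>" if "i < n" "j < n" for i j
    using K(3) g(2) that by (force simp: S_def)+
  obtain PM where PM: "\<And>i j. i < n \<Longrightarrow> j < n \<Longrightarrow> val \<eta> (ent PM i j) = P $$ (i, j)"
    by (rule poly_table[of n n "\<lambda>i j. P $$ (i, j)"]) (use mem in auto)
  obtain QM where QM: "\<And>i j. i < n \<Longrightarrow> j < n \<Longrightarrow> val \<eta> (ent QM i j) = Q $$ (i, j)"
    by (rule poly_table[of n n "\<lambda>i j. Q $$ (i, j)"]) (use mem in auto)
  obtain as where as: "length as = n" "\<And>i. i < n \<Longrightarrow> val \<eta> (nth_default 0 as i) = d i"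
    by (rule poly_row[of n d]) (use mem in auto)
  have XP: "?X * P = P * mdiag n d"
  proof -
    have "?X * P = P * mdiag n d * (Q * P)"
      using P Q by (subst X_eq) (simp only: mult_assoc_square[of _ n] mult_carrier_square[of _ n] mdiag_carrier)
    then show ?thesis using P by (simp add: QP right_mult_one_mat[OF mult_carrier_square[OF P mdiag_carrier]])
  qed
  have "eigen_cert f (mat_to_list A) g h as PM QM"
    unfolding eigen_cert_def len val_eq_0_iff[OF g(1), symmetric]
  proof (intro conjI allI impI)
    show "irreducible g" using g(1) by (simp add: presents_def)
    show "val \<eta> (pcompose f h) = 0" using f by (simp add: val_pcompose h presents_def)
    show "length as = n" by (rule as(1))
    fix i j assume ij: "i < n" "j < n"
    have "(\<Sum>k<n. ?X $$ (i, k) * P $$ (k, j)) = P $$ (i, j) * d j"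
      using arg_cong[OF XP, of "\<lambda>B. B $$ (i, j)"] ij
      by (simp only: mult_entry[OF X P ij] mdiag_mult_entry[OF P ij])
    then show "val \<eta> ((\<Sum>k<n. pcompose (ent (mat_to_list A) i k) h * ent PM k j) - ent PM i j * nth_default 0 as j) = 0"
      using ij A by (simp add: val_hom.hom_minus val_hom.hom_sum val_hom.hom_mult val_pcompose h PM as(2))
  next
    fix i j assume ij: "i < n" "j < n"
    have "(\<Sum>k<n. P $$ (i, k) * Q $$ (k, j)) = (if i = j then 1 else 0)"
      using arg_cong[OF PQ, of "\<lambda>B. B $$ (i, j)"] ij by (simp add: mult_entry[OF P Q ij] del: index_mult_mat)
    then show "val \<eta> ((\<Sum>k<n. ent PM i k * ent QM k j) - (if i = j then 1 else 0)) = 0"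
      using ij by (simp add: val_hom.hom_minus val_hom.hom_sum val_hom.hom_mult PM QM)
  qed
  then show ?thesis by blast
qed

lemma eigenvalues_computable:
  "\<exists>\<phi>. partial_recursive \<phi> \<and>
      (\<forall>f \<theta> n A. valid_input f \<theta> n A \<longrightarrow>
        (\<exists>g \<eta> h as. \<phi> (code_input f A) = Some (code_eigenvalues g h as) \<and>
           valid_eigenvalues \<theta> n A g \<eta> h as))"
proof -
  obtain \<phi> where \<phi>: "partial_recursive \<phi>"
    "\<And>x. \<exists>y. \<exists>PM QM. eigen_cert (fst x) (snd x) (fst y) (fst (snd y)) (snd (snd y)) PM QM \<Longrightarrow>
      \<exists>y. (\<exists>PM QM. eigen_cert (fst x) (snd x) (fst y) (fst (snd y)) (snd (snd y)) PM QM) \<and> \<phi> (enc x) = Some (enc y)"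
    by (rule semi_search[OF semi_eigen_cert]) blast
  show ?thesis
  proof (intro exI[of _ \<phi>] conjI allI impI)
    fix f \<theta> n A assume valid: "valid_input f \<theta> n A"
    then have fA: "presents f \<theta>" "A \<in> carrier_mat n n" by (auto simp: valid_input_def)
    obtain y PM QM where y: "eigen_cert f (mat_to_list A) (fst y) (fst (snd y)) (snd (snd y)) PM QM"
      "\<phi> (enc (f, mat_to_list A)) = Some (enc y)"
      using \<phi>(2)[of "(f, mat_to_list A)"] eigen_cert_complete[OF valid] by fastforce
    then obtain \<eta> where "valid_eigenvalues \<theta> n A (fst y) \<eta> (fst (snd y)) (snd (snd y))"
      using eigen_cert_sound[OF fA] by blast
    then show "\<exists>g \<eta> h as. \<phi> (code_input f A) = Some (code_eigenvalues g h as) \<and> valid_eigenvalues \<theta> n A g \<eta> h as"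
      using y(2) unfolding code_input_enc code_eigenvalues_enc
      by (intro exI[of _ "fst y"] exI[of _ \<eta>] exI[of _ "fst (snd y)"] exI[of _ "snd (snd y)"]) simp
  qed (rule \<phi>(1))
qed

section \<open>Computing the rational relations\<close>

text \<open>Only the basis \<open>B\<close> and its left inverse \<open>L\<close> are over
  \<open>F\<close>; \<open>M\<close>, \<open>U\<close> and \<open>W\<close> may use the whole
  ambient field. From \<open>B U + W M = 1\<close> a solution \<gamma> is
  \<open>B (U \<gamma>)\<close>, and \<open>L B = 1\<close> identifies the coefficients
  \<open>U \<gamma>\<close> with \<open>L \<gamma>\<close>, which lies in \<open>F\<close>.\<close>

lemma vec_basis_kernel:
  fixes V :: "'a::field vec set" and vs :: "'a vec list"
  assumes F: "is_subfield F" and Vn: "V \<subseteq> carrier_vec n"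
    and V: "\<And>\<gamma>. \<gamma> \<in> carrier_vec n \<Longrightarrow>
      \<gamma> \<in> V \<longleftrightarrow> (\<forall>j<n. \<gamma> $ j \<in> F) \<and> (\<forall>s<m. (\<Sum>j<n. M s j * \<gamma> $ j) = 0)"
    and len: "length vs = r" and vs: "\<And>i. i < r \<Longrightarrow> vs ! i \<in> carrier_vec n"
    and vsF: "\<And>i j. i < r \<Longrightarrow> j < n \<Longrightarrow> vs ! i $ j \<in> F"
    and ker: "\<And>i s. i < r \<Longrightarrow> s < m \<Longrightarrow> (\<Sum>j<n. M s j * vs ! i $ j) = 0"
    and LF: "\<And>i k. i < r \<Longrightarrow> k < n \<Longrightarrow> L i k \<in> F"
    and L: "\<And>i j. i < r \<Longrightarrow> j < r \<Longrightarrow> (\<Sum>k<n. L i k * vs ! j $ k) = (if i = j then 1 else 0)"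
    and U: "\<And>j l. j < n \<Longrightarrow> l < n \<Longrightarrow>
      (\<Sum>i<r. vs ! i $ j * U i l) + (\<Sum>s<m. W j s * M s l) = (if j = l then 1 else 0)"
  shows "vec_basis n F V vs"
  unfolding vec_basis_def
proof (intro conjI allI impI equalityI subsetI)
  have comb: "vec_comb n cs vs $ j = (\<Sum>i<r. cs ! i * vs ! i $ j)" if "j < n" for cs j
    using that by (simp add: vec_comb_def len)
  have Lcomb: "(\<Sum>k<n. L i k * (\<Sum>j<r. u j * vs ! j $ k)) = u i" if "i < r" for u i
  proof -
    have "(\<Sum>k<n. L i k * (\<Sum>j<r. u j * vs ! j $ k)) = (\<Sum>j<r. u j * (\<Sum>k<n. L i k * vs ! j $ k))"
      unfolding sum_distrib_left by (subst sum.swap) (simp add: mult_ac)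
    then show ?thesis using that by (simp add: L if_distrib[of "\<lambda>y. _ * y"] cong: if_cong)
  qed
  {
    fix v assume "v \<in> set vs"
    then obtain i where i: "i < r" "v = vs ! i" using len by (auto simp: in_set_conv_nth)
    then show "v \<in> V" using V[OF vs[OF i(1)]] vsF ker by simp
  next
    fix \<gamma> assume \<gamma>V: "\<gamma> \<in> V"
    then have \<gamma>: "\<gamma> \<in> carrier_vec n" using Vn by blast
    have \<gamma>F: "\<And>j. j < n \<Longrightarrow> \<gamma> $ j \<in> F" and \<gamma>ker: "\<And>s. s < m \<Longrightarrow> (\<Sum>j<n. M s j * \<gamma> $ j) = 0"
      using V[OF \<gamma>] \<gamma>V by auto
    define u where "u i = (\<Sum>l<n. U i l * \<gamma> $ l)" for i
    have eq: "\<gamma> $ j = (\<Sum>i<r. u i * vs ! i $ j)" if j: "j < n" for j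
    proof -
      have "\<gamma> $ j = (\<Sum>l<n. ((\<Sum>i<r. vs ! i $ j * U i l) + (\<Sum>s<m. W j s * M s l)) * \<gamma> $ l)"
        using j by (simp add: U if_distrib[of "\<lambda>y. y * _"] cong: if_cong)
      also have "\<dots> = (\<Sum>l<n. \<Sum>i<r. vs ! i $ j * U i l * \<gamma> $ l) + (\<Sum>l<n. \<Sum>s<m. W j s * M s l * \<gamma> $ l)"
        by (simp add: ring_distribs sum.distrib sum_distrib_right)
      also have "(\<Sum>l<n. \<Sum>i<r. vs ! i $ j * U i l * \<gamma> $ l) = (\<Sum>i<r. u i * vs ! i $ j)"
        unfolding u_def sum_distrib_right by (subst sum.swap) (simp add: mult_ac)
      also have "(\<Sum>l<n. \<Sum>s<m. W j s * M s l * \<gamma> $ l) = (\<Sum>s<m. W j s * (\<Sum>l<n. M s l * \<gamma> $ l))"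
        unfolding sum_distrib_left by (subst sum.swap) (simp add: mult_ac)
      finally show ?thesis by (simp add: \<gamma>ker)
    qed
    have "u i = (\<Sum>k<n. L i k * \<gamma> $ k)" if "i < r" for i
      using Lcomb[OF that, of u] by (simp add: eq)
    then have uF: "u i \<in> F" if "i < r" for i
      using that LF \<gamma>F by (auto intro!: subfield_sum[OF F] subfield_mult[OF F])
    have "\<gamma> = vec_comb n (map u [0..<r]) vs"
      using \<gamma> by (intro eq_vecI) (simp_all add: vec_comb_def len eq)
    then show "\<gamma> \<in> {vec_comb n cs vs |cs. length cs = length vs \<and> set cs \<subseteq> F}"
      using uF len by (intro CollectI exI[of _ "map u [0..<r]"]) auto
  next
    fix \<gamma> assume "\<gamma> \<in> {vec_comb n cs vs |cs. length cs = length vs \<and> set cs \<subseteq> F}"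
    then obtain cs where \<gamma>: "\<gamma> = vec_comb n cs vs" and cs: "length cs = r" "set cs \<subseteq> F" using len by auto
    have csF: "cs ! i \<in> F" if "i < r" for i using cs that nth_mem by blast
    have "(\<Sum>j<n. M s j * (\<Sum>i<r. cs ! i * vs ! i $ j)) = 0" if "s < m" for s
    proof -
      have "(\<Sum>j<n. M s j * (\<Sum>i<r. cs ! i * vs ! i $ j)) = (\<Sum>i<r. cs ! i * (\<Sum>j<n. M s j * vs ! i $ j))"
        unfolding sum_distrib_left by (subst sum.swap) (simp add: mult_ac)
      then show ?thesis using that by (simp add: ker)
    qed
    moreover have "(\<Sum>i<r. cs ! i * vs ! i $ j) \<in> F" if "j < n" for j
      using that csF vsF by (auto intro!: subfield_sum[OF F] subfield_mult[OF F])
    moreover have "\<gamma> \<in> carrier_vec n" by (simp add: \<gamma> vec_comb_def)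
    ultimately show "\<gamma> \<in> V" using V[of \<gamma>] by (simp add: \<gamma> comb)
  next
    fix cs c assume cs: "length cs = length vs \<and> set cs \<subseteq> F \<and> vec_comb n cs vs = 0\<^sub>v n" and c: "c \<in> set cs"
    then obtain i where i: "i < r" "c = cs ! i" using len by (auto simp: in_set_conv_nth)
    have "(\<Sum>i<r. cs ! i * vs ! i $ j) = 0" if "j < n" for j
      using comb[OF that, of cs] cs that by simp
    then show "c \<in> {0}" using Lcomb[OF i(1), of "\<lambda>i. cs ! i"] i(2) by simp
  }
qed

text \<open>\<rho> holds the remainders of the eigenvalues modulo \<open>g\<close>. Their
  coefficients form a rational linear system with one equation for each power below the degree of
  \<open>g\<close>; the remaining identities certify that \<open>bs\<close> is a basis of its
  kernel.\<close>

definition Lambda_cert where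
  "Lambda_cert g as bs \<rho> L U V \<longleftrightarrow>
     (\<forall>i<length bs. length (nth_default [] bs i) = length as) \<and>
     (\<forall>k<length as. g dvd nth_default 0 as k - nth_default 0 \<rho> k) \<and>
     (\<forall>k<length as. degree (nth_default (0 :: rat poly) \<rho> k) < degree g) \<and>
     (\<forall>i<length bs. \<forall>s<degree g. (\<Sum>k<length as. coeff (nth_default 0 \<rho> k) s * ent bs i k) = 0) \<and>
     (\<forall>i<length bs. \<forall>j<length bs. (\<Sum>k<length as. ent L i k * ent bs j k) = (if i = j then 1 else 0)) \<and>
     (\<forall>j<length as. \<forall>l<length as. (\<Sum>i<length bs. ent bs i j * ent U i l) +
        (\<Sum>s<degree g. ent V j s * coeff (nth_default 0 \<rho> l) s) = (if j = l then 1 else 0))"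

lemma semi_Lambda_cert:
  "semi (\<lambda>z. \<exists>\<rho> L U V. Lambda_cert (fst (fst z)) (snd (fst z)) (snd z) \<rho> L U V)"
  unfolding Lambda_cert_def
  by (intro semi_intros computable_intros) (rule semi_computable, intro computable_intros)+

text \<open>A combination of remainders has degree below that of \<open>g\<close>, so it vanishes at
  \<eta> only if it is the zero polynomial.\<close>

lemma Lambda_iff_coeffs:
  assumes g: "presents g \<eta>" and as: "length as = n" and e: "e \<in> carrier_vec n"
    and \<rho>: "\<And>k. k < n \<Longrightarrow> val \<eta> (nth_default 0 as k) = val \<eta> (\<rho> k)"
    and deg: "\<And>k. k < n \<Longrightarrow> degree (\<rho> k) < degree g"
  shows "e \<in> Lambda n (map (val \<eta>) as) \<longleftrightarrow> (\<forall>s<degree g. (\<Sum>k<n. coeff (\<rho> k) s * e $ k) = 0)"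
proof -
  define R where "R = (\<Sum>k<n. smult (e $ k) (\<rho> k))"
  have coeff_R: "coeff R s = (\<Sum>k<n. coeff (\<rho> k) s * e $ k)" for s
    by (simp add: R_def coeff_sum mult.commute)
  have high: "coeff R s = 0" if "degree g \<le> s" for s
    unfolding coeff_R using deg that by (intro sum.neutral) (fastforce intro: coeff_eq_0)
  have "(\<Sum>k<n. of_rat (e $ k) * map (val \<eta>) as ! k) = val \<eta> R"
    using as \<rho> by (simp add: R_def val_hom.hom_sum nth_default_nth)
  then have "e \<in> Lambda n (map (val \<eta>) as) \<longleftrightarrow> g dvd R"
    using e val_eq_0_iff[OF g, of R] by (simp add: Lambda_def)
  also have "\<dots> \<longleftrightarrow> R = 0"
  proof
    assume dvd: "g dvd R"
    show "R = 0"
    proof (rule ccontr)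
      assume "R \<noteq> 0"
      then have "degree g \<le> degree R" "lead_coeff R \<noteq> 0" using dvd dvd_imp_degree_le by auto
      then show False using high by blast
    qed
  qed simp
  also have "\<dots> \<longleftrightarrow> (\<forall>s<degree g. coeff R s = 0)"
    using high by (metis coeff_0 linorder_not_less poly_eqI)
  finally show ?thesis by (simp add: coeff_R)
qed

lemma Lambda_cert_sound:
  assumes g: "presents g \<eta>" and as: "length as = n" and cert: "Lambda_cert g as bs \<rho> L U V"
  shows "valid_Lambda n \<eta> as (map vec_of_list bs)"
proof -
  have rows: "length (bs ! i) = n" "nth_default [] bs i = bs ! i" if "i < length bs" for i
    using cert that as by (auto simp: Lambda_cert_def nth_default_nth)
  have bs: "map vec_of_list bs ! i \<in> carrier_vec n" "j < n \<Longrightarrow> map vec_of_list bs ! i $ j = ent bs i j"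
    if "i < length bs" for i j
    using that rows[OF that] by (auto simp: ent_def nth_default_nth vec_of_list_index intro: carrier_vecI)
  have \<rho>: "val \<eta> (nth_default 0 as k) = val \<eta> (nth_default 0 \<rho> k)" if "k < n" for k
  proof -
    have "val \<eta> (nth_default 0 as k - nth_default 0 \<rho> k) = 0"
      using cert that as by (simp add: Lambda_cert_def val_eq_0_iff[OF g])
    then show ?thesis by (simp add: val_hom.hom_minus)
  qed
  show ?thesis
    unfolding valid_Lambda_def Lambda_step_def
  proof (rule vec_basis_kernel[OF is_subfield_UNIV, where M = "\<lambda>s k. coeff (nth_default 0 \<rho> k) s"
        and m = "degree g" and r = "length bs" and L = "ent L" and U = "ent U" and W = "ent V"])
    show "Lambda n (map (val \<eta>) as) \<subseteq> carrier_vec n" by (auto simp: Lambda_def)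
    fix \<gamma> :: "rat vec" assume "\<gamma> \<in> carrier_vec n"
    then show "\<gamma> \<in> Lambda n (map (val \<eta>) as) \<longleftrightarrow>
        (\<forall>j<n. \<gamma> $ j \<in> UNIV) \<and> (\<forall>s<degree g. (\<Sum>k<n. coeff (nth_default 0 \<rho> k) s * \<gamma> $ k) = 0)"
      using Lambda_iff_coeffs[OF g as _ \<rho>] cert as by (simp add: Lambda_cert_def)
  qed (use bs cert as in \<open>simp_all add: Lambda_cert_def del: nth_map\<close>)
qed

lemma Lambda_cert_complete:
  assumes g: "presents g \<eta>" shows "\<exists>bs \<rho> L U V. Lambda_cert g as bs \<rho> L U V"
proof -
  define n where "n = length as"
  define \<rho> where "\<rho> = map (\<lambda>a. a mod g) as"
  have \<rho>: "nth_default 0 \<rho> k = nth_default 0 as k mod g" if "k < n" for k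
    using that by (simp add: \<rho>_def n_def nth_default_nth)
  have "degree g > 0" using g by (metis presents_def irreducible\<^sub>dD(1) irreducible_connect_field)
  then have deg: "degree (p mod g) < degree g" for p :: "rat poly"
    using degree_mod_less'[of g p] by fastforce
  obtain r :: nat and B U L V where
    "\<forall>j<n. \<forall>k<r. B j k \<in> (UNIV :: rat set)" "\<forall>k<r. \<forall>j<n. U k j \<in> (UNIV :: rat set)"
    "\<forall>k<r. \<forall>j<n. L k j \<in> (UNIV :: rat set)" "\<forall>j<n. \<forall>i<degree g. V j i \<in> (UNIV :: rat set)"
    and ker: "\<And>i k. i < degree g \<Longrightarrow> k < r \<Longrightarrow> (\<Sum>j<n. coeff (nth_default 0 \<rho> j) i * B j k) = 0"
    and L: "\<And>k l. k < r \<Longrightarrow> l < r \<Longrightarrow> (\<Sum>j<n. L k j * B j l) = (if k = l then 1 else 0)"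
    and U: "\<And>j l. j < n \<Longrightarrow> l < n \<Longrightarrow>
      (\<Sum>k<r. B j k * U k l) + (\<Sum>i<degree g. V j i * coeff (nth_default 0 \<rho> l) i) = (if j = l then 1 else 0)"
    by (rule kernel_basis_exists[OF is_subfield_UNIV, of "degree g" n "\<lambda>i j. coeff (nth_default 0 \<rho> j) i"]) (simp, blast)
  have "Lambda_cert g as (tab r n (\<lambda>k j. B j k)) \<rho> (tab r n L) (tab r n U) (tab n (degree g) V)"
    unfolding Lambda_cert_def n_def[symmetric] length_tab
  proof (intro conjI allI impI)
    fix k assume k: "k < n"
    show "g dvd nth_default 0 as k - nth_default 0 \<rho> k" "degree (nth_default 0 \<rho> k) < degree g"
      using k deg by (simp_all add: \<rho> minus_mod_eq_mult_div)
  next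
    fix i assume "i < r"
    then show "length (nth_default [] (tab r n (\<lambda>k j. B j k)) i) = n" by (simp add: tab_def nth_default_nth)
  qed (simp_all add: ker L U)
  then show ?thesis by blast
qed

lemma Lambda_computable:
  "\<exists>\<phi>. partial_recursive \<phi> \<and>
      (\<forall>f \<theta> n A g \<eta> h as. valid_input f \<theta> n A \<and> valid_eigenvalues \<theta> n A g \<eta> h as \<longrightarrow>
        (\<exists>bs. \<phi> (list_encode [code_input f A, code_eigenvalues g h as]) = Some (code_Lambda bs) \<and>
           valid_Lambda n \<eta> as bs))"
proof -
  obtain \<phi> where \<phi>: "partial_recursive \<phi>"
    "\<And>x. \<exists>y. \<exists>\<rho> L U V. Lambda_cert (fst x) (snd x) y \<rho> L U V \<Longrightarrow>
      \<exists>y. (\<exists>\<rho> L U V. Lambda_cert (fst x) (snd x) y \<rho> L U V) \<and> \<phi> (enc x) = Some (enc y)"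
    by (rule semi_search[OF semi_Lambda_cert]) blast
  \<comment> \<open>Extracts \<open>g\<close> and \<open>as\<close> from the second code and skips
    \<open>h\<close>: relations among the eigenvalues do not involve the base field.\<close>
  define s :: "nat list \<Rightarrow> nat \<times> nat" where
    "s l = (fst (prod_decode (nth_default 0 l 1)), snd (prod_decode (snd (prod_decode (nth_default 0 l 1)))))" for l
  have "computable s" unfolding s_def[abs_def] by (intro computable_intros)
  then obtain \<psi> where \<psi>: "partial_recursive \<psi>" "\<And>l. \<psi> (list_encode l) = \<phi> (enc (s l))"
    by (rule precompose_list[OF \<phi>(1)]) blast
  have s: "enc (s [a, enc (g, h, as)]) = enc (g, as)" for a and g h :: "rat poly" and as :: "rat poly list"
    by (simp add: s_def enc_prod_def nth_default_nth)
  show ?thesis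
  proof (intro exI[of _ \<psi>] conjI allI impI)
    fix f \<theta> n A g \<eta> h as assume valid: "valid_input f \<theta> n A \<and> valid_eigenvalues \<theta> n A g \<eta> h as"
    then have g: "presents g \<eta>" "length as = n" by (auto simp: valid_eigenvalues_def eigenvalue_step_def)
    obtain bs \<rho> L U V where cert: "Lambda_cert g as bs \<rho> L U V" "\<phi> (enc (g, as)) = Some (enc bs)"
      using \<phi>(2)[of "(g, as)"] Lambda_cert_complete[OF g(1), of as] by fastforce
    have "valid_Lambda n \<eta> as (map vec_of_list bs)" by (rule Lambda_cert_sound[OF g cert(1)])
    moreover have "code_Lambda (map vec_of_list bs) = enc bs" by (simp add: code_Lambda_enc o_def list_vec)
    ultimately show "\<exists>bs. \<psi> (list_encode [code_input f A, code_eigenvalues g h as]) = Some (code_Lambda bs) \<and>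
        valid_Lambda n \<eta> as bs"
      using cert(2) by (intro exI[of _ "map vec_of_list bs"]) (simp add: \<psi>(2) code_eigenvalues_enc s del: list_encode.simps)
  qed (rule \<psi>(1))
qed

section \<open>Computing the coefficient space\<close>

context diagonalized
begin

lemma assoc_algebra_eq:
  assumes F: "is_subfield F" and XF: "X \<in> mats n F"
  shows "assoc_algebra n F X = {tor (\<lambda>k. poly p (d k)) |p. p \<in> polys_over F}"
proof (intro equalityI subsetI)
  fix A assume "A \<in> assoc_algebra n F X"
  then have "\<exists>p\<in>polys_over F. A = tor (\<lambda>k. poly p (d k))"
  proof induction
    case one
    show ?case by (rule bexI[of _ 1]) (simp_all add: tor_one polys_over_1[OF F])
  next
    case gen
    show ?case
      by (rule bexI[of _ "monom 1 1"])
        (simp_all add: X_tor poly_monom polys_over_monom[OF F] subfield_1[OF F])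
  next
    case (add A B)
    then obtain p q where "p \<in> polys_over F" "A = tor (\<lambda>k. poly p (d k))"
      "q \<in> polys_over F" "B = tor (\<lambda>k. poly q (d k))" by blast
    then show ?case by (intro bexI[of _ "p + q"]) (simp_all add: tor_add polys_over_add[OF F])
  next
    case (smult c A)
    then obtain p where "p \<in> polys_over F" "A = tor (\<lambda>k. poly p (d k))" by blast
    then show ?case
      using smult by (intro bexI[of _ "smult c p"]) (simp_all add: tor_smult polys_over_smult[OF F])
  next
    case (mult A B)
    then obtain p q where "p \<in> polys_over F" "A = tor (\<lambda>k. poly p (d k))"
      "q \<in> polys_over F" "B = tor (\<lambda>k. poly q (d k))" by blast
    then show ?case by (intro bexI[of _ "p * q"]) (simp_all add: tor_mult polys_over_mult[OF F])
  qed
  then show "A \<in> {tor (\<lambda>k. poly p (d k)) |p. p \<in> polys_over F}" by blast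
next
  fix A assume "A \<in> {tor (\<lambda>k. poly p (d k)) |p. p \<in> polys_over F}"
  then obtain p where p: "p \<in> polys_over F" "A = tor (\<lambda>k. poly p (d k))" by blast
  have scal: "tor (\<lambda>_. c) \<in> assoc_algebra n F X" if "c \<in> F" for c
    using assoc_algebra.smult[OF that assoc_algebra.one[of n F X]] tor_smult[of c "\<lambda>_. 1"] by (simp add: tor_one)
  have "tor (\<lambda>k. poly p (d k)) \<in> assoc_algebra n F X" using p(1)
  proof (induction p)
    case 0
    then show ?case using scal[OF subfield_0[OF F]] by simp
  next
    case (pCons a p)
    have co: "coeff (pCons a p) i \<in> F" for i using pCons.prems by (simp only: polys_over_def mem_Collect_eq)
    have p: "p \<in> polys_over F"
      unfolding polys_over_def using co[of "Suc _"] by (simp only: coeff_pCons_Suc) simp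
    have "a \<in> F" using co[of 0] by simp
    then have "tor (\<lambda>_. a) + X * tor (\<lambda>k. poly p (d k)) \<in> assoc_algebra n F X"
      using scal pCons.IH[OF p] by (intro assoc_algebra.intros) auto
    moreover have "tor (\<lambda>k. poly (pCons a p) (d k)) = tor (\<lambda>_. a) + X * tor (\<lambda>k. poly p (d k))"
      by (subst X_tor) (simp add: tor_mult tor_add)
    ultimately show ?case by simp
  qed
  then show "A \<in> assoc_algebra n F X" by (simp add: p(2))
qed

lemma poly_sum_atMost:
  fixes q :: "complex poly"
  assumes "degree q \<le> t" shows "poly q z = (\<Sum>l\<le>t. coeff q l * z ^ l)"
  unfolding poly_altdef using assms by (intro sum.mono_neutral_left) (auto simp: coeff_eq_0)

text \<open>The hypothesis \<open>red\<close> gives a monic polynomial over \<open>F\<close> of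
  degree \<open>Suc t\<close> that vanishes at all eigenvalues. Reduction modulo it turns every
  polynomial in \<open>X\<close> into a combination of the powers up to \<open>t\<close>.\<close>

lemma powers_basis:
  assumes F: "is_subfield F" and XF: "X \<in> mats n F"
    and u: "\<forall>l\<le>t. u l \<in> F" and red: "\<And>k. k < n \<Longrightarrow> d k ^ Suc t = (\<Sum>l\<le>t. u l * d k ^ l)"
    and ind: "\<And>x. (\<forall>l\<le>t. x l \<in> F) \<Longrightarrow> (\<forall>k<n. (\<Sum>l\<le>t. x l * d k ^ l) = 0) \<Longrightarrow> \<forall>l\<le>t. x l = 0"
  shows "mat_basis n F (assoc_algebra n F X) (powers X t)"
  unfolding mat_basis_def
proof (intro conjI allI impI)
  have lenp: "length (powers X t) = t + 1" by (simp add: powers_def)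
  define m where "m = monom 1 (Suc t) - (\<Sum>l\<le>t. monom (u l) l)"
  have mF: "m \<in> polys_over F"
    unfolding m_def using u subfield_1[OF F]
    by (intro polys_over_diff[OF F] polys_over_monom[OF F] polys_over_sum[OF F]) auto
  have low: "degree (\<Sum>l\<le>t. monom (u l) l) \<le> t"
    by (intro degree_sum_le) (auto intro: order_trans[OF degree_monom_le])
  have "coeff m (Suc t) = 1"
    unfolding m_def using low by (simp add: coeff_eq_0)
  then have m0: "m \<noteq> 0" by auto
  have dm: "degree m \<le> Suc t"
    unfolding m_def using low by (intro degree_diff_le) (auto simp: degree_monom_eq)
  have mz: "poly m (d k) = 0" if "k < n" for k
    unfolding m_def using red[OF that] by (simp add: poly_sum poly_monom)
  show pw: "set (powers X t) \<subseteq> assoc_algebra n F X"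
  proof
    fix A assume "A \<in> set (powers X t)"
    then obtain i where "A = X ^\<^sub>m i" by (auto simp: powers_def)
    then show "A \<in> assoc_algebra n F X"
      unfolding assoc_algebra_eq[OF F XF]
      by (intro CollectI exI[of _ "monom 1 i"])
        (simp add: X_pow poly_monom polys_over_monom[OF F] subfield_1[OF F])
  qed
  show "assoc_algebra n F X = mat_span n F (powers X t)"
    unfolding assoc_algebra_eq[OF F XF] mat_span_def lenp
  proof (intro equalityI subsetI)
    fix A assume "A \<in> {tor (\<lambda>k. poly p (d k)) |p. p \<in> polys_over F}"
    then obtain p where p: "p \<in> polys_over F" "A = tor (\<lambda>k. poly p (d k))" by blast
    define q where "q = p mod m"
    have q: "q \<in> polys_over F" using polys_over_div_mod[OF F p(1) mF] by (simp add: q_def)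
    have dq: "degree q \<le> t"
      using degree_mod_less[OF m0, of p] dm by (auto simp: q_def)
    have "poly p (d k) = (\<Sum>l\<le>t. coeff q l * d k ^ l)" if "k < n" for k
    proof -
      have "poly p (d k) = poly (p div m * m + q) (d k)" by (simp add: q_def)
      also have "\<dots> = poly q (d k)" using mz[OF that] by simp
      finally show ?thesis by (simp add: poly_sum_atMost[OF dq])
    qed
    then have "A = mat_comb n (map (coeff q) [0..<t + 1]) (powers X t)"
      unfolding p(2) by (subst mat_comb_powers) (auto intro!: tor_cong sum.cong simp del: upt_Suc)
    moreover have "set (map (coeff q) [0..<t + 1]) \<subseteq> F" using q by (auto simp: polys_over_def)
    ultimately show "A \<in> {mat_comb n cs (powers X t) |cs. length cs = t + 1 \<and> set cs \<subseteq> F}"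
      by (intro CollectI exI[of _ "map (coeff q) [0..<t + 1]"]) simp
  next
    fix A assume "A \<in> {mat_comb n cs (powers X t) |cs. length cs = t + 1 \<and> set cs \<subseteq> F}"
    then obtain cs where A: "A = mat_comb n cs (powers X t)" and cs: "length cs = t + 1" "set cs \<subseteq> F" by blast
    have csF: "cs ! l \<in> F" if "l \<le> t" for l using cs that nth_mem[of l cs] by auto
    have "(\<Sum>l\<le>t. monom (cs ! l) l) \<in> polys_over F"
      using csF by (intro polys_over_sum[OF F] polys_over_monom[OF F]) auto
    then show "A \<in> {tor (\<lambda>k. poly p (d k)) |p. p \<in> polys_over F}"
      unfolding A mat_comb_powers[OF cs(1)]
      by (intro CollectI exI[of _ "\<Sum>l\<le>t. monom (cs ! l) l"]) (simp add: poly_sum poly_monom)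
  qed
  fix cs assume cs: "length cs = length (powers X t) \<and> set cs \<subseteq> F \<and> mat_comb n cs (powers X t) = 0\<^sub>m n n"
  then have len: "length cs = t + 1" by (simp add: lenp)
  have csF: "\<forall>l\<le>t. cs ! l \<in> F" using cs len nth_mem[of _ cs] by auto
  have "tor (\<lambda>k. \<Sum>l\<le>t. cs ! l * d k ^ l) = tor (\<lambda>_. 0)"
    using cs mat_comb_powers[OF len] by (intro eq_matI) (simp_all add: tor_entry carrier_matD[OF tor_carrier])
  then have "\<forall>k<n. (\<Sum>l\<le>t. cs ! l * d k ^ l) = 0" using tor_inj by blast
  from ind[OF csF this] show "set cs \<subseteq> {0}"
    using len by (auto simp: in_set_conv_nth)
qed

text \<open>\<open>Suc t\<close> is the degree of the minimal polynomial of \<open>X\<close> over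
  \<open>F\<close>, found as a monic polynomial of least positive degree vanishing at the
  eigenvalues. A dependence of lower powers would, after normalisation, contradict its
  minimality.\<close>

lemma power_relation_exists:
  assumes F: "is_subfield F" and XF: "X \<in> mats n F" and n: "0 < n"
  obtains t u where "\<forall>l\<le>t. u l \<in> F" "\<forall>k<n. d k ^ Suc t = (\<Sum>l\<le>t. u l * d k ^ l)"
    "\<forall>x. (\<forall>l\<le>t. x l \<in> F) \<longrightarrow> (\<forall>k<n. (\<Sum>l\<le>t. x l * d k ^ l) = 0) \<longrightarrow> (\<forall>l\<le>t. x l = 0)"
proof -
  let ?P = "\<lambda>m. m \<in> polys_over F \<and> lead_coeff m = 1 \<and> degree m > 0 \<and> (\<forall>k<n. poly m (d k) = 0)"
  have "?P (char_poly X)"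
    using degree_monic_char_poly[OF X_carrier] n char_poly_polys_over[OF F XF] char_poly_roots by auto
  then obtain m where m: "?P m" and least: "\<And>q. ?P q \<Longrightarrow> degree m \<le> degree q"
    using ex_has_least_nat[of ?P _ degree] by blast
  define t where "t = degree m - 1"
  have t: "degree m = Suc t" using m by (simp add: t_def)
  show thesis
  proof (rule that[of t "\<lambda>l. - coeff m l"])
    show "\<forall>l\<le>t. - coeff m l \<in> F" using m subfield_uminus[OF F] by (simp add: polys_over_def)
    show "\<forall>k<n. d k ^ Suc t = (\<Sum>l\<le>t. - coeff m l * d k ^ l)"
    proof (intro allI impI)
      fix k assume "k < n"
      then have "poly m (d k) = 0" using m by blast
      moreover have "coeff m (Suc t) = 1" using m by (simp add: t)
      ultimately have "(\<Sum>l\<le>t. coeff m l * d k ^ l) + d k ^ Suc t = 0"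
        by (simp add: poly_altdef t)
      then show "d k ^ Suc t = (\<Sum>l\<le>t. - coeff m l * d k ^ l)"
        by (simp add: sum_negf eq_neg_iff_add_eq_0 add.commute del: power_Suc)
    qed
    show "\<forall>x. (\<forall>l\<le>t. x l \<in> F) \<longrightarrow> (\<forall>k<n. (\<Sum>l\<le>t. x l * d k ^ l) = 0) \<longrightarrow> (\<forall>l\<le>t. x l = 0)"
    proof (intro allI impI)
      fix x l assume x: "\<forall>l\<le>t. x l \<in> F" "\<forall>k<n. (\<Sum>l\<le>t. x l * d k ^ l) = 0" and l: "l \<le> t"
      define q where "q = (\<Sum>l\<le>t. monom (x l) l)"
      have q: "q \<in> polys_over F"
        unfolding q_def using x by (intro polys_over_sum[OF F] polys_over_monom[OF F]) auto
      have dq: "degree q \<le> t"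
        unfolding q_def by (intro degree_sum_le) (auto intro: order_trans[OF degree_monom_le])
      have qz: "poly q (d k) = 0" if "k < n" for k
        using x(2) that by (simp add: q_def poly_sum poly_monom)
      have "q = 0"
      proof (rule ccontr)
        assume q0: "q \<noteq> 0"
        have "degree q \<noteq> 0"
        proof
          assume "degree q = 0"
          then obtain c where "q = [:c:]" by (rule degree_eq_zeroE)
          then show False using qz[OF n] q0 by simp
        qed
        moreover have "inverse (lead_coeff q) \<in> F"
          using q subfield_inverse[OF F] by (simp add: polys_over_def)
        ultimately have "?P (smult (inverse (lead_coeff q)) q)"
          using q q0 qz polys_over_smult[OF F] by simp
        from least[OF this] show False using q0 t dq by simp
      qed
      moreover have "coeff q l = x l"
        using l by (simp add: q_def coeff_sum if_distrib cong: if_cong)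
      ultimately show "x l = 0" by simp
    qed
  qed
qed

lemma power_comb_entry:
  assumes "i < n" "j < n"
  shows "(\<Sum>l\<le>t. x l * (X ^\<^sub>m l) $$ (i, j)) = tor (\<lambda>k. \<Sum>l\<le>t. x l * d k ^ l) $$ (i, j)"
  using assms unfolding X_pow
  by (simp add: tor_entry sum_distrib_left) (subst sum.swap, simp add: mult_ac)

text \<open>Independence of the powers is first known for coefficients in \<open>F\<close> only. A
  left inverse of the flattened powers extends it to complex coefficients, as the argument over
  \<open>K\<close> requires.\<close>

lemma independent_of_left_inverse:
  assumes W: "\<And>k l. k \<le> t \<Longrightarrow> l \<le> t \<Longrightarrow>
      (\<Sum>idx<n * n. W k idx * (X ^\<^sub>m l) $$ (idx div n, idx mod n)) = (if k = l then 1 else 0)"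
    and zero: "\<And>k. k < n \<Longrightarrow> (\<Sum>l\<le>t. x l * d k ^ l) = 0" and k: "k \<le> t"
  shows "x k = 0"
proof -
  have "tor (\<lambda>k. \<Sum>l\<le>t. x l * d k ^ l) = tor (\<lambda>_. 0)" using zero by (rule tor_cong)
  then have entry: "(\<Sum>l\<le>t. x l * (X ^\<^sub>m l) $$ (i, j)) = 0" if "i < n" "j < n" for i j
    using that by (simp add: power_comb_entry tor_entry)
  have idx: "idx div n < n" "idx mod n < n" if "idx < n * n" for idx
    using that by (auto simp: less_mult_imp_div_less) (metis mod_less_divisor mult_is_0 neq0_conv not_less_zero)
  have "x k = (\<Sum>l\<le>t. x l * (\<Sum>idx<n * n. W k idx * (X ^\<^sub>m l) $$ (idx div n, idx mod n)))"
    using k by (simp add: W if_distrib[of "\<lambda>y. _ * y"] cong: if_cong)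
  also have "\<dots> = (\<Sum>idx<n * n. W k idx * (\<Sum>l\<le>t. x l * (X ^\<^sub>m l) $$ (idx div n, idx mod n)))"
    unfolding sum_distrib_left by (subst sum.swap) (simp add: mult_ac)
  also have "\<dots> = 0" using idx by (intro sum.neutral) (auto simp: entry)
  finally show ?thesis .
qed

lemma power_left_inverse:
  assumes F: "is_subfield F" and XF: "X \<in> mats n F"
    and ind: "\<forall>x. (\<forall>l\<le>t. x l \<in> F) \<longrightarrow> (\<forall>k<n. (\<Sum>l\<le>t. x l * d k ^ l) = 0) \<longrightarrow> (\<forall>l\<le>t. x l = 0)"
  shows "\<exists>W. (\<forall>k\<le>t. \<forall>idx<n * n. W k idx \<in> F) \<and> (\<forall>k\<le>t. \<forall>l\<le>t.
      (\<Sum>idx<n * n. W k idx * (X ^\<^sub>m l) $$ (idx div n, idx mod n)) = (if k = l then 1 else 0))"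
proof -
  have XlF: "X ^\<^sub>m l \<in> mats n F" for l
    using tor_poly_mats[OF F XF, of "monom 1 l"]
    by (simp add: X_pow poly_monom polys_over_monom[OF F] subfield_1[OF F])
  have idx: "idx div n < n" "idx mod n < n" if "idx < n * n" for idx
    using that by (auto simp: less_mult_imp_div_less) (metis mod_less_divisor mult_is_0 neq0_conv not_less_zero)
  define M where "M idx l = (X ^\<^sub>m l) $$ (idx div n, idx mod n)" for idx l
  have MF: "\<forall>idx<n * n. \<forall>l<Suc t. M idx l \<in> F" using mats_entry[OF XlF] idx by (simp add: M_def)
  have "\<exists>W. (\<forall>k<Suc t. \<forall>idx<n * n. W k idx \<in> F) \<and>
    (\<forall>k<Suc t. \<forall>l<Suc t. (\<Sum>idx<n * n. W k idx * M idx l) = (if k = l then 1 else 0))"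
  proof (rule left_inverse_exists[OF F MF])
    fix x assume x: "\<forall>l<Suc t. x l \<in> F" "\<forall>idx<n * n. (\<Sum>l<Suc t. M idx l * x l) = 0"
    have "tor (\<lambda>k. \<Sum>l\<le>t. x l * d k ^ l) = tor (\<lambda>_. 0)"
    proof (rule eq_matI)
      fix i j assume "i < dim_row (tor (\<lambda>_. 0))" "j < dim_col (tor (\<lambda>_. 0))"
      then have ij: "i < n" "j < n" by (simp_all add: carrier_matD[OF tor_carrier])
      have "i * n + j < Suc i * n" using ij by simp
      also have "\<dots> \<le> n * n" using ij by (intro mult_right_mono) simp_all
      finally have "(\<Sum>l<Suc t. M (i * n + j) l * x l) = 0" using x(2) by blast
      then show "tor (\<lambda>k. \<Sum>l\<le>t. x l * d k ^ l) $$ (i, j) = tor (\<lambda>_. 0) $$ (i, j)"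
        using ij by (simp add: power_comb_entry[symmetric] tor_entry M_def lessThan_Suc_atMost mult.commute)
    qed (simp_all add: carrier_matD[OF tor_carrier])
    then have "\<forall>k<n. (\<Sum>l\<le>t. x l * d k ^ l) = 0" using tor_inj by blast
    moreover have "\<forall>l\<le>t. x l \<in> F" using x(1) by auto
    ultimately have "\<forall>l\<le>t. x l = 0" using ind by blast
    then show "\<forall>l<Suc t. x l = 0" by auto
  qed blast
  then show ?thesis by (simp only: M_def less_Suc_eq_le)
qed

end

section \<open>Solutions over \<open>F\<close> of a linear system over \<open>K\<close>\<close>

lemma Delta_orthogonal:
  assumes bs: "Lambda_step n \<alpha> bs" and x: "\<And>b. b < length bs \<Longrightarrow> (\<Sum>i\<le>t. \<Delta> n \<alpha> i (bs ! b) * x i) = 0"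
    and e: "e \<in> Lambda n \<alpha>"
  shows "(\<Sum>i\<le>t. \<Delta> n \<alpha> i e * x i) = 0"
proof -
  obtain cs where cs: "e = vec_comb n cs bs"
    using bs e unfolding Lambda_step_def vec_basis_def by blast
  have "\<Delta> n \<alpha> i e = (\<Sum>b<length bs. of_rat (cs ! b) * \<Delta> n \<alpha> i (bs ! b))" for i
    unfolding \<Delta>_def cs
    by (simp add: vec_comb_def of_rat_sum of_rat_mult sum_distrib_left sum_distrib_right)
      (subst sum.swap, simp add: mult_ac)
  then have "(\<Sum>i\<le>t. \<Delta> n \<alpha> i e * x i) = (\<Sum>b<length bs. of_rat (cs ! b) * (\<Sum>i\<le>t. \<Delta> n \<alpha> i (bs ! b) * x i))"
    by (simp add: sum_distrib_left sum_distrib_right) (subst sum.swap, simp add: mult_ac)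
  then show ?thesis by (simp add: x)
qed

lemma Upsilon_kernel_iff:
  assumes bs: "Lambda_step n \<alpha> bs" and \<gamma>: "\<gamma> \<in> carrier_vec (Suc t)"
  shows "\<gamma> \<in> Upsilon n F \<alpha> t \<longleftrightarrow> (\<forall>i<Suc t. \<gamma> $ i \<in> F) \<and>
    (\<forall>b<length bs. (\<Sum>i<Suc t. \<Delta> n \<alpha> i (bs ! b) * \<gamma> $ i) = 0)"
proof -
  have "set\<^sub>v \<gamma> \<subseteq> F \<longleftrightarrow> (\<forall>i<Suc t. \<gamma> $ i \<in> F)"
    using \<gamma> by (auto simp: vec_set_def)
  moreover have "(\<forall>e\<in>Lambda n \<alpha>. (\<Sum>i\<le>t. \<Delta> n \<alpha> i e * \<gamma> $ i) = 0) \<longleftrightarrow>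
      (\<forall>b<length bs. (\<Sum>i\<le>t. \<Delta> n \<alpha> i (bs ! b) * \<gamma> $ i) = 0)"
  proof
    have "set bs \<subseteq> Lambda n \<alpha>" using bs unfolding Lambda_step_def vec_basis_def by blast
    then show "\<forall>b<length bs. (\<Sum>i\<le>t. \<Delta> n \<alpha> i (bs ! b) * \<gamma> $ i) = 0"
      if "\<forall>e\<in>Lambda n \<alpha>. (\<Sum>i\<le>t. \<Delta> n \<alpha> i e * \<gamma> $ i) = 0"
      using that nth_mem by blast
  qed (use Delta_orthogonal[OF bs, where t = t and x = "\<lambda>i. \<gamma> $ i"] in blast)
  moreover have "\<gamma> \<in> carrier_vec (t + 1)" using \<gamma> by simp
  ultimately show ?thesis by (simp only: Upsilon_def mem_Collect_eq lessThan_Suc_atMost simp_thms)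
qed

context hull_setup
begin

text \<open>The relation projection commutes with Galois conjugation, so in the basis of powers it becomes
  a matrix \<open>S\<close> over \<open>F\<close>; it projects \<open>K\<^sup>t\<^sup>+\<^sup>1\<close> onto the solutions of the linear system defining
  \<open>\<Upsilon>\<close>.\<close>

lemma projection_matrix:
  assumes p: "relation_projection Z p"
  shows "\<exists>S. (\<forall>l\<le>t. S l \<in> F) \<and> (\<forall>z\<in>Z. (\<Sum>w\<in>Z. of_rat (p z w) * w ^ i) = (\<Sum>l\<le>t. S l * z ^ l))"
proof -
  define \<zeta> where "\<zeta> z = (\<Sum>w\<in>Z. of_rat (p z w) * w ^ i)" for z :: complex
  have wK: "of_rat q * w ^ i \<in> K" if "w \<in> Z" for q w
    using that ZK by (auto intro!: subfield_intros[OF subK] subfield_of_rat[OF subK])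
  have roots: "Z = {z. poly (char_poly X) z = 0}" by (simp add: char_poly_roots Z)
  have "char_poly X \<noteq> 0" using degree_monic_char_poly[OF X_carrier] by auto
  obtain r where r: "r \<in> polys_over F" "\<And>z. z \<in> Z \<Longrightarrow> poly r z = \<zeta> z"
  proof (rule equivariant_interpolation[OF F K FK char_poly_polys_over[OF F XF] \<open>char_poly X \<noteq> 0\<close> roots ZK])
    show "\<zeta> z \<in> K" if "z \<in> Z" for z
      unfolding \<zeta>_def by (intro subfield_sum[OF subK] wK)
    fix \<sigma> z
    assume \<sigma>: "field_embedding F K \<sigma>" and surj: "\<sigma> ` Z = Z" and inj: "inj_on \<sigma> Z" and z: "z \<in> Z"
    note emb = F subK FK \<sigma>
    have "\<sigma> (of_rat q * w ^ i) = of_rat q * \<sigma> w ^ i" if "w \<in> Z" for q w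
      using that ZK subfield_of_rat[OF F] subfield_of_rat[OF subK]
      by (subst embedding_mult[OF emb]) (auto simp: embedding_fix[OF emb] embedding_power[OF emb] intro: subfield_power[OF subK])
    then have "\<sigma> (\<zeta> z) = (\<Sum>w\<in>Z. of_rat (p z w) * \<sigma> w ^ i)"
      unfolding \<zeta>_def using wK by (subst embedding_sum[OF emb]) auto
    also have "\<dots> = (\<Sum>w\<in>Z. of_rat (p (\<sigma> z) (\<sigma> w)) * \<sigma> w ^ i)"
      using projection_equivariant[OF finZ p emb ZK surj z] by (intro sum.cong) auto
    also have "\<dots> = \<zeta> (\<sigma> z)"
      using sum.reindex[OF inj, of "\<lambda>w. of_rat (p (\<sigma> z) w) * w ^ i"] by (simp add: surj \<zeta>_def o_def)
    finally show "\<sigma> (\<zeta> z) = \<zeta> (\<sigma> z)" .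
  qed blast
  have "tor (\<lambda>k. poly r (d k)) = tor (\<lambda>k. \<zeta> (d k))" using r(2) dZ by (intro tor_cong) simp
  then have "tor (\<lambda>k. \<zeta> (d k)) \<in> mats n F" using tor_poly_mats[OF F XF r(1)] by simp
  then show ?thesis
  proof (rule tor_coefficients)
    fix \<gamma> assume "\<forall>l\<le>t. \<gamma> l \<in> F" "\<And>z. z \<in> Z \<Longrightarrow> \<zeta> z = (\<Sum>l\<le>t. \<gamma> l * z ^ l)"
    then show ?thesis unfolding \<zeta>_def[symmetric] by (intro exI[of _ \<gamma>] conjI ballI)
  qed
qed

text \<open>For a matrix \<open>D\<close> over \<open>K\<close>, solutions over \<open>F\<close>
  need not span all solutions. Here they do: \<open>S\<close> is over \<open>F\<close>, satisfies
  \<open>D S = 0\<close> and fixes every solution, so it projects onto the kernel of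
  \<open>D\<close>. A rank factorisation \<open>S = B C\<close> over \<open>F\<close> then gives a
  basis of the kernel by vectors over \<open>F\<close>.\<close>

lemma Upsilon_factors:
  assumes \<alpha>: "length \<alpha> = n" "set \<alpha> = Z" and bs: "Lambda_step n \<alpha> bs"
    and ind: "\<forall>x. (\<forall>z\<in>Z. (\<Sum>l\<le>t. x l * z ^ l) = 0) \<longrightarrow> (\<forall>l\<le>t. x l = (0 :: complex))"
  defines "D \<equiv> \<lambda>b i. \<Delta> n \<alpha> i (bs ! b)"
  obtains r :: nat and B C L V where "\<forall>i<Suc t. \<forall>c<r. B i c \<in> F" "\<forall>c<r. \<forall>l<Suc t. C c l \<in> F"
    "\<forall>c<r. \<forall>i<Suc t. L c i \<in> F" "\<forall>i<Suc t. \<forall>b<length bs. V i b \<in> K"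
    "\<forall>c<r. \<forall>b<length bs. (\<Sum>i<Suc t. D b i * B i c) = 0"
    "\<forall>c<r. \<forall>c'<r. (\<Sum>i<Suc t. L c i * B i c') = (if c = c' then 1 else 0)"
    "\<forall>i<Suc t. \<forall>l<Suc t. (\<Sum>c<r. B i c * C c l) + (\<Sum>b<length bs. V i b * D b l) = (if i = l then 1 else 0)"
proof -
  obtain p where p: "relation_projection Z p"
    by (rule Lambda_projection_exists[OF \<alpha>(1) bs, unfolded \<alpha>(2)])
  have "\<forall>i. \<exists>S. (\<forall>l\<le>t. S l \<in> F) \<and> (\<forall>z\<in>Z. (\<Sum>w\<in>Z. of_rat (p z w) * w ^ i) = (\<Sum>l\<le>t. S l * z ^ l))"
    using projection_matrix[OF p] by blast
  from choice[OF this] obtain S' where S': "\<forall>i. (\<forall>l\<le>t. S' i l \<in> F) \<and>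
    (\<forall>z\<in>Z. (\<Sum>w\<in>Z. of_rat (p z w) * w ^ i) = (\<Sum>l\<le>t. S' i l * z ^ l))" ..
  define S where "S l i = S' i l" for l i
  have SF: "S l i \<in> F" if "l \<le> t" for l i using S' that by (simp add: S_def)
  have Sz: "(\<Sum>l\<le>t. S l i * z ^ l) = (\<Sum>w\<in>Z. of_rat (p z w) * w ^ i)" if "z \<in> Z" for z i
    using S' that by (simp add: S_def)
  have Delta_sum: "(\<Sum>l\<le>t. \<Delta> n \<alpha> l e * x l) = (\<Sum>k<n. of_rat (e $ k) * (\<Sum>l\<le>t. x l * (\<alpha> ! k) ^ l))" for e x
    unfolding \<Delta>_def sum_distrib_left sum_distrib_right by (subst sum.swap) (simp add: mult_ac)
  have \<alpha>Z: "\<alpha> ! k \<in> Z" if "k < n" for k using \<alpha> that nth_mem by blast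
  have bsL: "bs ! b \<in> Lambda n \<alpha>" if "b < length bs" for b
    using bs that nth_mem unfolding Lambda_step_def vec_basis_def by blast
  \<comment> \<open>A column of \<open>S\<close> holds coefficients of a projected power function.
    By symmetry of the projection, its pairing with a relation is a pairing with the projection of
    that relation, which is 0.\<close>
  have DS: "(\<Sum>l\<le>t. D b l * S l i) = 0" if b: "b < length bs" for b i
  proof -
    have "(\<Sum>z\<in>Z. of_rat (v z) * (\<Sum>w\<in>Z. of_rat (p z w) * w ^ i)) = 0" if v: "v \<in> relations Z" for v
    proof -
      have "(\<Sum>z\<in>Z. of_rat (v z) * (\<Sum>w\<in>Z. of_rat (p z w) * w ^ i))
          = (\<Sum>w\<in>Z. of_rat (\<Sum>z\<in>Z. p w z * v z) * w ^ i)"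
        unfolding of_rat_sum of_rat_mult sum_distrib_left sum_distrib_right
        by (subst sum.swap) (auto intro!: sum.cong simp: projection_sym[OF finZ p] mult_ac)
      then show ?thesis using projection_orth[OF finZ p _ v] by simp
    qed
    then have "\<forall>e\<in>Lambda n \<alpha>. (\<Sum>k<n. of_rat (e $ k) * (\<Sum>w\<in>Z. of_rat (p (\<alpha> ! k) w) * w ^ i)) = 0"
      using Lambda_orthogonal_iff[OF \<alpha>(1), of "\<lambda>z. \<Sum>w\<in>Z. of_rat (p z w) * w ^ i"] \<alpha>(2) by simp
    then show ?thesis using bsL[OF b] by (simp add: D_def Delta_sum Sz \<alpha>Z)
  qed
  \<comment> \<open>A solution \<open>x\<close> yields a function \<beta> orthogonal to the
    relations, which the projection fixes; \<open>ind\<close> carries equality of values on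
    \<open>Z\<close> back to the coefficients.\<close>
  have fixed: "(\<Sum>i\<le>t. S l i * x i) = x l"
    if x: "\<And>b. b < length bs \<Longrightarrow> (\<Sum>i\<le>t. D b i * x i) = 0" and l: "l \<le> t" for x l
  proof -
    define \<beta> where "\<beta> z = (\<Sum>i\<le>t. x i * z ^ i)" for z
    have "\<forall>e\<in>Lambda n \<alpha>. (\<Sum>k<n. of_rat (e $ k) * \<beta> (\<alpha> ! k)) = 0"
      using Delta_orthogonal[OF bs x[unfolded D_def]] by (simp add: \<beta>_def Delta_sum)
    then have "(\<Sum>z\<in>Z. of_rat (v z) * \<beta> z) = 0" if "v \<in> relations Z" for v
      using Lambda_orthogonal_iff[OF \<alpha>(1), of \<beta>] \<alpha>(2) that by simp
    then have fix\<beta>: "(\<Sum>w\<in>Z. of_rat (p z w) * \<beta> w) = \<beta> z" if "z \<in> Z" for z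
      using projection_fixes[OF finZ p] that by blast
    have "(\<Sum>l\<le>t. ((\<Sum>i\<le>t. S l i * x i) - x l) * z ^ l) = 0" if z: "z \<in> Z" for z
    proof -
      have "(\<Sum>l\<le>t. (\<Sum>i\<le>t. S l i * x i) * z ^ l) = (\<Sum>i\<le>t. x i * (\<Sum>l\<le>t. S l i * z ^ l))"
        unfolding sum_distrib_left sum_distrib_right by (subst sum.swap) (simp add: mult_ac)
      also have "\<dots> = (\<Sum>w\<in>Z. of_rat (p z w) * \<beta> w)"
        unfolding Sz[OF z] \<beta>_def sum_distrib_left by (subst sum.swap) (simp add: mult_ac)
      finally have "(\<Sum>l\<le>t. (\<Sum>i\<le>t. S l i * x i) * z ^ l) = (\<Sum>l\<le>t. x l * z ^ l)"
        by (simp only: fix\<beta>[OF z]) (simp only: \<beta>_def)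
      then show ?thesis by (simp add: left_diff_distrib sum_subtractf)
    qed
    from ind[rule_format, OF this l] show ?thesis by simp
  qed
  have DK: "\<forall>b<length bs. \<forall>i<Suc t. D b i \<in> K"
    using \<alpha>Z ZK by (auto simp: D_def \<Delta>_def intro!: subfield_intros[OF subK] subfield_of_rat[OF subK])
  obtain G where GK: "\<forall>j<Suc t. \<forall>b<length bs. G j b \<in> K"
    and G: "\<And>i j. i < length bs \<Longrightarrow> j < Suc t \<Longrightarrow> (\<Sum>k<Suc t. D i k * (\<Sum>l<length bs. G k l * D l j)) = D i j"
    by (rule generalized_inverse[OF subK DK]) blast
  \<comment> \<open>\<open>V = G - S G\<close> for a generalized inverse \<open>G\<close> of
    \<open>D\<close>. Since \<open>1 - G D\<close> has its columns in the kernel of \<open>D\<close>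
    and \<open>S\<close> fixes them, \<open>S - S G D = 1 - G D\<close>, which is
    \<open>S + V D = 1\<close>.\<close>
  define V where "V l b = G l b - (\<Sum>i\<le>t. S l i * G i b)" for l b
  have VK: "\<forall>i<Suc t. \<forall>b<length bs. V i b \<in> K"
    using GK SF FK by (auto simp: V_def intro!: subfield_intros[OF subK])
  have SV: "S l j + (\<Sum>b<length bs. V l b * D b j) = (if l = j then 1 else 0)" if lj: "l \<le> t" "j \<le> t" for l j
  proof -
    define y where "y i = (if i = j then 1 else 0) - (\<Sum>b<length bs. G i b * D b j)" for i
    have "(\<Sum>i\<le>t. D b i * y i) = 0" if "b < length bs" for b
      using G[OF that, of j] lj(2)
      by (simp add: y_def right_diff_distrib sum_subtractf lessThan_Suc_atMost if_distrib[of "\<lambda>y. _ * y"] cong: if_cong)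
    from fixed[OF this lj(1)] have "(\<Sum>i\<le>t. S l i * y i) = y l" .
    moreover have "(\<Sum>i\<le>t. S l i * y i) = S l j - (\<Sum>i\<le>t. S l i * (\<Sum>b<length bs. G i b * D b j))"
      using lj(2) by (simp add: y_def right_diff_distrib sum_subtractf if_distrib[of "\<lambda>y. _ * y"] cong: if_cong)
    moreover have "(\<Sum>b<length bs. V l b * D b j)
        = (\<Sum>b<length bs. G l b * D b j) - (\<Sum>i\<le>t. S l i * (\<Sum>b<length bs. G i b * D b j))"
      unfolding V_def left_diff_distrib sum_subtractf sum_distrib_left sum_distrib_right
      by (intro arg_cong2[of _ _ _ _ "(-)"] refl) (subst sum.swap, simp add: mult_ac)
    moreover have "y l = (if l = j then 1 else 0) - (\<Sum>b<length bs. G l b * D b j)"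
      by (simp add: y_def)
    moreover have "a + (g - c) = e" if "a - c = e - g" for a c e g :: complex
      using that by (simp add: algebra_simps)
    ultimately show ?thesis by presburger
  qed
  have SF': "\<forall>i<Suc t. \<forall>j<Suc t. S i j \<in> F" using SF by simp
  obtain r B C L R where rank: "rank_factors F (Suc t) (Suc t) S r B C L R"
    using full_rank_factorization[OF F SF'] by blast
  note rank1 = rank[unfolded rank_factors_def[OF F]]
  note rank2 = rank1[THEN conjunct2] note rank3 = rank2[THEN conjunct2]
  note rank5 = rank3[THEN conjunct2, THEN conjunct2] note rank6 = rank5[THEN conjunct2]
  note mem = rank1[THEN conjunct1] rank2[THEN conjunct1] rank3[THEN conjunct1]
  note BC = rank5[THEN conjunct1, rule_format] and LB = rank6[THEN conjunct1]
    and CR = rank6[THEN conjunct2, rule_format]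
  have SR: "(\<Sum>k<Suc t. S i k * R k l) = B i l" if "i < Suc t" "l < r" for i l
  proof -
    have "(\<Sum>k<Suc t. S i k * R k l) = (\<Sum>k<Suc t. \<Sum>h<r. B i h * (C h k * R k l))"
      using that by (simp add: BC sum_distrib_right mult.assoc del: sum.lessThan_Suc)
    also have "\<dots> = (\<Sum>h<r. B i h * (\<Sum>k<Suc t. C h k * R k l))"
      by (subst sum.swap) (simp add: sum_distrib_left del: sum.lessThan_Suc)
    finally show ?thesis using that by (simp add: CR if_distrib[of "\<lambda>y. _ * y"] del: sum.lessThan_Suc cong: if_cong)
  qed
  have DB: "(\<Sum>i<Suc t. D b i * B i c) = 0" if "b < length bs" "c < r" for b c
  proof -
    have "(\<Sum>i<Suc t. D b i * B i c) = (\<Sum>i<Suc t. \<Sum>l<Suc t. D b i * S i l * R l c)"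
      using that by (simp add: SR[symmetric] sum_distrib_left mult.assoc del: sum.lessThan_Suc)
    also have "\<dots> = (\<Sum>l<Suc t. (\<Sum>i<Suc t. D b i * S i l) * R l c)"
      by (subst sum.swap) (simp add: sum_distrib_right del: sum.lessThan_Suc)
    finally show ?thesis using DS[OF that(1)] by (simp add: lessThan_Suc_atMost)
  qed
  have DB': "\<forall>c<r. \<forall>b<length bs. (\<Sum>i<Suc t. D b i * B i c) = 0"
    by (intro allI impI DB)
  have UV: "\<forall>i<Suc t. \<forall>l<Suc t. (\<Sum>c<r. B i c * C c l) + (\<Sum>b<length bs. V i b * D b l) = (if i = l then 1 else 0)"
    by (intro allI impI) (simp only: BC[symmetric] SV less_Suc_eq_le)
  show thesis by (rule that[OF mem VK DB' LB UV])
qed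

end

section \<open>Certificates for the third step\<close>

definition Delta_poly :: "rat poly list \<Rightarrow> rat list list \<Rightarrow> nat \<Rightarrow> nat \<Rightarrow> rat poly" where
  "Delta_poly as bs b i = (\<Sum>k<length as. smult (ent bs b k) (nth_default 0 as k ^ i))"

lemma computable_Delta_poly [computable_intros]:
  fixes i b :: "'a::coded \<Rightarrow> nat"
  assumes "computable as" "computable bs" "computable b" "computable i"
  shows "computable (\<lambda>x. Delta_poly (as x) (bs x) (b x) (i x))"
proof -
  have "computable (\<lambda>p. Delta_poly (fst (fst p)) (snd (fst p)) (fst (snd p)) (snd (snd p)))"
    unfolding Delta_poly_def by (intro computable_intros)
  from computable_comp[OF this computable_Pair[OF computable_Pair[OF assms(1,2)] computable_Pair[OF assms(3,4)]]]
  show ?thesis by simp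
qed

text \<open>The first two conditions certify the basis of powers: a relation for the power
  \<open>Suc t\<close> and a left inverse \<open>W\<close> of the flattened powers. The others
  certify a basis of \<Upsilon> as in \<open>vec_basis_kernel\<close>. Identities over
  \<open>F\<close> are tested modulo \<open>f\<close>; those that involve eigenvalues are tested
  modulo \<open>g\<close>, with \<open>h\<close> substituted into the entries of the basis.\<close>

definition Upsilon_cert where
  "Upsilon_cert f A g h as bs t cs u W L U V \<longleftrightarrow>
     (\<forall>i<length A. \<forall>j<length A. f dvd ent (mpow (length A) A (Suc t)) i j -
        (\<Sum>l<Suc t. nth_default 0 u l * ent (mpow (length A) A l) i j)) \<and>
     (\<forall>k<Suc t. \<forall>l<Suc t. f dvd (\<Sum>idx<length A * length A. ent W k idx *
        ent (mpow (length A) A l) (idx div length A) (idx mod length A)) - (if k = l then 1 else 0)) \<and>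
     (\<forall>c<length cs. length (nth_default [] cs c) = Suc t) \<and>
     (\<forall>c<length cs. \<forall>b<length bs. g dvd
        (\<Sum>i<Suc t. Delta_poly as bs b i * pcompose (ent cs c i) h)) \<and>
     (\<forall>c<length cs. \<forall>c'<length cs. f dvd
        (\<Sum>i<Suc t. ent L c i * ent cs c' i) - (if c = c' then 1 else 0)) \<and>
     (\<forall>i<Suc t. \<forall>l<Suc t. g dvd (\<Sum>c<length cs. pcompose (ent cs c i) h * ent U c l) +
        (\<Sum>b<length bs. ent V i b * Delta_poly as bs b l) - (if i = l then 1 else 0))"

lemma semi_Upsilon_cert:
  "semi (\<lambda>z. \<exists>u W L U V. Upsilon_cert (fst (fst (fst (fst z)))) (snd (fst (fst (fst z))))
     (fst (snd (fst (fst z)))) (fst (snd (snd (fst (fst z))))) (snd (snd (snd (fst (fst z))))) (snd (fst z))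
     (fst (snd z)) (snd (snd z)) u W L U V)"
  unfolding Upsilon_cert_def
  by (intro semi_intros computable_intros) (rule semi_computable, intro computable_intros)+

lemma val_Delta_poly:
  assumes as: "length as = n" and b: "b < length bs" and bs: "set bs \<subseteq> carrier_vec n"
  shows "val \<eta> (Delta_poly as (map list_of_vec bs) b i) = \<Delta> n (map (val \<eta>) as) i (bs ! b)"
proof -
  have "bs ! b \<in> carrier_vec n" using b bs nth_mem by blast
  then have "ent (map list_of_vec bs) b k = bs ! b $ k" if "k < n" for k
    using that b by (simp add: ent_def nth_default_nth list_of_vec_index)
  then show ?thesis
    using as by (simp add: Delta_poly_def \<Delta>_def val_hom.hom_sum val_hom.hom_power nth_default_nth)
qed

locale upsilon_data =
  fixes f \<theta> n A g \<eta> h as bs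
  assumes input: "valid_input f \<theta> n A" and eigs: "valid_eigenvalues \<theta> n A g \<eta> h as"
    and rels: "valid_Lambda n \<eta> as bs"
begin

abbreviation "X \<equiv> map_mat (val \<theta>) A"
abbreviation "\<alpha> \<equiv> map (val \<eta>) as"

lemma f: "presents f \<theta>" and n: "0 < n" and A: "A \<in> carrier_mat n n" and ss: "semisimple n (Q_adjoin \<theta>) X"
  using input by (auto simp: valid_input_def)

lemma g: "presents g \<eta>" and h: "val \<eta> h = \<theta>" and as: "length as = n"
    and K: "number_field (Q_adjoin \<eta>)" and FK: "Q_adjoin \<theta> \<subseteq> Q_adjoin \<eta>"
    and chX: "char_poly X = (\<Prod>a\<leftarrow>\<alpha>. [:- a, 1:])"
  using eigs by (auto simp: valid_eigenvalues_def eigenvalue_step_def)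

lemma bs: "Lambda_step n \<alpha> bs"
  using rels by (simp add: valid_Lambda_def)

lemma bs_carrier: "set bs \<subseteq> carrier_vec n"
  using bs unfolding Lambda_step_def vec_basis_def by (auto simp: Lambda_def)

lemma XF: "X \<in> mats n (Q_adjoin \<theta>)"
  using A by (intro matsI) auto

lemma F: "is_subfield (Q_adjoin \<theta>)"
  by (rule is_subfield_Q_adjoin[OF f])

lemma len: "length (mat_to_list A) = n"
  using A by (simp add: length_mat_to_list)

lemma idx: "idx < n * n \<Longrightarrow> idx div n < n \<and> idx mod n < n"
  using n by (simp add: less_mult_imp_div_less)

lemma dvd_iff: "f dvd p \<longleftrightarrow> val \<theta> p = 0" "g dvd q \<longleftrightarrow> val \<eta> q = 0"
  using val_eq_0_iff[OF f] val_eq_0_iff[OF g] by blast+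

lemmas val_simps = val_hom.hom_minus val_hom.hom_add val_hom.hom_sum val_hom.hom_mult val_pcompose h

text \<open>Reads every divisibility as an equation at \<theta> or \<eta>, so that soundness and
  completeness are matters of linear algebra only.\<close>

lemma Upsilon_cert_iff:
  "Upsilon_cert f (mat_to_list A) g h as (map list_of_vec bs) t cs u W L U V \<longleftrightarrow>
     (\<forall>i<n. \<forall>j<n. (X ^\<^sub>m Suc t) $$ (i, j) = (\<Sum>l<Suc t. val \<theta> (nth_default 0 u l) * (X ^\<^sub>m l) $$ (i, j))) \<and>
     (\<forall>k<Suc t. \<forall>l<Suc t. (\<Sum>idx<n * n. val \<theta> (ent W k idx) * (X ^\<^sub>m l) $$ (idx div n, idx mod n))
        = (if k = l then 1 else 0)) \<and>
     (\<forall>c<length cs. length (nth_default [] cs c) = Suc t) \<and>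
     (\<forall>c<length cs. \<forall>b<length bs. (\<Sum>i<Suc t. \<Delta> n \<alpha> i (bs ! b) * val \<theta> (ent cs c i)) = 0) \<and>
     (\<forall>c<length cs. \<forall>c'<length cs. (\<Sum>i<Suc t. val \<theta> (ent L c i) * val \<theta> (ent cs c' i))
        = (if c = c' then 1 else 0)) \<and>
     (\<forall>i<Suc t. \<forall>l<Suc t. (\<Sum>c<length cs. val \<theta> (ent cs c i) * val \<eta> (ent U c l)) +
        (\<Sum>b<length bs. val \<eta> (ent V i b) * \<Delta> n \<alpha> l (bs ! b)) = (if i = l then 1 else 0))"
proof -
  have eq: "(\<Sum>idx<n * n. val \<theta> (ent W k idx) * val \<theta> (ent (mpow n (mat_to_list A) l) (idx div n) (idx mod n)))
      = (\<Sum>idx<n * n. val \<theta> (ent W k idx) * (X ^\<^sub>m l) $$ (idx div n, idx mod n))" for k l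
    by (intro sum.cong refl) (simp add: val_mpow[OF A] idx)
  have D: "(\<Sum>b<length bs. val \<eta> (ent V i b) * val \<eta> (Delta_poly as (map list_of_vec bs) b l))
      = (\<Sum>b<length bs. val \<eta> (ent V i b) * \<Delta> n \<alpha> l (bs ! b))" for i l
    by (intro sum.cong refl) (simp add: val_Delta_poly[OF as _ bs_carrier])
  have delta: "val \<theta> (if P then 1 else 0) = (if P then 1 else 0)" "val \<eta> (if P then 1 else 0) = (if P then 1 else 0)" for P
    by simp_all
  show ?thesis
    unfolding Upsilon_cert_def len dvd_iff val_simps eq delta length_map D eq_iff_diff_eq_0[symmetric]
    by (intro arg_cong2[of _ _ _ _ "(\<and>)"] all_cong refl)
      (simp_all only: val_mpow[OF A] val_Delta_poly[OF as _ bs_carrier])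
qed

lemma Upsilon_cert_sound:
  assumes cert: "Upsilon_cert f (mat_to_list A) g h as (map list_of_vec bs) t cs u W L U V"
  shows "valid_Upsilon \<theta> n A \<eta> as t (map vec_of_list cs)"
proof -
  note c1 = cert[unfolded Upsilon_cert_iff]
  note c2 = c1[THEN conjunct2] note c3 = c2[THEN conjunct2] note c4 = c3[THEN conjunct2]
  note c5 = c4[THEN conjunct2] note c6 = c5[THEN conjunct2]
  note red = c1[THEN conjunct1, rule_format] and left = c2[THEN conjunct1, rule_format]
    and rows = c3[THEN conjunct1, rule_format] and ker = c4[THEN conjunct1, rule_format]
    and L = c5[THEN conjunct1, rule_format] and U = c6[rule_format]
  obtain P Q d where diag: "diagonalized n X P Q d" by (rule semisimple_diagonalized[OF ss])
  interpret diagonalized n X P Q d by (rule diag)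
  have "tor (\<lambda>k. d k ^ Suc t) = tor (\<lambda>k. \<Sum>l\<le>t. val \<theta> (nth_default 0 u l) * d k ^ l)"
  proof (rule eq_matI)
    fix i j
    assume "i < dim_row (tor (\<lambda>k. \<Sum>l\<le>t. val \<theta> (nth_default 0 u l) * d k ^ l))"
      "j < dim_col (tor (\<lambda>k. \<Sum>l\<le>t. val \<theta> (nth_default 0 u l) * d k ^ l))"
    then have ij: "i < n" "j < n" by (simp_all add: carrier_matD[OF tor_carrier])
    show "tor (\<lambda>k. d k ^ Suc t) $$ (i, j) = tor (\<lambda>k. \<Sum>l\<le>t. val \<theta> (nth_default 0 u l) * d k ^ l) $$ (i, j)"
      using red[OF ij] power_comb_entry[OF ij, of "\<lambda>l. val \<theta> (nth_default 0 u l)" t]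
      by (simp only: X_pow[symmetric] lessThan_Suc_atMost)
  qed (simp_all add: carrier_matD[OF tor_carrier])
  then have dred: "d k ^ Suc t = (\<Sum>l\<le>t. val \<theta> (nth_default 0 u l) * d k ^ l)" if "k < n" for k
    using tor_inj that by blast
  have "mat_basis n (Q_adjoin \<theta>) (assoc_algebra n (Q_adjoin \<theta>) X) (powers X t)"
  proof (rule powers_basis[OF F XF _ dred])
    fix x assume "\<forall>k<n. (\<Sum>l\<le>t. x l * d k ^ l) = 0"
    then show "\<forall>l\<le>t. x l = 0"
      using independent_of_left_inverse[of t "\<lambda>k idx. val \<theta> (ent W k idx)" x] left by (simp add: less_Suc_eq_le)
  qed simp_all
  moreover define ws where "ws = map (map_vec (val \<theta>)) (map vec_of_list cs)"
  have "vec_basis (t + 1) (Q_adjoin \<theta>) (Upsilon n (Q_adjoin \<theta>) \<alpha> t) ws"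
    unfolding Suc_eq_plus1[symmetric]
  \<comment> \<open>The system, \<open>U\<close> and \<open>V\<close> have values in the field of
    \<eta>, the basis and \<open>L\<close> in the field of \<theta>: the mixture that
    \<open>vec_basis_kernel\<close> admits.\<close>
  proof (rule vec_basis_kernel[OF F, where M = "\<lambda>b i. \<Delta> n \<alpha> i (bs ! b)" and m = "length bs" and r = "length cs"
        and L = "\<lambda>c i. val \<theta> (ent L c i)" and U = "\<lambda>c l. val \<eta> (ent U c l)" and W = "\<lambda>i b. val \<eta> (ent V i b)"])
    show "Upsilon n (Q_adjoin \<theta>) \<alpha> t \<subseteq> carrier_vec (Suc t)" by (auto simp: Upsilon_def)
    show "length ws = length cs" by (simp add: ws_def)
    have csl: "length (cs ! c) = Suc t" if "c < length cs" for c
      using rows[OF that] that by (simp add: nth_default_nth)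
    then show car: "ws ! c \<in> carrier_vec (Suc t)" if "c < length cs" for c
      using that by (auto simp: ws_def intro!: carrier_vecI)
    have vs: "ws ! c $ i = val \<theta> (ent cs c i)" if "c < length cs" "i < Suc t" for c i
      using that csl[OF that(1)] by (simp add: ws_def ent_def nth_default_nth vec_of_list_index)
    show "ws ! c $ i \<in> Q_adjoin \<theta>" if "c < length cs" "i < Suc t" for c i
      unfolding vs[OF that] by simp
    show "(\<Sum>i<Suc t. \<Delta> n \<alpha> i (bs ! b) * ws ! c $ i) = 0" if "c < length cs" "b < length bs" for c b
      using ker[OF that] that by (simp add: vs del: sum.lessThan_Suc)
    show "(\<Sum>i<Suc t. val \<theta> (ent L c i) * ws ! c' $ i) = (if c = c' then 1 else 0)"
      if "c < length cs" "c' < length cs" for c c'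
      using L[OF that] that by (simp add: vs del: sum.lessThan_Suc)
    show "(\<Sum>c<length cs. ws ! c $ i * val \<eta> (ent U c l)) +
        (\<Sum>b<length bs. val \<eta> (ent V i b) * \<Delta> n \<alpha> l (bs ! b)) = (if i = l then 1 else 0)"
      if "i < Suc t" "l < Suc t" for i l
      using U[OF that] that by (simp add: vs del: sum.lessThan_Suc)
  qed (simp_all add: Upsilon_kernel_iff[OF bs] del: sum.lessThan_Suc)
  ultimately show ?thesis by (simp add: valid_Upsilon_def Upsilon_step_def ws_def)
qed

lemma Upsilon_cert_complete:
  "\<exists>t cs u W L U V. Upsilon_cert f (mat_to_list A) g h as (map list_of_vec bs) t cs u W L U V"
proof -
  obtain P Q d where diag: "diagonalized n X P Q d" by (rule semisimple_diagonalized[OF ss])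
  interpret diagonalized n X P Q d by (rule diag)
  obtain t u where u: "\<forall>l\<le>t. u l \<in> Q_adjoin \<theta>" and red: "\<forall>k<n. d k ^ Suc t = (\<Sum>l\<le>t. u l * d k ^ l)"
    and ind: "\<forall>x. (\<forall>l\<le>t. x l \<in> Q_adjoin \<theta>) \<longrightarrow> (\<forall>k<n. (\<Sum>l\<le>t. x l * d k ^ l) = 0) \<longrightarrow> (\<forall>l\<le>t. x l = 0)"
    by (rule power_relation_exists[OF F XF n])
  obtain W where WF: "\<forall>k\<le>t. \<forall>idx<n * n. W k idx \<in> Q_adjoin \<theta>"
    and W: "\<forall>k\<le>t. \<forall>l\<le>t. (\<Sum>idx<n * n. W k idx * (X ^\<^sub>m l) $$ (idx div n, idx mod n)) = (if k = l then 1 else 0)"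
    using power_left_inverse[OF F XF ind] by blast
  have basis: "mat_basis n (Q_adjoin \<theta>) (assoc_algebra n (Q_adjoin \<theta>) X) (powers X t)"
    by (rule powers_basis[OF F XF u]) (use red ind in blast)+
  have Z: "set \<alpha> = d ` {..<n}" by (rule eigenvalue_set[OF chX])
  interpret hull_setup n X P Q d "Q_adjoin \<theta>" "Q_adjoin \<eta>" "set \<alpha>" t
    by (intro hull_setup.intro hull_setup_axioms.intro diag F K FK XF Z basis) auto
  \<comment> \<open>\<open>Upsilon_factors\<close> compares coefficient vectors over
    \<open>K\<close>, so independence is extended to complex coefficients by the left inverse
    \<open>W\<close>.\<close>
  have indC: "\<forall>x. (\<forall>z\<in>set \<alpha>. (\<Sum>l\<le>t. x l * z ^ l) = 0) \<longrightarrow> (\<forall>l\<le>t. x l = (0 :: complex))"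
  proof (intro allI impI)
    fix x l assume x: "\<forall>z\<in>set \<alpha>. (\<Sum>l\<le>t. x l * z ^ l) = (0 :: complex)" and l: "l \<le> t"
    show "x l = 0"
    proof (rule independent_of_left_inverse[of t W x, OF _ _ l])
      show "(\<Sum>l\<le>t. x l * d k ^ l) = 0" if "k < n" for k using x that unfolding Z by blast
    qed (use W in blast)
  qed
  have "length \<alpha> = n" by (simp add: as)
  obtain r :: nat and B C L V where BF: "\<forall>i<Suc t. \<forall>c<r. B i c \<in> Q_adjoin \<theta>" and CF: "\<forall>c<r. \<forall>l<Suc t. C c l \<in> Q_adjoin \<theta>"
    and LF: "\<forall>c<r. \<forall>i<Suc t. L c i \<in> Q_adjoin \<theta>" and VK: "\<forall>i<Suc t. \<forall>b<length bs. V i b \<in> Q_adjoin \<eta>"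
    and DB: "\<forall>c<r. \<forall>b<length bs. (\<Sum>i<Suc t. \<Delta> n \<alpha> i (bs ! b) * B i c) = 0"
    and LB: "\<forall>c<r. \<forall>c'<r. (\<Sum>i<Suc t. L c i * B i c') = (if c = c' then 1 else 0)"
    and UV: "\<forall>i<Suc t. \<forall>l<Suc t. (\<Sum>c<r. B i c * C c l) + (\<Sum>b<length bs. V i b * \<Delta> n \<alpha> l (bs ! b)) = (if i = l then 1 else 0)"
    by (rule Upsilon_factors[OF \<open>length \<alpha> = n\<close> refl bs indC])
  obtain ul where ul: "\<forall>l<Suc t. val \<theta> (nth_default 0 ul l) = u l"
    using poly_row[of "Suc t" u \<theta>] u by (metis less_Suc_eq_le)
  obtain Wl where Wl: "\<forall>k<Suc t. \<forall>idx<n * n. val \<theta> (ent Wl k idx) = W k idx"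
    using poly_table[of "Suc t" "n * n" W \<theta>] WF by (metis less_Suc_eq_le)
  obtain cs where cs: "\<forall>c<r. \<forall>i<Suc t. val \<theta> (ent cs c i) = B i c" "length cs = r"
    "\<forall>c<r. length (nth_default [] cs c) = Suc t"
    using poly_table[of r "Suc t" "\<lambda>c i. B i c" \<theta>] BF by metis
  obtain Ll where Ll: "\<forall>c<r. \<forall>i<Suc t. val \<theta> (ent Ll c i) = L c i"
    using poly_table[of r "Suc t" L \<theta>] LF by metis
  obtain Ul where Ul: "\<forall>c<r. \<forall>l<Suc t. val \<eta> (ent Ul c l) = C c l"
    using poly_table[of r "Suc t" C \<eta>] CF FK by (metis subsetD)
  obtain Vl where Vl: "\<forall>i<Suc t. \<forall>b<length bs. val \<eta> (ent Vl i b) = V i b"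
    using poly_table[of "Suc t" "length bs" V \<eta>] VK by metis
  have "tor (\<lambda>k. d k ^ Suc t) = tor (\<lambda>k. \<Sum>l\<le>t. u l * d k ^ l)" by (rule tor_cong) (use red in blast)
  then have Xred: "(X ^\<^sub>m Suc t) $$ (i, j) = (\<Sum>l<Suc t. u l * (X ^\<^sub>m l) $$ (i, j))" if "i < n" "j < n" for i j
    unfolding lessThan_Suc_atMost power_comb_entry[OF that] by (simp only: X_pow)
  have "Upsilon_cert f (mat_to_list A) g h as (map list_of_vec bs) t cs ul Wl Ll Ul Vl"
    unfolding Upsilon_cert_iff cs(2)
  proof (intro conjI allI impI)
    show "(X ^\<^sub>m Suc t) $$ (i, j) = (\<Sum>l<Suc t. val \<theta> (nth_default 0 ul l) * (X ^\<^sub>m l) $$ (i, j))"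
      if "i < n" "j < n" for i j
      unfolding Xred[OF that] by (intro sum.cong refl) (simp add: ul)
    show "(\<Sum>idx<n * n. val \<theta> (ent Wl k idx) * (X ^\<^sub>m l) $$ (idx div n, idx mod n)) = (if k = l then 1 else 0)"
      if "k < Suc t" "l < Suc t" for k l
      using W that Wl by (simp add: less_Suc_eq_le)
    show "length (nth_default [] cs c) = Suc t" if "c < r" for c using cs(3) that by blast
    show "(\<Sum>i<Suc t. \<Delta> n \<alpha> i (bs ! b) * val \<theta> (ent cs c i)) = 0" if "c < r" "b < length bs" for c b
      using DB cs(1) that by (simp add: cs(1) del: sum.lessThan_Suc)
    show "(\<Sum>i<Suc t. val \<theta> (ent Ll c i) * val \<theta> (ent cs c' i)) = (if c = c' then 1 else 0)"
      if "c < r" "c' < r" for c c'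
      using LB that by (simp add: cs(1) Ll del: sum.lessThan_Suc)
    show "(\<Sum>c<r. val \<theta> (ent cs c i) * val \<eta> (ent Ul c l)) +
        (\<Sum>b<length bs. val \<eta> (ent Vl i b) * \<Delta> n \<alpha> l (bs ! b)) = (if i = l then 1 else 0)"
      if "i < Suc t" "l < Suc t" for i l
      using UV that by (simp add: cs(1) Ul Vl)
  qed
  then show ?thesis by blast
qed

end

lemma Upsilon_computable:
  "\<exists>\<phi>. partial_recursive \<phi> \<and>
      (\<forall>f \<theta> n A g \<eta> h as bs. valid_input f \<theta> n A \<and> valid_eigenvalues \<theta> n A g \<eta> h as \<and>
          valid_Lambda n \<eta> as bs \<longrightarrow>
        (\<exists>t cs. \<phi> (list_encode [code_input f A, code_eigenvalues g h as, code_Lambda bs])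
             = Some (code_Upsilon t cs) \<and>
           valid_Upsilon \<theta> n A \<eta> as t cs))"
proof -
  define C where "C x y \<longleftrightarrow> (\<exists>u W L U V. Upsilon_cert (fst (fst (fst x))) (snd (fst (fst x)))
     (fst (snd (fst x))) (fst (snd (snd (fst x)))) (snd (snd (snd (fst x)))) (snd x)
     (fst y) (snd y) u W L U V)" for x y
  have "semi (\<lambda>z. C (fst z) (snd z))" unfolding C_def by (rule semi_Upsilon_cert)
  then obtain \<phi> where \<phi>: "partial_recursive \<phi>"
    "\<And>x. \<exists>y. C x y \<Longrightarrow> \<exists>y. C x y \<and> \<phi> (enc x) = Some (enc y)"
    by (rule semi_search) blast
  define s :: "nat list \<Rightarrow> (nat \<times> nat) \<times> nat" where
    "s l = ((nth_default 0 l 0, nth_default 0 l 1), nth_default 0 l 2)" for l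
  have "computable s" unfolding s_def[abs_def] by (intro computable_intros)
  then obtain \<psi> where \<psi>: "partial_recursive \<psi>" "\<And>l. \<psi> (list_encode l) = \<phi> (enc (s l))"
    by (rule precompose_list[OF \<phi>(1)]) blast
  have s: "enc (s [enc (fA :: rat poly \<times> rat poly list list), enc (gh :: rat poly \<times> rat poly \<times> rat poly list),
      enc (bs :: rat list list)]) = enc ((fA, gh), bs)" for fA gh bs
    by (simp add: s_def enc_prod_def nth_default_nth)
  show ?thesis
  proof (intro exI[of _ \<psi>] conjI allI impI)
    fix f \<theta> n A g \<eta> h as bs
    assume "valid_input f \<theta> n A \<and> valid_eigenvalues \<theta> n A g \<eta> h as \<and> valid_Lambda n \<eta> as bs"
    then interpret upsilon_data f \<theta> n A g \<eta> h as bs by unfold_locales auto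
    have "\<exists>y. C (((f, mat_to_list A), (g, h, as)), map list_of_vec bs) y"
      using Upsilon_cert_complete by (fastforce simp: C_def)
    from \<phi>(2)[OF this] obtain y where Cy: "C (((f, mat_to_list A), (g, h, as)), map list_of_vec bs) y"
      and \<phi>y: "\<phi> (enc (((f, mat_to_list A), (g, h, as)), map list_of_vec bs)) = Some (enc y)" by blast
    obtain t cs where y: "y = (t, cs)" by (rule prod.exhaust)
    note \<phi>cs = \<phi>y[unfolded y]
    obtain u W L U V where
      cert: "Upsilon_cert f (mat_to_list A) g h as (map list_of_vec bs) t cs u W L U V"
      using Cy unfolding C_def y prod.sel by blast
    have "valid_Upsilon \<theta> n A \<eta> as t (map vec_of_list cs)" by (rule Upsilon_cert_sound[OF cert])
    moreover have "code_Upsilon t (map vec_of_list cs) = enc (t, cs)"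
      by (simp add: code_Upsilon_enc o_def list_vec)
    ultimately show "\<exists>t cs. \<psi> (list_encode [code_input f A, code_eigenvalues g h as, code_Lambda bs])
        = Some (code_Upsilon t cs) \<and> valid_Upsilon \<theta> n A \<eta> as t cs"
      using \<phi>cs by (intro exI[of _ t] exI[of _ "map vec_of_list cs"])
        (simp add: \<psi>(2) code_input_enc code_eigenvalues_enc code_Lambda_enc s del: list_encode.simps)
  qed (rule \<psi>(1))
qed

section \<open>Computing the returned matrices\<close>

lemma returned_matrices_computable:
  "\<exists>\<phi>. partial_recursive \<phi> \<and>
      (\<forall>f \<theta> n A g \<eta> h as bs t cs. valid_input f \<theta> n A \<and> valid_eigenvalues \<theta> n A g \<eta> h as \<and>
          valid_Lambda n \<eta> as bs \<and> valid_Upsilon \<theta> n A \<eta> as t cs \<longrightarrow>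
        (\<exists>Ms. \<phi> (list_encode [code_input f A, code_eigenvalues g h as, code_Lambda bs,
               code_Upsilon t cs])
             = Some (code_list (code_mat code_poly) Ms) \<and>
           map (map_mat (val \<theta>)) Ms =
             returned_matrices n (map_mat (val \<theta>) A) t (map (map_vec (val \<theta>)) cs)))"
proof -
  \<comment> \<open>The entries are left as unreduced polynomials; what the theorem asks for is
    their value at \<theta>.\<close>
  define M where "M A t = map (\<lambda>c. tab (length A) (length A) (\<lambda>i j.
    \<Sum>l<Suc t. nth_default 0 c l * ent (mpow (length A) A l) i j))" for A t
  have "computable (\<lambda>x :: (rat poly \<times> rat poly list list) \<times> nat \<times> rat poly list list.
      M (snd (fst x)) (fst (snd x)) (snd (snd x)))"
    unfolding M_def by (intro computable_intros)
  then obtain \<phi> where \<phi>1: "partial_recursive \<phi>"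
    and \<phi>2: "\<forall>x :: (rat poly \<times> rat poly list list) \<times> nat \<times> rat poly list list.
      \<phi> (enc x) = Some (enc (M (snd (fst x)) (fst (snd x)) (snd (snd x))))"
    unfolding computable_def by blast
  note \<phi> = \<phi>1 \<phi>2[rule_format, of "(fA, t, cs)" for fA t cs, unfolded prod.sel]
  \<comment> \<open>The matrices depend on the input and on the result of the third step, at
    positions 0 and 3 of the list.\<close>
  define s :: "nat list \<Rightarrow> nat \<times> nat" where "s l = (nth_default 0 l 0, nth_default 0 l 3)" for l
  have "computable s" unfolding s_def[abs_def] by (intro computable_intros)
  then obtain \<psi> where \<psi>: "partial_recursive \<psi>" "\<And>l. \<psi> (list_encode l) = \<phi> (enc (s l))"
    by (rule precompose_list[OF \<phi>(1)]) blast
  have s: "enc (s [enc (fA :: rat poly \<times> rat poly list list), a, b, enc (tcs :: nat \<times> rat poly list list)])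
      = enc (fA, tcs)" for fA a b tcs
    by (simp add: s_def enc_prod_def nth_default_nth)
  show ?thesis
  proof (intro exI[of _ \<psi>] conjI allI impI)
    fix f \<theta> n A g \<eta> h as bs t cs
    assume valid: "valid_input f \<theta> n A \<and> valid_eigenvalues \<theta> n A g \<eta> h as \<and>
      valid_Lambda n \<eta> as bs \<and> valid_Upsilon \<theta> n A \<eta> as t cs"
    then interpret upsilon_data f \<theta> n A g \<eta> h as bs by unfold_locales auto
    have \<gamma>s: "set (map (map_vec (val \<theta>)) cs) \<subseteq> carrier_vec (t + 1)"
      using valid unfolding valid_Upsilon_def Upsilon_step_def vec_basis_def by (auto simp: Upsilon_def)
    then have car: "c \<in> carrier_vec (Suc t)" if "c \<in> set cs" for c
      using \<gamma>s that by (simp only: set_map image_subset_iff map_carrier_vec Suc_eq_plus1)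
    define N where "N c = mat n n (\<lambda>(i, j). \<Sum>l<Suc t. nth_default 0 (list_of_vec c) l *
      ent (mpow n (mat_to_list A) l) i j)" for c
    have "mat_to_list (mat n n (\<lambda>(i, j). e i j)) = tab n n e" for e :: "nat \<Rightarrow> nat \<Rightarrow> rat poly"
      by (auto simp: mat_to_list_def tab_def)
    then have "M (mat_to_list A) t (map list_of_vec cs) = map mat_to_list (map N cs)"
      by (simp add: M_def N_def len)
    moreover have "code_list (code_mat code_poly) (map N cs) = enc (map mat_to_list (map N cs))"
      by (rule code_list_map) (simp add: code_poly_enc code_mat_enc)
    ultimately have "\<psi> (list_encode [code_input f A, code_eigenvalues g h as, code_Lambda bs, code_Upsilon t cs])
        = Some (code_list (code_mat code_poly) (map N cs))"
      by (simp add: \<psi>(2) code_input_enc code_Upsilon_enc s \<phi>(2) del: list_encode.simps)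
    moreover have "map_mat (val \<theta>) (N c) = mat_comb n (list_of_vec (map_vec (val \<theta>) c)) (powers X t)" if "c \<in> set cs" for c
    proof (rule eq_matI)
      fix i j assume "i < dim_row (mat_comb n (list_of_vec (map_vec (val \<theta>) c)) (powers X t))"
        "j < dim_col (mat_comb n (list_of_vec (map_vec (val \<theta>) c)) (powers X t))"
      then have ij: "i < n" "j < n" by (simp_all add: mat_comb_def)
      have eq: "val \<theta> (nth_default 0 (list_of_vec c) l) * (X ^\<^sub>m l) $$ (i, j)
          = list_of_vec (map_vec (val \<theta>) c) ! l * powers X t ! l $$ (i, j)" if "l < Suc t" for l
        using that car[OF \<open>c \<in> set cs\<close>]
        by (simp add: powers_def nth_default_nth list_of_vec_index del: upt_Suc)
      have "map_mat (val \<theta>) (N c) $$ (i, j)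
          = (\<Sum>l<Suc t. val \<theta> (nth_default 0 (list_of_vec c) l) * (X ^\<^sub>m l) $$ (i, j))"
        using ij by (simp add: N_def val_hom.hom_sum val_hom.hom_mult val_mpow[OF A] del: sum.lessThan_Suc)
      also have "\<dots> = (\<Sum>l<Suc t. list_of_vec (map_vec (val \<theta>) c) ! l * powers X t ! l $$ (i, j))"
        by (intro sum.cong refl eq) simp
      also have "\<dots> = mat_comb n (list_of_vec (map_vec (val \<theta>) c)) (powers X t) $$ (i, j)"
        using ij by (simp add: mat_comb_def powers_def del: sum.lessThan_Suc upt_Suc)
      finally show "map_mat (val \<theta>) (N c) $$ (i, j)
        = mat_comb n (list_of_vec (map_vec (val \<theta>) c)) (powers X t) $$ (i, j)" .
    qed (simp_all add: N_def mat_comb_def)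
    then have "map (map_mat (val \<theta>)) (map N cs) = returned_matrices n X t (map (map_vec (val \<theta>)) cs)"
      by (simp add: returned_matrices_def)
    ultimately show "\<exists>Ms. \<psi> (list_encode [code_input f A, code_eigenvalues g h as, code_Lambda bs, code_Upsilon t cs])
        = Some (code_list (code_mat code_poly) Ms) \<and>
      map (map_mat (val \<theta>)) Ms = returned_matrices n (map_mat (val \<theta>) A) t (map (map_vec (val \<theta>)) cs)" by blast
  qed (rule \<psi>(1))
qed

theorem mainTheorem1:
  shows
   "(\<exists>\<phi>. partial_recursive \<phi> \<and>
      (\<forall>f \<theta> n A. valid_input f \<theta> n A \<longrightarrow>
        (\<exists>g \<eta> h as. \<phi> (code_input f A) = Some (code_eigenvalues g h as) \<and>
           valid_eigenvalues \<theta> n A g \<eta> h as))) \<and>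
    (\<exists>\<phi>. partial_recursive \<phi> \<and>
      (\<forall>f \<theta> n A g \<eta> h as. valid_input f \<theta> n A \<and> valid_eigenvalues \<theta> n A g \<eta> h as \<longrightarrow>
        (\<exists>bs. \<phi> (list_encode [code_input f A, code_eigenvalues g h as]) = Some (code_Lambda bs) \<and>
           valid_Lambda n \<eta> as bs))) \<and>
    (\<exists>\<phi>. partial_recursive \<phi> \<and>
      (\<forall>f \<theta> n A g \<eta> h as bs. valid_input f \<theta> n A \<and> valid_eigenvalues \<theta> n A g \<eta> h as \<and>
          valid_Lambda n \<eta> as bs \<longrightarrow>
        (\<exists>t cs. \<phi> (list_encode [code_input f A, code_eigenvalues g h as, code_Lambda bs])
             = Some (code_Upsilon t cs) \<and>
           valid_Upsilon \<theta> n A \<eta> as t cs))) \<and>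
    (\<exists>\<phi>. partial_recursive \<phi> \<and>
      (\<forall>f \<theta> n A g \<eta> h as bs t cs. valid_input f \<theta> n A \<and> valid_eigenvalues \<theta> n A g \<eta> h as \<and>
          valid_Lambda n \<eta> as bs \<and> valid_Upsilon \<theta> n A \<eta> as t cs \<longrightarrow>
        (\<exists>Ms. \<phi> (list_encode [code_input f A, code_eigenvalues g h as, code_Lambda bs,
               code_Upsilon t cs])
             = Some (code_list (code_mat code_poly) Ms) \<and>
           map (map_mat (val \<theta>)) Ms =
             returned_matrices n (map_mat (val \<theta>) A) t (map (map_vec (val \<theta>)) cs)))) \<and>
    (\<forall>F n X K \<alpha> bs t \<gamma>s. number_field F \<and> 0 < n \<and> semisimple n F X \<and>
        eigenvalue_step n F X K \<alpha> \<and> Lambda_step n \<alpha> bs \<and> Upsilon_step n F X \<alpha> t \<gamma>s \<longrightarrow>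
      (\<exists>H. is_algebraic_hull n F (mat_span n F [X]) H \<and>
         mat_basis n F H (returned_matrices n X t \<gamma>s)))"
  by (intro conjI eigenvalues_computable Lambda_computable Upsilon_computable returned_matrices_computable)
    (intro allI impI, elim conjE, rule hull_correct)

end
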